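(* Let $D_h:=J_h^{\mathrm{CR}}-J_h^c:L^2(\Omega)\to V_{h,0}^{\mathrm{CR}}$ be the gap operator between the Crouzeix--Raviart and the conforming discrete Poisson solution operators. For all $f,g\in L^2(\Omega)$, $$(D_hf,g)=a_h(D_hf,D_hg),\qquad a_h(v,w):=(\nabla_hv,\nabla_hw).$$ Consequently $D_h$, viewed as an operator on $L^2(\Omega)$, is positive and self-adjoint. Furthermore, with $M_h:=\sqrt{C_{0,h}^2+\kappa_{M,h}^2}$, for all $f\in L^2(\Omega)$, $$|D_hf|_{H^1(\mathbb T_h)}\le C_{0,h}\|f-\Pi_h^0f\|_{L^2(\Omega)}+\kappa_{M,h}\|\Pi_h^0f\|_{L^2(\Omega)}\le M_h\|f\|_{L^2(\Omega)},$$ and $$\|D_h\|_{\mathcal L(L^2(\Omega),L^2(\Omega))}\le M_h^2 .$$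
   Context: Let $d\in\{2,3\}$, let $\Omega\subset\mathbb R^d$ be a bounded polyhedral Lipschitz domain, and let $\mathbb T_h$ be a finite conforming triangulation of $\overline\Omega$ into non-degenerate closed $d$-simplices (the intersection of two distinct elements is empty or a common subsimplex); no shape regularity is assumed. $(\cdot,\cdot)$ is the $L^2(\Omega)$ inner product (scalar or vector valued). For elementwise $H^1$ functions $v$, $\nabla_hv$ is the elementwise (broken) gradient and $|v|_{H^1(\mathbb T_h)}:=\|\nabla_hv\|_{L^2(\Omega)^d}$. "Positive" means $(D_hf,f)\ge0$ for all $f$. $X_h$ is the space of functions constant on each $T\in\mathbb T_h$, and $\Pi_h^0:L^2(\Omega)\to X_h$ is the $L^2$-orthogonal projection (elementwise mean). $V_h^c:=\{v\in H_0^1(\Omega): v|_T \text{ affine } \forall T\in\mathbb T_h\}$. The Crouzeix--Raviart space $V_{h,0}^{\mathrm{CR}}$ consists of the elementwise affine functions $v$ such that $\int_F[\![v]\!]\,ds=0$ for all faces $F$, where $[\![v]\!]$ is the jump across an interior face and the trace of $v$ on a boundary face; $V_h^c\subset V_{h,0}^{\mathrm{CR}}$. For $f\in L^2(\Omega)$: $J_h^cf\in V_h^c$ is the unique solution of $(\nabla J_h^cf,\nabla v_h)=(f,v_h)$ for all $v_h\in V_h^c$; $J_h^{\mathrm{CR}}f\in V_{h,0}^{\mathrm{CR}}$ is the unique solution of $(\nabla_hJ_h^{\mathrm{CR}}f,\nabla_hv_h)=(f,v_h)$ for all $v_h\in V_{h,0}^{\mathrm{CR}}$. For $g_h\in X_h$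 write $z_h^c(g_h):=J_h^cg_h$, $z_h^{\mathrm{CR}}(g_h):=J_h^{\mathrm{CR}}g_h$, and define the Marini flux $\bm\sigma_h^M(g_h)|_T:=\nabla_h z_h^{\mathrm{CR}}(g_h)|_T-\frac{g_h|_T}{d}(\bm x-\bm x_T)$, with $\bm x_T$ the barycentre of $T$, and $$\kappa_{M,h}:=\sup_{0\ne g_h\in X_h}\frac{\|\bm\sigma_h^M(g_h)-\nabla z_h^c(g_h)\|_{L^2(\Omega)^d}}{\|g_h\|_{L^2(\Omega)}}.$$ The optimal Poincaré constants are $C_0(T):=\sup\{\|v\|_{L^2(T)}/\|\nabla v\|_{L^2(T)^d}: 0\ne v\in H^1(T),\ \int_Tv\,dx=0\}$ and $C_{0,h}:=\max_{T\in\mathbb T_h}C_0(T)$. *)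

theory Defs
  imports "HOL-Analysis.Analysis"
begin

section \<open>Square-integrable functions\<close>

text \<open>
  Elements of $L^2(U)$ are represented by functions on the whole space; only their values on \<open>U\<close>,
  up to Lebesgue null sets, matter. One definition covers scalar- and vector-valued functions.
\<close>

definition L2_space :: "(real ^ 'n) set \<Rightarrow> (real ^ 'n \<Rightarrow> 'b::euclidean_space) set" where
  "L2_space U = {f \<in> borel_measurable (lebesgue_on U). integrable (lebesgue_on U) (\<lambda>x. (norm (f x))\<^sup>2)}"

definition L2_inner :: "(real ^ 'n) set \<Rightarrow> (real ^ 'n \<Rightarrow> 'b::euclidean_space) \<Rightarrow> (real ^ 'n \<Rightarrow> 'b) \<Rightarrow> real" where
  "L2_inner U f g = (LINT x|lebesgue_on U. f x \<bullet> g x)"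

definition L2_norm :: "(real ^ 'n) set \<Rightarrow> (real ^ 'n \<Rightarrow> 'b::euclidean_space) \<Rightarrow> real" where
  "L2_norm U f = sqrt (L2_inner U f f)"

text \<open>
  An operator on $L^2(U)$ acts on representatives, so it has to respect equality almost everywhere.
\<close>

definition bounded_L2_operator ::
    "(real ^ 'n) set \<Rightarrow> ((real ^ 'n \<Rightarrow> real) \<Rightarrow> (real ^ 'n \<Rightarrow> real)) \<Rightarrow> bool" where
  "bounded_L2_operator U A \<longleftrightarrow>
     (\<forall>f\<in>L2_space U. A f \<in> L2_space U) \<and>
     (\<forall>f\<in>L2_space U. \<forall>g\<in>L2_space U.
        (AE x in lebesgue_on U. f x = g x) \<longrightarrow> (AE x in lebesgue_on U. A f x = A g x)) \<and>
     (\<forall>f\<in>L2_space U. \<forall>g\<in>L2_space U. AE x in lebesgue_on U. A (\<lambda>y. f y + g y) x = A f x + A g x) \<and>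
     (\<forall>c. \<forall>f\<in>L2_space U. AE x in lebesgue_on U. A (\<lambda>y. c * f y) x = c * A f x) \<and>
     (\<exists>B. \<forall>f\<in>L2_space U. L2_norm U (A f) \<le> B * L2_norm U f)"

definition positive_L2_operator ::
    "(real ^ 'n) set \<Rightarrow> ((real ^ 'n \<Rightarrow> real) \<Rightarrow> (real ^ 'n \<Rightarrow> real)) \<Rightarrow> bool" where
  "positive_L2_operator U A \<longleftrightarrow> (\<forall>f\<in>L2_space U. L2_inner U (A f) f \<ge> 0)"

definition selfadjoint_L2_operator ::
    "(real ^ 'n) set \<Rightarrow> ((real ^ 'n \<Rightarrow> real) \<Rightarrow> (real ^ 'n \<Rightarrow> real)) \<Rightarrow> bool" where
  "selfadjoint_L2_operator U A \<longleftrightarrow>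
     (\<forall>f\<in>L2_space U. \<forall>g\<in>L2_space U. L2_inner U (A f) g = L2_inner U f (A g))"

definition L2_operator_norm ::
    "(real ^ 'n) set \<Rightarrow> ((real ^ 'n \<Rightarrow> real) \<Rightarrow> (real ^ 'n \<Rightarrow> real)) \<Rightarrow> real" where
  "L2_operator_norm U A =
     Sup {L2_norm U (A f) / L2_norm U f | f. f \<in> L2_space U \<and> L2_norm U f \<noteq> 0}"


section \<open>Sobolev spaces\<close>

definition partial_deriv :: "'n \<Rightarrow> (real ^ 'n \<Rightarrow> real) \<Rightarrow> real ^ 'n \<Rightarrow> real" where
  "partial_deriv i f x = frechet_derivative f (at x) (axis i 1)"

definition classical_grad :: "(real ^ 'n \<Rightarrow> real) \<Rightarrow> real ^ 'n \<Rightarrow> real ^ 'n" where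
  "classical_grad f x = (\<chi> i. partial_deriv i f x)"

text \<open>$C^\infty$: every iterated partial derivative is differentiable (hence also continuous).\<close>

definition smooth :: "(real ^ 'n \<Rightarrow> real) \<Rightarrow> bool" where
  "smooth f \<longleftrightarrow> (\<forall>is. foldr partial_deriv is f differentiable_on UNIV)"

definition test_function :: "(real ^ 'n) set \<Rightarrow> (real ^ 'n \<Rightarrow> real) \<Rightarrow> bool" where
  "test_function U \<phi> \<longleftrightarrow>
     smooth \<phi> \<and> compact (closure {x. \<phi> x \<noteq> 0}) \<and> closure {x. \<phi> x \<noteq> 0} \<subseteq> U"

definition has_weak_grad :: "(real ^ 'n) set \<Rightarrow> (real ^ 'n \<Rightarrow> real) \<Rightarrow> (real ^ 'n \<Rightarrow> real ^ 'n) \<Rightarrow> bool" where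
  "has_weak_grad U u G \<longleftrightarrow>
     (\<forall>\<phi> i. test_function U \<phi> \<longrightarrow>
        (LINT x|lebesgue_on U. u x * partial_deriv i \<phi> x) = - (LINT x|lebesgue_on U. G x $ i * \<phi> x))"

definition H1_space :: "(real ^ 'n) set \<Rightarrow> (real ^ 'n \<Rightarrow> real) set" where
  "H1_space U = {u \<in> L2_space U. \<exists>G. G \<in> L2_space U \<and> has_weak_grad U u G}"

text \<open>The weak gradient is unique up to null sets; some representative is chosen.\<close>

definition weak_grad :: "(real ^ 'n) set \<Rightarrow> (real ^ 'n \<Rightarrow> real) \<Rightarrow> real ^ 'n \<Rightarrow> real ^ 'n" where
  "weak_grad U u = (SOME G. G \<in> L2_space U \<and> has_weak_grad U u G)"

text \<open>$H^1_0(U)$ is the closure of the test functions in the $H^1$ norm.\<close>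

definition H10_space :: "(real ^ 'n) set \<Rightarrow> (real ^ 'n \<Rightarrow> real) set" where
  "H10_space U = {u \<in> H1_space U. \<exists>\<phi>. (\<forall>k::nat. test_function U (\<phi> k)) \<and>
      (\<lambda>k. L2_norm U (\<lambda>x. \<phi> k x - u x)) \<longlonglongrightarrow> 0 \<and>
      (\<lambda>k. L2_norm U (\<lambda>x. classical_grad (\<phi> k) x - weak_grad U u x)) \<longlonglongrightarrow> 0}"


section \<open>Domain and triangulation\<close>

text \<open>
  Near each boundary point the domain lies on one side of the graph of a Lipschitz function \<open>\<gamma>\<close>
  over the hyperplane orthogonal to some unit vector \<open>e\<close>.
\<close>

definition lipschitz_domain :: "(real ^ 'n) set \<Rightarrow> bool" where
  "lipschitz_domain \<Omega> \<longleftrightarrow> open \<Omega> \<and> connected \<Omega> \<and> \<Omega> \<noteq> {} \<and>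
     (\<forall>p\<in>frontier \<Omega>. \<exists>e N \<gamma> L. norm e = 1 \<and> open N \<and> p \<in> N \<and> L-lipschitz_on {y. y \<bullet> e = 0} \<gamma> \<and>
        \<Omega> \<inter> N = {y \<in> N. \<gamma> (y - (y \<bullet> e) *\<^sub>R e) < y \<bullet> e})"

definition polyhedral :: "(real ^ 'n) set \<Rightarrow> bool" where
  "polyhedral \<Omega> \<longleftrightarrow> (\<exists>\<P>. finite \<P> \<and> (\<forall>P\<in>\<P>. polytope P) \<and> closure \<Omega> = \<Union>\<P>)"

text \<open>
  \<^const>\<open>triangulation\<close> supplies finiteness and the condition that the intersection of two elements
  is a (possibly empty) face of each of them.
\<close>

definition conforming_triangulation :: "(real ^ 'n) set \<Rightarrow> (real ^ 'n) set set \<Rightarrow> bool" where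
  "conforming_triangulation \<Omega> \<T> \<longleftrightarrow>
     triangulation \<T> \<and> (\<forall>T\<in>\<T>. int CARD('n) simplex T) \<and> \<Union>\<T> = closure \<Omega>"

definition simplex_barycentre :: "(real ^ 'n) set \<Rightarrow> real ^ 'n" where
  "simplex_barycentre T = (\<Sum>v | v extreme_point_of T. v) /\<^sub>R real (CARD('n) + 1)"

text \<open>
  The integral over a $(d-1)$-dimensional flat set \<open>F\<close> with respect to surface measure: by Fubini it
  equals the volume integral over the orthogonal prism of height one above \<open>F\<close> of the function
  extended constantly in the normal direction.
\<close>

definition unit_normal :: "(real ^ 'n) set \<Rightarrow> real ^ 'n" where
  "unit_normal F = (SOME n. norm n = 1 \<and> (\<forall>x\<in>F. \<forall>y\<in>F. (x - y) \<bullet> n = 0))"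

definition face_integral :: "(real ^ 'n) set \<Rightarrow> (real ^ 'n \<Rightarrow> real) \<Rightarrow> real" where
  "face_integral F g =
     (LINT x|lebesgue_on {y + t *\<^sub>R unit_normal F | y t. y \<in> F \<and> t \<in> {0..1}}.
        g (closest_point (affine hull F) x))"


section \<open>Discrete spaces\<close>

text \<open>
  A piecewise polynomial function is an $L^2$ class, and its values on the mesh skeleton, a null set,
  are irrelevant. Each class is represented by the function that vanishes outside the open elements,
  so that equality of discrete functions is equality of representatives. In particular the
  continuous members of $V_h^c$ appear here modified on the skeleton.
\<close>

definition supported_on_elements :: "(real ^ 'n) set set \<Rightarrow> (real ^ 'n \<Rightarrow> real) \<Rightarrow> bool" where
  "supported_on_elements \<T> v \<longleftrightarrow> (\<forall>x. x \<notin> (\<Union>T\<in>\<T>. interior T) \<longrightarrow> v x = 0)"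

definition P0_space :: "(real ^ 'n) set set \<Rightarrow> (real ^ 'n \<Rightarrow> real) set" where
  "P0_space \<T> = {v. supported_on_elements \<T> v \<and> (\<forall>T\<in>\<T>. \<exists>c. \<forall>x\<in>interior T. v x = c)}"

definition P1_space :: "(real ^ 'n) set set \<Rightarrow> (real ^ 'n \<Rightarrow> real) set" where
  "P1_space \<T> = {v. supported_on_elements \<T> v \<and> (\<forall>T\<in>\<T>. \<exists>a b. \<forall>x\<in>interior T. v x = a \<bullet> x + b)}"

definition broken_grad :: "(real ^ 'n) set set \<Rightarrow> (real ^ 'n \<Rightarrow> real) \<Rightarrow> real ^ 'n \<Rightarrow> real ^ 'n" where
  "broken_grad \<T> v x = (\<Sum>T\<in>\<T>. indicator (interior T) x *\<^sub>R weak_grad (interior T) v x)"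

definition broken_form ::
    "(real ^ 'n) set \<Rightarrow> (real ^ 'n) set set \<Rightarrow> (real ^ 'n \<Rightarrow> real) \<Rightarrow> (real ^ 'n \<Rightarrow> real) \<Rightarrow> real" where
  "broken_form \<Omega> \<T> v w = L2_inner \<Omega> (broken_grad \<T> v) (broken_grad \<T> w)"

definition broken_H1_seminorm :: "(real ^ 'n) set \<Rightarrow> (real ^ 'n) set set \<Rightarrow> (real ^ 'n \<Rightarrow> real) \<Rightarrow> real" where
  "broken_H1_seminorm \<Omega> \<T> v = L2_norm \<Omega> (broken_grad \<T> v)"

definition conforming_space :: "(real ^ 'n) set \<Rightarrow> (real ^ 'n) set set \<Rightarrow> (real ^ 'n \<Rightarrow> real) set" where
  "conforming_space \<Omega> \<T> = H10_space \<Omega> \<inter> P1_space \<T>"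

text \<open>The trace from inside \<open>T\<close>, for functions extending continuously from the interior to \<open>T\<close>.\<close>

definition element_trace :: "(real ^ 'n) set \<Rightarrow> (real ^ 'n \<Rightarrow> real) \<Rightarrow> real ^ 'n \<Rightarrow> real" where
  "element_trace T v x = Lim (at x within interior T) v"

text \<open>The sign of the jump across an interior face is immaterial, so no orientation is fixed.\<close>

definition CR_space :: "(real ^ 'n) set \<Rightarrow> (real ^ 'n) set set \<Rightarrow> (real ^ 'n \<Rightarrow> real) set" where
  "CR_space \<Omega> \<T> = {v \<in> P1_space \<T>.
      (\<forall>T\<in>\<T>. \<forall>T'\<in>\<T>. \<forall>F. T \<noteq> T' \<and> F facet_of T \<and> F facet_of T' \<longrightarrow>
         face_integral F (\<lambda>x. element_trace T v x - element_trace T' v x) = 0) \<and>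
      (\<forall>T\<in>\<T>. \<forall>F. F facet_of T \<and> F \<subseteq> frontier \<Omega> \<longrightarrow> face_integral F (element_trace T v) = 0)}"

definition P0_projection ::
    "(real ^ 'n) set \<Rightarrow> (real ^ 'n) set set \<Rightarrow> (real ^ 'n \<Rightarrow> real) \<Rightarrow> (real ^ 'n \<Rightarrow> real)" where
  "P0_projection \<Omega> \<T> f =
     (THE q. q \<in> P0_space \<T> \<and> (\<forall>p\<in>P0_space \<T>. L2_inner \<Omega> (\<lambda>x. f x - q x) p = 0))"


section \<open>Discrete solution operators and constants\<close>

definition conforming_solution ::
    "(real ^ 'n) set \<Rightarrow> (real ^ 'n) set set \<Rightarrow> (real ^ 'n \<Rightarrow> real) \<Rightarrow> (real ^ 'n \<Rightarrow> real)" where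
  "conforming_solution \<Omega> \<T> f =
     (THE u. u \<in> conforming_space \<Omega> \<T> \<and>
        (\<forall>v\<in>conforming_space \<Omega> \<T>. L2_inner \<Omega> (weak_grad \<Omega> u) (weak_grad \<Omega> v) = L2_inner \<Omega> f v))"

definition CR_solution ::
    "(real ^ 'n) set \<Rightarrow> (real ^ 'n) set set \<Rightarrow> (real ^ 'n \<Rightarrow> real) \<Rightarrow> (real ^ 'n \<Rightarrow> real)" where
  "CR_solution \<Omega> \<T> f =
     (THE u. u \<in> CR_space \<Omega> \<T> \<and>
        (\<forall>v\<in>CR_space \<Omega> \<T>. L2_inner \<Omega> (broken_grad \<T> u) (broken_grad \<T> v) = L2_inner \<Omega> f v))"

definition gap_operator ::
    "(real ^ 'n) set \<Rightarrow> (real ^ 'n) set set \<Rightarrow> (real ^ 'n \<Rightarrow> real) \<Rightarrow> (real ^ 'n \<Rightarrow> real)" where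
  "gap_operator \<Omega> \<T> f = (\<lambda>x. CR_solution \<Omega> \<T> f x - conforming_solution \<Omega> \<T> f x)"

definition marini_flux ::
    "(real ^ 'n) set \<Rightarrow> (real ^ 'n) set set \<Rightarrow> (real ^ 'n \<Rightarrow> real) \<Rightarrow> real ^ 'n \<Rightarrow> real ^ 'n" where
  "marini_flux \<Omega> \<T> g x =
     broken_grad \<T> (CR_solution \<Omega> \<T> g) x
     - (\<Sum>T\<in>\<T>. indicator (interior T) x *\<^sub>R ((g x / real CARD('n)) *\<^sub>R (x - simplex_barycentre T)))"

definition kappa_M :: "(real ^ 'n) set \<Rightarrow> (real ^ 'n) set set \<Rightarrow> real" where
  "kappa_M \<Omega> \<T> =
     Sup {L2_norm \<Omega> (\<lambda>x. marini_flux \<Omega> \<T> g x - weak_grad \<Omega> (conforming_solution \<Omega> \<T> g) x) / L2_norm \<Omega> g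
          | g. g \<in> P0_space \<T> \<and> L2_norm \<Omega> g \<noteq> 0}"

definition poincare_const :: "(real ^ 'n) set \<Rightarrow> real" where
  "poincare_const T =
     Sup {L2_norm (interior T) v / L2_norm (interior T) (weak_grad (interior T) v)
          | v. v \<in> H1_space (interior T) \<and> L2_norm (interior T) v \<noteq> 0 \<and>
               (LINT x|lebesgue_on (interior T). v x) = 0}"

definition max_poincare_const :: "(real ^ 'n) set set \<Rightarrow> real" where
  "max_poincare_const \<T> = Max (poincare_const ` \<T>)"

definition gap_const :: "(real ^ 'n) set \<Rightarrow> (real ^ 'n) set set \<Rightarrow> real" where
  "gap_const \<Omega> \<T> = sqrt ((max_poincare_const \<T>)\<^sup>2 + (kappa_M \<Omega> \<T>)\<^sup>2)"

end

theory Submission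
  imports Defs "HOL-Computational_Algebra.Polynomial"
begin

text \<open>
  The identity \<open>(D\<^sub>h f, g) = a\<^sub>h(D\<^sub>h f, D\<^sub>h g)\<close> is Galerkin orthogonality. It needs the inclusion
  $V_h^c \subset V_{h,0}^{\mathrm{CR}}$ and, for the well-posedness of both discrete problems, that the
  broken gradient is injective on $V_{h,0}^{\mathrm{CR}}$. Symmetry and positivity are immediate. The
  energy bound follows from
  \<open>|D\<^sub>h f|\<^sup>2 = (D\<^sub>h f, f) = (D\<^sub>h f - \<Pi> D\<^sub>h f, f - \<Pi> f) + a\<^sub>h(D\<^sub>h f, D\<^sub>h \<Pi> f)\<close>:
  the first term is estimated by elementwise Poincare inequalities, and the broken gradient of
  \<open>D\<^sub>h \<Pi> f\<close> is the orthogonal projection of the equilibration error in \<open>\<kappa>\<close> onto piecewise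
  constants. Taking \<open>g = D\<^sub>h f\<close> in the identity turns the energy bound into the operator norm bound.

  The constants are suprema of sets of reals, hence meaningful only once these sets are known to be
  bounded. For $C_0(T)$ this is the Poincare inequality for weakly differentiable functions on convex
  domains, derived from an $L^2$ bound for differences $u(\cdot + h) - u$; the same bound shows that
  weakly differentiable piecewise affine functions do not jump. For \<open>\<kappa>\<close> it is finite dimensionality.
\<close>

section \<open>Square-integrable functions\<close>

text \<open>Discrete functions are representatives vanishing off the open elements, so two of them
  that agree almost everywhere are equal. This gives sense to the descriptions by
  \<open>THE\<close>, makes the forms definite on actual functions, and lets finite dimension be
  expressed by point evaluations. The obstacle to well-posedness is geometric: a Crouzeix-Raviart
  function with vanishing broken gradient is a priori only constant on each element. Instead of
  joining an element to the boundary by a chain of neighbours, one takes all elements with a nonzero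
  constant: no facet of the family lies on the boundary and none is left without a partner, which no
  nonempty finite union of elements allows. The form of \<open>gap_const\<close> comes from the
  orthogonal splitting of the data into oscillation and element means: Cauchy-Schwarz in the plane
  pairs the two constants with the two norms. The projection property of the equilibration error
  needs the barycentre to be the centroid; this is obtained by comparing distribution functions of
  the barycentric coordinates, with no map to a reference simplex.\<close>

lemma L2_spaceI:
  assumes "f \<in> borel_measurable (lebesgue_on U)" "integrable (lebesgue_on U) (\<lambda>x. (norm (f x))\<^sup>2)"
  shows "f \<in> L2_space U"
  using assms by (simp add: L2_space_def)

lemma L2_space_measurable: "f \<in> L2_space U \<Longrightarrow> f \<in> borel_measurable (lebesgue_on U)"
  by (simp add: L2_space_def)

lemma L2_space_integrable_square:
  "f \<in> L2_space U \<Longrightarrow> integrable (lebesgue_on U) (\<lambda>x. (norm (f x))\<^sup>2)"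
  by (simp add: L2_space_def)

lemma L2_inner_integrable:
  assumes f: "f \<in> L2_space U" and g: "g \<in> L2_space U"
  shows "integrable (lebesgue_on U) (\<lambda>x. f x \<bullet> g x)"
proof (rule Bochner_Integration.integrable_bound)
  show "integrable (lebesgue_on U) (\<lambda>x. (norm (f x))\<^sup>2 + (norm (g x))\<^sup>2)"
    using L2_space_integrable_square[OF f] L2_space_integrable_square[OF g] by simp
  show "(\<lambda>x. f x \<bullet> g x) \<in> borel_measurable (lebesgue_on U)"
    using L2_space_measurable[OF f] L2_space_measurable[OF g] by (rule borel_measurable_inner)
  have "norm (f x \<bullet> g x) \<le> norm ((norm (f x))\<^sup>2 + (norm (g x))\<^sup>2)" for x
  proof -
    have "\<bar>f x \<bullet> g x\<bar> \<le> norm (f x) * norm (g x)" by (rule Cauchy_Schwarz_ineq2)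
    also have "\<dots> \<le> (norm (f x))\<^sup>2 + (norm (g x))\<^sup>2"
      using sum_squares_bound[of "norm (f x)" "norm (g x)"]
        mult_nonneg_nonneg[OF norm_ge_zero norm_ge_zero, of "f x" "g x"] by linarith
    finally show ?thesis by simp
  qed
  then show "AE x in lebesgue_on U. norm (f x \<bullet> g x) \<le> norm ((norm (f x))\<^sup>2 + (norm (g x))\<^sup>2)"
    by simp
qed

lemma L2_space_mult_integrable:
  fixes f g :: "real ^ 'n \<Rightarrow> real"
  shows "f \<in> L2_space U \<Longrightarrow> g \<in> L2_space U \<Longrightarrow> integrable (lebesgue_on U) (\<lambda>x. f x * g x)"
  using L2_inner_integrable[of f U g] by simp

lemma L2_space_add:
  assumes f: "f \<in> L2_space U" and g: "g \<in> L2_space U"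
  shows "(\<lambda>x. f x + g x) \<in> L2_space U"
proof (rule L2_spaceI)
  show "(\<lambda>x. f x + g x) \<in> borel_measurable (lebesgue_on U)"
    using L2_space_measurable[OF f] L2_space_measurable[OF g] by (rule borel_measurable_add)
  have "(\<lambda>x. (norm (f x + g x))\<^sup>2) = (\<lambda>x. (norm (f x))\<^sup>2 + (norm (g x))\<^sup>2 + 2 * (f x \<bullet> g x))"
    by (simp add: power2_norm_eq_inner inner_add_left inner_add_right inner_commute fun_eq_iff)
  then show "integrable (lebesgue_on U) (\<lambda>x. (norm (f x + g x))\<^sup>2)"
    using L2_space_integrable_square[OF f] L2_space_integrable_square[OF g] L2_inner_integrable[OF f g]
    by simp
qed

lemma L2_space_scaleR: "f \<in> L2_space U \<Longrightarrow> (\<lambda>x. c *\<^sub>R f x) \<in> L2_space U"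
  by (auto simp: L2_space_def power_mult_distrib)

lemma L2_space_mult:
  fixes f :: "real ^ 'n \<Rightarrow> real"
  shows "f \<in> L2_space U \<Longrightarrow> (\<lambda>x. c * f x) \<in> L2_space U"
  using L2_space_scaleR[of f U c] by simp

lemma L2_space_uminus: "f \<in> L2_space U \<Longrightarrow> (\<lambda>x. - f x) \<in> L2_space U"
  using L2_space_scaleR[of f U "-1"] by simp

lemma L2_space_diff: "f \<in> L2_space U \<Longrightarrow> g \<in> L2_space U \<Longrightarrow> (\<lambda>x. f x - g x) \<in> L2_space U"
  using L2_space_add[OF _ L2_space_uminus, of f U g] by simp

lemma L2_space_zero [simp]: "(\<lambda>x. 0) \<in> L2_space U"
  by (simp add: L2_space_def)

lemma L2_space_sum: "(\<And>i. i \<in> I \<Longrightarrow> f i \<in> L2_space U) \<Longrightarrow> (\<lambda>x. \<Sum>i\<in>I. f i x) \<in> L2_space U"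
  by (induction I rule: infinite_finite_induct) (auto intro!: L2_space_add)

lemma L2_space_component: 
  assumes "f \<in> L2_space U" shows "(\<lambda>x. f x \<bullet> b) \<in> L2_space U"
proof (rule L2_spaceI)
  show m: "(\<lambda>x. f x \<bullet> b) \<in> borel_measurable (lebesgue_on U)"
    using L2_space_measurable[OF assms] by simp
  show "integrable (lebesgue_on U) (\<lambda>x. (norm (f x \<bullet> b))\<^sup>2)"
  proof (rule Bochner_Integration.integrable_bound)
    show "integrable (lebesgue_on U) (\<lambda>x. (norm (f x))\<^sup>2 * (norm b)\<^sup>2)"
      using L2_space_integrable_square[OF assms] by simp
    show "(\<lambda>x. (norm (f x \<bullet> b))\<^sup>2) \<in> borel_measurable (lebesgue_on U)" using m by simp
    have "(norm (f x \<bullet> b))\<^sup>2 \<le> (norm (f x))\<^sup>2 * (norm b)\<^sup>2" for x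
      using Cauchy_Schwarz_ineq2[of "f x" b]
      by (metis abs_ge_zero power_mono power_mult_distrib real_norm_def)
    then show "AE x in lebesgue_on U. norm ((norm (f x \<bullet> b))\<^sup>2) \<le> norm ((norm (f x))\<^sup>2 * (norm b)\<^sup>2)"
      by simp
  qed
qed

text \<open>Completeness of Lebesgue measure carries measurability over to \<open>g\<close>;
  extension by zero off \<open>U\<close> reduces the claim to the whole space.\<close>

lemma L2_space_cong_AE:
  assumes "f \<in> L2_space U" "U \<in> sets lebesgue" "AE x in lebesgue_on U. f x = g x"
  shows "g \<in> L2_space U"
proof -
  have m: "g \<in> borel_measurable (lebesgue_on U)"
  proof -
    have "(\<lambda>x. if x \<in> U then f x else 0) \<in> borel_measurable lebesgue"
      using L2_space_measurable[OF assms(1)] assms(2) borel_measurable_if by blast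
    moreover have "AE x in lebesgue. (if x \<in> U then f x else 0) = (if x \<in> U then g x else 0)"
      using assms(3) by (subst (asm) AE_restrict_space_iff) (use assms(2) in auto)
    ultimately have "(\<lambda>x. if x \<in> U then g x else 0) \<in> borel_measurable lebesgue"
      by (rule borel_measurable_AE)
    then show ?thesis
      using assms(2) borel_measurable_if by blast
  qed
  moreover have "integrable (lebesgue_on U) (\<lambda>x. (norm (g x))\<^sup>2)"
    using L2_space_integrable_square[OF assms(1)]
    by (rule Bochner_Integration.integrable_cong_AE_imp) (use m assms(3) in auto)
  ultimately show ?thesis by (rule L2_spaceI)
qed

lemma integrable_lebesgue_on_subset:
  fixes f :: "'a::euclidean_space \<Rightarrow> real"
  assumes "integrable (lebesgue_on U) f" "V \<subseteq> U" "U \<in> sets lebesgue" "V \<in> sets lebesgue"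
  shows "integrable (lebesgue_on V) f"
proof -
  have "integrable lebesgue (\<lambda>x. (if x \<in> U then f x else 0) * indicator V x)"
    using iffD2[OF Lebesgue_Measure.integrable_restrict_UNIV[OF assms(3)] assms(1)] assms(4)
    by (intro integrable_real_mult_indicator) auto
  also have "(\<lambda>x. (if x \<in> U then f x else 0) * indicator V x) = (\<lambda>x. if x \<in> V then f x else 0)"
    using assms(2) by (auto simp: fun_eq_iff)
  finally show ?thesis using assms(4) by (simp add: Lebesgue_Measure.integrable_restrict_UNIV)
qed

lemma L2_space_subset:
  assumes "f \<in> L2_space U" "V \<subseteq> U" "U \<in> sets lebesgue" "V \<in> sets lebesgue"
  shows "f \<in> L2_space V"
proof (rule L2_spaceI)
  show "f \<in> borel_measurable (lebesgue_on V)"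
    using L2_space_measurable[OF assms(1)] assms(2)
    by (metis measurable_restrict_mono)
  show "integrable (lebesgue_on V) (\<lambda>x. (norm (f x))\<^sup>2)"
    by (rule integrable_lebesgue_on_subset[OF L2_space_integrable_square[OF assms(1)] assms(2-)])
qed

section \<open>Inner product and norm of L2\<close>

lemma L2_inner_commute: "L2_inner U f g = L2_inner U g f"
  by (simp add: L2_inner_def inner_commute)

lemma L2_inner_add_left:
  "f \<in> L2_space U \<Longrightarrow> g \<in> L2_space U \<Longrightarrow> h \<in> L2_space U \<Longrightarrow>
    L2_inner U (\<lambda>x. f x + g x) h = L2_inner U f h + L2_inner U g h"
  by (simp add: L2_inner_def inner_add_left L2_inner_integrable)

lemma L2_inner_add_right:
  "f \<in> L2_space U \<Longrightarrow> g \<in> L2_space U \<Longrightarrow> h \<in> L2_space U \<Longrightarrow>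
    L2_inner U h (\<lambda>x. f x + g x) = L2_inner U h f + L2_inner U h g"
  by (simp add: L2_inner_commute[of U h] L2_inner_add_left)

lemma L2_inner_diff_left:
  "f \<in> L2_space U \<Longrightarrow> g \<in> L2_space U \<Longrightarrow> h \<in> L2_space U \<Longrightarrow>
    L2_inner U (\<lambda>x. f x - g x) h = L2_inner U f h - L2_inner U g h"
  by (simp add: L2_inner_def inner_diff_left L2_inner_integrable)

lemma L2_inner_diff_right:
  "f \<in> L2_space U \<Longrightarrow> g \<in> L2_space U \<Longrightarrow> h \<in> L2_space U \<Longrightarrow>
    L2_inner U h (\<lambda>x. f x - g x) = L2_inner U h f - L2_inner U h g"
  by (simp add: L2_inner_commute[of U h] L2_inner_diff_left)

lemma L2_inner_scaleR_left: "L2_inner U (\<lambda>x. c *\<^sub>R f x) g = c * L2_inner U f g"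
  by (simp add: L2_inner_def)

lemma L2_inner_scaleR_right: "L2_inner U f (\<lambda>x. c *\<^sub>R g x) = c * L2_inner U f g"
  by (simp add: L2_inner_def)

lemma L2_inner_mult_left:
  fixes f :: "real ^ 'n \<Rightarrow> real"
  shows "L2_inner U (\<lambda>x. c * f x) g = c * L2_inner U f g"
  using L2_inner_scaleR_left[of U c f g] by simp

lemma L2_inner_mult_right:
  fixes f :: "real ^ 'n \<Rightarrow> real"
  shows "L2_inner U f (\<lambda>x. c * g x) = c * L2_inner U f g"
  using L2_inner_scaleR_right[of U f c g] by simp

lemma L2_inner_zero [simp]: "L2_inner U (\<lambda>x. 0) g = 0" "L2_inner U g (\<lambda>x. 0) = 0"
  by (simp_all add: L2_inner_def)

lemma L2_inner_self_nonneg: "0 \<le> L2_inner U f f"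
  by (simp add: L2_inner_def)

lemma L2_norm_nonneg [simp]: "0 \<le> L2_norm U f"
  by (simp add: L2_norm_def L2_inner_self_nonneg)

lemma L2_norm_square: "(L2_norm U f)\<^sup>2 = L2_inner U f f"
  by (simp add: L2_norm_def L2_inner_self_nonneg)

lemma L2_inner_cong_AE:
  assumes "AE x in lebesgue_on U. f x = f' x" "AE x in lebesgue_on U. g x = g' x"
    "f \<in> L2_space U" "f' \<in> L2_space U" "g \<in> L2_space U" "g' \<in> L2_space U"
  shows "L2_inner U f g = L2_inner U f' g'"
  unfolding L2_inner_def
proof (rule integral_cong_AE)
  show "AE x in lebesgue_on U. f x \<bullet> g x = f' x \<bullet> g' x"
    using assms(1,2) by eventually_elim simp
qed (use assms(3-) in \<open>auto intro: borel_measurable_inner L2_space_measurable\<close>)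

lemma L2_norm_cong_AE:
  assumes "AE x in lebesgue_on U. f x = f' x" "f \<in> L2_space U" "f' \<in> L2_space U"
  shows "L2_norm U f = L2_norm U f'"
  using L2_inner_cong_AE[OF assms(1,1)] assms(2,3) by (simp add: L2_norm_def)

lemma L2_norm_eq_0_iff:
  assumes "f \<in> L2_space U"
  shows "L2_norm U f = 0 \<longleftrightarrow> (AE x in lebesgue_on U. f x = 0)"
proof -
  have "L2_norm U f = 0 \<longleftrightarrow> (LINT x|lebesgue_on U. f x \<bullet> f x) = 0"
    by (simp add: L2_norm_def L2_inner_def)
  also have "\<dots> \<longleftrightarrow> (AE x in lebesgue_on U. f x \<bullet> f x = 0)"
    by (rule integral_nonneg_eq_0_iff_AE) (use L2_inner_integrable[OF assms assms] in auto)
  finally show ?thesis by simp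
qed

text \<open>The squared norm of f - t g is a nonnegative quadratic in t. It is evaluated at its
  minimiser \<open>?B / ?C\<close> or, if \<open>?C\<close> vanishes, at a point that excludes
  \<open>?B \<noteq> 0\<close>.\<close>

lemma L2_Cauchy_Schwarz:
  assumes f: "f \<in> L2_space U" and g: "g \<in> L2_space U"
  shows "\<bar>L2_inner U f g\<bar> \<le> L2_norm U f * L2_norm U g"
proof -
  let ?A = "L2_inner U f f" and ?B = "L2_inner U f g" and ?C = "L2_inner U g g"
  have q: "?A - 2 * t * ?B + t\<^sup>2 * ?C \<ge> 0" for t
  proof -
    have tg: "(\<lambda>x. t *\<^sub>R g x) \<in> L2_space U" by (rule L2_space_scaleR[OF g])
    have "0 \<le> L2_inner U (\<lambda>x. f x - t *\<^sub>R g x) (\<lambda>x. f x - t *\<^sub>R g x)"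
      by (rule L2_inner_self_nonneg)
    also have "\<dots> = ?A - 2 * t * ?B + t\<^sup>2 * ?C"
      using f g tg
      by (simp add: L2_inner_diff_left L2_inner_diff_right L2_space_diff L2_inner_scaleR_left
          L2_inner_scaleR_right L2_inner_commute[of U g f] power2_eq_square algebra_simps)
    finally show ?thesis .
  qed
  have "?B\<^sup>2 \<le> ?A * ?C"
  proof (cases "?C = 0")
    case True
    have "?B = 0"
    proof (rule ccontr)
      assume "?B \<noteq> 0"
      \<comment> \<open>With \<open>?C = 0\<close> the quadratic is affine in \<open>t\<close>, and
        at this point its value is -1.\<close>
      then show False using q[of "(?A + 1) / (2 * ?B)"] True by simp
    qed
    then show ?thesis using True by simp
  next
    case False
    then have "?C > 0" using L2_inner_self_nonneg[of U g] by simp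
    then have "?A - 2 * (?B / ?C) * ?B + (?B / ?C)\<^sup>2 * ?C = ?A - ?B\<^sup>2 / ?C"
      by (simp add: power2_eq_square field_simps)
    then have "?B\<^sup>2 / ?C \<le> ?A" using q[of "?B / ?C"] by simp
    then show ?thesis using \<open>?C > 0\<close> by (simp add: field_simps)
  qed
  then have "sqrt (?B\<^sup>2) \<le> sqrt (?A * ?C)" by (rule real_sqrt_le_mono)
  then show ?thesis by (simp add: L2_norm_def real_sqrt_mult)
qed

lemma L2_norm_triangle:
  assumes f: "f \<in> L2_space U" and g: "g \<in> L2_space U"
  shows "L2_norm U (\<lambda>x. f x + g x) \<le> L2_norm U f + L2_norm U g"
proof (rule power2_le_imp_le)
  have "(L2_norm U (\<lambda>x. f x + g x))\<^sup>2 = (L2_norm U f)\<^sup>2 + 2 * L2_inner U f g + (L2_norm U g)\<^sup>2"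
    using f g by (simp add: L2_norm_square L2_inner_add_left L2_inner_add_right L2_space_add
        L2_inner_commute[of U g f])
  also have "\<dots> \<le> (L2_norm U f)\<^sup>2 + 2 * (L2_norm U f * L2_norm U g) + (L2_norm U g)\<^sup>2"
    using L2_Cauchy_Schwarz[OF f g] by simp
  also have "\<dots> = (L2_norm U f + L2_norm U g)\<^sup>2"
    by (simp add: power2_sum)
  finally show "(L2_norm U (\<lambda>x. f x + g x))\<^sup>2 \<le> (L2_norm U f + L2_norm U g)\<^sup>2" .
qed simp

lemma L2_norm_scaleR: "L2_norm U (\<lambda>x. c *\<^sub>R f x) = \<bar>c\<bar> * L2_norm U f"
  by (simp add: L2_norm_def L2_inner_scaleR_left L2_inner_scaleR_right real_sqrt_mult flip: mult.assoc)

lemma L2_norm_mult: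
  fixes f :: "real ^ 'n \<Rightarrow> real"
  shows "L2_norm U (\<lambda>x. c * f x) = \<bar>c\<bar> * L2_norm U f"
  using L2_norm_scaleR[of U c f] by simp

lemma L2_norm_minus_commute: "L2_norm U (\<lambda>x. f x - g x) = L2_norm U (\<lambda>x. g x - f x)"
  by (simp add: L2_norm_def L2_inner_def inner_diff_left inner_diff_right algebra_simps)

lemma L2_norm_triangle_ge:
  assumes f: "f \<in> L2_space U" and g: "g \<in> L2_space U"
  shows "\<bar>L2_norm U f - L2_norm U g\<bar> \<le> L2_norm U (\<lambda>x. f x - g x)"
  using L2_norm_triangle[OF L2_space_diff[OF f g] g] L2_norm_triangle[OF L2_space_diff[OF g f] f]
  by (simp add: L2_norm_minus_commute[of U f g])

lemma L2_inner_subset: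
  assumes "V \<subseteq> U" "U \<in> sets lebesgue" "V \<in> sets lebesgue"
  shows "L2_inner V f g = (LINT x|lebesgue_on U. indicator V x * (f x \<bullet> g x))"
proof -
  have "(LINT x|lebesgue_on U. (if x \<in> V then f x \<bullet> g x else 0)) = L2_inner V f g"
    unfolding L2_inner_def using integral_restrict[of V U "\<lambda>x. f x \<bullet> g x"] assms by simp
  moreover have "(\<lambda>x. if x \<in> V then f x \<bullet> g x else 0) = (\<lambda>x. indicator V x * (f x \<bullet> g x))"
    by (auto simp: fun_eq_iff)
  ultimately show ?thesis by simp
qed

lemma L2_norm_subset:
  assumes "f \<in> L2_space U" "V \<subseteq> U" "U \<in> sets lebesgue" "V \<in> sets lebesgue"
  shows "L2_norm V f \<le> L2_norm U f"
proof -
  have "L2_inner V f f \<le> L2_inner U f f"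
    unfolding L2_inner_subset[OF assms(2-)] unfolding L2_inner_def
  proof (rule integral_mono)
    have "integrable (lebesgue_on U) (\<lambda>x. f x \<bullet> f x * indicator V x)"
      by (rule integrable_real_mult_indicator)
        (use assms L2_inner_integrable[OF assms(1,1)] in \<open>auto simp: sets_restrict_space_iff\<close>)
    then show "integrable (lebesgue_on U) (\<lambda>x. indicator V x * (f x \<bullet> f x))"
      by (simp add: mult.commute)
  qed (use L2_inner_integrable[OF assms(1,1)] in \<open>auto simp: indicator_def\<close>)
  then show ?thesis by (simp add: L2_norm_def)
qed

lemma bounded_in_L2_space:
  assumes "f \<in> borel_measurable (lebesgue_on U)" "U \<in> lmeasurable" "\<And>x. x \<in> U \<Longrightarrow> norm (f x) \<le> B"
  shows "f \<in> L2_space U"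
proof (rule L2_spaceI[OF assms(1)])
  interpret finite_measure "lebesgue_on U" using assms(2) by (rule finite_measure_lebesgue_on)
  show "integrable (lebesgue_on U) (\<lambda>x. (norm (f x))\<^sup>2)"
  proof (rule integrable_const_bound)
    have "(norm (f x))\<^sup>2 \<le> B\<^sup>2" if "x \<in> U" for x using assms(3)[OF that] by (intro power_mono) auto
    then show "AE x in lebesgue_on U. norm ((norm (f x))\<^sup>2) \<le> B\<^sup>2"
      by (intro AE_I2) (use assms(2) in \<open>auto simp: fmeasurableD\<close>)
  qed (use assms(1) in simp)
qed

lemma const_in_L2_space: "U \<in> lmeasurable \<Longrightarrow> (\<lambda>x. c) \<in> L2_space U"
  by (rule bounded_in_L2_space[where B = "norm c"]) auto

lemma continuous_in_L2_space:
  fixes f :: "real ^ 'n \<Rightarrow> 'b::euclidean_space"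
  assumes "continuous_on UNIV f" "bounded U" "U \<in> sets lebesgue"
  shows "f \<in> L2_space U"
proof -
  have "compact (f ` closure U)"
    using assms by (meson compact_closure compact_continuous_image continuous_on_subset subset_UNIV)
  then obtain B where "\<And>x. x \<in> closure U \<Longrightarrow> norm (f x) \<le> B"
    by (metis bounded_iff compact_imp_bounded imageI)
  then show ?thesis
    using assms closure_subset[of U]
    by (intro bounded_in_L2_space[where B = B] bounded_set_imp_lmeasurable)
      (auto intro: continuous_imp_measurable_on_sets_lebesgue continuous_on_subset)
qed

lemma bounded_open_lmeasurable: "open U \<Longrightarrow> bounded U \<Longrightarrow> U \<in> lmeasurable"
  by (simp add: lmeasurable_open)

lemma L2_space_integrable:
  fixes f :: "real ^ 'n \<Rightarrow> real"
  assumes "f \<in> L2_space U" "U \<in> lmeasurable"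
  shows "integrable (lebesgue_on U) f"
  using L2_inner_integrable[OF assms(1) const_in_L2_space[OF assms(2), of 1]] by simp

section \<open>Smooth functions and test functions\<close>

text \<open>An invariant takes the place of formulas for iterated derivatives:
  \<open>foldr partial_deriv\<close> never leaves a class that is closed under partial
  derivatives.\<close>

lemma smooth_coinduct:
  assumes "f \<in> X"
    and "\<And>g. g \<in> X \<Longrightarrow> g differentiable_on UNIV \<and> (\<forall>i. partial_deriv i g \<in> X)"
  shows "smooth f"
proof -
  have "foldr partial_deriv is f \<in> X" for "is"
    by (induction "is") (use assms in auto)
  then show ?thesis using assms(2) by (auto simp: smooth_def)
qed

lemma smooth_differentiable_on: "smooth f \<Longrightarrow> f differentiable_on UNIV"
  unfolding smooth_def by (drule spec[of _ "[]"]) simp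

lemma smooth_differentiable: "smooth f \<Longrightarrow> f differentiable (at x)"
  using smooth_differentiable_on[of f] by (simp add: differentiable_on_def)

lemma smooth_partial_deriv: "smooth f \<Longrightarrow> smooth (partial_deriv i f)"
  unfolding smooth_def
proof
  fix "is" assume "\<forall>is. foldr partial_deriv is f differentiable_on UNIV"
  \<comment> \<open>\<open>foldr\<close> applies the last entry of the list first, so the derivative
    taken beforehand is appended at the end.\<close>
  then have "foldr partial_deriv (is @ [i]) f differentiable_on UNIV" by blast
  then show "foldr partial_deriv is (partial_deriv i f) differentiable_on UNIV" by simp
qed

lemma smooth_continuous_on: "smooth f \<Longrightarrow> continuous_on S f"
  using differentiable_imp_continuous_on smooth_differentiable_on continuous_on_subset by blast

lemma partial_deriv_eqI: "(f has_derivative f') (at x) \<Longrightarrow> partial_deriv i f x = f' (axis i 1)"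
  unfolding partial_deriv_def using frechet_derivative_at by metis

lemma smooth_has_derivative:
  assumes "smooth f"
  shows "(f has_derivative (\<lambda>h. h \<bullet> classical_grad f x)) (at x)"
proof -
  let ?D = "frechet_derivative f (at x)"
  have D: "(f has_derivative ?D) (at x)"
    using smooth_differentiable[OF assms] frechet_derivative_works by blast
  then interpret bounded_linear ?D by (rule has_derivative_bounded_linear)
  have "?D h = h \<bullet> classical_grad f x" for h
  proof -
    have "?D h = ?D (\<Sum>i\<in>UNIV. (h $ i) *s axis i 1)"
      using basis_expansion[of h] by simp
    also have "\<dots> = (\<Sum>i\<in>UNIV. h $ i * ?D (axis i 1))"
      by (simp add: sum scaleR scalar_mult_eq_scaleR)
    also have "\<dots> = h \<bullet> classical_grad f x"
      by (simp add: inner_vec_def classical_grad_def partial_deriv_def)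
    finally show ?thesis .
  qed
  then show ?thesis using D by (metis (no_types, lifting) ext)
qed

lemma partial_deriv_add:
  "smooth f \<Longrightarrow> smooth g \<Longrightarrow> partial_deriv i (\<lambda>x. f x + g x) = (\<lambda>x. partial_deriv i f x + partial_deriv i g x)"
  using partial_deriv_eqI[OF has_derivative_add[OF smooth_has_derivative smooth_has_derivative], of f g]
  by (simp add: fun_eq_iff inner_axis' classical_grad_def)

lemma partial_deriv_mult:
  "smooth f \<Longrightarrow> smooth g \<Longrightarrow>
    partial_deriv i (\<lambda>x. f x * g x) = (\<lambda>x. f x * partial_deriv i g x + partial_deriv i f x * g x)"
  using partial_deriv_eqI[OF has_derivative_mult[OF smooth_has_derivative smooth_has_derivative], of f g]
  by (simp add: fun_eq_iff inner_axis' classical_grad_def)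

text \<open>The product rule turns a product into a sum of products, so products of smooth functions
  alone are not closed under differentiation. The algebra they generate is, which makes it an
  invariant for \<open>smooth_coinduct\<close>.\<close>

inductive_set smooth_algebra :: "(real ^ 'n \<Rightarrow> real) set" where
  base: "smooth f \<Longrightarrow> f \<in> smooth_algebra"
| add: "f \<in> smooth_algebra \<Longrightarrow> g \<in> smooth_algebra \<Longrightarrow> (\<lambda>x. f x + g x) \<in> smooth_algebra"
| mult: "f \<in> smooth_algebra \<Longrightarrow> g \<in> smooth_algebra \<Longrightarrow> (\<lambda>x. f x * g x) \<in> smooth_algebra"

lemma partial_deriv_has_derivative:
  "f differentiable_on UNIV \<Longrightarrow> (f has_derivative frechet_derivative f (at x)) (at x)"
  by (simp add: differentiable_on_def frechet_derivative_works)

lemma smooth_algebra_smooth: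
  assumes "f \<in> smooth_algebra" shows "smooth f"
proof (rule smooth_coinduct[OF assms])
  fix g :: "real ^ 'n \<Rightarrow> real" assume "g \<in> smooth_algebra"
  then show "g differentiable_on UNIV \<and> (\<forall>i. partial_deriv i g \<in> smooth_algebra)"
  proof induction
    case (base f)
    then show ?case
      using smooth_differentiable_on smooth_partial_deriv smooth_algebra.base by blast
  next
    case (add f g)
    have "partial_deriv i (\<lambda>x. f x + g x) = (\<lambda>x. partial_deriv i f x + partial_deriv i g x)" for i
      using partial_deriv_eqI[OF has_derivative_add[OF partial_deriv_has_derivative partial_deriv_has_derivative], of f g] add.IH
      by (auto simp: partial_deriv_def)
    then show ?case using add by (auto intro: smooth_algebra.add differentiable_on_add)
  next
    case (mult f g)
    have "partial_deriv i (\<lambda>x. f x * g x) = (\<lambda>x. f x * partial_deriv i g x + partial_deriv i f x * g x)" for i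
      using partial_deriv_eqI[OF has_derivative_mult[OF partial_deriv_has_derivative partial_deriv_has_derivative], of f g] mult.IH
      by (auto simp: partial_deriv_def)
    then show ?case using mult
      by (auto intro!: smooth_algebra.add smooth_algebra.mult differentiable_on_mult)
  qed
qed

lemma smooth_add: "smooth f \<Longrightarrow> smooth g \<Longrightarrow> smooth (\<lambda>x. f x + g x)"
  by (rule smooth_algebra_smooth[OF smooth_algebra.add[OF smooth_algebra.base smooth_algebra.base]])

lemma smooth_mult: "smooth f \<Longrightarrow> smooth g \<Longrightarrow> smooth (\<lambda>x. f x * g x)"
  by (rule smooth_algebra_smooth[OF smooth_algebra.mult[OF smooth_algebra.base smooth_algebra.base]])

lemma smooth_const [simp]: "smooth (\<lambda>x. c)"
proof (rule smooth_coinduct[where X = "range (\<lambda>c x. c)"])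
  fix g :: "real ^ 'n \<Rightarrow> real" assume "g \<in> range (\<lambda>c x. c)"
  then obtain c where g: "g = (\<lambda>x. c)" by auto
  have "partial_deriv i g = (\<lambda>x. 0)" for i by (simp add: g partial_deriv_def fun_eq_iff)
  then show "g differentiable_on UNIV \<and> (\<forall>i. partial_deriv i g \<in> range (\<lambda>c x. c))"
    by (auto simp: g)
qed simp

lemma smooth_prod: "(\<And>i. i \<in> I \<Longrightarrow> smooth (f i)) \<Longrightarrow> smooth (\<lambda>x. \<Prod>i\<in>I. f i x)"
  by (induction I rule: infinite_finite_induct) (auto intro: smooth_mult)

lemma smooth_diff: "smooth f \<Longrightarrow> smooth g \<Longrightarrow> smooth (\<lambda>x. f x - g x)"
  using smooth_add[OF _ smooth_mult[OF smooth_const[of "-1"]], of f g] by simp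

lemma has_derivative_translate:
  assumes "(f has_derivative f') (at (x + t))" shows "((\<lambda>x. f (x + t)) has_derivative f') (at x)"
proof -
  have "((\<lambda>x. x + t) has_derivative (\<lambda>x. x)) (at x)" by (auto intro!: derivative_eq_intros)
  from has_derivative_compose[OF this assms] show ?thesis .
qed

lemma partial_deriv_translate:
  assumes "f differentiable_on UNIV"
  shows "partial_deriv i (\<lambda>x. f (x + t)) = (\<lambda>x. partial_deriv i f (x + t))"
proof
  fix x
  have "((\<lambda>x. f (x + t)) has_derivative frechet_derivative f (at (x + t))) (at x)"
    by (intro has_derivative_translate partial_deriv_has_derivative assms)
  then show "partial_deriv i (\<lambda>x. f (x + t)) x = partial_deriv i f (x + t)"
    by (subst partial_deriv_eqI) (auto simp: partial_deriv_def)
qed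

lemma smooth_translate:
  fixes f :: "real ^ 'n \<Rightarrow> real"
  assumes "smooth f" shows "smooth (\<lambda>x. f (x + t))"
proof (rule smooth_coinduct[where X = "(\<lambda>f x. f (x + t)) ` {f. smooth f}"])
  fix g :: "real ^ 'n \<Rightarrow> real" assume "g \<in> (\<lambda>f x. f (x + t)) ` {f. smooth f}"
  then obtain f where f: "smooth f" "g = (\<lambda>x. f (x + t))" by auto
  have "g differentiable at x" for x
    unfolding f(2) using has_derivative_translate[OF smooth_has_derivative[OF f(1)]]
    by (auto simp: differentiable_def)
  moreover have "partial_deriv i g \<in> (\<lambda>f x. f (x + t)) ` {f. smooth f}" for i
    unfolding f(2) partial_deriv_translate[OF smooth_differentiable_on[OF f(1)]]
    using smooth_partial_deriv[OF f(1)] by blast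
  ultimately show "g differentiable_on UNIV \<and> (\<forall>i. partial_deriv i g \<in> (\<lambda>f x. f (x + t)) ` {f. smooth f})"
    by (auto simp: differentiable_on_def)
qed (use assms in auto)

text \<open>
  The derivatives of $e^{-1/t}$, extended by $0$ to $t \le 0$, all have the form
  $p(1/t)\,e^{-1/t}$ with a polynomial $p$.
\<close>

definition exp_poly :: "real poly \<Rightarrow> real \<Rightarrow> real" where
  "exp_poly p t = (if t > 0 then poly p (1 / t) * exp (- (1 / t)) else 0)"

lemma tendsto_poly_over_exp: "((\<lambda>x::real. poly p x / exp x) \<longlongrightarrow> 0) at_top"
proof -
  have "((\<lambda>x::real. \<Sum>i\<le>degree p. coeff p i * (x ^ i / exp x)) \<longlongrightarrow> (\<Sum>i\<le>degree p. coeff p i * 0)) at_top"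
    by (intro tendsto_intros tendsto_power_div_exp_0)
  then show ?thesis by (simp add: poly_altdef sum_divide_distrib)
qed

text \<open>With s = 1/t the derivative of p(s) exp(-s) in t is s^2 (p(s) - p'(s)) exp(-s), and the
  polynomial \<open>[:0, 0, 1:]\<close> is s^2.\<close>

lemma exp_poly_has_derivative:
  "(exp_poly p has_real_derivative exp_poly ([:0, 0, 1:] * (p - pderiv p)) t) (at t)"
proof -
  let ?q = "[:0, 0, 1:] * (p - pderiv p)"
  consider "t > 0" | "t < 0" | "t = 0" by linarith
  then show ?thesis
  proof cases
    case 1
    have D: "((\<lambda>t. poly p (1 / t) * exp (- (1 / t))) has_real_derivative exp_poly ?q t) (at t)"
      using 1 by (auto intro!: derivative_eq_intros DERIV_chain2[OF poly_DERIV]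
          simp: exp_poly_def field_simps power2_eq_square)
    have ev: "\<forall>\<^sub>F s in nhds t. poly p (1 / s) * exp (- (1 / s)) = exp_poly p s"
      using eventually_nhds_in_open[of "{0<..}" t] 1 by (auto simp: exp_poly_def elim: eventually_mono)
    show ?thesis
      using D by (rule iffD1[OF DERIV_cong_ev[OF refl ev refl]])
  next
    case 2
    have D: "((\<lambda>t. 0) has_real_derivative exp_poly ?q t) (at t)"
      using 2 by (simp add: exp_poly_def)
    have ev: "\<forall>\<^sub>F s in nhds t. 0 = exp_poly p s"
      using eventually_nhds_in_open[of "{..<0}" t] 2 by (auto simp: exp_poly_def elim: eventually_mono)
    show ?thesis
      using D by (rule iffD1[OF DERIV_cong_ev[OF refl ev refl]])
  next
    case 3
    \<comment> \<open>At 0 the right difference quotient is s p(s) / exp(s) with s = 1/h tending to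
      infinity; from the left it is 0.\<close>
    have "((\<lambda>h. poly ([:0, 1:] * p) (inverse h) / exp (inverse h)) \<longlongrightarrow> 0) (at_right 0)"
      using filterlim_compose[OF tendsto_poly_over_exp filterlim_inverse_at_top_right] .
    moreover have "\<forall>\<^sub>F h in at_right 0. poly ([:0, 1:] * p) (inverse h) / exp (inverse h)
        = (exp_poly p (0 + h) - exp_poly p 0) / h"
      by (auto simp: eventually_at_filter exp_poly_def field_simps exp_minus)
    ultimately have "((\<lambda>h. (exp_poly p (0 + h) - exp_poly p 0) / h) \<longlongrightarrow> 0) (at_right 0)"
      by (rule Lim_transform_eventually)
    moreover have "((\<lambda>h. (exp_poly p (0 + h) - exp_poly p 0) / h) \<longlongrightarrow> 0) (at_left 0)"
    proof (rule Lim_transform_eventually[OF tendsto_const])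
      show "\<forall>\<^sub>F h in at_left 0. 0 = (exp_poly p (0 + h) - exp_poly p 0) / h"
        by (auto simp: eventually_at_filter exp_poly_def)
    qed
    ultimately have "((\<lambda>h. (exp_poly p (0 + h) - exp_poly p 0) / h) \<longlongrightarrow> 0) (at 0)"
      by (simp add: filterlim_at_split)
    then show ?thesis using 3 by (simp add: DERIV_def exp_poly_def)
  qed
qed

text \<open>The factor \<open>c\<close> belongs to the invariant family because differentiating in
  direction i brings out \<open>a $ i\<close>.\<close>

lemma smooth_exp_poly: "smooth (\<lambda>x::real ^ 'n. exp_poly p (a \<bullet> x + b))"
proof (rule smooth_coinduct[where X = "{\<lambda>x. c * exp_poly p (a \<bullet> x + b) | c p. True}"])
  fix g assume "g \<in> {\<lambda>x. c * exp_poly p (a \<bullet> x + b) | c p. True}"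
  then obtain c p where g: "g = (\<lambda>x. c * exp_poly p (a \<bullet> x + b))" by auto
  let ?q = "[:0, 0, 1:] * (p - pderiv p)"
  have D: "(g has_derivative (\<lambda>h. c * ((a \<bullet> h) * exp_poly ?q (a \<bullet> x + b)))) (at x)" for x
    unfolding g
    by (rule has_derivative_mult_right, rule DERIV_compose_FDERIV[OF exp_poly_has_derivative])
      (auto intro!: derivative_eq_intros)
  then have "partial_deriv i g = (\<lambda>x. (c * (a $ i)) * exp_poly ?q (a \<bullet> x + b))" for i
    using partial_deriv_eqI[OF D] by (simp add: fun_eq_iff inner_axis)
  then show "g differentiable_on UNIV \<and> (\<forall>i. partial_deriv i g \<in> {\<lambda>x. c * exp_poly p (a \<bullet> x + b) | c p. True})"
    using D by (auto simp: differentiable_on_def differentiable_def)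
qed (rule CollectI, rule exI[of _ 1], rule exI[of _ p], simp)

section \<open>Test functions\<close>

lemma test_functionI:
  assumes "smooth \<phi>" "compact K" "K \<subseteq> U" "\<And>x. x \<notin> K \<Longrightarrow> \<phi> x = 0"
  shows "test_function U \<phi>"
proof -
  have "closure {x. \<phi> x \<noteq> 0} \<subseteq> K"
    using assms(2,4) by (intro closure_minimal) (auto simp: compact_imp_closed)
  then show ?thesis
    using assms unfolding test_function_def
    by (metis bounded_subset closed_closure compact_eq_bounded_closed order_trans)
qed

lemma test_functionE:
  assumes "test_function U \<phi>"
  obtains K where "smooth \<phi>" "compact K" "K \<subseteq> U" "\<And>x. x \<notin> K \<Longrightarrow> \<phi> x = 0"
proof
  show "\<phi> x = 0" if "x \<notin> closure {x. \<phi> x \<noteq> 0}" for x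
    using that closure_subset[of "{x. \<phi> x \<noteq> 0}"] by auto
qed (use assms in \<open>auto simp: test_function_def\<close>)

lemma test_function_smooth: "test_function U \<phi> \<Longrightarrow> smooth \<phi>"
  by (simp add: test_function_def)

lemma test_function_mono: "test_function U \<phi> \<Longrightarrow> U \<subseteq> V \<Longrightarrow> test_function V \<phi>"
  by (auto simp: test_function_def)

lemma test_function_zero [simp]: "test_function U (\<lambda>x. 0)"
  by (rule test_functionI[of _ "{}"]) auto

lemma test_function_add:
  assumes "test_function U \<phi>" "test_function U \<psi>" shows "test_function U (\<lambda>x. \<phi> x + \<psi> x)"
proof -
  obtain K where K: "smooth \<phi>" "compact K" "K \<subseteq> U" "\<And>x. x \<notin> K \<Longrightarrow> \<phi> x = 0"
    using assms(1) by (rule test_functionE) blast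
  obtain L where L: "smooth \<psi>" "compact L" "L \<subseteq> U" "\<And>x. x \<notin> L \<Longrightarrow> \<psi> x = 0"
    using assms(2) by (rule test_functionE) blast
  show ?thesis
    by (rule test_functionI[of _ "K \<union> L"]) (use K L in \<open>auto intro: smooth_add\<close>)
qed

lemma test_function_smooth_mult:
  assumes "smooth \<psi>" "test_function U \<phi>" shows "test_function U (\<lambda>x. \<psi> x * \<phi> x)"
proof -
  obtain K where K: "smooth \<phi>" "compact K" "K \<subseteq> U" "\<And>x. x \<notin> K \<Longrightarrow> \<phi> x = 0"
    using assms(2) by (rule test_functionE) blast
  show ?thesis
    by (rule test_functionI[of _ K]) (use K assms in \<open>auto intro: smooth_mult\<close>)
qed

lemma test_function_scale: "test_function U \<phi> \<Longrightarrow> test_function U (\<lambda>x. c * \<phi> x)"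
  using test_function_smooth_mult[of "\<lambda>x. c"] by simp

lemma test_function_partial_deriv:
  assumes "test_function U \<phi>" shows "test_function U (partial_deriv i \<phi>)"
proof -
  obtain K where K: "smooth \<phi>" "compact K" "K \<subseteq> U" "\<And>x. x \<notin> K \<Longrightarrow> \<phi> x = 0"
    using assms by (rule test_functionE) blast
  have "partial_deriv i \<phi> x = 0" if "x \<notin> K" for x
  proof -
    have "(\<phi> has_derivative (\<lambda>h. 0)) (at x)"
    proof (rule has_derivative_transform_within_open)
      show "((\<lambda>x. 0) has_derivative (\<lambda>h. 0)) (at x)" by simp
      show "open (- K)" using K(2) compact_imp_closed by blast
    qed (use K that in auto)
    then show ?thesis by (simp add: partial_deriv_eqI)
  qed
  then show ?thesis
    by (intro test_functionI[of _ K]) (use K smooth_partial_deriv in auto)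
qed

lemma test_function_continuous_on: "test_function U \<phi> \<Longrightarrow> continuous_on S \<phi>"
  using smooth_continuous_on test_function_smooth by blast

lemma test_function_bounded:
  assumes "test_function U \<phi>" obtains B where "B > 0" "\<And>x. \<bar>\<phi> x\<bar> \<le> B"
proof -
  obtain K where K: "smooth \<phi>" "compact K" "K \<subseteq> U" "\<And>x. x \<notin> K \<Longrightarrow> \<phi> x = 0"
    using assms by (rule test_functionE) blast
  have "compact (\<phi> ` K)"
    using K by (intro compact_continuous_image smooth_continuous_on)
  then obtain B where B: "B > 0" "\<And>x. x \<in> K \<Longrightarrow> \<bar>\<phi> x\<bar> \<le> B"
    by (metis bounded_pos compact_imp_bounded imageI real_norm_def)
  then show ?thesis using that[of B] K(4) by (metis abs_zero less_imp_le)
qed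

lemma test_function_in_L2_space:
  assumes "test_function U \<phi>" "V \<in> lmeasurable" shows "\<phi> \<in> L2_space V"
proof -
  obtain B where "\<And>x. \<bar>\<phi> x\<bar> \<le> B" using test_function_bounded[OF assms(1)] by metis
  then show ?thesis
    using assms by (intro bounded_in_L2_space[where B = B])
      (auto intro!: continuous_imp_measurable_on_sets_lebesgue test_function_continuous_on[OF assms(1)])
qed

lemma test_function_translate:
  assumes "test_function U \<phi>" "\<And>x. x \<in> U \<Longrightarrow> x - t \<in> V" shows "test_function V (\<lambda>x. \<phi> (x + t))"
proof -
  obtain K where K: "smooth \<phi>" "compact K" "K \<subseteq> U" "\<And>x. x \<notin> K \<Longrightarrow> \<phi> x = 0"
    using assms(1) by (rule test_functionE) blast
  show ?thesis
  proof (rule test_functionI)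
    show "smooth (\<lambda>x. \<phi> (x + t))" using K by (intro smooth_translate)
    show "compact ((\<lambda>x. x - t) ` K)"
      using K by (intro compact_continuous_image continuous_intros)
    show "(\<lambda>x. x - t) ` K \<subseteq> V" using K assms by auto
    show "\<phi> (x + t) = 0" if "x \<notin> (\<lambda>x. x - t) ` K" for x
      using that K(4)[of "x + t"] by (metis add_diff_cancel_right' imageI)
  qed
qed

section \<open>Density of test functions\<close>

text \<open>For the polynomial 1, \<open>exp_poly\<close> is exp(-1/t) for t > 0 and 0 otherwise.
  Each coordinate contributes such a factor for its distance to either end of its interval.
  Multiplying the distances by \<open>Suc k\<close> drives every factor to 1 inside the box and
  leaves a zero factor outside.\<close>

lemma bump_box:
  fixes a b :: "real ^ 'n"
  obtains \<phi> :: "nat \<Rightarrow> real ^ 'n \<Rightarrow> real" where "\<And>k. smooth (\<phi> k)" "\<And>k x. 0 \<le> \<phi> k x" "\<And>k x. \<phi> k x \<le> 1"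
    "\<And>k x. x \<notin> box a b \<Longrightarrow> \<phi> k x = 0" "\<And>x. x \<in> box a b \<Longrightarrow> (\<lambda>k. \<phi> k x) \<longlonglongrightarrow> 1"
proof -
  let ?E = "exp_poly 1"
  define \<phi> where "\<phi> k x = (\<Prod>i\<in>UNIV. ?E (real (Suc k) * (x $ i - a $ i)) * ?E (real (Suc k) * (b $ i - x $ i)))"
    for k :: nat and x :: "real ^ 'n"
  have E: "0 \<le> ?E t" "?E t \<le> 1" for t by (auto simp: exp_poly_def)
  have lim: "(\<lambda>k. ?E (real (Suc k) * t)) \<longlonglongrightarrow> 1" if "t > 0" for t
  proof -
    have "(\<lambda>k. exp (- (inverse (real (Suc k)) * (1 / t)))) \<longlonglongrightarrow> exp (- (0 * (1 / t)))"
      by (intro tendsto_intros LIMSEQ_inverse_real_of_nat)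
    moreover have "exp (- (inverse (real (Suc k)) * (1 / t))) = ?E (real (Suc k) * t)" for k
      using that mult_pos_pos[of "real (Suc k)" t] by (simp add: exp_poly_def divide_inverse mult.commute)
    ultimately show ?thesis by simp
  qed
  show ?thesis
  proof (rule that[of \<phi>])
    show "smooth (\<phi> k)" for k
    proof -
      have "smooth (\<lambda>x::real ^ 'n. ?E (real (Suc k) * (x $ i - a $ i)))" for i
        using smooth_exp_poly[of 1 "axis i (real (Suc k))" "- real (Suc k) * a $ i"]
        by (simp add: inner_axis' algebra_simps)
      moreover have "smooth (\<lambda>x::real ^ 'n. ?E (real (Suc k) * (b $ i - x $ i)))" for i
        using smooth_exp_poly[of 1 "axis i (- real (Suc k))" "real (Suc k) * b $ i"]
        by (simp add: inner_axis' algebra_simps)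
      ultimately show ?thesis unfolding \<phi>_def by (intro smooth_prod smooth_mult)
    qed
    show "0 \<le> \<phi> k x" for k x unfolding \<phi>_def using E by (intro prod_nonneg) simp
    show "\<phi> k x \<le> 1" for k x unfolding \<phi>_def using E by (intro prod_le_1) (simp add: mult_le_one)
    show "\<phi> k x = 0" if "x \<notin> box a b" for k x
    proof -
      from that obtain i where "x $ i \<le> a $ i \<or> b $ i \<le> x $ i" by (auto simp: mem_box_cart not_less)
      then have "?E (real (Suc k) * (x $ i - a $ i)) * ?E (real (Suc k) * (b $ i - x $ i)) = 0"
        by (auto simp: exp_poly_def zero_less_mult_iff)
      then show ?thesis unfolding \<phi>_def by (intro prod_zero) auto
    qed
    show "(\<lambda>k. \<phi> k x) \<longlonglongrightarrow> 1" if "x \<in> box a b" for x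
    proof -
      have "(\<lambda>k. \<phi> k x) \<longlonglongrightarrow> (\<Prod>i\<in>(UNIV::'n set). 1 * 1)"
        unfolding \<phi>_def using that by (intro tendsto_intros lim) (auto simp: mem_box_cart)
      then show ?thesis by simp
    qed
  qed
qed

text \<open>By Lindelof an open set is a countable union of open boxes whose closed boxes it
  contains, so finitely many of them lie in a compact subset. One index does two jobs: at stage k
  only the first k boxes take part, and their bumps are sharpened to level k.\<close>

lemma test_functions_to_indicator:
  fixes V :: "(real ^ 'n) set"
  assumes "open V"
  obtains \<phi> where "\<And>k::nat. test_function V (\<phi> k)" "\<And>k x. 0 \<le> \<phi> k x" "\<And>k x. \<phi> k x \<le> 1"
    "\<And>x. (\<lambda>k. \<phi> k x) \<longlonglongrightarrow> indicator V x"
proof (cases "V = {}")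
  case True
  then show ?thesis using that[of "\<lambda>k x. 0"] by simp
next
  case False
  define F where "F = {box a b | a b. cbox a b \<subseteq> V}"
  have FV: "\<Union>F = V"
  proof
    show "\<Union>F \<subseteq> V" unfolding F_def using box_subset_cbox by blast
    show "V \<subseteq> \<Union>F"
    proof
      fix x assume "x \<in> V"
      then obtain a b where "x \<in> box a b" "cbox a b \<subseteq> V"
        using open_contains_cbox[of V] assms by metis
      then show "x \<in> \<Union>F" unfolding F_def by auto
    qed
  qed
  obtain F' where F': "F' \<subseteq> F" "countable F'" "\<Union>F' = \<Union>F"
    using Lindelof[of F] unfolding F_def using open_box by blast
  then have ne: "F' \<noteq> {}" using FV False by auto
  have "\<exists>a b. from_nat_into F' j = box a b \<and> cbox a b \<subseteq> V" for j
    using from_nat_into[OF ne, of j] F'(1) unfolding F_def by blast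
  then obtain a b where ab: "\<And>j. from_nat_into F' j = box (a j) (b j)" "\<And>j. cbox (a j) (b j) \<subseteq> V"
    by metis
  have U: "(\<Union>j. box (a j) (b j)) = V"
    using range_from_nat_into[OF ne F'(2)] ab(1) F'(3) FV by (metis (no_types, lifting) image_cong)
  have "\<exists>\<phi>. (\<forall>k. smooth (\<phi> k)) \<and> (\<forall>k x. 0 \<le> \<phi> k x \<and> \<phi> k x \<le> 1) \<and>
      (\<forall>k x. x \<notin> box (a j) (b j) \<longrightarrow> \<phi> k x = 0) \<and> (\<forall>x\<in>box (a j) (b j). (\<lambda>k::nat. \<phi> k x) \<longlonglongrightarrow> 1)" for j :: nat
    by (rule bump_box[of "a j" "b j"]) blast
  then obtain \<phi> where \<phi>: "\<And>j k. smooth (\<phi> j k)" "\<And>j k x. 0 \<le> \<phi> j k x" "\<And>j k x. \<phi> j k x \<le> 1"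
      "\<And>j k x. x \<notin> box (a j) (b j) \<Longrightarrow> \<phi> j k x = 0"
      "\<And>j x. x \<in> box (a j) (b j) \<Longrightarrow> (\<lambda>k::nat. \<phi> j k x) \<longlonglongrightarrow> 1" by metis
  \<comment> \<open>A smooth substitute for the maximum of the first k bumps: its values stay in
    [0, 1], dominate each single bump and vanish where all bumps vanish.\<close>
  define \<psi> where "\<psi> k x = 1 - (\<Prod>j<k. 1 - \<phi> j k x)" for k x
  have out: "\<psi> k x = 0" if "x \<notin> (\<Union>j<k. box (a j) (b j))" for k x
    unfolding \<psi>_def using that \<phi>(4) by simp
  show ?thesis
  proof (rule that[of \<psi>])
    show "test_function V (\<psi> k)" for k
    proof (rule test_functionI[of _ "\<Union>j<k. cbox (a j) (b j)"])
      show "smooth (\<psi> k)" unfolding \<psi>_def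
        by (intro smooth_diff smooth_prod smooth_const \<phi>(1))
      show "compact (\<Union>j<k. cbox (a j) (b j))" by auto
      show "(\<Union>j<k. cbox (a j) (b j)) \<subseteq> V" using ab by auto
      show "\<psi> k x = 0" if "x \<notin> (\<Union>j<k. cbox (a j) (b j))" for x
        using that box_subset_cbox by (intro out) blast
    qed
    have P: "0 \<le> (\<Prod>j<k. 1 - \<phi> j k x)" "(\<Prod>j<k. 1 - \<phi> j k x) \<le> 1" for k x
      using \<phi>(2,3) by (auto intro!: prod_nonneg prod_le_1)
    show "0 \<le> \<psi> k x" "\<psi> k x \<le> 1" for k x using P[of k x] by (auto simp: \<psi>_def)
    show "(\<lambda>k. \<psi> k x) \<longlonglongrightarrow> indicator V x" for x
    proof (cases "x \<in> V")
      case False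
      then have "\<psi> k x = 0" for k using U by (intro out) auto
      then show ?thesis using False by simp
    next
      case True
      then obtain j where j: "x \<in> box (a j) (b j)" using U by auto
      have le: "(\<Prod>j<k. 1 - \<phi> j k x) \<le> 1 - \<phi> j k x" if "k > j" for k
      proof -
        have "(\<Prod>j<k. 1 - \<phi> j k x) = (1 - \<phi> j k x) * (\<Prod>i\<in>{..<k} - {j}. 1 - \<phi> i k x)"
          using that by (intro prod.remove) auto
        also have "\<dots> \<le> (1 - \<phi> j k x) * 1"
          using \<phi>(2,3) by (intro mult_left_mono prod_le_1) auto
        finally show ?thesis by simp
      qed
      have "(\<lambda>k. \<Prod>j<k. 1 - \<phi> j k x) \<longlonglongrightarrow> 0"
      proof (rule tendsto_sandwich[OF _ _ tendsto_const])
        show "\<forall>\<^sub>F k in sequentially. (\<Prod>j<k. 1 - \<phi> j k x) \<le> 1 - \<phi> j k x"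
          using eventually_gt_at_top[of j] by eventually_elim (rule le)
        show "(\<lambda>k. 1 - \<phi> j k x) \<longlonglongrightarrow> 0"
          using tendsto_diff[OF tendsto_const[of 1] \<phi>(5)[OF j]] by simp
      qed (use P in auto)
      then have "(\<lambda>k. \<psi> k x) \<longlonglongrightarrow> 1 - 0" unfolding \<psi>_def by (intro tendsto_intros)
      then show ?thesis using True by simp
    qed
  qed
qed

lemma L2_dominated_convergence:
  fixes f :: "real ^ 'n \<Rightarrow> real"
  assumes "\<And>k. s k \<in> L2_space U" "f \<in> L2_space U" "w \<in> L2_space U"
    and "AE x in lebesgue_on U. (\<lambda>k. s k x) \<longlonglongrightarrow> f x"
    and "\<And>k. AE x in lebesgue_on U. \<bar>s k x - f x\<bar> \<le> \<bar>w x\<bar>"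
  shows "(\<lambda>k. L2_norm U (\<lambda>x. f x - s k x)) \<longlonglongrightarrow> 0"
proof -
  have "(\<lambda>k. LINT x|lebesgue_on U. (f x - s k x) \<bullet> (f x - s k x)) \<longlonglongrightarrow> (LINT x|lebesgue_on U. 0)"
  proof (rule integral_dominated_convergence)
    show "integrable (lebesgue_on U) (\<lambda>x. w x \<bullet> w x)"
      using assms(3) by (intro L2_inner_integrable)
    show "(\<lambda>x. (f x - s k x) \<bullet> (f x - s k x)) \<in> borel_measurable (lebesgue_on U)" for k
      using L2_inner_integrable[OF L2_space_diff[OF assms(2) assms(1)] L2_space_diff[OF assms(2) assms(1)]]
      by (rule borel_measurable_integrable)
    show "AE x in lebesgue_on U. (\<lambda>k. (f x - s k x) \<bullet> (f x - s k x)) \<longlonglongrightarrow> 0"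
      using assms(4)
    proof eventually_elim
      case (elim x)
      have "(\<lambda>k. (f x - s k x) \<bullet> (f x - s k x)) \<longlonglongrightarrow> (f x - f x) \<bullet> (f x - f x)"
        by (intro tendsto_intros elim)
      then show ?case by simp
    qed
    show "AE x in lebesgue_on U. norm ((f x - s k x) \<bullet> (f x - s k x)) \<le> w x \<bullet> w x" for k
      using assms(5)[of k]
    proof eventually_elim
      case (elim x)
      then have "(f x - s k x)\<^sup>2 \<le> (w x)\<^sup>2" by (simp add: abs_le_square_iff abs_minus_commute)
      then show ?case by (simp add: abs_mult_self_eq flip: power2_eq_square)
    qed
  qed simp
  then have "(\<lambda>k. sqrt (L2_inner U (\<lambda>x. f x - s k x) (\<lambda>x. f x - s k x))) \<longlonglongrightarrow> sqrt 0"
    by (intro tendsto_intros) (simp add: L2_inner_def)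
  then show ?thesis by (simp add: L2_norm_def)
qed

text \<open>The L2 closure of the test functions. Being a closed subspace, it grows from indicators
  of open sets to indicators of measurable sets, to simple functions, and finally to all of
  L2.\<close>

definition test_closure :: "(real ^ 'n) set \<Rightarrow> (real ^ 'n \<Rightarrow> real) set" where
  "test_closure U = {g \<in> L2_space U. \<forall>e>0. \<exists>\<phi>. test_function U \<phi> \<and> L2_norm U (\<lambda>x. g x - \<phi> x) < e}"

lemma test_closure_limit:
  assumes "U \<in> lmeasurable" "g \<in> L2_space U" "\<And>e. e > 0 \<Longrightarrow> \<exists>h \<in> test_closure U. L2_norm U (\<lambda>x. g x - h x) < e"
  shows "g \<in> test_closure U"
  unfolding test_closure_def
proof (intro CollectI conjI allI impI assms)
  fix e :: real assume "e > 0"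
  obtain h where h: "h \<in> test_closure U" "L2_norm U (\<lambda>x. g x - h x) < e / 2"
    using assms(3)[of "e / 2"] \<open>e > 0\<close> by auto
  obtain \<phi> where \<phi>: "test_function U \<phi>" "L2_norm U (\<lambda>x. h x - \<phi> x) < e / 2"
    using h(1) half_gt_zero[OF \<open>e > 0\<close>] unfolding test_closure_def by blast
  have "h \<in> L2_space U" "\<phi> \<in> L2_space U"
    using h(1) \<phi>(1) assms(1) test_function_in_L2_space by (auto simp: test_closure_def)
  then have "L2_norm U (\<lambda>x. (g x - h x) + (h x - \<phi> x)) \<le> L2_norm U (\<lambda>x. g x - h x) + L2_norm U (\<lambda>x. h x - \<phi> x)"
    using assms(2) by (intro L2_norm_triangle L2_space_diff)
  then show "\<exists>\<phi>. test_function U \<phi> \<and> L2_norm U (\<lambda>x. g x - \<phi> x) < e"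
    using \<phi> h(2) by (intro exI[of _ \<phi>]) simp
qed

lemma test_closure_add:
  assumes "U \<in> lmeasurable" "g \<in> test_closure U" "h \<in> test_closure U"
  shows "(\<lambda>x. g x + h x) \<in> test_closure U"
  unfolding test_closure_def
proof (intro CollectI conjI allI impI)
  have gh: "g \<in> L2_space U" "h \<in> L2_space U" using assms by (auto simp: test_closure_def)
  then show "(\<lambda>x. g x + h x) \<in> L2_space U" by (rule L2_space_add)
  fix e :: real assume "e > 0"
  then have "e / 2 > 0" by simp
  then obtain \<phi> \<psi> where *: "test_function U \<phi>" "L2_norm U (\<lambda>x. g x - \<phi> x) < e / 2"
      "test_function U \<psi>" "L2_norm U (\<lambda>x. h x - \<psi> x) < e / 2"
    using assms(2,3) unfolding test_closure_def by blast
  have "L2_norm U (\<lambda>x. (g x - \<phi> x) + (h x - \<psi> x)) \<le> L2_norm U (\<lambda>x. g x - \<phi> x) + L2_norm U (\<lambda>x. h x - \<psi> x)"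
    using gh * assms(1) test_function_in_L2_space by (intro L2_norm_triangle L2_space_diff) blast+
  then have "L2_norm U (\<lambda>x. g x + h x - (\<phi> x + \<psi> x)) < e" using * by (simp add: algebra_simps)
  then show "\<exists>\<phi>. test_function U \<phi> \<and> L2_norm U (\<lambda>x. g x + h x - \<phi> x) < e"
    using test_function_add[OF *(1,3)] by (intro exI[of _ "\<lambda>x. \<phi> x + \<psi> x"]) simp
qed

lemma test_closure_scale:
  assumes "g \<in> test_closure U"
  shows "(\<lambda>x. c * g x) \<in> test_closure U"
  unfolding test_closure_def
proof (intro CollectI conjI allI impI)
  show "(\<lambda>x. c * g x) \<in> L2_space U" using assms by (auto simp: test_closure_def intro: L2_space_mult)
  fix e :: real assume "e > 0"
  \<comment> \<open>Adding 1 to the modulus keeps the division meaningful for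
    \<open>c = 0\<close>.\<close>
  then have "e / (\<bar>c\<bar> + 1) > 0" by (simp add: add_nonneg_pos)
  then obtain \<phi> where *: "test_function U \<phi>" "L2_norm U (\<lambda>x. g x - \<phi> x) < e / (\<bar>c\<bar> + 1)"
    using assms unfolding test_closure_def by blast
  have "L2_norm U (\<lambda>x. c * g x - c * \<phi> x) = \<bar>c\<bar> * L2_norm U (\<lambda>x. g x - \<phi> x)"
    using L2_norm_mult[of U c "\<lambda>x. g x - \<phi> x"] by (simp add: algebra_simps)
  also have "\<dots> \<le> (\<bar>c\<bar> + 1) * L2_norm U (\<lambda>x. g x - \<phi> x)" by (intro mult_right_mono) auto
  also have "\<dots> < e" using *(2) by (simp add: field_simps)
  finally show "\<exists>\<phi>. test_function U \<phi> \<and> L2_norm U (\<lambda>x. c * g x - \<phi> x) < e"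
    using test_function_scale[OF *(1)] by (intro exI[of _ "\<lambda>x. c * \<phi> x"]) simp
qed

lemma test_closure_sum:
  assumes "U \<in> lmeasurable" "\<And>i. i \<in> I \<Longrightarrow> g i \<in> test_closure U"
  shows "(\<lambda>x. \<Sum>i\<in>I. g i x) \<in> test_closure U"
proof -
  have "(\<lambda>x. 0) \<in> test_closure U"
    unfolding test_closure_def by (auto simp: L2_norm_def intro!: exI[of _ "\<lambda>x. 0"])
  then show ?thesis using assms(2)
    by (induction I rule: infinite_finite_induct) (auto intro: test_closure_add assms(1))
qed

lemma indicator_in_L2_space:
  assumes "U \<in> lmeasurable" "A \<in> sets lebesgue"
  shows "(indicator A :: real ^ 'n \<Rightarrow> real) \<in> L2_space U"
proof (rule bounded_in_L2_space[where B = 1])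
  show "indicator A \<in> borel_measurable (lebesgue_on U)"
    using assms by (intro measurable_restrict_space1 borel_measurable_indicator)
qed (use assms in auto)

lemma indicator_open_in_test_closure:
  fixes U V :: "(real ^ 'n) set"
  assumes "open U" "U \<in> lmeasurable" "open V" "V \<subseteq> U"
  shows "indicator V \<in> test_closure U"
  unfolding test_closure_def
proof (intro CollectI conjI allI impI)
  show L: "(indicator V :: real ^ 'n \<Rightarrow> real) \<in> L2_space U"
    using assms by (intro indicator_in_L2_space) auto
  obtain \<phi> where \<phi>: "\<And>k::nat. test_function V (\<phi> k)" "\<And>k x. 0 \<le> \<phi> k x" "\<And>k x. \<phi> k x \<le> 1"
    "\<And>x. (\<lambda>k. \<phi> k x) \<longlonglongrightarrow> indicator V x" using test_functions_to_indicator[OF assms(3)] by metis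
  have "(\<lambda>k. L2_norm U (\<lambda>x. indicator V x - \<phi> k x)) \<longlonglongrightarrow> 0"
  proof (rule L2_dominated_convergence[where w = "\<lambda>x. 1"])
    show "\<phi> k \<in> L2_space U" for k using \<phi>(1) assms(2) by (rule test_function_in_L2_space)
    have "\<bar>\<phi> k x - indicator V x\<bar> \<le> \<bar>1\<bar>" for k x
      using \<phi>(2)[of k x] \<phi>(3)[of k x] by (auto simp: indicator_def)
    then show "AE x in lebesgue_on U. \<bar>\<phi> k x - indicator V x\<bar> \<le> \<bar>1\<bar>" for k by simp
  qed (use L \<phi> assms const_in_L2_space in auto)
  moreover fix e :: real assume "e > 0"
  ultimately have "\<forall>\<^sub>F k in sequentially. L2_norm U (\<lambda>x. indicator V x - \<phi> k x) < e"
    by (rule order_tendstoD)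
  then obtain k where "L2_norm U (\<lambda>x. indicator V x - \<phi> k x) < e"
    unfolding eventually_sequentially by blast
  then show "\<exists>\<phi>. test_function U \<phi> \<and> L2_norm U (\<lambda>x. indicator V x - \<phi> x) < e"
    using \<phi>(1) assms(4) test_function_mono by blast
qed

lemma indicator_in_test_closure:
  fixes U A :: "(real ^ 'n) set"
  assumes "open U" "U \<in> lmeasurable" "A \<in> sets lebesgue" "A \<subseteq> U"
  shows "indicator A \<in> test_closure U"
proof (rule test_closure_limit[OF assms(2) indicator_in_L2_space[OF assms(2,3)]])
  fix e :: real assume "e > 0"
  \<comment> \<open>Outer regularity with tolerance \<open>e\<^sup>2\<close>: the squared L2
    distance of the two indicators is the measure of the part of \<open>T - A\<close> inside
    \<open>U\<close>.\<close>
  then obtain T where T: "open T" "A \<subseteq> T" "T - A \<in> lmeasurable" "emeasure lebesgue (T - A) < ennreal (e\<^sup>2)"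
    using sets_lebesgue_outer_open[OF assms(3), of "e\<^sup>2"] by auto
  have "L2_norm U (\<lambda>x. indicator A x - indicator (T \<inter> U) x :: real) < e"
  proof -
    have "(L2_norm U (\<lambda>x. indicator A x - indicator (T \<inter> U) x :: real))\<^sup>2 = measure (lebesgue_on U) ((T - A) \<inter> U)"
    proof -
      have "(indicator A x - indicator (T \<inter> U) x) * (indicator A x - indicator (T \<inter> U) x) = (indicator ((T - A) \<inter> U) x :: real)" for x
        using T(2) assms(4) by (auto simp: indicator_def)
      then have "(L2_norm U (\<lambda>x. indicator A x - indicator (T \<inter> U) x :: real))\<^sup>2 = (LINT x|lebesgue_on U. indicator ((T - A) \<inter> U) x)"
        unfolding L2_norm_square L2_inner_def by simp
      then show ?thesis using assms(2) T(3) by (simp add: fmeasurableD)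
    qed
    also have "\<dots> = measure lebesgue ((T - A) \<inter> U)"
      using assms(2) T(3) by (intro measure_restrict_space) (auto simp: fmeasurableD)
    also have "\<dots> \<le> measure lebesgue (T - A)"
      using T(3) assms(2) by (intro measure_mono_fmeasurable) (auto simp: fmeasurableD)
    also have "\<dots> < e\<^sup>2"
      using T(3,4) \<open>e > 0\<close> by (simp add: emeasure_eq_measure2 ennreal_less_iff)
    finally show ?thesis using \<open>e > 0\<close> by (simp add: power_less_imp_less_base)
  qed
  then show "\<exists>h\<in>test_closure U. L2_norm U (\<lambda>x. indicator A x - h x) < e"
    using indicator_open_in_test_closure[OF assms(1,2), of "T \<inter> U"] T(1) assms(1) by blast
qed

text \<open>The approximating simple functions obey |s| \<le> 2 |f|, hence |s - f| \<le> 3 |f|, and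
  this majorant turns pointwise convergence into L2 convergence.\<close>

lemma test_functions_dense:
  assumes "open U" "U \<in> lmeasurable" "f \<in> L2_space U" "e > 0"
  obtains \<phi> where "test_function U \<phi>" "L2_norm U (\<lambda>x. f x - \<phi> x) < e"
proof -
  have sp: "space (lebesgue_on U) = U" by simp
  have "\<exists>s. (\<forall>i. simple_function (lebesgue_on U) (s i)) \<and> (\<forall>x\<in>U. (\<lambda>i. s i x) \<longlonglongrightarrow> f x) \<and>
      (\<forall>i. \<forall>x\<in>U. dist (s i x) 0 \<le> 2 * dist (f x) 0)"
    using borel_measurable_implies_sequence_metric[OF L2_space_measurable[OF assms(3)], of 0]
    unfolding sp .
  then obtain s where s: "\<And>i. simple_function (lebesgue_on U) (s i)"
      "\<And>x. x \<in> U \<Longrightarrow> (\<lambda>i. s i x) \<longlonglongrightarrow> f x" "\<And>i x. x \<in> U \<Longrightarrow> \<bar>s i x\<bar> \<le> 2 * \<bar>f x\<bar>"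
    unfolding dist_real_def diff_0_right by blast
  have sU: "s i \<in> L2_space U" for i
  proof (rule L2_spaceI)
    show m: "s i \<in> borel_measurable (lebesgue_on U)" using s(1) by (rule borel_measurable_simple_function)
    show "integrable (lebesgue_on U) (\<lambda>x. (norm (s i x))\<^sup>2)"
    proof (rule Bochner_Integration.integrable_bound)
      show "integrable (lebesgue_on U) (\<lambda>x. 4 * (norm (f x))\<^sup>2)"
        using L2_space_integrable_square[OF assms(3)] by simp
      have "(s i x)\<^sup>2 \<le> 4 * (f x)\<^sup>2" if "x \<in> U" for x
        using power_mono[OF s(3)[OF that, of i], of 2] by (simp add: power_mult_distrib)
      then show "AE x in lebesgue_on U. norm ((norm (s i x))\<^sup>2) \<le> norm (4 * (norm (f x))\<^sup>2)"
        by (intro AE_I2) simp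
    qed (use m in simp)
  qed
  have closure: "s i \<in> test_closure U" for i
  proof -
    \<comment> \<open>The expansion of \<open>s i\<close> over its level sets is only valid on
      \<open>U\<close>, hence the detour through a vanishing L2 distance instead of an equality of
      functions.\<close>
    define h where "h x = (\<Sum>y\<in>s i ` U. y * indicator (s i -` {y} \<inter> U) x)" for x
    have "h \<in> test_closure U" unfolding h_def
    proof (intro test_closure_sum test_closure_scale indicator_in_test_closure assms)
      fix y
      have "s i -` {y} \<inter> space (lebesgue_on U) \<in> sets (lebesgue_on U)"
        using s(1) by (rule simple_functionD)
      then show "s i -` {y} \<inter> U \<in> sets lebesgue"
        using assms(2) by (simp add: sets_restrict_space_iff fmeasurableD)
    qed auto
    moreover have "h x = s i x" if "x \<in> U" for x
    proof -
      have "finite (s i ` U)" using simple_functionD(1)[OF s(1), of i] by simp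
      moreover have "h x = (\<Sum>y\<in>s i ` U. if y = s i x then y else 0)"
        unfolding h_def using that by (intro sum.cong) auto
      ultimately show ?thesis using that by simp
    qed
    then have "(LINT x|lebesgue_on U. (s i x - h x) \<bullet> (s i x - h x)) = (LINT x|lebesgue_on U. 0)"
      by (intro Bochner_Integration.integral_cong) auto
    then have "L2_norm U (\<lambda>x. s i x - h x) = 0"
      by (simp add: L2_norm_def L2_inner_def)
    ultimately show ?thesis
      by (intro test_closure_limit[OF assms(2) sU]) (metis)
  qed
  have "f \<in> test_closure U"
  proof (rule test_closure_limit[OF assms(2,3)])
    have "(\<lambda>k. L2_norm U (\<lambda>x. f x - s k x)) \<longlonglongrightarrow> 0"
    proof (rule L2_dominated_convergence[where w = "\<lambda>x. 3 * f x"])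
      have "\<bar>s k x - f x\<bar> \<le> \<bar>3 * f x\<bar>" if "x \<in> U" for k x
        using s(3)[OF that, of k] by linarith
      then show "AE x in lebesgue_on U. \<bar>s k x - f x\<bar> \<le> \<bar>3 * f x\<bar>" for k
        by (intro AE_I2) simp
    qed (use s sU assms(3) L2_space_mult in auto)
    moreover fix e :: real assume "e > 0"
    ultimately have "\<forall>\<^sub>F k in sequentially. L2_norm U (\<lambda>x. f x - s k x) < e"
      by (rule order_tendstoD)
    then obtain k where "L2_norm U (\<lambda>x. f x - s k x) < e"
      unfolding eventually_sequentially by blast
    then show "\<exists>h\<in>test_closure U. L2_norm U (\<lambda>x. f x - h x) < e" using closure by blast
  qed
  then show ?thesis using that assms(4) unfolding test_closure_def by blast
qed

text \<open>One would like to test with \<open>w\<close> itself; a test function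
  \<open>\<phi>\<close> close to \<open>w\<close> gives (w, w) = (w, w - \<phi>) + (w, \<phi>),
  where the first term is small and the hypothesis applies to the second.\<close>

lemma L2_norm_le_by_duality:
  assumes "open U" "U \<in> lmeasurable" "w \<in> L2_space U" "C \<ge> 0"
    and "\<And>\<phi>. test_function U \<phi> \<Longrightarrow> L2_inner U w \<phi> \<le> C * L2_norm U \<phi>"
  shows "L2_norm U w \<le> C"
proof (rule ccontr)
  let ?N = "L2_norm U w"
  assume "\<not> ?N \<le> C"
  then have N: "?N > C" "?N > 0" using assms(4) by auto
  \<comment> \<open>Chosen so that \<open>(?N + C) * e\<close> is half of
    \<open>?N * (?N - C)\<close>, the room left by the assumption \<open>?N > C\<close>.\<close>
  define e where "e = ?N * (?N - C) / (2 * (?N + C))"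
  have "e > 0" using N assms(4) by (simp add: e_def)
  then obtain \<phi> where \<phi>: "test_function U \<phi>" "L2_norm U (\<lambda>x. w x - \<phi> x) < e"
    using test_functions_dense[OF assms(1-3)] by metis
  have \<phi>L: "\<phi> \<in> L2_space U" using \<phi>(1) assms(2) by (rule test_function_in_L2_space)
  have "?N\<^sup>2 = L2_inner U w (\<lambda>x. w x - \<phi> x) + L2_inner U w \<phi>"
    using assms(3) \<phi>L by (simp add: L2_norm_square L2_inner_diff_right)
  also have "\<dots> \<le> ?N * L2_norm U (\<lambda>x. w x - \<phi> x) + C * L2_norm U \<phi>"
    using L2_Cauchy_Schwarz[OF assms(3) L2_space_diff[OF assms(3) \<phi>L]] assms(5)[OF \<phi>(1)] by linarith
  also have "\<dots> \<le> ?N * e + C * (?N + e)"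
  proof -
    have "L2_norm U \<phi> \<le> ?N + e"
      using L2_norm_triangle_ge[OF assms(3) \<phi>L] \<phi>(2) by linarith
    then show ?thesis
      using \<phi>(2) N assms(4) by (intro add_mono mult_left_mono) auto
  qed
  also have "\<dots> = (?N + C) * e + C * ?N" by (simp add: algebra_simps)
  also have "(?N + C) * e = ?N * (?N - C) / 2"
    unfolding e_def using N assms(4) by (simp add: field_simps)
  finally have "?N\<^sup>2 \<le> ?N * (?N - C) / 2 + C * ?N" .
  moreover have "?N * (?N - C) = ?N\<^sup>2 - C * ?N" by (simp add: power2_eq_square algebra_simps)
  moreover have "?N * (?N - C) > 0" using N by simp
  ultimately show False by linarith
qed

lemma AE_eq_0_by_duality:
  assumes "open U" "U \<in> lmeasurable" "w \<in> L2_space U"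
    and "\<And>\<phi>. test_function U \<phi> \<Longrightarrow> L2_inner U w \<phi> = 0"
  shows "AE x in lebesgue_on U. w x = 0"
proof -
  have "L2_norm U w \<le> 0"
    by (rule L2_norm_le_by_duality[OF assms(1-3)]) (use assms(4) in auto)
  then have "L2_norm U w = 0" using L2_norm_nonneg[of U w] by simp
  then show ?thesis using L2_norm_eq_0_iff[OF assms(3)] by simp
qed

section \<open>Translations\<close>

lemma lebesgue_distr_translate: "distr lebesgue lebesgue (\<lambda>x. x + h) = (lebesgue :: 'a::euclidean_space measure)"
proof -
  have *: "h + (\<Sum>j\<in>Basis. (1 * (x \<bullet> j)) *\<^sub>R j) = x + h" for x :: 'a
    by (simp add: euclidean_representation add.commute)
  show ?thesis
    using lebesgue_affine_euclidean[of "\<lambda>_. 1" h] unfolding * by (simp add: density_1)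
qed

lemma lebesgue_measurable_translate: "(\<lambda>x. x + h) \<in> lebesgue \<rightarrow>\<^sub>M (lebesgue :: 'a::euclidean_space measure)"
proof -
  have *: "h + (\<Sum>j\<in>Basis. (1 * (x \<bullet> j)) *\<^sub>R j) = x + h" for x :: 'a
    by (simp add: euclidean_representation add.commute)
  show ?thesis
    using lebesgue_affine_measurable[of "\<lambda>_. 1" h] unfolding * by simp
qed

lemma sets_lebesgue_translate:
  "U \<in> sets lebesgue \<Longrightarrow> {x. x + h \<in> U} \<in> sets (lebesgue :: 'a::euclidean_space measure)"
  using measurable_sets[OF lebesgue_measurable_translate, of U h] by (simp add: vimage_def)

lemma lebesgue_on_distr_translate:
  assumes "U \<in> sets lebesgue"
  shows "distr (lebesgue_on {x. x + h \<in> U}) (lebesgue_on U) (\<lambda>x. x + h) = lebesgue_on (U :: 'a::euclidean_space set)"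
proof (rule measure_eqI)
  have V: "{x. x + h \<in> U} \<in> sets lebesgue" by (rule sets_lebesgue_translate[OF assms])
  have m: "(\<lambda>x. x + h) \<in> lebesgue_on {x. x + h \<in> U} \<rightarrow>\<^sub>M lebesgue_on U"
    by (intro measurable_restrict_space3[OF lebesgue_measurable_translate]) auto
  fix A assume "A \<in> sets (distr (lebesgue_on {x. x + h \<in> U}) (lebesgue_on U) (\<lambda>x. x + h))"
  then have A: "A \<in> sets lebesgue" "A \<subseteq> U" using assms by (auto simp: sets_restrict_space_iff)
  have "emeasure (distr (lebesgue_on {x. x + h \<in> U}) (lebesgue_on U) (\<lambda>x. x + h)) A
      = emeasure (lebesgue_on {x. x + h \<in> U}) {x. x + h \<in> A}"
  proof (subst emeasure_distr[OF m])
    show "A \<in> sets (lebesgue_on U)" using A assms by (auto simp: sets_restrict_space_iff)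
    have "(\<lambda>x. x + h) -` A \<inter> space (lebesgue_on {x. x + h \<in> U}) = {x. x + h \<in> A}"
      using A(2) by auto
    then show "emeasure (lebesgue_on {x. x + h \<in> U}) ((\<lambda>x. x + h) -` A \<inter> space (lebesgue_on {x. x + h \<in> U}))
       = emeasure (lebesgue_on {x. x + h \<in> U}) {x. x + h \<in> A}" by simp
  qed
  also have "\<dots> = emeasure lebesgue {x. x + h \<in> A}"
    using V A by (subst emeasure_restrict_space) auto
  also have "\<dots> = emeasure (distr lebesgue lebesgue (\<lambda>x. x + h)) A"
    using A by (subst emeasure_distr[OF lebesgue_measurable_translate]) (auto simp: vimage_def)
  also have "\<dots> = emeasure lebesgue A" by (simp add: lebesgue_distr_translate)
  also have "\<dots> = emeasure (lebesgue_on U) A"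
    using A assms by (subst emeasure_restrict_space) auto
  finally show "emeasure (distr (lebesgue_on {x. x + h \<in> U}) (lebesgue_on U) (\<lambda>x. x + h)) A = emeasure (lebesgue_on U) A" .
qed simp

lemma
  fixes f :: "'a::euclidean_space \<Rightarrow> real"
  assumes "U \<in> sets lebesgue" "f \<in> borel_measurable (lebesgue_on U)"
  shows lebesgue_on_integral_translate:
      "(LINT x|lebesgue_on {x. x + h \<in> U}. f (x + h)) = (LINT x|lebesgue_on U. f x)"
    and lebesgue_on_integrable_translate:
      "integrable (lebesgue_on {x. x + h \<in> U}) (\<lambda>x. f (x + h)) \<longleftrightarrow> integrable (lebesgue_on U) f"
proof -
  have m: "(\<lambda>x. x + h) \<in> lebesgue_on {x. x + h \<in> U} \<rightarrow>\<^sub>M lebesgue_on U"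
    by (intro measurable_restrict_space3[OF lebesgue_measurable_translate]) auto
  show "(LINT x|lebesgue_on {x. x + h \<in> U}. f (x + h)) = (LINT x|lebesgue_on U. f x)"
    using integral_distr[OF m assms(2)] by (simp add: lebesgue_on_distr_translate[OF assms(1)])
  show "integrable (lebesgue_on {x. x + h \<in> U}) (\<lambda>x. f (x + h)) \<longleftrightarrow> integrable (lebesgue_on U) f"
    using integrable_distr_eq[OF m assms(2)] by (simp add: lebesgue_on_distr_translate[OF assms(1)])
qed

lemma L2_space_translate:
  assumes "U \<in> sets lebesgue" "f \<in> L2_space U"
  shows "(\<lambda>x. f (x + h)) \<in> L2_space {x. x + h \<in> U}"
proof (rule L2_spaceI)
  show "(\<lambda>x. f (x + h)) \<in> borel_measurable (lebesgue_on {x. x + h \<in> U})"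
    by (rule measurable_compose[OF measurable_restrict_space3[OF lebesgue_measurable_translate] L2_space_measurable[OF assms(2)]])
      auto
  show "integrable (lebesgue_on {x. x + h \<in> U}) (\<lambda>x. (norm (f (x + h)))\<^sup>2)"
    using lebesgue_on_integrable_translate[OF assms(1) borel_measurable_integrable[OF L2_space_integrable_square[OF assms(2)]], of h]
      L2_space_integrable_square[OF assms(2)] by simp
qed

lemma L2_inner_translate:
  assumes "U \<in> sets lebesgue" "f \<in> L2_space U" "g \<in> L2_space U"
  shows "L2_inner {x. x + h \<in> U} (\<lambda>x. f (x + h)) (\<lambda>x. g (x + h)) = L2_inner U f g"
  unfolding L2_inner_def
  using lebesgue_on_integral_translate[OF assms(1) borel_measurable_integrable[OF L2_inner_integrable[OF assms(2,3)]], of h]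
  by simp

lemma L2_inner_support:
  assumes "V \<subseteq> U" "U \<in> sets lebesgue" "V \<in> sets lebesgue" "\<And>x. x \<in> U - V \<Longrightarrow> f x \<bullet> g x = 0"
  shows "L2_inner U f g = L2_inner V f g"
  unfolding L2_inner_subset[OF assms(1-3)] unfolding L2_inner_def
  by (intro Bochner_Integration.integral_cong) (use assms(4) in \<open>auto simp: indicator_def\<close>)

lemma test_function_outside: "test_function U \<phi> \<Longrightarrow> x \<notin> U \<Longrightarrow> \<phi> x = 0"
  by (elim test_functionE) auto

lemma test_function_translate_in_L2_space:
  "test_function V \<phi> \<Longrightarrow> U \<in> lmeasurable \<Longrightarrow> (\<lambda>x. \<phi> (x + t)) \<in> L2_space U"
  by (rule test_function_in_L2_space[OF test_function_translate[of V \<phi> t UNIV]]) auto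

text \<open>Written as a combination of partial derivatives, so that it is a test function by
  closure under sums and scaling; \<open>directional_deriv_eq\<close> gives the form with the
  gradient.\<close>

definition directional_deriv :: "real ^ 'n \<Rightarrow> (real ^ 'n \<Rightarrow> real) \<Rightarrow> real ^ 'n \<Rightarrow> real" where
  "directional_deriv h \<phi> x = (\<Sum>i\<in>UNIV. h $ i * partial_deriv i \<phi> x)"

lemma directional_deriv_eq: "directional_deriv h \<phi> x = h \<bullet> classical_grad \<phi> x"
  by (simp add: directional_deriv_def classical_grad_def inner_vec_def)

lemma test_function_sum:
  "(\<And>i. i \<in> I \<Longrightarrow> test_function U (f i)) \<Longrightarrow> test_function U (\<lambda>x. \<Sum>i\<in>I. f i x)"
  by (induction I rule: infinite_finite_induct) (auto intro: test_function_add)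

lemma test_function_directional_deriv:
  "test_function U \<phi> \<Longrightarrow> test_function U (directional_deriv h \<phi>)"
  unfolding directional_deriv_def[abs_def]
  by (intro test_function_sum test_function_scale test_function_partial_deriv)

lemma directional_deriv_translate:
  "smooth \<phi> \<Longrightarrow> directional_deriv h (\<lambda>x. \<phi> (x + t)) = (\<lambda>x. directional_deriv h \<phi> (x + t))"
  by (simp add: directional_deriv_def fun_eq_iff partial_deriv_translate smooth_differentiable_on)

lemma smooth_line_derivative:
  assumes "smooth \<phi>"
  shows "((\<lambda>s. \<phi> (x + s *\<^sub>R h)) has_real_derivative directional_deriv h \<phi> (x + s *\<^sub>R h)) (at s)"
proof -
  have "((\<lambda>s. x + s *\<^sub>R h) has_derivative (\<lambda>t. t *\<^sub>R h)) (at s)"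
    by (auto intro!: derivative_eq_intros)
  from has_derivative_compose[OF this smooth_has_derivative[OF assms]]
  show ?thesis
    by (simp add: has_field_derivative_def directional_deriv_eq mult_commute_abs)
qed

text \<open>The translation acts on the smooth factor, so \<open>u\<close> may be merely square
  integrable. Difference quotients of \<open>\<phi>\<close> are bounded uniformly, and a bound times
  |u| is an integrable majorant because \<open>U\<close> has finite measure.\<close>

lemma translated_test_derivative:
  assumes "U \<in> lmeasurable" "u \<in> L2_space U" "test_function V \<phi>"
  shows "((\<lambda>s. L2_inner U u (\<lambda>x. \<phi> (x + s *\<^sub>R h))) has_real_derivative
      L2_inner U u (\<lambda>x. directional_deriv h \<phi> (x + s *\<^sub>R h))) (at s)"
proof -
  let ?D = "directional_deriv h \<phi>"
  have sm: "smooth \<phi>" using assms(3) by (rule test_function_smooth)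
  have tD: "test_function V ?D" using assms(3) by (rule test_function_directional_deriv)
  obtain B where B: "B > 0" "\<And>x. \<bar>?D x\<bar> \<le> B" using test_function_bounded[OF tD] by metis
  have tr: "(\<lambda>x. \<psi> (x + t)) \<in> L2_space U" if "test_function V \<psi>" for \<psi> t
    using that assms(1) by (rule test_function_translate_in_L2_space)
  \<comment> \<open>Mean value estimate along the line. For \<open>t = 0\<close> the quotient is 0
    by the convention for division, so \<open>t\<close> needs no restriction.\<close>
  have quot: "\<bar>(\<phi> (x + (s + t) *\<^sub>R h) - \<phi> (x + s *\<^sub>R h)) / t\<bar> \<le> B" for x t
  proof (cases "t = 0")
    case False
    have "\<bar>\<phi> (x + (s + t) *\<^sub>R h) - \<phi> (x + s *\<^sub>R h)\<bar> \<le> B * \<bar>s + t - s\<bar>"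
      using field_differentiable_bound[of UNIV "\<lambda>s. \<phi> (x + s *\<^sub>R h)" "\<lambda>s. ?D (x + s *\<^sub>R h)" B "s + t" s]
        smooth_line_derivative[OF sm] B(2) by auto
    then show ?thesis using False by (simp add: field_simps)
  qed (use B in simp)
  have "((\<lambda>t. (L2_inner U u (\<lambda>x. \<phi> (x + (s + t) *\<^sub>R h)) - L2_inner U u (\<lambda>x. \<phi> (x + s *\<^sub>R h))) / t)
      \<longlongrightarrow> L2_inner U u (\<lambda>x. ?D (x + s *\<^sub>R h))) (at 0)"
    unfolding tendsto_at_iff_sequentially
  proof (intro allI impI)
    fix X :: "nat \<Rightarrow> real" assume X: "\<forall>i. X i \<in> UNIV - {0}" "X \<longlonglongrightarrow> 0"
    define q where "q i x = (\<phi> (x + (s + X i) *\<^sub>R h) - \<phi> (x + s *\<^sub>R h)) / X i" for i x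
    have qL: "q i \<in> L2_space U" for i
      unfolding q_def using L2_space_mult[OF L2_space_diff[OF tr[OF assms(3)] tr[OF assms(3)]], of "1 / X i"] by simp
    have "(\<lambda>i. LINT x|lebesgue_on U. u x \<bullet> q i x) \<longlonglongrightarrow> (LINT x|lebesgue_on U. u x \<bullet> ?D (x + s *\<^sub>R h))"
    proof (rule integral_dominated_convergence)
      show "(\<lambda>x. u x \<bullet> ?D (x + s *\<^sub>R h)) \<in> borel_measurable (lebesgue_on U)"
        using L2_inner_integrable[OF assms(2) tr[OF tD]] by (rule borel_measurable_integrable)
      show "(\<lambda>x. u x \<bullet> q i x) \<in> borel_measurable (lebesgue_on U)" for i
        using L2_inner_integrable[OF assms(2) qL] by (rule borel_measurable_integrable)
      show "integrable (lebesgue_on U) (\<lambda>x. \<bar>u x\<bar> * B)"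
        using L2_space_integrable[OF assms(2,1)] by simp
      have "(\<lambda>i. q i x) \<longlonglongrightarrow> ?D (x + s *\<^sub>R h)" for x
      proof -
        have "((\<lambda>t. (\<phi> (x + (s + t) *\<^sub>R h) - \<phi> (x + s *\<^sub>R h)) / t) \<longlongrightarrow> ?D (x + s *\<^sub>R h)) (at 0)"
          using smooth_line_derivative[OF sm, of x h s] by (simp add: DERIV_def)
        then show ?thesis using X unfolding tendsto_at_iff_sequentially q_def comp_def by blast
      qed
      then show "AE x in lebesgue_on U. (\<lambda>i. u x \<bullet> q i x) \<longlonglongrightarrow> u x \<bullet> ?D (x + s *\<^sub>R h)"
        by (intro AE_I2 tendsto_intros)
      have "norm (u x \<bullet> q i x) \<le> \<bar>u x\<bar> * B" for i x
        using mult_left_mono[OF quot[of x "X i"] abs_ge_zero[of "u x"]]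
        by (simp add: abs_mult flip: q_def)
      then show "AE x in lebesgue_on U. norm (u x \<bullet> q i x) \<le> \<bar>u x\<bar> * B" for i by simp
    qed
    moreover have "(LINT x|lebesgue_on U. u x \<bullet> q i x) =
        (L2_inner U u (\<lambda>x. \<phi> (x + (s + X i) *\<^sub>R h)) - L2_inner U u (\<lambda>x. \<phi> (x + s *\<^sub>R h))) / X i" for i
    proof -
      have "(LINT x|lebesgue_on U. u x \<bullet> q i x) = L2_inner U u (\<lambda>x. (1 / X i) * (\<phi> (x + (s + X i) *\<^sub>R h) - \<phi> (x + s *\<^sub>R h)))"
        by (simp add: L2_inner_def q_def)
      also have "\<dots> = (1 / X i) * (L2_inner U u (\<lambda>x. \<phi> (x + (s + X i) *\<^sub>R h)) - L2_inner U u (\<lambda>x. \<phi> (x + s *\<^sub>R h)))"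
        by (subst L2_inner_mult_right, subst L2_inner_diff_right) (use assms tr in auto)
      finally show ?thesis by simp
    qed
    ultimately show "((\<lambda>t. (L2_inner U u (\<lambda>x. \<phi> (x + (s + t) *\<^sub>R h)) - L2_inner U u (\<lambda>x. \<phi> (x + s *\<^sub>R h))) / t) \<circ> X)
      \<longlonglongrightarrow> L2_inner U u (\<lambda>x. ?D (x + s *\<^sub>R h))" by (simp add: comp_def L2_inner_def)
  qed
  then show ?thesis by (simp add: DERIV_def)
qed

section \<open>Weak gradients\<close>

lemma has_weak_grad_iff:
  "has_weak_grad U u G \<longleftrightarrow> (\<forall>\<phi> i. test_function U \<phi> \<longrightarrow>
      L2_inner U u (partial_deriv i \<phi>) = - L2_inner U (\<lambda>x. G x $ i) \<phi>)"
  by (simp add: has_weak_grad_def L2_inner_def)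

lemma L2_space_nth:
  fixes G :: "real ^ 'n \<Rightarrow> real ^ 'm"
  shows "G \<in> L2_space U \<Longrightarrow> (\<lambda>x. G x $ i) \<in> L2_space U"
  using L2_space_component[of G U "axis i 1"] by (simp add: inner_axis)

lemma has_weak_grad_directional:
  assumes "U \<in> lmeasurable" "u \<in> L2_space U" "G \<in> L2_space U" "has_weak_grad U u G" "test_function U \<phi>"
  shows "L2_inner U u (directional_deriv h \<phi>) = - L2_inner U (\<lambda>x. G x \<bullet> h) \<phi>"
proof -
  have t: "partial_deriv i \<phi> \<in> L2_space U" for i
    using assms(1,5) test_function_in_L2_space test_function_partial_deriv by blast
  have \<phi>: "\<phi> \<in> L2_space U" using assms(1,5) test_function_in_L2_space by blast
  have "L2_inner U u (directional_deriv h \<phi>) = (LINT x|lebesgue_on U. (\<Sum>i\<in>UNIV. h $ i * (u x \<bullet> partial_deriv i \<phi> x)))"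
    by (simp add: L2_inner_def directional_deriv_def sum_distrib_left mult_ac)
  also have "\<dots> = (\<Sum>i\<in>UNIV. h $ i * L2_inner U u (partial_deriv i \<phi>))"
    using L2_inner_integrable[OF assms(2) t] by (subst Bochner_Integration.integral_sum) (auto simp: L2_inner_def)
  also have "\<dots> = - (\<Sum>i\<in>UNIV. h $ i * L2_inner U (\<lambda>x. G x $ i) \<phi>)"
    using assms(4,5) by (simp add: has_weak_grad_iff sum_negf)
  also have "(\<Sum>i\<in>UNIV. h $ i * L2_inner U (\<lambda>x. G x $ i) \<phi>) =
      (LINT x|lebesgue_on U. (\<Sum>i\<in>UNIV. h $ i * (G x $ i \<bullet> \<phi> x)))"
    using L2_inner_integrable[OF L2_space_nth[OF assms(3)] \<phi>]
    by (subst Bochner_Integration.integral_sum) (auto simp: L2_inner_def)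
  also have "\<dots> = L2_inner U (\<lambda>x. G x \<bullet> h) \<phi>"
    by (simp add: L2_inner_def inner_vec_def sum_distrib_right sum_distrib_left mult_ac)
  finally show ?thesis .
qed

lemma has_weak_grad_add:
  assumes "U \<in> lmeasurable" "u \<in> L2_space U" "G \<in> L2_space U" "has_weak_grad U u G"
    "v \<in> L2_space U" "H \<in> L2_space U" "has_weak_grad U v H"
  shows "has_weak_grad U (\<lambda>x. u x + v x) (\<lambda>x. G x + H x)"
  unfolding has_weak_grad_iff
proof (intro allI impI)
  fix \<phi> i assume \<phi>: "test_function U \<phi>"
  then have t: "partial_deriv i \<phi> \<in> L2_space U" "\<phi> \<in> L2_space U"
    using assms(1) test_function_in_L2_space test_function_partial_deriv by blast+
  show "L2_inner U (\<lambda>x. u x + v x) (partial_deriv i \<phi>) = - L2_inner U (\<lambda>x. (G x + H x) $ i) \<phi>"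
    using assms \<phi> t L2_space_nth[OF assms(3)] L2_space_nth[OF assms(6)]
    by (simp add: L2_inner_add_left has_weak_grad_iff)
qed

lemma has_weak_grad_scale:
  "has_weak_grad U u G \<Longrightarrow> has_weak_grad U (\<lambda>x. c * u x) (\<lambda>x. c *\<^sub>R G x)"
  by (simp add: has_weak_grad_iff L2_inner_mult_left)

lemma has_weak_grad_subset:
  assumes "has_weak_grad U u G" "V \<subseteq> U" "U \<in> sets lebesgue" "V \<in> sets lebesgue"
  shows "has_weak_grad V u G"
  unfolding has_weak_grad_iff
proof (intro allI impI)
  fix \<phi> i assume \<phi>: "test_function V \<phi>"
  then have U: "test_function U \<phi>" using assms(2) test_function_mono by blast
  have "L2_inner V u (partial_deriv i \<phi>) = L2_inner U u (partial_deriv i \<phi>)"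
    by (rule L2_inner_support[symmetric, OF assms(2-)])
      (use test_function_outside[OF test_function_partial_deriv[OF \<phi>]] in auto)
  moreover have "L2_inner V (\<lambda>x. G x $ i) \<phi> = L2_inner U (\<lambda>x. G x $ i) \<phi>"
    by (rule L2_inner_support[symmetric, OF assms(2-)]) (use test_function_outside[OF \<phi>] in auto)
  ultimately show "L2_inner V u (partial_deriv i \<phi>) = - L2_inner V (\<lambda>x. G x $ i) \<phi>"
    using assms(1) U by (simp add: has_weak_grad_iff)
qed

lemma has_weak_grad_cong_AE:
  assumes "U \<in> lmeasurable" "has_weak_grad U u G" "u \<in> L2_space U" "G \<in> L2_space U"
    "AE x in lebesgue_on U. u x = u' x" "AE x in lebesgue_on U. G x = G' x"
  shows "has_weak_grad U u' G'"
  unfolding has_weak_grad_iff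
proof (intro allI impI)
  have U: "U \<in> sets lebesgue" using assms(1) by (rule fmeasurableD)
  fix \<phi> i assume \<phi>: "test_function U \<phi>"
  then have t: "partial_deriv i \<phi> \<in> L2_space U" "\<phi> \<in> L2_space U"
    using assms(1) test_function_in_L2_space test_function_partial_deriv by blast+
  have "L2_inner U u (partial_deriv i \<phi>) = L2_inner U u' (partial_deriv i \<phi>)"
    by (rule L2_inner_cong_AE) (use assms t U in \<open>auto intro: L2_space_cong_AE\<close>)
  moreover have "L2_inner U (\<lambda>x. G x $ i) \<phi> = L2_inner U (\<lambda>x. G' x $ i) \<phi>"
  proof (rule L2_inner_cong_AE)
    show "AE x in lebesgue_on U. G x $ i = G' x $ i" using assms(6) by eventually_elim simp
    show "(\<lambda>x. G' x $ i) \<in> L2_space U"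
      by (rule L2_space_nth[OF L2_space_cong_AE[OF assms(4) U assms(6)]])
  qed (use t L2_space_nth[OF assms(4)] in auto)
  ultimately show "L2_inner U u' (partial_deriv i \<phi>) = - L2_inner U (\<lambda>x. G' x $ i) \<phi>"
    using assms(2) \<phi> by (simp add: has_weak_grad_iff)
qed

lemma has_weak_grad_unique:
  assumes "open U" "U \<in> lmeasurable" "has_weak_grad U u G" "has_weak_grad U u H" "G \<in> L2_space U" "H \<in> L2_space U"
  shows "AE x in lebesgue_on U. G x = H x"
proof -
  have "AE x in lebesgue_on U. G x $ i - H x $ i = 0" for i
  proof (rule AE_eq_0_by_duality[OF assms(1,2)])
    show "(\<lambda>x. G x $ i - H x $ i) \<in> L2_space U"
      using assms(5,6) by (intro L2_space_diff L2_space_nth)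
    fix \<phi> assume \<phi>: "test_function U \<phi>"
    then have "\<phi> \<in> L2_space U" using assms(2) test_function_in_L2_space by blast
    then have "L2_inner U (\<lambda>x. G x $ i - H x $ i) \<phi> = L2_inner U (\<lambda>x. G x $ i) \<phi> - L2_inner U (\<lambda>x. H x $ i) \<phi>"
      using assms(5,6) by (simp add: L2_inner_diff_left L2_space_nth)
    also have "\<dots> = 0"
      using assms(3,4) \<phi> unfolding has_weak_grad_iff by (metis add.inverse_inverse cancel_comm_monoid_add_class.diff_cancel)
    finally show "L2_inner U (\<lambda>x. G x $ i - H x $ i) \<phi> = 0" .
  qed
  then have "AE x in lebesgue_on U. \<forall>i\<in>UNIV. G x $ i - H x $ i = 0"
    by (intro AE_finite_allI) auto
  then show ?thesis by eventually_elim (simp add: vec_eq_iff)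
qed

lemma weak_grad:
  assumes "u \<in> H1_space U"
  shows weak_grad_in_L2_space: "weak_grad U u \<in> L2_space U"
    and has_weak_grad_weak_grad: "has_weak_grad U u (weak_grad U u)"
proof -
  have "\<exists>G. G \<in> L2_space U \<and> has_weak_grad U u G" using assms by (simp add: H1_space_def)
  then have "weak_grad U u \<in> L2_space U \<and> has_weak_grad U u (weak_grad U u)"
    unfolding weak_grad_def by (rule someI_ex)
  then show "weak_grad U u \<in> L2_space U" "has_weak_grad U u (weak_grad U u)" by auto
qed

lemma H1_spaceI: "u \<in> L2_space U \<Longrightarrow> G \<in> L2_space U \<Longrightarrow> has_weak_grad U u G \<Longrightarrow> u \<in> H1_space U"
  by (auto simp: H1_space_def)

lemma H1_space_L2: "u \<in> H1_space U \<Longrightarrow> u \<in> L2_space U"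
  by (simp add: H1_space_def)

lemma weak_grad_eqI:
  assumes "open U" "U \<in> lmeasurable" "u \<in> L2_space U" "G \<in> L2_space U" "has_weak_grad U u G"
  shows "AE x in lebesgue_on U. weak_grad U u x = G x"
  using has_weak_grad_unique[OF assms(1,2)] weak_grad[OF H1_spaceI[OF assms(3-5)]] assms by blast

lemma weak_grad_add:
  assumes "open U" "U \<in> lmeasurable" "u \<in> H1_space U" "v \<in> H1_space U"
  shows "(\<lambda>x. u x + v x) \<in> H1_space U"
    and "AE x in lebesgue_on U. weak_grad U (\<lambda>x. u x + v x) x = weak_grad U u x + weak_grad U v x"
proof -
  note * = H1_space_L2[OF assms(3)] weak_grad[OF assms(3)] H1_space_L2[OF assms(4)] weak_grad[OF assms(4)]
  show "(\<lambda>x. u x + v x) \<in> H1_space U"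
    using has_weak_grad_add[OF assms(2) *] * by (blast intro: H1_spaceI L2_space_add)
  show "AE x in lebesgue_on U. weak_grad U (\<lambda>x. u x + v x) x = weak_grad U u x + weak_grad U v x"
    by (rule weak_grad_eqI[OF assms(1,2) L2_space_add[OF *(1,4)] L2_space_add[OF *(2,5)] has_weak_grad_add[OF assms(2) *]])
qed

lemma weak_grad_scale:
  assumes "open U" "U \<in> lmeasurable" "u \<in> H1_space U"
  shows "(\<lambda>x. c * u x) \<in> H1_space U"
    and "AE x in lebesgue_on U. weak_grad U (\<lambda>x. c * u x) x = c *\<^sub>R weak_grad U u x"
proof -
  note * = H1_space_L2[OF assms(3)] weak_grad[OF assms(3)]
  show "(\<lambda>x. c * u x) \<in> H1_space U"
    using has_weak_grad_scale[OF *(3)] * by (blast intro: H1_spaceI L2_space_mult L2_space_scaleR)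
  show "AE x in lebesgue_on U. weak_grad U (\<lambda>x. c * u x) x = c *\<^sub>R weak_grad U u x"
    by (rule weak_grad_eqI[OF assms(1,2) L2_space_mult[OF *(1)] L2_space_scaleR[OF *(2)] has_weak_grad_scale[OF *(3)]])
qed

text \<open>In place of integration by parts, the integral of the affine function against a
  translate of \<open>\<phi>\<close> is differentiated at 0 in two ways: with the translation acting
  on \<open>\<phi>\<close>, and, after a change of variables, with the translation acting on the
  affine function.\<close>

lemma affine_has_weak_grad:
  fixes a :: "real ^ 'n"
  assumes "bounded U" "U \<in> sets lebesgue"
  shows "has_weak_grad U (\<lambda>x. a \<bullet> x + b) (\<lambda>x. a)"
  unfolding has_weak_grad_iff
proof (intro allI impI)
  fix \<phi> and i :: 'n assume \<phi>: "test_function U \<phi>"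
  obtain R where R: "R > 0" "\<And>x. x \<in> U \<Longrightarrow> norm x \<le> R"
    using assms(1) by (metis bounded_pos)
  let ?V = "ball (0::real ^ 'n) (R + 1)" and ?e = "axis i 1 :: real ^ 'n" and ?\<alpha> = "\<lambda>x. a \<bullet> x + b"
  have U: "U \<in> lmeasurable" using assms bounded_set_imp_lmeasurable by blast
  have \<alpha>: "?\<alpha> \<in> L2_space S" if "bounded S" "S \<in> sets lebesgue" for S
    using that by (intro continuous_in_L2_space continuous_intros)
  have \<phi>L: "\<phi> \<in> L2_space S" if "S \<in> lmeasurable" for S using test_function_in_L2_space[OF \<phi> that] .
  have UV: "U \<subseteq> ?V" using R by force
  define F where "F s = L2_inner ?V ?\<alpha> (\<lambda>x. \<phi> (x + s *\<^sub>R ?e))" for s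
  have D1: "(F has_real_derivative L2_inner ?V ?\<alpha> (\<lambda>x. directional_deriv ?e \<phi> (x + 0 *\<^sub>R ?e))) (at 0)"
    unfolding F_def by (intro translated_test_derivative[OF _ \<alpha> \<phi>]) auto
  \<comment> \<open>For |s| < 1 the shifted ball of radius \<open>R + 1\<close> still contains
    \<open>U\<close>. The domain of integration therefore does not move, and \<open>F\<close> is
    exactly affine in \<open>s\<close> near 0.\<close>
  have eq: "F s = L2_inner U ?\<alpha> \<phi> - s * (a $ i * L2_inner U (\<lambda>x. 1) \<phi>)" if "\<bar>s\<bar> < 1" for s
  proof -
    let ?V' = "{x. x + (- s) *\<^sub>R ?e \<in> ?V}"
    have sub: "U \<subseteq> ?V'"
    proof
      fix x assume "x \<in> U"
      have "norm (x + (- s) *\<^sub>R ?e) \<le> norm x + norm ((- s) *\<^sub>R ?e)" by (rule norm_triangle_ineq)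
      also have "\<dots> < R + 1" using R(2)[OF \<open>x \<in> U\<close>] that by simp
      finally show "x \<in> ?V'" by simp
    qed
    have V': "?V' \<in> sets lebesgue" by (intro sets_lebesgue_translate) auto
    have "(\<lambda>x. \<phi> (x + s *\<^sub>R ?e)) \<in> L2_space ?V"
      by (rule test_function_translate_in_L2_space[OF \<phi>]) simp
    then have "F s = L2_inner ?V' (\<lambda>x. ?\<alpha> (x + (- s) *\<^sub>R ?e)) (\<lambda>x. \<phi> (x + (- s) *\<^sub>R ?e + s *\<^sub>R ?e))"
      unfolding F_def by (intro L2_inner_translate[symmetric] \<alpha>) auto
    also have "\<dots> = L2_inner ?V' (\<lambda>x. ?\<alpha> x - s * a $ i) \<phi>"
      by (simp add: inner_add_right inner_diff_right inner_axis algebra_simps)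
    also have "\<dots> = L2_inner U (\<lambda>x. ?\<alpha> x - s * a $ i) \<phi>"
      by (rule L2_inner_support[OF sub V' assms(2)]) (use test_function_outside[OF \<phi>] in auto)
    also have "\<dots> = L2_inner U ?\<alpha> \<phi> - L2_inner U (\<lambda>x. s * a $ i) \<phi>"
      using \<alpha> assms \<phi>L U by (intro L2_inner_diff_left const_in_L2_space) auto
    also have "L2_inner U (\<lambda>x. s * a $ i) \<phi> = s * (a $ i * L2_inner U (\<lambda>x. 1) \<phi>)"
      using L2_inner_mult_left[of U "s * a $ i" "\<lambda>x. 1" \<phi>] by simp
    finally show ?thesis .
  qed
  have "((\<lambda>s. L2_inner U ?\<alpha> \<phi> - s * (a $ i * L2_inner U (\<lambda>x. 1) \<phi>)) has_real_derivative
      - (a $ i * L2_inner U (\<lambda>x. 1) \<phi>)) (at 0)"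
    by (auto intro!: derivative_eq_intros)
  moreover have "\<forall>\<^sub>F s in nhds 0. L2_inner U ?\<alpha> \<phi> - s * (a $ i * L2_inner U (\<lambda>x. 1) \<phi>) = F s"
    using eventually_nhds_in_open[of "{-1<..<1}" "0::real"] by (auto elim!: eventually_mono simp: eq)
  ultimately have D2: "(F has_real_derivative - (a $ i * L2_inner U (\<lambda>x. 1) \<phi>)) (at 0)"
    by (simp add: DERIV_cong_ev[OF refl _ refl])
  have "L2_inner U ?\<alpha> (partial_deriv i \<phi>) = L2_inner ?V ?\<alpha> (partial_deriv i \<phi>)"
    by (rule L2_inner_support[symmetric, OF UV _ assms(2)])
      (use test_function_outside[OF test_function_partial_deriv[OF \<phi>]] in auto)
  also have "\<dots> = L2_inner ?V ?\<alpha> (directional_deriv ?e \<phi>)"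
    by (simp add: directional_deriv_eq[abs_def] inner_axis' classical_grad_def)
  also have "\<dots> = - (a $ i * L2_inner U (\<lambda>x. 1) \<phi>)"
    using DERIV_unique[OF D1 D2] by simp
  also have "a $ i * L2_inner U (\<lambda>x. 1) \<phi> = L2_inner U (\<lambda>x. a $ i) \<phi>"
    using L2_inner_mult_left[of U "a $ i" "\<lambda>x. 1" \<phi>] by simp
  finally show "L2_inner U ?\<alpha> (partial_deriv i \<phi>) = - L2_inner U (\<lambda>x. a $ i) \<phi>" .
qed

text \<open>
  By duality, differentiating $s \mapsto \int u(x)\,\varphi(x - sh)\,dx$ for test functions $\varphi$.
\<close>

lemma translation_estimate:
  fixes U :: "(real ^ 'n) set"
  assumes U: "open U" "bounded U" "convex U"
    and u: "u \<in> L2_space U" "G \<in> L2_space U" "has_weak_grad U u G"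
  shows "L2_norm {x \<in> U. x + h \<in> U} (\<lambda>x. u (x + h) - u x) \<le> norm h * L2_norm U G"
proof -
  let ?W = "{x \<in> U. x + h \<in> U}" and ?U' = "{x. x + h \<in> U}"
  have Um: "U \<in> lmeasurable" "U \<in> sets lebesgue"
    using U bounded_open_lmeasurable by (auto simp: fmeasurableD)
  have "open ?U'" using open_vimage[OF U(1), of "\<lambda>x. x + h"] by (simp add: vimage_def continuous_intros)
  then have U': "?U' \<in> sets lebesgue" and Wo: "open ?W" using U(1) open_Int[of U ?U'] by (auto simp: Collect_conj_eq)
  have Wm: "?W \<in> lmeasurable" "?W \<in> sets lebesgue"
    using Wo U(2) bounded_subset[of U ?W] by (auto intro!: bounded_open_lmeasurable)
  have uh: "(\<lambda>x. u (x + h)) \<in> L2_space ?U'" using L2_space_translate[OF Um(2) u(1)] .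
  have uhW: "(\<lambda>x. u (x + h)) \<in> L2_space ?W" "u \<in> L2_space ?W"
    by (rule L2_space_subset[OF uh _ U' Wm(2)], blast) (rule L2_space_subset[OF u(1) _ Um(2) Wm(2)], blast)
  show ?thesis
  proof (rule L2_norm_le_by_duality[OF Wo Wm(1) L2_space_diff[OF uhW]])
    fix \<phi> assume \<phi>: "test_function ?W \<phi>"
    have out: "\<phi> x = 0" if "x \<notin> ?W" for x using test_function_outside[OF \<phi> that] .
    define F where "F s = L2_inner U u (\<lambda>x. \<phi> (x + s *\<^sub>R (- h)))" for s
    \<comment> \<open>Here convexity enters: the whole path from \<open>x\<close> to
      \<open>x + h\<close> stays in \<open>U\<close>, so every intermediate translate of
      \<open>\<phi>\<close> is still a test function on \<open>U\<close>.\<close>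
    have seg: "x + s *\<^sub>R h \<in> U" if "x \<in> ?W" "0 \<le> s" "s \<le> 1" for x s
    proof -
      have "(1 - s) *\<^sub>R x + s *\<^sub>R (x + h) \<in> U" using that U(3) by (intro convexD_alt) auto
      then show ?thesis by (simp add: algebra_simps)
    qed
    have D: "(F has_real_derivative L2_inner U u (\<lambda>x. directional_deriv (- h) \<phi> (x + s *\<^sub>R (- h)))) (at s)" for s
      unfolding F_def by (rule translated_test_derivative[OF Um(1) u(1) \<phi>])
    have bd: "L2_inner U u (\<lambda>x. directional_deriv (- h) \<phi> (x + s *\<^sub>R (- h))) \<le> norm h * L2_norm U G * L2_norm ?W \<phi>"
      if s: "0 \<le> s" "s \<le> 1" for s
    proof -
      let ?\<psi> = "\<lambda>x. \<phi> (x + s *\<^sub>R (- h))"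
      have \<psi>: "test_function U ?\<psi>"
        by (rule test_function_translate[OF \<phi>]) (use seg[OF _ s] in auto)
      have \<psi>L: "?\<psi> \<in> L2_space U" using test_function_in_L2_space[OF \<psi> Um(1)] .
      have "L2_inner U u (\<lambda>x. directional_deriv (- h) \<phi> (x + s *\<^sub>R (- h))) = L2_inner U u (directional_deriv (- h) ?\<psi>)"
        by (simp only: directional_deriv_translate[OF test_function_smooth[OF \<phi>]])
      also have "\<dots> = - L2_inner U (\<lambda>x. G x \<bullet> (- h)) ?\<psi>"
        by (rule has_weak_grad_directional[OF Um(1) u \<psi>])
      also have "\<dots> \<le> L2_norm U (\<lambda>x. G x \<bullet> (- h)) * L2_norm U ?\<psi>"
        using L2_Cauchy_Schwarz[OF L2_space_component[OF u(2), of "- h"] \<psi>L] by linarith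
      also have "L2_norm U (\<lambda>x. G x \<bullet> (- h)) \<le> norm h * L2_norm U G"
      proof -
        have "L2_inner U (\<lambda>x. G x \<bullet> (- h)) (\<lambda>x. G x \<bullet> (- h)) \<le> (LINT x|lebesgue_on U. (norm h)\<^sup>2 * (G x \<bullet> G x))"
          unfolding L2_inner_def
        proof (rule integral_mono)
          show "integrable (lebesgue_on U) (\<lambda>x. (G x \<bullet> (- h)) \<bullet> (G x \<bullet> (- h)))"
            using L2_inner_integrable[OF L2_space_component[OF u(2), of "- h"] L2_space_component[OF u(2), of "- h"]] .
          show "integrable (lebesgue_on U) (\<lambda>x. (norm h)\<^sup>2 * (G x \<bullet> G x))"
            using L2_inner_integrable[OF u(2) u(2)] by simp
          show "(G x \<bullet> (- h)) \<bullet> (G x \<bullet> (- h)) \<le> (norm h)\<^sup>2 * (G x \<bullet> G x)" for x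
            using Cauchy_Schwarz_ineq[of "G x" h] by (simp add: power2_norm_eq_inner mult.commute power2_eq_square[of "G x \<bullet> h"])
        qed
        also have "\<dots> = (norm h)\<^sup>2 * L2_inner U G G" by (simp add: L2_inner_def)
        finally show ?thesis unfolding L2_norm_def using real_sqrt_le_mono by (fastforce simp: real_sqrt_mult)
      qed
      also have "L2_norm U ?\<psi> = L2_norm ?W \<phi>"
      proof -
        let ?V = "{x. x + s *\<^sub>R h \<in> U}"
        have V: "?V \<in> sets lebesgue" by (rule sets_lebesgue_translate[OF Um(2)])
        have "L2_inner U ?\<psi> ?\<psi> = L2_inner ?V (\<lambda>x. ?\<psi> (x + s *\<^sub>R h)) (\<lambda>x. ?\<psi> (x + s *\<^sub>R h))"
          by (rule L2_inner_translate[symmetric, OF Um(2) \<psi>L \<psi>L])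
        also have "\<dots> = L2_inner ?V \<phi> \<phi>" by simp
        also have "\<dots> = L2_inner ?W \<phi> \<phi>"
          by (rule L2_inner_support[OF _ V Wm(2)]) (use seg[OF _ s] out in auto)
        finally show ?thesis by (simp add: L2_norm_def)
      qed
      finally show ?thesis by (simp add: mult_right_mono)
    qed
    \<comment> \<open>The mean value theorem at an intermediate point replaces integration of the
      derivative over [0, 1]; the bound \<open>bd\<close> is uniform in that point.\<close>
    have "\<exists>z::real. z > 0 \<and> z < 1 \<and> F 1 - F 0 = (1 - 0) * L2_inner U u (\<lambda>x. directional_deriv (- h) \<phi> (x + z *\<^sub>R (- h)))"
      using D by (intro MVT2) auto
    then have "F 1 - F 0 \<le> norm h * L2_norm U G * L2_norm ?W \<phi>" using bd by force
    moreover have "F 1 - F 0 = L2_inner ?W (\<lambda>x. u (x + h) - u x) \<phi>"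
    proof -
      have "F 0 = L2_inner ?W u \<phi>"
        unfolding F_def by (simp, rule L2_inner_support[OF _ Um(2) Wm(2)]) (use out in auto)
      moreover have "F 1 = L2_inner ?W (\<lambda>x. u (x + h)) \<phi>"
      proof -
        have "(\<lambda>x. \<phi> (x + 1 *\<^sub>R (- h))) \<in> L2_space U"
          by (rule test_function_translate_in_L2_space[OF \<phi> Um(1)])
        then have "F 1 = L2_inner ?U' (\<lambda>x. u (x + h)) (\<lambda>x. \<phi> (x + h + 1 *\<^sub>R (- h)))"
          unfolding F_def by (rule L2_inner_translate[symmetric, OF Um(2) u(1)])
        also have "\<dots> = L2_inner ?U' (\<lambda>x. u (x + h)) \<phi>" by simp
        also have "\<dots> = L2_inner ?W (\<lambda>x. u (x + h)) \<phi>"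
          by (rule L2_inner_support[OF _ U' Wm(2)]) (use out in auto)
        finally show ?thesis .
      qed
      ultimately show ?thesis
        using uhW test_function_in_L2_space[OF \<phi> Wm(1)] by (simp add: L2_inner_diff_left)
    qed
    ultimately show "L2_inner ?W (\<lambda>x. u (x + h) - u x) \<phi> \<le> norm h * L2_norm U G * L2_norm ?W \<phi>" by simp
  qed simp
qed

section \<open>The Poincare inequality on convex domains\<close>

lemma nn_integral_L2_norm:
  assumes "f \<in> L2_space W" "W \<in> sets lebesgue"
  shows "(\<integral>\<^sup>+x. ennreal ((f x)\<^sup>2) * indicator W x \<partial>lborel) = ennreal ((L2_norm W f)\<^sup>2)"
proof -
  have "ennreal ((L2_norm W f)\<^sup>2) = ennreal (LINT x|lebesgue_on W. (f x)\<^sup>2)"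
    by (simp add: L2_norm_square L2_inner_def flip: power2_eq_square)
  also have "\<dots> = (\<integral>\<^sup>+x. ennreal ((f x)\<^sup>2) \<partial>lebesgue_on W)"
    using L2_space_integrable_square[OF assms(1)] by (intro nn_integral_eq_integral[symmetric]) auto
  also have "\<dots> = (\<integral>\<^sup>+x. ennreal ((f x)\<^sup>2) * indicator W x \<partial>lebesgue)"
    using assms(2) by (intro nn_integral_restrict_space) auto
  also have "\<dots> = (\<integral>\<^sup>+x. ennreal ((f x)\<^sup>2) * indicator W x \<partial>lborel)"
    by (rule nn_integral_completion)
  finally show ?thesis by simp
qed

text \<open>
  Both sides of the estimate come from the double integral of $|u(y) - u(x)|^2$ over $U \times U$,
  evaluated with and without the substitution $y = x + h$.
\<close>

lemma poincare_inequality_borel: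
  fixes U :: "(real ^ 'n) set"
  assumes U: "open U" "bounded U" "convex U" "U \<noteq> {}"
  obtains C where "C \<ge> 0" "\<And>u G. u \<in> borel_measurable borel \<Longrightarrow> u \<in> L2_space U \<Longrightarrow> G \<in> L2_space U \<Longrightarrow>
      has_weak_grad U u G \<Longrightarrow> (LINT x|lebesgue_on U. u x) = 0 \<Longrightarrow> L2_norm U u \<le> C * L2_norm U G"
proof -
  have Um: "U \<in> lmeasurable" "U \<in> sets lebesgue" "U \<in> sets borel"
    using U bounded_open_lmeasurable by (auto simp: fmeasurableD)
  define \<mu> where "\<mu> = measure lborel U"
  have \<mu>: "emeasure lborel U = ennreal \<mu>" "\<mu> > 0"
  proof -
    have fin: "emeasure lborel U < \<infinity>" using U(2) emeasure_bounded_finite by blast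
    then show "emeasure lborel U = ennreal \<mu>" by (simp add: \<mu>_def emeasure_eq_ennreal_measure less_top)
    have "\<not> negligible U" using U open_not_negligible by blast
    then have "emeasure lborel U \<noteq> 0"
      using Um(3) by (auto simp: negligible_iff_null_sets null_sets_def)
    then show "\<mu> > 0" using fin by (simp add: \<mu>_def measure_def enn2real_positive_iff less_top zero_less_iff_neq_zero)
  qed
  obtain D where D: "D > 0" "\<And>x y. x \<in> U \<Longrightarrow> y \<in> U \<Longrightarrow> dist x y \<le> D"
    using U(2) unfolding bounded_two_points
    by (metis dual_order.trans linorder_le_cases not_one_le_zero order_less_le_trans zero_less_one less_eq_real_def)
  define \<beta> where "\<beta> = measure lborel (cball (0::real ^ 'n) D)"
  have \<beta>: "emeasure lborel (cball (0::real ^ 'n) D) = ennreal \<beta>"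
    using emeasure_bounded_finite[of "cball (0::real ^ 'n) D"] by (simp add: \<beta>_def emeasure_eq_ennreal_measure less_top)
  have \<beta>0: "\<beta> \<ge> 0" by (simp add: \<beta>_def)
  \<comment> \<open>All differences of points of \<open>U\<close> lie in the ball of radius
    \<open>D\<close>, of volume \<open>\<beta>\<close>, and each translation contributes at most (D
    N)^2. The double integral also dominates \<open>\<mu>\<close> times the squared norm of
    \<open>u\<close>, so the ratio is this constant.\<close>
  define C where "C = sqrt (D\<^sup>2 * \<beta> / \<mu>)"
  show thesis
  proof (rule that[of C])
    show "C \<ge> 0" using \<beta>0 \<mu>(2) by (simp add: C_def)
    fix u G
    assume m[measurable]: "u \<in> borel_measurable borel" and u: "u \<in> L2_space U" "G \<in> L2_space U" "has_weak_grad U u G"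
      and mean: "(LINT x|lebesgue_on U. u x) = 0"
    note [measurable] = Um(3)
    \<comment> \<open>Integrals of nonnegative functions can be exchanged without integrability
      conditions. Borel measurability of \<open>u\<close> yields joint measurability of
      \<open>u (x + h)\<close> in both variables.\<close>
    define k where "k x h = ennreal ((u (x + h) - u x)\<^sup>2) * indicator {x \<in> U. x + h \<in> U} x" for x h
    define N where "N = L2_norm U G"
    have "(\<integral>\<^sup>+x. \<integral>\<^sup>+h. k x h \<partial>lborel \<partial>lborel) = (\<integral>\<^sup>+h. \<integral>\<^sup>+x. k x h \<partial>lborel \<partial>lborel)"
      unfolding k_def by (rule lborel_pair.Fubini') measurable
    also have "\<dots> \<le> (\<integral>\<^sup>+h. ennreal ((D * N)\<^sup>2) * indicator (cball (0::real ^ 'n) D) h \<partial>lborel)"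
    proof (rule nn_integral_mono)
      fix h :: "real ^ 'n"
      let ?W = "{x \<in> U. x + h \<in> U}" and ?U' = "{x. x + h \<in> U}"
      have U': "?U' \<in> sets lebesgue" by (rule sets_lebesgue_translate[OF Um(2)])
      then have W: "?W \<in> sets lebesgue" using Um(2) by (simp add: Collect_conj_eq)
      have L: "(\<lambda>x. u (x + h) - u x) \<in> L2_space ?W"
        by (rule L2_space_diff, rule L2_space_subset[OF L2_space_translate[OF Um(2) u(1)] _ U' W], blast)
          (rule L2_space_subset[OF u(1) _ Um(2) W], blast)
      have "(\<integral>\<^sup>+x. k x h \<partial>lborel) = ennreal ((L2_norm ?W (\<lambda>x. u (x + h) - u x))\<^sup>2)"
        unfolding k_def by (rule nn_integral_L2_norm[OF L W])
      also have "\<dots> \<le> ennreal ((D * N)\<^sup>2) * indicator (cball 0 D) h"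
      \<comment> \<open>If no point of \<open>U\<close> is carried into \<open>U\<close> by the
        translation, the left side is 0; otherwise \<open>h\<close> is a difference of two points of
        \<open>U\<close> and has norm at most \<open>D\<close>.\<close>
      proof (cases "?W = {}")
        case True
        show ?thesis unfolding True by (simp add: L2_norm_def L2_inner_def)
      next
        case False
        then obtain x where "x \<in> U" "x + h \<in> U" by auto
        then have h: "norm h \<le> D" using D(2)[of "x + h" x] by (simp add: dist_norm)
        have "L2_norm ?W (\<lambda>x. u (x + h) - u x) \<le> norm h * N"
          unfolding N_def by (rule translation_estimate[OF U(1-3) u])
        also have "\<dots> \<le> D * N" using h by (simp add: N_def mult_right_mono)
        finally have "(L2_norm ?W (\<lambda>x. u (x + h) - u x))\<^sup>2 \<le> (D * N)\<^sup>2" by (intro power_mono) auto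
        then show ?thesis using h by (simp add: ennreal_leI)
      qed
      finally show "(\<integral>\<^sup>+x. k x h \<partial>lborel) \<le> ennreal ((D * N)\<^sup>2) * indicator (cball 0 D) h" .
    qed
    also have "\<dots> = ennreal ((D * N)\<^sup>2 * \<beta>)"
      using \<beta>0 by (simp add: nn_integral_cmult_indicator \<beta> ennreal_mult)
    finally have upper: "(\<integral>\<^sup>+x. \<integral>\<^sup>+h. k x h \<partial>lborel \<partial>lborel) \<le> ennreal ((D * N)\<^sup>2 * \<beta>)" .
    have lower: "ennreal ((L2_norm U u)\<^sup>2) * indicator U x \<le> (\<integral>\<^sup>+h. k x h \<partial>lborel)" for x
    proof (cases "x \<in> U")
      case True
      have cL: "(\<lambda>y. u x) \<in> L2_space U" by (rule const_in_L2_space[OF Um(1)])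
      \<comment> \<open>Mean zero makes \<open>u\<close> orthogonal to constants, so subtracting the
        number \<open>u x\<close> cannot decrease the norm.\<close>
      have "L2_inner U u (\<lambda>y. u x) = 0" using mean by (simp add: L2_inner_def)
      then have "(L2_norm U u)\<^sup>2 \<le> (L2_norm U (\<lambda>y. u y - u x))\<^sup>2"
        using u(1) cL L2_inner_self_nonneg[of U "\<lambda>y. u x"]
        by (simp add: L2_norm_square L2_inner_diff_left L2_inner_diff_right L2_space_diff L2_inner_commute[of U "\<lambda>y. u x" u])
      then have "ennreal ((L2_norm U u)\<^sup>2) \<le> ennreal ((L2_norm U (\<lambda>y. u y - u x))\<^sup>2)" by (rule ennreal_leI)
      also have "\<dots> = (\<integral>\<^sup>+y. ennreal ((u y - u x)\<^sup>2) * indicator U y \<partial>lborel)"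
        by (rule nn_integral_L2_norm[symmetric, OF L2_space_diff[OF u(1) cL] Um(2)])
      also have "\<dots> = (\<integral>\<^sup>+y. ennreal ((u y - u x)\<^sup>2) * indicator U y \<partial>distr lborel borel ((+) x))"
        by (simp add: lborel_distr_plus)
      also have "\<dots> = (\<integral>\<^sup>+h. ennreal ((u (x + h) - u x)\<^sup>2) * indicator U (x + h) \<partial>lborel)"
        by (rule nn_integral_distr) measurable
      also have "\<dots> = (\<integral>\<^sup>+h. k x h \<partial>lborel)"
        unfolding k_def using True by (intro nn_integral_cong) (auto simp: indicator_def)
      finally show ?thesis using True by simp
    qed simp
    have "ennreal ((L2_norm U u)\<^sup>2 * \<mu>) = (\<integral>\<^sup>+x. ennreal ((L2_norm U u)\<^sup>2) * indicator U x \<partial>lborel)"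
      using \<mu> by (simp add: nn_integral_cmult_indicator ennreal_mult)
    also have "\<dots> \<le> (\<integral>\<^sup>+x. \<integral>\<^sup>+h. k x h \<partial>lborel \<partial>lborel)"
      by (rule nn_integral_mono) (rule lower)
    also note upper
    finally have "(L2_norm U u)\<^sup>2 * \<mu> \<le> (D * N)\<^sup>2 * \<beta>" using \<beta>0 by (simp add: ennreal_le_iff)
    then have "(L2_norm U u)\<^sup>2 \<le> (D\<^sup>2 * \<beta> / \<mu>) * N\<^sup>2" using \<mu>(2) by (simp add: field_simps power_mult_distrib)
    also have "\<dots> = (C * N)\<^sup>2" using \<beta>0 \<mu>(2) by (simp add: C_def power_mult_distrib)
    finally have "(L2_norm U u)\<^sup>2 \<le> (C * N)\<^sup>2" .
    moreover have "0 \<le> C * N" using \<open>C \<ge> 0\<close> by (simp add: N_def)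
    ultimately show "L2_norm U u \<le> C * L2_norm U G"
      unfolding N_def by (rule power2_le_imp_le)
  qed
qed

text \<open>A Lebesgue measurable function has a Borel representative, and mean, norm and weak
  gradient do not notice the change.\<close>

lemma poincare_inequality:
  fixes U :: "(real ^ 'n) set"
  assumes U: "open U" "bounded U" "convex U" "U \<noteq> {}"
  obtains C where "C \<ge> 0" "\<And>u G. u \<in> L2_space U \<Longrightarrow> G \<in> L2_space U \<Longrightarrow>
      has_weak_grad U u G \<Longrightarrow> (LINT x|lebesgue_on U. u x) = 0 \<Longrightarrow> L2_norm U u \<le> C * L2_norm U G"
proof -
  have Um: "U \<in> lmeasurable" "U \<in> sets lebesgue"
    using U bounded_open_lmeasurable by (auto simp: fmeasurableD)
  obtain C where C: "C \<ge> 0" "\<And>u G. u \<in> borel_measurable borel \<Longrightarrow> u \<in> L2_space U \<Longrightarrow> G \<in> L2_space U \<Longrightarrow>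
      has_weak_grad U u G \<Longrightarrow> (LINT x|lebesgue_on U. u x) = 0 \<Longrightarrow> L2_norm U u \<le> C * L2_norm U G"
    using poincare_inequality_borel[OF U] by metis
  show thesis
  proof (rule that[OF C(1)])
    fix u G assume u: "u \<in> L2_space U" "G \<in> L2_space U" "has_weak_grad U u G"
      and mean: "(LINT x|lebesgue_on U. u x) = 0"
    have "(\<lambda>x. if x \<in> U then u x else 0) \<in> borel_measurable lebesgue"
      using L2_space_measurable[OF u(1)] Um(2) borel_measurable_if by blast
    then obtain v where v: "v \<in> borel_measurable lborel" "AE x in lborel. (if x \<in> U then u x else 0) = v x"
      using completion_ex_borel_measurable_real by blast
    have ae: "AE x in lebesgue_on U. u x = v x"
      using AE_completion[OF v(2)] by (subst AE_restrict_space_iff) (use Um in auto)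
    have vL: "v \<in> L2_space U" by (rule L2_space_cong_AE[OF u(1) Um(2) ae])
    have "(LINT x|lebesgue_on U. v x) = (LINT x|lebesgue_on U. u x)"
      using ae by (intro integral_cong_AE L2_space_measurable u(1) vL) auto
    moreover have "has_weak_grad U v G"
      by (rule has_weak_grad_cong_AE[OF Um(1) u(3,1,2) ae]) simp
    ultimately have "L2_norm U v \<le> C * L2_norm U G"
      using v(1) u vL mean by (intro C(2)) auto
    then show "L2_norm U u \<le> C * L2_norm U G"
      using L2_norm_cong_AE[OF ae u(1) vL] by simp
  qed
qed

section \<open>Geometry of the mesh\<close>

text \<open>A local graph excludes slits. A point outside the domain lies on or below the graph;
  moving it a little against \<open>e\<close> brings it strictly below, into an open set disjoint
  from the domain, so it cannot be interior to the closure. Through this the closed elements, whose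
  union is the closure, determine the open domain.\<close>

lemma lipschitz_domain_interior_closure:
  assumes "lipschitz_domain \<Omega>" shows "interior (closure \<Omega>) = \<Omega>"
proof
  have op: "open \<Omega>" using assms by (simp add: lipschitz_domain_def)
  then show "\<Omega> \<subseteq> interior (closure \<Omega>)" by (simp add: closure_subset interior_maximal)
  show "interior (closure \<Omega>) \<subseteq> \<Omega>"
  proof
    fix p assume p: "p \<in> interior (closure \<Omega>)"
    show "p \<in> \<Omega>"
    proof (rule ccontr)
      assume np: "p \<notin> \<Omega>"
      then have "p \<in> frontier \<Omega>"
        using p interior_subset op by (auto simp: frontier_def interior_open)
      then obtain e N \<gamma> L where e: "norm e = 1" "open N" "p \<in> N" "L-lipschitz_on {y. y \<bullet> e = 0} \<gamma>"
          "\<Omega> \<inter> N = {y \<in> N. \<gamma> (y - (y \<bullet> e) *\<^sub>R e) < y \<bullet> e}"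
        using assms unfolding lipschitz_domain_def by blast
      have ee: "e \<bullet> e = 1" using e(1) by (simp add: dot_square_norm)
      let ?g = "\<lambda>y. \<gamma> (y - (y \<bullet> e) *\<^sub>R e) - y \<bullet> e"
      have c\<gamma>: "continuous_on {y. y \<bullet> e = 0} \<gamma>" by (rule lipschitz_on_continuous_on[OF e(4)])
      have "continuous_on UNIV (\<lambda>y. \<gamma> (y - (y \<bullet> e) *\<^sub>R e))"
        by (rule continuous_on_compose2[OF c\<gamma>]) (auto intro!: continuous_intros simp: inner_diff_left ee)
      then have "continuous_on UNIV ?g" by (intro continuous_intros)
      then have "open {y. 0 < ?g y}" by (rule open_Collect_less[OF continuous_on_const])
      then have A: "open ({y. 0 < ?g y} \<inter> N)" using e(2) by blast
      have in\<Omega>: "?g y < 0" if "y \<in> N" "y \<in> \<Omega>" for y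
      proof -
        have "y \<in> {y \<in> N. \<gamma> (y - (y \<bullet> e) *\<^sub>R e) < y \<bullet> e}" using that e(5) by blast
        then show ?thesis by simp
      qed
      have disj: "{y. 0 < ?g y} \<inter> N \<inter> \<Omega> = {}"
      proof (rule ccontr)
        assume "{y. 0 < ?g y} \<inter> N \<inter> \<Omega> \<noteq> {}"
        then obtain y where "0 < ?g y" "y \<in> N" "y \<in> \<Omega>" by blast
        then show False using in\<Omega>[of y] by linarith
      qed
      have gp: "?g p \<ge> 0" using np e(3,5) by fastforce
      have "open (N \<inter> interior (closure \<Omega>))" using e(2) by blast
      then obtain r where r: "r > 0" "ball p r \<subseteq> N \<inter> interior (closure \<Omega>)"
        using e(3) p open_contains_ball by (metis IntI)
      let ?q = "p - (r / 2) *\<^sub>R e"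
      have "?q \<in> ball p r" using r(1) e(1) by (simp add: dist_norm)
      then have q: "?q \<in> N" "?q \<in> closure \<Omega>" using r(2) interior_subset by blast+
      have proj: "?q - (?q \<bullet> e) *\<^sub>R e = p - (p \<bullet> e) *\<^sub>R e"
        by (simp add: inner_diff_left ee algebra_simps)
      have "?g ?q = ?g p + r / 2" unfolding proj by (simp add: inner_diff_left ee)
      then have "?q \<in> {y. 0 < ?g y} \<inter> N" using gp r(1) q(1) by simp
      then show False using q(2) A disj open_Int_closure_eq_empty[OF A, of \<Omega>] by blast
    qed
  qed
qed

text \<open>The facet is cut out by a supporting hyperplane. Near \<open>z\<close> a point on the
  inner side of the hyperplane lies between a fixed point \<open>w\<close> of \<open>T\<close> off
  the hyperplane and its central projection from \<open>w\<close>, which by continuity falls into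
  the facet; convexity puts it into \<open>T\<close>.\<close>

lemma facet_local_halfspace:
  fixes T :: "'a::euclidean_space set"
  assumes T: "polyhedron T" "aff_dim T = DIM('a)" and F: "F facet_of T" and z: "z \<in> rel_interior F"
  obtains a b \<epsilon> where "norm a = 1" "affine hull F = {x. a \<bullet> x = b}" "\<epsilon> > 0"
    "\<And>x. x \<in> ball z \<epsilon> \<Longrightarrow> x \<in> T \<longleftrightarrow> a \<bullet> x \<le> b"
proof -
  have conv: "convex T" using T(1) by (rule polyhedron_imp_convex)
  have FT: "F face_of T" "F \<noteq> {}" "aff_dim F = int DIM('a) - 1"
    using F T(2) by (auto simp: facet_of_def)
  then have "F \<noteq> T" using T(2) by auto
  moreover have "F exposed_face_of T" using FT(1) exposed_face_of_polyhedron[OF T(1)] by simp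
  ultimately obtain a0 b0 where a0: "a0 \<noteq> 0" "T \<subseteq> {x. a0 \<bullet> x \<le> b0}" "F = T \<inter> {x. a0 \<bullet> x = b0}"
    using FT(2) by (auto simp: exposed_face_of)
  define a where "a = a0 /\<^sub>R norm a0"
  define b where "b = b0 / norm a0"
  have na: "norm a = 1" using a0(1) by (simp add: a_def)
  have Tle: "a \<bullet> x \<le> b" if "x \<in> T" for x
    using a0(1,2) that by (auto simp: a_def b_def divide_inverse mult.commute intro!: mult_left_mono)
  have FH: "F = T \<inter> {x. a \<bullet> x = b}"
    using a0(1,3) by (auto simp: a_def b_def field_simps)
  have "a \<noteq> 0" using na by auto
  have hull: "affine hull F = {x. a \<bullet> x = b}"
  proof (rule affine_dim_equal)
    show "affine hull F \<subseteq> {x. a \<bullet> x = b}"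
      using FH by (intro hull_minimal) (auto simp: affine_hyperplane)
    show "aff_dim (affine hull F) = aff_dim {x. a \<bullet> x = b}"
      using FT(3) \<open>a \<noteq> 0\<close> by (simp add: aff_dim_hyperplane)
  qed (use FT(2) in \<open>auto simp: affine_hyperplane\<close>)
  obtain \<delta> where \<delta>: "\<delta> > 0" "ball z \<delta> \<inter> {x. a \<bullet> x = b} \<subseteq> F"
    using z by (auto simp: mem_rel_interior_ball hull)
  have zb: "a \<bullet> z = b" using z rel_interior_subset hull_subset[of F affine] hull by blast
  have "\<not> T \<subseteq> {x. a \<bullet> x = b}"
    using FH \<open>F \<noteq> T\<close> by blast
  then obtain w where w: "w \<in> T" "a \<bullet> w < b" using Tle by force
  define k where "k = b - a \<bullet> w"
  have k: "k > 0" using w by (simp add: k_def)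
  \<comment> \<open>\<open>t x\<close> measures the depth of \<open>x\<close> below the hyperplane
    relative to that of \<open>w\<close>; \<open>y x\<close> is the projection of \<open>x\<close>
    from \<open>w\<close>, so that x = (1 - t) y + t w.\<close>
  define t where "t x = (b - a \<bullet> x) / k" for x
  define y where "y x = (x - t x *\<^sub>R w) /\<^sub>R (1 - t x)" for x
  have tz: "t z = 0" by (simp add: t_def zb)
  have ct: "isCont t z" unfolding t_def using k by (intro continuous_intros) auto
  have "isCont y z" unfolding y_def using tz by (intro continuous_intros ct) auto
  moreover have "y z = z" by (simp add: y_def tz)
  ultimately have "\<forall>\<^sub>F x in nhds z. y x \<in> ball z \<delta>"
    using \<delta>(1) by (metis centre_in_ball isCont_def open_ball topological_tendstoD tendsto_at_iff_tendsto_nhds)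
  moreover have "\<forall>\<^sub>F x in nhds z. t x < 1"
  proof -
    have "(t \<longlongrightarrow> t z) (nhds z)" using ct by (simp add: continuous_within tendsto_at_iff_tendsto_nhds)
    then show ?thesis using tz by (auto intro: order_tendstoD(2))
  qed
  ultimately have "\<forall>\<^sub>F x in nhds z. y x \<in> ball z \<delta> \<and> t x < 1" by (rule eventually_conj)
  then obtain \<epsilon> where \<epsilon>: "\<epsilon> > 0" "\<And>x. dist x z < \<epsilon> \<Longrightarrow> y x \<in> ball z \<delta> \<and> t x < 1"
    unfolding eventually_nhds_metric by blast
  show thesis
  proof (rule that[OF na hull \<epsilon>(1)])
    fix x assume "x \<in> ball z \<epsilon>"
    then have x: "y x \<in> ball z \<delta>" "t x < 1" using \<epsilon>(2) by (auto simp: dist_commute)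
    show "x \<in> T \<longleftrightarrow> a \<bullet> x \<le> b"
    proof
      assume "a \<bullet> x \<le> b"
      then have t0: "t x \<ge> 0" using k by (simp add: t_def)
      have "a \<bullet> (x - t x *\<^sub>R w) = (1 - t x) * b"
      proof -
        have "t x * k = b - a \<bullet> x" using k by (simp add: t_def)
        then show ?thesis by (simp add: inner_diff_right k_def algebra_simps)
      qed
      then have "a \<bullet> y x = b" using x(2) by (simp add: y_def)
      then have "y x \<in> T" using x(1) \<delta>(2) FH by blast
      moreover have "x = (1 - t x) *\<^sub>R y x + t x *\<^sub>R w" using x(2) by (simp add: y_def)
      ultimately show "x \<in> T"
        using convexD_alt[OF conv \<open>y x \<in> T\<close> w(1) t0] x(2) by simp
    qed (rule Tle)
  qed
qed

text \<open>The component \<open>w\<close> of \<open>a'\<close> orthogonal to \<open>a\<close> is a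
  direction inside the common hyperplane, hence also orthogonal to \<open>a'\<close>, hence zero;
  two parallel unit vectors agree up to sign.\<close>

lemma hyperplane_eq_imp_normal_eq:
  fixes a a' :: "'a::euclidean_space"
  assumes "{x. a \<bullet> x = b} = {x. a' \<bullet> x = b'}" "norm a = 1" "norm a' = 1"
  shows "(a' = a \<and> b' = b) \<or> (a' = - a \<and> b' = - b)"
proof -
  have aa: "a \<bullet> a = 1" "a' \<bullet> a' = 1" using assms by (simp_all add: dot_square_norm)
  define z where "z = b *\<^sub>R a"
  have "a \<bullet> z = b" by (simp add: z_def aa)
  then have z': "a' \<bullet> z = b'" using assms(1) by blast
  define c where "c = a \<bullet> a'"
  define w where "w = a' - c *\<^sub>R a"
  have "a \<bullet> w = 0" by (simp add: w_def c_def inner_diff_right aa)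
  then have "a \<bullet> (z + w) = b" using \<open>a \<bullet> z = b\<close> by (simp add: inner_add_right)
  then have "a' \<bullet> (z + w) = b'" using assms(1) by blast
  then have "a' \<bullet> w = 0" using z' by (simp add: inner_add_right)
  then have "w \<bullet> w = 0" using \<open>a \<bullet> w = 0\<close> by (simp add: w_def inner_diff_left)
  then have a': "a' = c *\<^sub>R a" by (simp add: w_def)
  then have "\<bar>c\<bar> = 1" using assms(2,3) by simp
  moreover have "b' = c * b" using z' \<open>a \<bullet> z = b\<close> by (simp add: a')
  ultimately show ?thesis using a' by (auto simp: abs_if split: if_splits)
qed

lemma negligible_aff_lowdim:
  fixes S :: "'a::euclidean_space set"
  assumes "aff_dim S < DIM('a)" shows "negligible S"
proof -
  obtain a b where "a \<noteq> 0" "S \<subseteq> {x. a \<bullet> x = b}" using aff_lowdim_subset_hyperplane[OF assms] .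
  then show ?thesis using negligible_hyperplane negligible_subset by blast
qed

locale mesh =
  fixes \<Omega> :: "(real ^ 'n) set" and \<T> :: "(real ^ 'n) set set"
  assumes bounded_domain: "bounded \<Omega>" and lipschitz: "lipschitz_domain \<Omega>"
    and conforming: "conforming_triangulation \<Omega> \<T>"
begin

lemma open_domain: "open \<Omega>" and nonempty_domain: "\<Omega> \<noteq> {}"
  using lipschitz by (auto simp: lipschitz_domain_def)

lemma domain_lmeasurable: "\<Omega> \<in> lmeasurable"
  by (rule bounded_open_lmeasurable[OF open_domain bounded_domain])

lemma domain_sets: "\<Omega> \<in> sets lebesgue"
  using domain_lmeasurable by (rule fmeasurableD)

lemma interior_closure_domain: "interior (closure \<Omega>) = \<Omega>"
  by (rule lipschitz_domain_interior_closure[OF lipschitz])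

lemma finite_mesh: "finite \<T>" and Union_mesh: "\<Union>\<T> = closure \<Omega>"
  and simplex_mesh: "T \<in> \<T> \<Longrightarrow> int CARD('n) simplex T"
  and Int_face_of: "T \<in> \<T> \<Longrightarrow> T' \<in> \<T> \<Longrightarrow> (T \<inter> T') face_of T"
  using conforming by (auto simp: conforming_triangulation_def triangulation_def)

lemma mesh_nonempty: "\<T> \<noteq> {}"
  using Union_mesh nonempty_domain by (metis Union_empty closure_eq_empty)

lemma element:
  assumes "T \<in> \<T>"
  shows element_polytope: "polytope T" and element_polyhedron: "polyhedron T" and element_convex: "convex T"
    and element_closed: "closed T" and element_bounded: "bounded T"
    and element_aff_dim: "aff_dim T = int DIM(real ^ 'n)"
  using simplex_mesh[OF assms]
  by (auto simp: simplex_imp_polytope simplex_imp_polyhedron convex_simplex closed_simplex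
      compact_simplex compact_imp_bounded aff_dim_simplex)

lemma element_interior:
  assumes "T \<in> \<T>"
  shows rel_interior_element: "rel_interior T = interior T" and element_interior_nonempty: "interior T \<noteq> {}"
    and closure_element_interior: "closure (interior T) = T"
proof -
  show *: "rel_interior T = interior T" by (rule interior_rel_interior[OF element_aff_dim[OF assms]])
  have "T \<noteq> {}" using element_aff_dim[OF assms] by auto
  then show ne: "interior T \<noteq> {}" using element_convex[OF assms] * rel_interior_eq_empty by metis
  show "closure (interior T) = T"
    using convex_closure_interior[OF element_convex[OF assms] ne] element_closed[OF assms] by simp
qed

lemma element_subset: "T \<in> \<T> \<Longrightarrow> T \<subseteq> closure \<Omega>"
  using Union_mesh by blast

lemma interior_element_subset: "T \<in> \<T> \<Longrightarrow> interior T \<subseteq> \<Omega>"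
  using interior_mono[OF element_subset] interior_closure_domain by blast

lemma interior_element_convex: "T \<in> \<T> \<Longrightarrow> convex (interior T)"
  by (simp add: convex_interior element_convex)

lemma interior_element_bounded: "T \<in> \<T> \<Longrightarrow> bounded (interior T)"
  by (meson bounded_subset element_bounded interior_subset)

lemma interior_element_lmeasurable: "T \<in> \<T> \<Longrightarrow> interior T \<in> lmeasurable"
  by (simp add: bounded_open_lmeasurable interior_element_bounded)

lemma interior_sets [simp]: "interior T \<in> sets lebesgue"
  by (simp add: borel_open)

text \<open>The intersection is a face of \<open>T\<close>, and a face that meets the interior is
  everything.\<close>

lemma elements_overlap:
  assumes "T \<in> \<T>" "T' \<in> \<T>" "T' \<inter> interior T \<noteq> {}" shows "T \<subseteq> T'"
  using face_of_disjoint_interior[OF Int_face_of[OF assms(1,2)]] assms(3) interior_subset[of T] by blast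

lemma element_subset_imp_eq:
  assumes "T \<in> \<T>" "T' \<in> \<T>" "T \<subseteq> T'" shows "T = T'"
proof (rule ccontr)
  assume "T \<noteq> T'"
  moreover have "T face_of T'" using Int_face_of[OF assms(2,1)] assms(3) by (simp add: Int_absorb1)
  ultimately have "aff_dim T < aff_dim T'" by (intro face_of_aff_dim_lt element_convex assms)
  then show False using element_aff_dim assms by simp
qed

lemma interiors_disjoint:
  assumes "T \<in> \<T>" "T' \<in> \<T>" "T \<noteq> T'" shows "interior T \<inter> T' = {}"
  using elements_overlap[OF assms(1,2)] element_subset_imp_eq[OF assms(1,2)] assms(3) by blast

lemma skeleton_negligible: "negligible (closure \<Omega> - (\<Union>T\<in>\<T>. interior T))"
proof (rule negligible_subset)
  show "negligible (\<Union>T\<in>\<T>. frontier T)"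
    using finite_mesh element_convex negligible_convex_frontier by (intro negligible_Union) auto
  show "closure \<Omega> - (\<Union>T\<in>\<T>. interior T) \<subseteq> (\<Union>T\<in>\<T>. frontier T)"
  proof
    fix x assume "x \<in> closure \<Omega> - (\<Union>T\<in>\<T>. interior T)"
    then obtain T where "T \<in> \<T>" "x \<in> T" "x \<notin> interior T" using Union_mesh by blast
    then show "x \<in> (\<Union>T\<in>\<T>. frontier T)" using closure_subset by (auto simp: frontier_def)
  qed
qed

lemma AE_in_elements: "AE x in lebesgue_on \<Omega>. x \<in> (\<Union>T\<in>\<T>. interior T)"
proof -
  have "closure \<Omega> - (\<Union>T\<in>\<T>. interior T) \<in> null_sets lebesgue"
    using skeleton_negligible by (simp add: negligible_iff_null_sets)
  then have "AE x in lebesgue. x \<notin> closure \<Omega> - (\<Union>T\<in>\<T>. interior T)" by (rule AE_not_in)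
  then show ?thesis
    using closure_subset[of \<Omega>] by (subst AE_restrict_space_iff) (use domain_sets in \<open>auto elim!: eventually_mono\<close>)
qed

text \<open>The main use of conformity: touching the relative interior of \<open>F\<close> forces
  the neighbour to contain all of \<open>F\<close>. The intersection of both elements is a proper
  face of \<open>T\<close> containing the facet, and by dimension it cannot be larger.\<close>

lemma facet_of_neighbour:
  assumes "T \<in> \<T>" "T' \<in> \<T>" "T \<noteq> T'" "F facet_of T" "z \<in> rel_interior F" "z \<in> T'"
  shows "F facet_of T'"
proof -
  have FT: "F face_of T" "F \<noteq> {}" "aff_dim F = aff_dim T - 1" using assms(4) by (auto simp: facet_of_def)
  have zT: "z \<in> T" using assms(5) rel_interior_subset face_of_imp_subset[OF FT(1)] by blast
  have sub: "F \<subseteq> T \<inter> T'"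
    by (rule subset_of_face_of[OF Int_face_of[OF assms(1,2)] face_of_imp_subset[OF FT(1)]])
      (use assms(5,6) zT in auto)
  have FI: "F face_of T \<inter> T'" by (rule face_of_subset[OF FT(1) sub]) simp
  have "T \<inter> T' \<noteq> T" using element_subset_imp_eq[OF assms(1,2)] assms(3) by blast
  then have lt: "aff_dim (T \<inter> T') < aff_dim T"
    by (rule face_of_aff_dim_lt[OF element_convex[OF assms(1)] Int_face_of[OF assms(1,2)]])
  have "F = T \<inter> T'"
  proof (rule ccontr)
    assume "F \<noteq> T \<inter> T'"
    then have "aff_dim F < aff_dim (T \<inter> T')"
      using FI element_convex assms(1,2) by (intro face_of_aff_dim_lt convex_Int) auto
    then show False using lt FT(3) by simp
  qed
  then have "F face_of T'" using Int_face_of[OF assms(2,1)] by (simp add: Int_commute)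
  then show ?thesis using FT element_aff_dim assms(1,2) by (simp add: facet_of_def)
qed

text \<open>Both elements are locally half-spaces with the same bounding hyperplane, so their unit
  normals are equal or opposite; equal ones would make the interiors overlap.\<close>

lemma interior_facet_local:
  assumes "T \<in> \<T>" "T' \<in> \<T>" "T \<noteq> T'" "F facet_of T" "F facet_of T'" "z \<in> rel_interior F"
  obtains a b \<epsilon> where "norm a = 1" "affine hull F = {x. a \<bullet> x = b}" "\<epsilon> > 0"
    "\<And>x. x \<in> ball z \<epsilon> \<Longrightarrow> (x \<in> T \<longleftrightarrow> a \<bullet> x \<le> b) \<and> (x \<in> T' \<longleftrightarrow> b \<le> a \<bullet> x)"
proof -
  obtain a b \<epsilon> where a: "norm a = 1" "affine hull F = {x. a \<bullet> x = b}" "\<epsilon> > 0"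
    "\<And>x. x \<in> ball z \<epsilon> \<Longrightarrow> x \<in> T \<longleftrightarrow> a \<bullet> x \<le> b"
    using facet_local_halfspace[OF element_polyhedron[OF assms(1)] element_aff_dim[OF assms(1)] assms(4,6)] by metis
  obtain a' b' \<epsilon>' where a': "norm a' = 1" "affine hull F = {x. a' \<bullet> x = b'}" "\<epsilon>' > 0"
    "\<And>x. x \<in> ball z \<epsilon>' \<Longrightarrow> x \<in> T' \<longleftrightarrow> a' \<bullet> x \<le> b'"
    using facet_local_halfspace[OF element_polyhedron[OF assms(2)] element_aff_dim[OF assms(2)] assms(5,6)] by metis
  have zb: "a \<bullet> z = b" using assms(6) rel_interior_subset hull_subset[of F affine] a(2) by blast
  have "\<not> (a' = a \<and> b' = b)"
  proof
    assume eq: "a' = a \<and> b' = b"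
    let ?\<epsilon> = "min \<epsilon> \<epsilon>'"
    let ?S = "ball z ?\<epsilon> \<inter> {x. a \<bullet> x < b}"
    have "?S \<subseteq> T" "?S \<subseteq> T'" using a(4) a'(4) eq by (auto simp: less_imp_le)
    moreover have "open ?S" by (intro open_Int open_ball open_halfspace_lt)
    ultimately have "?S \<subseteq> interior T \<inter> T'" by (simp add: interior_maximal)
    moreover have "z - (?\<epsilon> / 2) *\<^sub>R a \<in> ?S"
      using a(1,3) a'(3) zb by (auto simp: dist_norm inner_diff_right dot_square_norm min_less_iff_disj)
    ultimately show False using interiors_disjoint[OF assms(1-3)] by blast
  qed
  then have "a' = - a" "b' = - b"
    using hyperplane_eq_imp_normal_eq[of a b a' b'] a(1,2) a'(1,2) by auto
  then show thesis
    using a a'(3,4) by (intro that[of a b "min \<epsilon> \<epsilon>'"]) auto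
qed

lemma shared_facet_interior:
  assumes "T \<in> \<T>" "T' \<in> \<T>" "T \<noteq> T'" "F facet_of T" "F facet_of T'" "z \<in> rel_interior F"
  shows "z \<in> interior (T \<union> T')"
proof -
  obtain a b \<epsilon> where a: "norm a = 1" "affine hull F = {x. a \<bullet> x = b}" "\<epsilon> > 0"
    "\<And>x. x \<in> ball z \<epsilon> \<Longrightarrow> (x \<in> T \<longleftrightarrow> a \<bullet> x \<le> b) \<and> (x \<in> T' \<longleftrightarrow> b \<le> a \<bullet> x)"
    using interior_facet_local[OF assms] by metis
  have "ball z \<epsilon> \<subseteq> T \<union> T'" using a(4) by (meson UnCI linear subsetI)
  then show ?thesis using a(3) by (meson centre_in_ball interiorI open_ball)
qed

text \<open>Two elements sharing the facet would fill a neighbourhood of \<open>z\<close>, placing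
  it in the interior of the closure, which is the open domain itself.\<close>

lemma boundary_facet_not_shared:
  assumes "T \<in> \<T>" "T' \<in> \<T>" "T \<noteq> T'" "F facet_of T" "F \<subseteq> frontier \<Omega>" "z \<in> rel_interior F"
  shows "z \<notin> T'"
proof
  assume "z \<in> T'"
  then have "F facet_of T'" using facet_of_neighbour assms by blast
  then have "z \<in> interior (T \<union> T')" using shared_facet_interior assms by blast
  moreover have "interior (T \<union> T') \<subseteq> \<Omega>"
    using interior_mono[of "T \<union> T'" "closure \<Omega>"] element_subset assms(1,2) interior_closure_domain by auto
  moreover have "z \<in> frontier \<Omega>" using assms(5,6) rel_interior_subset by blast
  ultimately show False using open_domain by (auto simp: frontier_def interior_open)
qed

text \<open>The other elements form a closed set that avoids \<open>z\<close>, so near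
  \<open>z\<close> the closure of the domain is just \<open>T\<close>. The open domain is recovered
  from it as the interior of its closure.\<close>

lemma boundary_facet_local:
  assumes "T \<in> \<T>" "F facet_of T" "z \<in> rel_interior F" "\<And>T'. T' \<in> \<T> \<Longrightarrow> T' \<noteq> T \<Longrightarrow> z \<notin> T'"
  obtains a b \<epsilon> where "norm a = 1" "affine hull F = {x. a \<bullet> x = b}" "\<epsilon> > 0"
    "\<And>x. x \<in> ball z \<epsilon> \<Longrightarrow> (x \<in> T \<longleftrightarrow> a \<bullet> x \<le> b) \<and> (x \<in> \<Omega> \<longleftrightarrow> a \<bullet> x < b)"
proof -
  obtain a b \<epsilon> where a: "norm a = 1" "affine hull F = {x. a \<bullet> x = b}" "\<epsilon> > 0"
    "\<And>x. x \<in> ball z \<epsilon> \<Longrightarrow> x \<in> T \<longleftrightarrow> a \<bullet> x \<le> b"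
    using facet_local_halfspace[OF element_polyhedron[OF assms(1)] element_aff_dim[OF assms(1)] assms(2,3)] by metis
  have "closed (\<Union>(\<T> - {T}))" using finite_mesh element_closed by (intro closed_Union) auto
  then have "open (- \<Union>(\<T> - {T}))" by blast
  moreover have "z \<in> - \<Union>(\<T> - {T})" using assms(4) by auto
  ultimately obtain \<delta> where \<delta>: "\<delta> > 0" "ball z \<delta> \<subseteq> - \<Union>(\<T> - {T})" by (meson open_contains_ball)
  let ?\<epsilon> = "min \<epsilon> \<delta>"
  have cl: "x \<in> closure \<Omega> \<longleftrightarrow> a \<bullet> x \<le> b" if "x \<in> ball z ?\<epsilon>" for x
  proof -
    have "x \<in> closure \<Omega> \<longleftrightarrow> x \<in> T" using that \<delta>(2) Union_mesh assms(1) by fastforce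
    then show ?thesis using a(4) that by simp
  qed
  show thesis
  proof (rule that[of a b ?\<epsilon>])
    fix x assume x: "x \<in> ball z ?\<epsilon>"
    have "x \<in> \<Omega> \<longleftrightarrow> a \<bullet> x < b"
    proof
      assume "x \<in> \<Omega>"
      then have le: "a \<bullet> x \<le> b" using cl[OF x] closure_subset by blast
      show "a \<bullet> x < b"
      proof (rule ccontr)
        assume "\<not> a \<bullet> x < b"
        then have eq: "a \<bullet> x = b" using le by simp
        have "open (\<Omega> \<inter> ball z ?\<epsilon>)" using open_domain by blast
        then obtain r where r: "r > 0" "ball x r \<subseteq> \<Omega> \<inter> ball z ?\<epsilon>"
          using \<open>x \<in> \<Omega>\<close> x by (metis IntI open_contains_ball)
        let ?y = "x + (r / 2) *\<^sub>R a"
        have "?y \<in> ball x r" using r(1) a(1) by (simp add: dist_norm)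
        then have "?y \<in> closure \<Omega>" "?y \<in> ball z ?\<epsilon>" using r(2) closure_subset by blast+
        then have "a \<bullet> ?y \<le> b" using cl by blast
        then show False using r(1) a(1) eq by (simp add: inner_add_right dot_square_norm)
      qed
    next
      assume "a \<bullet> x < b"
      have "ball z ?\<epsilon> \<inter> {x. a \<bullet> x < b} \<subseteq> closure \<Omega>"
      proof
        fix y assume "y \<in> ball z ?\<epsilon> \<inter> {x. a \<bullet> x < b}"
        then show "y \<in> closure \<Omega>" using cl[of y] by auto
      qed
      then have "ball z ?\<epsilon> \<inter> {x. a \<bullet> x < b} \<subseteq> interior (closure \<Omega>)"
        by (intro interior_maximal open_Int open_ball open_halfspace_lt)
      then show "x \<in> \<Omega>" using x \<open>a \<bullet> x < b\<close> interior_closure_domain by blast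
    qed
    then show "(x \<in> T \<longleftrightarrow> a \<bullet> x \<le> b) \<and> (x \<in> \<Omega> \<longleftrightarrow> a \<bullet> x < b)" using a(4) x by simp
  qed (use a \<delta> in auto)
qed

text \<open>Without a partner no other element meets the relative interior of \<open>F\<close>, so
  the local picture at a boundary facet applies at each of its points; the rest of \<open>F\<close>
  follows by closure.\<close>

lemma facet_shared_or_boundary:
  assumes "T \<in> \<T>" "F facet_of T"
  shows "F \<subseteq> frontier \<Omega> \<or> (\<exists>T'\<in>\<T>. T' \<noteq> T \<and> F facet_of T')"
proof (rule ccontr)
  assume neg: "\<not> ?thesis"
  have "rel_interior F \<subseteq> frontier \<Omega>"
  proof
    fix z assume z: "z \<in> rel_interior F"
    have "z \<notin> T'" if "T' \<in> \<T>" "T' \<noteq> T" for T'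
      using facet_of_neighbour[OF assms(1) that(1) _ assms(2) z] that neg by blast
    then obtain a b \<epsilon> where a: "norm a = 1" "affine hull F = {x. a \<bullet> x = b}" "\<epsilon> > 0"
      "\<And>x. x \<in> ball z \<epsilon> \<Longrightarrow> (x \<in> T \<longleftrightarrow> a \<bullet> x \<le> b) \<and> (x \<in> \<Omega> \<longleftrightarrow> a \<bullet> x < b)"
      using boundary_facet_local[OF assms z] by metis
    have "a \<bullet> z = b" using z rel_interior_subset hull_subset[of F affine] a(2) by blast
    then have "z \<in> T" "z \<notin> \<Omega>" using a(3) a(4)[of z] by auto
    then show "z \<in> frontier \<Omega>"
      using element_subset[OF assms(1)] open_domain by (auto simp: frontier_def interior_open)
  qed
  then have "closure (rel_interior F) \<subseteq> frontier \<Omega>" by (simp add: closure_minimal)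
  moreover have "F \<subseteq> closure (rel_interior F)"
  proof -
    have "convex F" using assms(2) element_convex[OF assms(1)] face_of_imp_convex facet_of_imp_face_of by blast
    from convex_closure_rel_interior[OF this] show ?thesis using closure_subset[of F] by simp
  qed
  ultimately show False using neg by blast
qed

text \<open>
  A generic ray starting inside the union of such a family leaves it through the relative interior of
  a facet, since the rays meeting the skeleton of codimension two fill only a null set.
\<close>

lemma no_subfamily_without_boundary:
  assumes "A \<subseteq> \<T>" "\<And>T F. T \<in> A \<Longrightarrow> F facet_of T \<Longrightarrow> \<exists>T'\<in>A. T' \<noteq> T \<and> F facet_of T'"
  shows "A = {}"
proof (rule ccontr)
  assume "A \<noteq> {}"
  then obtain T0 where T0: "T0 \<in> A" by auto
  have finA: "finite A" using finite_mesh assms(1) finite_subset by blast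
  define U where "U = \<Union>A"
  have U: "closed U" "bounded U"
    unfolding U_def using finA assms(1) element_closed element_bounded by (auto intro!: closed_Union bounded_Union)
  obtain x where x: "x \<in> interior T0" using element_interior_nonempty T0 assms(1) by blast
  then have xU: "x \<in> interior U" using T0 interior_mono[of T0 U] U_def by blast
  \<comment> \<open>Faces of codimension two: together with \<open>x\<close> each spans at most a
    hyperplane, a null set, so an endpoint \<open>y\<close> outside \<open>U\<close> can be chosen
    off all these hulls.\<close>
  define \<G> where "\<G> = (\<Union>T\<in>A. \<Union>F\<in>{F. F facet_of T}. {G. G facet_of F})"
  have poly: "polytope F" if "T \<in> A" "F facet_of T" for T F
    using that assms(1) element_polytope face_of_polytope_polytope facet_of_imp_face_of by blast
  have fin\<G>: "finite \<G>"
    unfolding \<G>_def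
    using finite_polytope_facets[OF element_polytope] finite_polytope_facets[OF poly] assms(1)
    by (intro finite_UN_I finA) (auto simp: subset_iff)
  have dim\<G>: "aff_dim G = int DIM(real ^ 'n) - 2" if "G \<in> \<G>" for G
    using that element_aff_dim assms(1) unfolding \<G>_def facet_of_def by fastforce
  have neg: "negligible (\<Union>G\<in>\<G>. affine hull (insert x G))"
  proof (intro negligible_Union)
    fix S assume "S \<in> (\<lambda>G. affine hull insert x G) ` \<G>"
    then obtain G where G: "G \<in> \<G>" "S = affine hull insert x G" by auto
    then show "negligible S" using dim\<G>[OF G(1)] by (intro negligible_aff_lowdim) (auto simp: aff_dim_insert)
  qed (use fin\<G> in auto)
  have "U \<noteq> UNIV" using U(2) not_bounded_UNIV by blast
  then have "\<not> negligible (- U)" using U(1) by (intro open_not_negligible) auto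
  then have "\<not> - U \<subseteq> (\<Union>G\<in>\<G>. affine hull (insert x G))" using negligible_subset[OF neg] by blast
  then obtain y where y: "y \<notin> U" "y \<notin> (\<Union>G\<in>\<G>. affine hull (insert x G))" by blast
  have "closed_segment x y \<inter> frontier U \<noteq> {}"
    using xU interior_subset y(1) by (intro connected_Int_frontier) auto
  then obtain z where z: "z \<in> closed_segment x y" "z \<in> frontier U" by auto
  then have zU: "z \<in> U" "z \<notin> interior U" using U(1) by (auto simp: frontier_def)
  then obtain T where T: "T \<in> A" "z \<in> T" by (auto simp: U_def)
  then have TT: "T \<in> \<T>" using assms(1) by blast
  have "z \<notin> interior T" using zU(2) T interior_mono[of T U] U_def by blast
  then have "z \<in> rel_frontier T"
    using T(2) element_closed[OF TT] rel_interior_element[OF TT] by (simp add: rel_frontier_def)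
  then obtain F where F: "F facet_of T" "z \<in> F"
    using rel_frontier_of_polyhedron[OF element_polyhedron[OF TT]] by auto
  have "z \<notin> rel_interior F"
  proof
    assume zF: "z \<in> rel_interior F"
    obtain T' where T': "T' \<in> A" "T' \<noteq> T" "F facet_of T'" using assms(2)[OF T(1) F(1)] by auto
    then have "z \<in> interior (T \<union> T')" using shared_facet_interior[of T T' F z] TT F(1) zF assms(1) by blast
    moreover have "interior (T \<union> T') \<subseteq> interior U" using T(1) T'(1) by (intro interior_mono) (auto simp: U_def)
    ultimately show False using zU(2) by blast
  qed
  moreover have pF: "polytope F" using poly T(1) F(1) by blast
  ultimately have "z \<in> rel_frontier F"
    using F(2) closure_subset[of F] by (auto simp: rel_frontier_def)
  then obtain G where G: "G facet_of F" "z \<in> G"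
    using rel_frontier_of_polyhedron[OF polytope_imp_polyhedron[OF pF]] by auto
  then have G\<G>: "G \<in> \<G>" unfolding \<G>_def using T(1) F(1) by blast
  obtain s where s: "z = (1 - s) *\<^sub>R x + s *\<^sub>R y" "0 \<le> s" "s \<le> 1" using z(1) by (auto simp: in_segment)
  have "s \<noteq> 0" using s(1) xU zU(2) by auto
  \<comment> \<open>Solving for the far endpoint: \<open>y\<close> lies on the line through
    \<open>x\<close> and \<open>z\<close>, hence in one of the hulls it was chosen to avoid.\<close>
  then have "y = (1 - 1 / s) *\<^sub>R x + (1 / s) *\<^sub>R z" by (simp add: s(1) algebra_simps)
  moreover have "(1 - 1 / s) *\<^sub>R x + (1 / s) *\<^sub>R z \<in> affine hull (insert x G)"
    using G(2) by (intro mem_affine affine_affine_hull hull_inc) auto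
  ultimately show False using y(2) G\<G> by auto
qed

end

section \<open>Integrals over facets\<close>

definition prism :: "(real ^ 'n) set \<Rightarrow> (real ^ 'n) set" where
  "prism F = {y + t *\<^sub>R unit_normal F | y t. y \<in> F \<and> t \<in> {0..1}}"

lemma face_integral_prism:
  "face_integral F g = (LINT x|lebesgue_on (prism F). g (closest_point (affine hull F) x))"
  by (simp add: face_integral_def prism_def)

locale flat_face =
  fixes F :: "(real ^ 'n) set"
  assumes compact_face: "compact F" and convex_face: "convex F" and aff_dim_face: "aff_dim F = int CARD('n) - 1"
    and nonempty_face: "F \<noteq> {}"
begin

lemma unit_normal: "norm (unit_normal F) = 1" "\<And>x y. x \<in> F \<Longrightarrow> y \<in> F \<Longrightarrow> (x - y) \<bullet> unit_normal F = 0"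
proof -
  have "aff_dim F < DIM(real ^ 'n)" using aff_dim_face by simp
  then obtain a b where ab: "a \<noteq> 0" "F \<subseteq> {x. a \<bullet> x = b}" using aff_lowdim_subset_hyperplane by metis
  have "norm (a /\<^sub>R norm a) = 1" using ab(1) by simp
  moreover have "(x - y) \<bullet> (a /\<^sub>R norm a) = 0" if "x \<in> F" "y \<in> F" for x y
  proof -
    have "a \<bullet> x = b" "a \<bullet> y = b" using that ab(2) by auto
    then show ?thesis by (simp add: inner_diff_left inner_diff_right inner_commute)
  qed
  ultimately have "\<exists>n. norm n = 1 \<and> (\<forall>x\<in>F. \<forall>y\<in>F. (x - y) \<bullet> n = 0)" by blast
  then have *: "norm (unit_normal F) = 1 \<and> (\<forall>x\<in>F. \<forall>y\<in>F. (x - y) \<bullet> unit_normal F = 0)"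
    unfolding unit_normal_def by (rule someI_ex)
  show "norm (unit_normal F) = 1" using * by blast
  show "\<And>x y. x \<in> F \<Longrightarrow> y \<in> F \<Longrightarrow> (x - y) \<bullet> unit_normal F = 0" using * by blast
qed

lemma affine_hull_face_orthogonal:
  assumes "x \<in> affine hull F" "y \<in> F" shows "(x - y) \<bullet> unit_normal F = 0"
proof -
  have "affine hull F \<subseteq> {x. unit_normal F \<bullet> x = unit_normal F \<bullet> y}"
  proof (rule hull_minimal)
    show "F \<subseteq> {x. unit_normal F \<bullet> x = unit_normal F \<bullet> y}"
      using unit_normal(2)[OF _ assms(2)] by (auto simp: inner_diff_left inner_diff_right inner_commute)
  qed (rule affine_hyperplane)
  then have "unit_normal F \<bullet> x = unit_normal F \<bullet> y" using assms(1) by blast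
  then show ?thesis by (simp add: inner_diff_left inner_diff_right inner_commute)
qed

text \<open>By Pythagoras, since the normal is orthogonal to the hull. The integrand over the prism
  is therefore the value at the foot point, and only values on \<open>F\<close> enter a face
  integral.\<close>

lemma closest_point_prism:
  assumes "y \<in> F" shows "closest_point (affine hull F) (y + t *\<^sub>R unit_normal F) = y"
proof (rule closest_point_unique[symmetric])
  show "y \<in> affine hull F" using assms hull_inc by fast
  show "\<forall>z\<in>affine hull F. dist (y + t *\<^sub>R unit_normal F) y \<le> dist (y + t *\<^sub>R unit_normal F) z"
  proof
    fix z assume z: "z \<in> affine hull F"
    let ?n = "unit_normal F"
    have o: "(y - z) \<bullet> (t *\<^sub>R ?n) = 0"
      using affine_hull_face_orthogonal[OF z assms] by (simp add: inner_diff_left)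
    have "(norm (y - z + t *\<^sub>R ?n))\<^sup>2 = (norm (y - z))\<^sup>2 + (norm (t *\<^sub>R ?n))\<^sup>2"
      using o by (intro norm_add_Pythagorean) (simp add: orthogonal_def)
    then have "(norm (t *\<^sub>R ?n))\<^sup>2 \<le> (norm (y - z + t *\<^sub>R ?n))\<^sup>2" by simp
    then have "norm (t *\<^sub>R ?n) \<le> norm (y - z + t *\<^sub>R ?n)" by (rule power2_le_imp_le) simp
    then show "dist (y + t *\<^sub>R ?n) y \<le> dist (y + t *\<^sub>R ?n) z" by (simp add: dist_norm algebra_simps)
  qed
qed (auto simp: affine_imp_convex)

lemma prism_eq_image: "prism F = (\<lambda>(y, t). y + t *\<^sub>R unit_normal F) ` (F \<times> {0..1})"
  by (auto simp: prism_def) blast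

lemma prism_compact: "compact (prism F)"
  unfolding prism_eq_image
  by (intro compact_continuous_image compact_Times compact_face) (auto intro!: continuous_intros simp: case_prod_beta)

lemma prism_lmeasurable: "prism F \<in> lmeasurable"
  using prism_compact by (rule lmeasurable_compact)

lemma prism_convex: "convex (prism F)"
proof -
  have "linear (\<lambda>(y, t::real). y + t *\<^sub>R unit_normal F)"
    by (rule linearI) (auto simp: algebra_simps)
  then show ?thesis unfolding prism_eq_image
    by (rule convex_linear_image) (intro convex_Times convex_face convex_real_interval)
qed

text \<open>The prism contains \<open>F\<close> and a point off its hyperplane, so this convex set
  has full dimension and nonempty interior. This is what makes a constant with vanishing face
  integral zero.\<close>

lemma prism_measure_pos: "measure lebesgue (prism F) > 0"
proof -
  obtain y where y: "y \<in> F" using nonempty_face by auto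
  have sub: "insert (y + unit_normal F) F \<subseteq> prism F"
  proof -
    have "y + 1 *\<^sub>R unit_normal F \<in> prism F" unfolding prism_def using y by fastforce
    moreover have "x + 0 *\<^sub>R unit_normal F \<in> prism F" if "x \<in> F" for x unfolding prism_def using that by fastforce
    ultimately show ?thesis by auto
  qed
  have "y + unit_normal F \<notin> affine hull F"
    using affine_hull_face_orthogonal[of "y + unit_normal F" y] unit_normal(1) y by (auto simp: dot_square_norm)
  then have "aff_dim (insert (y + unit_normal F) F) = CARD('n)" using aff_dim_face by (simp add: aff_dim_insert)
  then have "aff_dim (prism F) \<ge> CARD('n)" using aff_dim_subset[OF sub] by simp
  then have "aff_dim (prism F) = int DIM(real ^ 'n)" using aff_dim_le_DIM[of "prism F"] by simp
  then have "interior (prism F) \<noteq> {}"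
    using interior_rel_interior rel_interior_eq_empty[OF prism_convex] sub by (metis insert_not_empty subset_empty)
  then have "\<not> negligible (prism F)"
    by (metis interior_subset negligible_subset open_interior open_not_negligible)
  then show ?thesis
    using negligible_iff_measure0[OF prism_lmeasurable] by (metis measure_nonneg order_le_less)
qed

lemma face_integral_cong:
  assumes "\<And>x. x \<in> F \<Longrightarrow> f x = g x" shows "face_integral F f = face_integral F g"
  unfolding face_integral_prism
proof (rule Bochner_Integration.integral_cong)
  fix x assume "x \<in> space (lebesgue_on (prism F))"
  then obtain y t where "y \<in> F" "x = y + t *\<^sub>R unit_normal F" by (auto simp: prism_def)
  then show "f (closest_point (affine hull F) x) = g (closest_point (affine hull F) x)"
    using closest_point_prism assms by simp
qed simp

lemma affine_on_face_integrable:
  "integrable (lebesgue_on (prism F)) (\<lambda>x. a \<bullet> closest_point (affine hull F) x + b)"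
proof -
  have "continuous_on UNIV (closest_point (affine hull F))"
    using nonempty_face by (intro continuous_on_closest_point) (auto simp: affine_imp_convex)
  then have "(\<lambda>x. a \<bullet> closest_point (affine hull F) x + b) \<in> L2_space (prism F)"
    using prism_compact prism_lmeasurable
    by (intro continuous_in_L2_space continuous_intros) (auto simp: compact_imp_bounded fmeasurableD)
  then show ?thesis using prism_lmeasurable by (rule L2_space_integrable)
qed

lemma face_integral_add:
  assumes "\<And>x. x \<in> F \<Longrightarrow> f x = a \<bullet> x + b" "\<And>x. x \<in> F \<Longrightarrow> g x = a' \<bullet> x + b'"
  shows "face_integral F (\<lambda>x. f x + g x) = face_integral F f + face_integral F g"
proof -
  have "face_integral F (\<lambda>x. f x + g x) = face_integral F (\<lambda>x. (a \<bullet> x + b) + (a' \<bullet> x + b'))"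
    using assms by (intro face_integral_cong) simp
  also have "\<dots> = face_integral F (\<lambda>x. a \<bullet> x + b) + face_integral F (\<lambda>x. a' \<bullet> x + b')"
    unfolding face_integral_prism by (intro Bochner_Integration.integral_add affine_on_face_integrable)
  also have "\<dots> = face_integral F f + face_integral F g"
    using assms face_integral_cong[of f "\<lambda>x. a \<bullet> x + b"] face_integral_cong[of g "\<lambda>x. a' \<bullet> x + b'"] by simp
  finally show ?thesis .
qed

lemma face_integral_const: "face_integral F (\<lambda>x. c) = c * measure lebesgue (prism F)"
proof -
  have "prism F \<in> sets lebesgue" using prism_lmeasurable by (rule fmeasurableD)
  then have "measure (lebesgue_on (prism F)) (prism F) = measure lebesgue (prism F)"
    by (intro measure_restrict_space) auto
  then show ?thesis by (simp add: face_integral_prism)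
qed

lemma face_integral_const_eq_0_iff: "face_integral F (\<lambda>x. c) = 0 \<longleftrightarrow> c = 0"
  using prism_measure_pos by (simp add: face_integral_const)

end

section \<open>Piecewise affine functions\<close>

text \<open>Linear subspaces as sets of functions under pointwise operations; no quotient by null
  sets is formed.\<close>

definition function_space :: "('a \<Rightarrow> real) set \<Rightarrow> bool" where
  "function_space V \<longleftrightarrow> (\<lambda>x. 0) \<in> V \<and> (\<forall>u\<in>V. \<forall>v\<in>V. (\<lambda>x. u x + v x) \<in> V) \<and> (\<forall>c. \<forall>v\<in>V. (\<lambda>x. c * v x) \<in> V)"

lemma function_space_zero: "function_space V \<Longrightarrow> (\<lambda>x. 0) \<in> V"
  and function_space_add: "function_space V \<Longrightarrow> u \<in> V \<Longrightarrow> v \<in> V \<Longrightarrow> (\<lambda>x. u x + v x) \<in> V"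
  and function_space_mult: "function_space V \<Longrightarrow> v \<in> V \<Longrightarrow> (\<lambda>x. c * v x) \<in> V"
  by (simp_all add: function_space_def)

lemma function_space_diff: "function_space V \<Longrightarrow> u \<in> V \<Longrightarrow> v \<in> V \<Longrightarrow> (\<lambda>x. u x - v x) \<in> V"
  using function_space_add[OF _ _ function_space_mult[of V v "-1"], of u] by simp

context mesh
begin

lemma facet_flat_face:
  assumes "T \<in> \<T>" "F facet_of T" shows "flat_face F"
proof
  have "polytope F" using face_of_polytope_polytope[OF element_polytope[OF assms(1)]] assms(2) facet_of_imp_face_of by blast
  then show "compact F" "convex F" by (auto simp: polytope_imp_compact polytope_imp_convex)
  show "aff_dim F = int CARD('n) - 1" "F \<noteq> {}"
    using assms(2) element_aff_dim[OF assms(1)] by (auto simp: facet_of_def)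
qed

text \<open>The coefficients are fixed for all elements at once, so that \<open>a\<close> represents
  the broken gradient and \<open>a T \<bullet> x + b T\<close> extends the function to the closed
  element.\<close>

definition affine_pieces :: "(real ^ 'n \<Rightarrow> real) \<Rightarrow> ((real ^ 'n) set \<Rightarrow> real ^ 'n) \<Rightarrow> ((real ^ 'n) set \<Rightarrow> real) \<Rightarrow> bool" where
  "affine_pieces v a b \<longleftrightarrow> (\<forall>T\<in>\<T>. \<forall>x\<in>interior T. v x = a T \<bullet> x + b T)"

lemma affine_piecesD: "affine_pieces v a b \<Longrightarrow> T \<in> \<T> \<Longrightarrow> x \<in> interior T \<Longrightarrow> v x = a T \<bullet> x + b T"
  by (simp add: affine_pieces_def)

lemma P1_space_iff:
  "v \<in> P1_space \<T> \<longleftrightarrow> supported_on_elements \<T> v \<and> (\<exists>a b. affine_pieces v a b)"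
proof -
  have "(\<forall>T\<in>\<T>. \<exists>a b. \<forall>x\<in>interior T. v x = a \<bullet> x + b) \<longleftrightarrow> (\<exists>a b. affine_pieces v a b)"
    unfolding affine_pieces_def by (subst bchoice_iff, subst bchoice_iff) blast
  then show ?thesis by (auto simp: P1_space_def)
qed

lemma P1_spaceE:
  assumes "v \<in> P1_space \<T>"
  obtains a b where "affine_pieces v a b"
  using assms by (auto simp: P1_space_iff)

lemma affine_pieces_add:
  "affine_pieces u a b \<Longrightarrow> affine_pieces v a' b' \<Longrightarrow> affine_pieces (\<lambda>x. u x + v x) (\<lambda>T. a T + a' T) (\<lambda>T. b T + b' T)"
  by (simp add: affine_pieces_def inner_add_left)

lemma affine_pieces_mult:
  "affine_pieces v a b \<Longrightarrow> affine_pieces (\<lambda>x. c * v x) (\<lambda>T. c *\<^sub>R a T) (\<lambda>T. c * b T)"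
  by (simp add: affine_pieces_def algebra_simps)

lemma P1_function_space: "function_space (P1_space \<T>)"
  unfolding function_space_def
proof (intro conjI ballI allI)
  have "affine_pieces (\<lambda>x. 0) (\<lambda>T. 0) (\<lambda>T. 0)" by (simp add: affine_pieces_def)
  then show "(\<lambda>x. 0) \<in> P1_space \<T>" unfolding P1_space_iff by (auto simp: supported_on_elements_def)
next
  fix u v assume "u \<in> P1_space \<T>" "v \<in> P1_space \<T>"
  then show "(\<lambda>x. u x + v x) \<in> P1_space \<T>"
    unfolding P1_space_iff using affine_pieces_add by (fastforce simp: supported_on_elements_def)
next
  fix c v assume "v \<in> P1_space \<T>"
  then show "(\<lambda>x. c * v x) \<in> P1_space \<T>"
    unfolding P1_space_iff using affine_pieces_mult by (fastforce simp: supported_on_elements_def)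
qed

lemma element_trace_affine:
  assumes "affine_pieces v a b" "T \<in> \<T>" "x \<in> T"
  shows "element_trace T v x = a T \<bullet> x + b T"
  unfolding element_trace_def
proof (rule tendsto_Lim)
  have "x \<in> closure (interior T)" using closure_element_interior[OF assms(2)] assms(3) by simp
  then show "\<not> trivial_limit (at x within interior T)"
    unfolding trivial_limit_within using interior_limit_point[of x "interior T"] by (auto simp: closure_def)
  have "((\<lambda>x. a T \<bullet> x + b T) \<longlongrightarrow> a T \<bullet> x + b T) (at x within interior T)"
    by (intro tendsto_intros)
  moreover have "\<forall>\<^sub>F y in at x within interior T. a T \<bullet> y + b T = v y"
    using affine_piecesD[OF assms(1,2)] by (auto simp: eventually_at_filter)
  ultimately show "(v \<longlongrightarrow> a T \<bullet> x + b T) (at x within interior T)" by (rule Lim_transform_eventually)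
qed

text \<open>Replaces traces, which are limits, by integrals of affine functions, on which
  \<open>face_integral\<close> is additive without further conditions.\<close>

lemma CR_space_iff:
  assumes "affine_pieces v a b"
  shows "v \<in> CR_space \<Omega> \<T> \<longleftrightarrow> v \<in> P1_space \<T> \<and>
      (\<forall>T\<in>\<T>. \<forall>T'\<in>\<T>. \<forall>F. T \<noteq> T' \<and> F facet_of T \<and> F facet_of T' \<longrightarrow>
         face_integral F (\<lambda>x. (a T - a T') \<bullet> x + (b T - b T')) = 0) \<and>
      (\<forall>T\<in>\<T>. \<forall>F. F facet_of T \<and> F \<subseteq> frontier \<Omega> \<longrightarrow> face_integral F (\<lambda>x. a T \<bullet> x + b T) = 0)"
proof -
  have 1: "face_integral F (\<lambda>x. element_trace T v x - element_trace T' v x) =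
      face_integral F (\<lambda>x. (a T - a T') \<bullet> x + (b T - b T'))"
    if "T \<in> \<T>" "T' \<in> \<T>" "F facet_of T" "F facet_of T'" for T T' F
  proof -
    interpret flat_face F using facet_flat_face that by blast
    show ?thesis
    proof (rule face_integral_cong)
      fix x assume "x \<in> F"
      then have "x \<in> T" "x \<in> T'" using that(3,4) facet_of_imp_subset by blast+
      then show "element_trace T v x - element_trace T' v x = (a T - a T') \<bullet> x + (b T - b T')"
        using that(1,2) by (simp add: element_trace_affine[OF assms] inner_diff_left)
    qed
  qed
  have 2: "face_integral F (element_trace T v) = face_integral F (\<lambda>x. a T \<bullet> x + b T)"
    if "T \<in> \<T>" "F facet_of T" for T F
  proof -
    interpret flat_face F using facet_flat_face that by blast
    show ?thesis
      using that facet_of_imp_subset[OF that(2)] element_trace_affine[OF assms that(1)]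
      by (intro face_integral_cong) blast
  qed
  show ?thesis unfolding CR_space_def using 1 2 by auto
qed

lemma CR_space_shared_facet:
  "v \<in> CR_space \<Omega> \<T> \<Longrightarrow> affine_pieces v a b \<Longrightarrow> T \<in> \<T> \<Longrightarrow> T' \<in> \<T> \<Longrightarrow> T \<noteq> T' \<Longrightarrow> F facet_of T \<Longrightarrow> F facet_of T' \<Longrightarrow>
    face_integral F (\<lambda>x. (a T - a T') \<bullet> x + (b T - b T')) = 0"
  by (simp add: CR_space_iff)

lemma CR_space_boundary_facet:
  "v \<in> CR_space \<Omega> \<T> \<Longrightarrow> affine_pieces v a b \<Longrightarrow> T \<in> \<T> \<Longrightarrow> F facet_of T \<Longrightarrow> F \<subseteq> frontier \<Omega> \<Longrightarrow>
    face_integral F (\<lambda>x. a T \<bullet> x + b T) = 0"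
  by (simp add: CR_space_iff)

lemma CR_subset_P1: "CR_space \<Omega> \<T> \<subseteq> P1_space \<T>"
  by (auto simp: CR_space_def)

lemma CR_function_space: "function_space (CR_space \<Omega> \<T>)"
  unfolding function_space_def
proof (intro conjI ballI allI)
  have "affine_pieces (\<lambda>x. 0) (\<lambda>T. 0) (\<lambda>T. 0)" by (simp add: affine_pieces_def)
  then show "(\<lambda>x. 0) \<in> CR_space \<Omega> \<T>"
    using P1_function_space by (subst CR_space_iff) (auto simp: function_space_def face_integral_def)
next
  fix u v assume uv: "u \<in> CR_space \<Omega> \<T>" "v \<in> CR_space \<Omega> \<T>"
  obtain a b where a: "affine_pieces u a b" using uv(1) CR_subset_P1 P1_spaceE by blast
  obtain a' b' where a': "affine_pieces v a' b'" using uv(2) CR_subset_P1 P1_spaceE by blast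
  have add: "face_integral F (\<lambda>x. (c + c') \<bullet> x + (d + d')) =
      face_integral F (\<lambda>x. c \<bullet> x + d) + face_integral F (\<lambda>x. c' \<bullet> x + d')" if "T \<in> \<T>" "F facet_of T" for T F c d c' d'
  proof -
    interpret flat_face F using facet_flat_face that by blast
    have "face_integral F (\<lambda>x. (c + c') \<bullet> x + (d + d')) = face_integral F (\<lambda>x. (c \<bullet> x + d) + (c' \<bullet> x + d'))"
      by (simp add: inner_add_left algebra_simps)
    also have "\<dots> = face_integral F (\<lambda>x. c \<bullet> x + d) + face_integral F (\<lambda>x. c' \<bullet> x + d')"
      by (rule face_integral_add) (rule refl)+
    finally show ?thesis .
  qed
  have P1: "(\<lambda>x. u x + v x) \<in> P1_space \<T>"
    using uv CR_subset_P1 P1_function_space unfolding function_space_def by blast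
  show "(\<lambda>x. u x + v x) \<in> CR_space \<Omega> \<T>"
  proof (subst CR_space_iff[OF affine_pieces_add[OF a a']], intro conjI ballI allI impI P1)
    fix T T' F assume T: "T \<in> \<T>" "T' \<in> \<T>" "T \<noteq> T' \<and> F facet_of T \<and> F facet_of T'"
    have "a T + a' T - (a T' + a' T') = (a T - a T') + (a' T - a' T')"
      "b T + b' T - (b T' + b' T') = (b T - b T') + (b' T - b' T')" by auto
    then show "face_integral F (\<lambda>x. (a T + a' T - (a T' + a' T')) \<bullet> x + (b T + b' T - (b T' + b' T'))) = 0"
      using T uv CR_space_iff[OF a] CR_space_iff[OF a'] by (simp only: add[of T F]; simp)
  next
    fix T F assume T: "T \<in> \<T>" "F facet_of T \<and> F \<subseteq> frontier \<Omega>"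
    then show "face_integral F (\<lambda>x. (a T + a' T) \<bullet> x + (b T + b' T)) = 0"
      using uv CR_space_iff[OF a] CR_space_iff[OF a'] by (simp only: add[of T F]; simp)
  qed
next
  fix c v assume v: "v \<in> CR_space \<Omega> \<T>"
  obtain a b where a: "affine_pieces v a b" using v CR_subset_P1 P1_spaceE by blast
  have P1: "(\<lambda>x. c * v x) \<in> P1_space \<T>"
    using v CR_subset_P1 P1_function_space unfolding function_space_def by blast
  have mult: "face_integral F (\<lambda>x. (c *\<^sub>R a') \<bullet> x + c * b') = c * face_integral F (\<lambda>x. a' \<bullet> x + b')" for F a' b'
    by (simp add: face_integral_def flip: distrib_left)
  show "(\<lambda>x. c * v x) \<in> CR_space \<Omega> \<T>"
  proof (subst CR_space_iff[OF affine_pieces_mult[OF a]], intro conjI ballI allI impI P1)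
    fix T T' F assume T: "T \<in> \<T>" "T' \<in> \<T>" "T \<noteq> T' \<and> F facet_of T \<and> F facet_of T'"
    have "c *\<^sub>R a T - c *\<^sub>R a T' = c *\<^sub>R (a T - a T')" "c * b T - c * b T' = c * (b T - b T')"
      by (auto simp: algebra_simps)
    then show "face_integral F (\<lambda>x. (c *\<^sub>R a T - c *\<^sub>R a T') \<bullet> x + (c * b T - c * b T')) = 0"
      using T v CR_space_iff[OF a] by (simp only: mult; simp)
  next
    fix T F assume T: "T \<in> \<T>" "F facet_of T \<and> F \<subseteq> frontier \<Omega>"
    then show "face_integral F (\<lambda>x. (c *\<^sub>R a T) \<bullet> x + c * b T) = 0"
      using v CR_space_iff[OF a] by (simp only: mult; simp)
  qed
qed

section \<open>Elementwise constant fields and broken gradients\<close>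

definition piecewise :: "((real ^ 'n) set \<Rightarrow> 'b::euclidean_space) \<Rightarrow> real ^ 'n \<Rightarrow> 'b" where
  "piecewise c x = (\<Sum>T\<in>\<T>. indicator (interior T) x *\<^sub>R c T)"

lemma sum_over_elements:
  fixes h :: "(real ^ 'n) set \<Rightarrow> 'b::real_vector"
  assumes "T \<in> \<T>" "x \<in> interior T"
  shows "(\<Sum>T'\<in>\<T>. indicator (interior T') x *\<^sub>R h T') = h T"
proof -
  have "indicator (interior T') x *\<^sub>R h T' = (if T' = T then h T' else 0)" if "T' \<in> \<T>" for T'
    using that assms interiors_disjoint[of T T'] interior_subset[of T'] by (auto simp: indicator_def)
  then have "(\<Sum>T'\<in>\<T>. indicator (interior T') x *\<^sub>R h T') = (\<Sum>T'\<in>\<T>. if T' = T then h T' else 0)"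
    by (intro sum.cong) auto
  then show ?thesis using assms(1) finite_mesh by simp
qed

lemma piecewise_on_element: "T \<in> \<T> \<Longrightarrow> x \<in> interior T \<Longrightarrow> piecewise c x = c T"
  unfolding piecewise_def by (rule sum_over_elements)

lemma broken_grad_on_element: "T \<in> \<T> \<Longrightarrow> x \<in> interior T \<Longrightarrow> broken_grad \<T> v x = weak_grad (interior T) v x"
  unfolding broken_grad_def by (rule sum_over_elements)

lemma indicator_scaleR_in_L2:
  assumes "f \<in> L2_space (interior T)" "T \<in> \<T>"
  shows "(\<lambda>x. indicator (interior T) x *\<^sub>R f x) \<in> L2_space \<Omega>"
proof (rule L2_spaceI)
  have sub: "interior T \<subseteq> \<Omega>" using interior_element_subset[OF assms(2)] .
  have 1: "(\<lambda>x. if x \<in> interior T then f x else 0) = (\<lambda>x. indicator (interior T) x *\<^sub>R f x)"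
    by (auto simp: fun_eq_iff)
  have "(\<lambda>x. if x \<in> interior T then f x else 0) \<in> borel_measurable lebesgue"
    using L2_space_measurable[OF assms(1)] interior_sets borel_measurable_if by blast
  then show "(\<lambda>x. indicator (interior T) x *\<^sub>R f x) \<in> borel_measurable (lebesgue_on \<Omega>)"
    unfolding 1 by (rule measurable_restrict_space1)
  have "integrable lebesgue (\<lambda>x. if x \<in> interior T then (norm (f x))\<^sup>2 else 0)"
    using L2_space_integrable_square[OF assms(1)] by (simp add: Lebesgue_Measure.integrable_restrict_UNIV)
  also have "(\<lambda>x. if x \<in> interior T then (norm (f x))\<^sup>2 else 0) = (\<lambda>x. if x \<in> \<Omega> then (norm (indicator (interior T) x *\<^sub>R f x))\<^sup>2 else 0)"
    using sub by (auto simp: fun_eq_iff)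
  finally show "integrable (lebesgue_on \<Omega>) (\<lambda>x. (norm (indicator (interior T) x *\<^sub>R f x))\<^sup>2)"
    using Lebesgue_Measure.integrable_restrict_UNIV[OF domain_sets, of "\<lambda>x. (norm (indicator (interior T) x *\<^sub>R f x))\<^sup>2"] by simp
qed

lemma piecewise_in_L2: "piecewise c \<in> L2_space \<Omega>"
  unfolding piecewise_def[abs_def]
  by (intro L2_space_sum indicator_scaleR_in_L2 const_in_L2_space interior_element_lmeasurable)

lemma AE_elements:
  assumes "\<And>T. T \<in> \<T> \<Longrightarrow> AE x in lebesgue_on (interior T). P x"
  shows "AE x in lebesgue_on \<Omega>. P x"
proof -
  have "AE x in lebesgue. \<forall>T\<in>\<T>. x \<in> interior T \<longrightarrow> P x"
    using finite_mesh assms by (intro AE_finite_allI) (simp_all add: AE_restrict_space_iff)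
  then have "AE x in lebesgue_on \<Omega>. \<forall>T\<in>\<T>. x \<in> interior T \<longrightarrow> P x"
    by (subst AE_restrict_space_iff) (use domain_sets in auto)
  with AE_in_elements show ?thesis by eventually_elim auto
qed

lemma AE_on_element:
  assumes "AE x in lebesgue_on \<Omega>. P x" "T \<in> \<T>"
  shows "AE x in lebesgue_on (interior T). P x"
proof -
  have "AE x in lebesgue. x \<in> \<Omega> \<longrightarrow> P x"
    using assms(1) by (subst (asm) AE_restrict_space_iff) (use domain_sets in auto)
  then have "AE x in lebesgue. x \<in> interior T \<longrightarrow> P x"
    using interior_element_subset[OF assms(2)] by (auto elim: eventually_mono)
  then show ?thesis by (subst AE_restrict_space_iff) auto
qed

text \<open>Only an almost everywhere statement is possible, since \<open>weak_grad\<close> selects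
  an arbitrary representative of its class.\<close>

lemma broken_grad_eqI:
  assumes "\<And>T. T \<in> \<T> \<Longrightarrow> v \<in> L2_space (interior T)" "G \<in> L2_space \<Omega>"
    "\<And>T. T \<in> \<T> \<Longrightarrow> has_weak_grad (interior T) v G"
  shows "AE x in lebesgue_on \<Omega>. broken_grad \<T> v x = G x"
proof (rule AE_elements)
  fix T assume T: "T \<in> \<T>"
  have "G \<in> L2_space (interior T)"
    by (rule L2_space_subset[OF assms(2) interior_element_subset[OF T] domain_sets interior_sets])
  then have "AE x in lebesgue_on (interior T). weak_grad (interior T) v x = G x"
    using assms T interior_element_lmeasurable by (intro weak_grad_eqI) auto
  then show "AE x in lebesgue_on (interior T). broken_grad \<T> v x = G x"
    using AE_space by eventually_elim (simp add: broken_grad_on_element[OF T])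
qed

lemma affine_pieces_weak_grad:
  assumes "affine_pieces v a b" "T \<in> \<T>"
  shows "v \<in> L2_space (interior T)" "has_weak_grad (interior T) v (\<lambda>x. a T)"
proof -
  have eq: "AE x in lebesgue_on (interior T). a T \<bullet> x + b T = v x"
    using affine_piecesD[OF assms] by (intro AE_I2) auto
  have L: "(\<lambda>x. a T \<bullet> x + b T) \<in> L2_space (interior T)"
    using interior_element_bounded[OF assms(2)] by (intro continuous_in_L2_space continuous_intros) auto
  then show "v \<in> L2_space (interior T)" using eq L2_space_cong_AE interior_sets by blast
  show "has_weak_grad (interior T) v (\<lambda>x. a T)"
    using affine_has_weak_grad[OF interior_element_bounded[OF assms(2)] interior_sets, of "a T" "b T"]
    by (rule has_weak_grad_cong_AE[rotated, OF _ L _ eq])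
      (use interior_element_lmeasurable[OF assms(2)] const_in_L2_space in auto)
qed

lemma broken_grad_affine_pieces:
  assumes "affine_pieces v a b"
  shows "AE x in lebesgue_on \<Omega>. broken_grad \<T> v x = piecewise a x"
proof (rule broken_grad_eqI[OF affine_pieces_weak_grad(1)[OF assms] piecewise_in_L2])
  fix T assume T: "T \<in> \<T>"
  show "has_weak_grad (interior T) v (piecewise a)"
  proof (rule has_weak_grad_cong_AE[OF interior_element_lmeasurable[OF T] affine_pieces_weak_grad(2)[OF assms T] affine_pieces_weak_grad(1)[OF assms T]])
    show "(\<lambda>x. a T) \<in> L2_space (interior T)" by (rule const_in_L2_space[OF interior_element_lmeasurable[OF T]])
    show "AE x in lebesgue_on (interior T). a T = piecewise a x"
      by (intro AE_I2) (simp add: piecewise_on_element[OF T])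
  qed simp
qed

lemma broken_grad_in_L2:
  assumes "v \<in> P1_space \<T>" shows "broken_grad \<T> v \<in> L2_space \<Omega>"
proof -
  obtain a b where ab: "affine_pieces v a b" using assms by (rule P1_spaceE)
  have "AE x in lebesgue_on \<Omega>. piecewise a x = broken_grad \<T> v x"
    using broken_grad_affine_pieces[OF ab] by eventually_elim simp
  then show ?thesis by (rule L2_space_cong_AE[OF piecewise_in_L2 domain_sets])
qed

lemma P1_in_L2: assumes "v \<in> P1_space \<T>" shows "v \<in> L2_space \<Omega>"
proof -
  obtain a b where ab: "affine_pieces v a b" using assms by (rule P1_spaceE)
  have "(\<lambda>x. \<Sum>T\<in>\<T>. indicator (interior T) x *\<^sub>R v x) \<in> L2_space \<Omega>"
    by (intro L2_space_sum indicator_scaleR_in_L2 affine_pieces_weak_grad[OF ab])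
  moreover have "AE x in lebesgue_on \<Omega>. (\<Sum>T\<in>\<T>. indicator (interior T) x *\<^sub>R v x) = v x"
    using AE_in_elements by eventually_elim (auto simp: sum_over_elements simp del: real_scaleR_def)
  ultimately show ?thesis using L2_space_cong_AE domain_sets by blast
qed

lemma broken_grad_add:
  assumes "u \<in> P1_space \<T>" "v \<in> P1_space \<T>"
  shows "AE x in lebesgue_on \<Omega>. broken_grad \<T> (\<lambda>x. u x + v x) x = broken_grad \<T> u x + broken_grad \<T> v x"
proof -
  obtain a b where a: "affine_pieces u a b" using assms(1) by (rule P1_spaceE)
  obtain a' b' where a': "affine_pieces v a' b'" using assms(2) by (rule P1_spaceE)
  show ?thesis
    using broken_grad_affine_pieces[OF a] broken_grad_affine_pieces[OF a']
      broken_grad_affine_pieces[OF affine_pieces_add[OF a a']]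
    by eventually_elim (simp add: piecewise_def scaleR_add_right sum.distrib)
qed

lemma broken_grad_mult:
  assumes "v \<in> P1_space \<T>"
  shows "AE x in lebesgue_on \<Omega>. broken_grad \<T> (\<lambda>x. c * v x) x = c *\<^sub>R broken_grad \<T> v x"
proof -
  obtain a b where a: "affine_pieces v a b" using assms by (rule P1_spaceE)
  show ?thesis
    using broken_grad_affine_pieces[OF a] broken_grad_affine_pieces[OF affine_pieces_mult[OF a, of c]]
    by eventually_elim (simp add: piecewise_def scaleR_sum_right mult.commute)
qed

lemma AE_const_on_element:
  assumes "AE x in lebesgue_on (interior T). c = d" "T \<in> \<T>" shows "c = d"
proof (rule ccontr)
  assume "c \<noteq> d"
  then have "AE x in lebesgue. x \<notin> interior T"
    using assms(1) by (subst (asm) AE_restrict_space_iff) auto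
  then have "interior T \<in> null_sets lebesgue" by (simp add: AE_iff_null_sets)
  then have "negligible (interior T)" by (simp add: negligible_iff_null_sets)
  then show False using open_not_negligible[OF open_interior element_interior_nonempty[OF assms(2)]] by blast
qed

text \<open>Only the constants \<open>b\<close> remain. Vanishing face means say that they agree
  across shared facets and vanish at boundary facets, so the elements with
  \<open>b T \<noteq> 0\<close> form a family in which every facet has a partner. Such a family is
  empty by \<open>no_subfamily_without_boundary\<close>.\<close>

lemma CR_broken_grad_eq_0_imp:
  assumes "u \<in> CR_space \<Omega> \<T>" "AE x in lebesgue_on \<Omega>. broken_grad \<T> u x = 0"
  shows "u = (\<lambda>x. 0)"
proof -
  have P1: "u \<in> P1_space \<T>" using assms(1) CR_subset_P1 by blast
  then obtain a b where ab: "affine_pieces u a b" by (rule P1_spaceE)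
  have a0: "a T = 0" if T: "T \<in> \<T>" for T
  proof -
    have "AE x in lebesgue_on \<Omega>. piecewise a x = 0"
      using broken_grad_affine_pieces[OF ab] assms(2) by eventually_elim simp
    then have "AE x in lebesgue_on (interior T). piecewise a x = 0" using T by (rule AE_on_element)
    then have "AE x in lebesgue_on (interior T). a T = 0"
      using AE_space by eventually_elim (simp add: piecewise_on_element[OF T])
    then show ?thesis using T by (rule AE_const_on_element)
  qed
  define A where "A = {T \<in> \<T>. b T \<noteq> 0}"
  have "A = {}"
  proof (rule no_subfamily_without_boundary)
    fix T F assume T: "T \<in> A" and F: "F facet_of T"
    have TT: "T \<in> \<T>" "b T \<noteq> 0" using T by (auto simp: A_def)
    interpret flat_face F using facet_flat_face TT(1) F by blast
    have "\<not> F \<subseteq> frontier \<Omega>"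
    proof
      assume "F \<subseteq> frontier \<Omega>"
      then have "face_integral F (\<lambda>x. a T \<bullet> x + b T) = 0"
        by (rule CR_space_boundary_facet[OF assms(1) ab TT(1) F])
      then show False using TT a0 by (simp add: face_integral_const_eq_0_iff)
    qed
    then obtain T' where T': "T' \<in> \<T>" "T' \<noteq> T" "F facet_of T'"
      using facet_shared_or_boundary[OF TT(1) F] by blast
    then have "face_integral F (\<lambda>x. (a T - a T') \<bullet> x + (b T - b T')) = 0"
      using CR_space_shared_facet[OF assms(1) ab TT(1) T'(1)] F by metis
    then have "b T' = b T" using a0 TT(1) T'(1) by (simp add: face_integral_const_eq_0_iff)
    then show "\<exists>T'\<in>A. T' \<noteq> T \<and> F facet_of T'" using T' TT by (auto simp: A_def)
  qed (auto simp: A_def)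
  then have b0: "b T = 0" if "T \<in> \<T>" for T using that by (auto simp: A_def)
  show ?thesis
  proof
    fix x show "u x = 0"
    proof (cases "x \<in> (\<Union>T\<in>\<T>. interior T)")
      case True
      then show ?thesis using affine_piecesD[OF ab] a0 b0 by auto
    next
      case False
      then show ?thesis using P1 by (auto simp: P1_space_def supported_on_elements_def)
    qed
  qed
qed

end

section \<open>Conforming functions have no jumps\<close>

lemma borel_imp_measurable_lebesgue_on:
  "f \<in> borel_measurable borel \<Longrightarrow> f \<in> borel_measurable (lebesgue_on U)"
  by (intro measurable_restrict_space1 measurable_completion) simp

text \<open>A slab of thickness r consists of m layers of thickness h, each a translate of the top
  layer along the normal, because such a translation leaves the cylinder condition unchanged. It
  serves to bound the measure of a thin layer from below by that of the fixed slab divided by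
  m.\<close>

lemma slab_translates_cover:
  fixes n z :: "real ^ 'n" and c :: real
  assumes n: "norm n = 1" and h: "h > 0" and m: "r = real m * h"
  defines "S \<equiv> \<lambda>h. {x. norm (x - z - ((x - z) \<bullet> n) *\<^sub>R n) < r} \<inter> {x. c - h < n \<bullet> x} \<inter> {x. n \<bullet> x \<le> c}"
  shows "S r \<subseteq> (\<Union>j<m. {x. x + (real j * h) *\<^sub>R n \<in> S h})"
proof
  fix x assume x: "x \<in> S r"
  define t where "t = (c - n \<bullet> x) / h"
  have t: "0 \<le> t" "t < real m" using x h m by (auto simp: S_def t_def field_simps)
  \<comment> \<open>The number of full layers between \<open>x\<close> and the hyperplane; raising
    \<open>x\<close> by that many thicknesses puts it into the top layer.\<close>
  define j where "j = nat \<lfloor>t\<rfloor>"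
  have j: "real j \<le> t" "t < real j + 1" "j < m" using t by (auto simp: j_def) linarith+
  have nn: "n \<bullet> n = 1" using n by (simp add: dot_square_norm)
  have th: "t * h = c - n \<bullet> x" using h by (simp add: t_def)
  have "real j * h \<le> t * h" "t * h < (real j + 1) * h" using j h by auto
  then have 1: "real j * h \<le> c - n \<bullet> x" "c - n \<bullet> x < real j * h + h" unfolding th by (simp_all add: algebra_simps)
  have eq: "x + (real j * h) *\<^sub>R n - z - ((x + (real j * h) *\<^sub>R n - z) \<bullet> n) *\<^sub>R n = x - z - ((x - z) \<bullet> n) *\<^sub>R n"
    by (simp add: inner_add_left inner_diff_left nn algebra_simps)
  have "x + (real j * h) *\<^sub>R n \<in> S h"
    unfolding S_def
  proof (intro IntI CollectI)
    show "norm (x + (real j * h) *\<^sub>R n - z - ((x + (real j * h) *\<^sub>R n - z) \<bullet> n) *\<^sub>R n) < r"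
      unfolding eq using x by (simp add: S_def)
  qed (use 1 in \<open>auto simp: inner_add_right nn\<close>)
  then show "x \<in> (\<Union>j<m. {x. x + (real j * h) *\<^sub>R n \<in> S h})" using j(3) by blast
qed

text \<open>
  For a jump of height at least $\eta$ the squared $L^2$ distance between a function and its
  translate by $h$ is at least of order $\eta^2 h$, whereas for weakly differentiable functions it
  is of order $h^2$.
\<close>

lemma jump_vanishes:
  fixes z n a :: "real ^ 'n"
  assumes n: "norm n = 1" "n \<bullet> z = c" and e: "e > 0"
    and G: "G \<in> L2_space (ball z e)" "has_weak_grad (ball z e) (\<lambda>x. if n \<bullet> x \<le> c then a \<bullet> x + b else 0) G"
  shows "a \<bullet> z + b = 0"
proof (rule ccontr)
  let ?\<alpha> = "\<lambda>x. a \<bullet> x + b" and ?B = "ball z e"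
  let ?w = "\<lambda>x. if n \<bullet> x \<le> c then ?\<alpha> x else 0"
  assume nz: "?\<alpha> z \<noteq> 0"
  \<comment> \<open>Half the supposed jump, so that by continuity the affine function stays above it
    in modulus near \<open>z\<close>.\<close>
  define \<eta> where "\<eta> = \<bar>?\<alpha> z\<bar> / 2"
  have \<eta>: "\<eta> > 0" using nz by (simp add: \<eta>_def)
  have nn: "n \<bullet> n = 1" using n by (simp add: dot_square_norm)
  have "((\<lambda>x. \<bar>?\<alpha> x\<bar>) \<longlongrightarrow> \<bar>?\<alpha> z\<bar>) (nhds z)" by (intro tendsto_intros filterlim_ident)
  then have "\<forall>\<^sub>F x in nhds z. \<eta> < \<bar>?\<alpha> x\<bar>" using nz by (intro order_tendstoD(1)) (auto simp: \<eta>_def)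
  then obtain \<delta> where \<delta>: "\<delta> > 0" "\<And>x. dist x z < \<delta> \<Longrightarrow> \<eta> < \<bar>?\<alpha> x\<bar>"
    unfolding eventually_nhds_metric by blast
  \<comment> \<open>The points of the slab and their shifts lie within 2 r of \<open>z\<close>;
    halving the minimum keeps them both in the ball and in the region where the jump is
    large.\<close>
  define r where "r = min \<delta> e / 2"
  have r: "r > 0" "2 * r \<le> \<delta>" "2 * r \<le> e" using \<delta>(1) e by (auto simp: r_def)
  \<comment> \<open>The layer of height \<open>h\<close> just below the hyperplane, in a cylinder of
    radius \<open>r\<close> around the normal through \<open>z\<close>. A shift by \<open>h\<close>
    along the normal carries all of it across the jump.\<close>
  define S where "S h = {x. norm (x - z - ((x - z) \<bullet> n) *\<^sub>R n) < r} \<inter> {x. c - h < n \<bullet> x} \<inter> {x. n \<bullet> x \<le> c}" for h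
  have near: "dist x z < 2 * r" "dist (x + h *\<^sub>R n) z < 2 * r" if "x \<in> S h" "0 \<le> h" "h \<le> r" for x h
  proof -
    define \<tau> where "\<tau> = (x - z) \<bullet> n"
    have \<tau>: "\<tau> = n \<bullet> x - c" using n(2) by (simp add: \<tau>_def inner_diff_left inner_diff_right inner_commute)
    have \<tau>h: "- h < \<tau>" "\<tau> \<le> 0" using that(1) by (auto simp: S_def \<tau>)
    let ?y = "x - z - \<tau> *\<^sub>R n"
    have y: "norm ?y < r" using that(1) by (simp add: S_def \<tau>_def)
    have "norm (?y + \<tau> *\<^sub>R n) \<le> norm ?y + norm (\<tau> *\<^sub>R n)" by (rule norm_triangle_ineq)
    also have "\<dots> < 2 * r" using y \<tau>h that n(1) by simp
    finally show "dist x z < 2 * r" by (simp add: dist_norm)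
    have "norm (?y + (\<tau> + h) *\<^sub>R n) \<le> norm ?y + norm ((\<tau> + h) *\<^sub>R n)" by (rule norm_triangle_ineq)
    also have "\<dots> < 2 * r" using y \<tau>h that n(1) by simp
    finally show "dist (x + h *\<^sub>R n) z < 2 * r" by (simp add: dist_norm algebra_simps)
  qed
  have SB: "S h \<subseteq> ?B" if "0 \<le> h" "h \<le> r" for h
    using near(1)[OF _ that] r(3) by (force simp: dist_commute)
  have "S h \<in> sets borel" for h
    unfolding S_def
    by (intro sets.Int borel_open borel_closed open_Collect_less closed_Collect_le continuous_intros)
  then have Sm: "S h \<in> lmeasurable" if "0 \<le> h" "h \<le> r" for h
    using SB[OF that] bounded_subset[OF bounded_ball] by (intro bounded_set_imp_lmeasurable) auto
  have wL: "?w \<in> L2_space ?B"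
  proof (rule bounded_in_L2_space)
    show "?w \<in> borel_measurable (lebesgue_on ?B)" by (rule borel_imp_measurable_lebesgue_on) measurable
    show "norm (?w x) \<le> norm a * (norm z + e) + \<bar>b\<bar>" if "x \<in> ?B" for x
    proof -
      have nx: "norm x \<le> norm z + e" using that norm_triangle_ineq2[of x z] by (simp add: dist_norm norm_minus_commute)
      have "\<bar>a \<bullet> x\<bar> \<le> norm a * (norm z + e)"
        using Cauchy_Schwarz_ineq2[of a x] mult_left_mono[OF nx norm_ge_zero[of a]] by linarith
      moreover have "0 \<le> norm a * (norm z + e)" using e by simp
      ultimately show ?thesis by (cases "n \<bullet> x \<le> c") auto
    qed
  qed simp
  define N where "N = L2_norm ?B G"
  have est: "\<eta>\<^sup>2 * measure lebesgue (S h) \<le> (h * N)\<^sup>2" if h: "0 < h" "h \<le> r" for h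
  proof -
    let ?W = "{x \<in> ?B. x + h *\<^sub>R n \<in> ?B}" and ?g = "\<lambda>x. ?w (x + h *\<^sub>R n) - ?w x"
    have h0: "0 \<le> h" using h by simp
    have U': "{x. x + h *\<^sub>R n \<in> ?B} \<in> sets lebesgue" by (rule sets_lebesgue_translate) simp
    then have W: "?W \<in> sets lebesgue" by (simp add: Collect_conj_eq)
    have gL: "?g \<in> L2_space ?W"
      by (rule L2_space_diff, rule L2_space_subset[OF L2_space_translate[OF _ wL] _ U' W], simp, blast)
        (rule L2_space_subset[OF wL _ _ W], blast, simp)
    have SW: "S h \<subseteq> ?W" using near[OF _ h0 h(2)] r(3) by (force simp: dist_commute)
    have S: "S h \<in> lmeasurable" "S h \<in> sets lebesgue" using Sm[OF h0 h(2)] by (auto simp: fmeasurableD)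
    have gS: "?g \<in> L2_space (S h)" by (rule L2_space_subset[OF gL SW W S(2)])
    have big: "\<eta>\<^sup>2 \<le> ?g x \<bullet> ?g x" if x: "x \<in> S h" for x
    proof -
      have "n \<bullet> x \<le> c" "\<not> n \<bullet> (x + h *\<^sub>R n) \<le> c" using x by (auto simp: S_def inner_add_right nn)
      then have "?g x \<bullet> ?g x = \<bar>?\<alpha> x\<bar>\<^sup>2" by (simp add: power2_eq_square algebra_simps)
      moreover have "\<eta> \<le> \<bar>?\<alpha> x\<bar>" using \<delta>(2)[of x] near(1)[OF x h0 h(2)] r(2) by linarith
      then have "\<eta>\<^sup>2 \<le> \<bar>?\<alpha> x\<bar>\<^sup>2" using \<eta> by (intro power_mono) auto
      ultimately show ?thesis by (simp only:)
    qed
    have "\<eta>\<^sup>2 * measure lebesgue (S h) = (LINT x|lebesgue_on (S h). \<eta>\<^sup>2)"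
      using S by (simp add: measure_restrict_space)
    also have "\<dots> \<le> L2_inner (S h) ?g ?g"
      unfolding L2_inner_def
    proof (rule integral_mono)
      show "integrable (lebesgue_on (S h)) (\<lambda>x. \<eta>\<^sup>2)"
        by (rule L2_space_integrable[OF const_in_L2_space[OF S(1)] S(1)])
      show "integrable (lebesgue_on (S h)) (\<lambda>x. ?g x \<bullet> ?g x)" by (rule L2_inner_integrable[OF gS gS])
    qed (use big in simp)
    also have "\<dots> = (L2_norm (S h) ?g)\<^sup>2" by (simp only: L2_norm_square)
    also have "\<dots> \<le> (norm (h *\<^sub>R n) * N)\<^sup>2"
    proof (rule power_mono)
      show "L2_norm (S h) ?g \<le> norm (h *\<^sub>R n) * N"
        using L2_norm_subset[OF gL SW W S(2)] translation_estimate[OF open_ball bounded_ball convex_ball wL G, of "h *\<^sub>R n"]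
        unfolding N_def by linarith
    qed simp
    finally show ?thesis using h n(1) by simp
  qed
  have Spos: "measure lebesgue (S r) > 0"
  proof -
    let ?O = "{x. norm (x - z - ((x - z) \<bullet> n) *\<^sub>R n) < r} \<inter> {x. c - r < n \<bullet> x} \<inter> {x. n \<bullet> x < c}"
    have "open ?O" by (intro open_Int open_Collect_less continuous_intros)
    moreover have "z - (r / 2) *\<^sub>R n \<in> ?O" using r(1) n nn by (simp add: inner_diff_right)
    ultimately have "\<not> negligible ?O" using open_not_negligible by blast
    moreover have "?O \<subseteq> S r" by (auto simp: S_def)
    ultimately have "\<not> negligible (S r)" using negligible_subset by blast
    then show ?thesis using negligible_iff_measure0[OF Sm[of r]] r(1) by (simp add: zero_less_measure_iff)
  qed
  \<comment> \<open>With h = r / (m + 1) the layers give \<open>\<eta>\<close>^2 |S r| \<le> (m + 1)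
    (h N)^2 = r^2 N^2 / (m + 1), which fails for this \<open>m\<close>.\<close>
  obtain m where m: "r\<^sup>2 * N\<^sup>2 / (\<eta>\<^sup>2 * measure lebesgue (S r)) < real (Suc m)"
    using reals_Archimedean2 by (meson less_trans of_nat_less_iff lessI)
  define h where "h = r / real (Suc m)"
  have h: "h > 0" "h \<le> r" "r = real (Suc m) * h" using r(1) by (auto simp: h_def field_simps)
  have tr: "{x. x + t \<in> S h} = (+) (- t) ` S h" for t by force
  have "measure lebesgue (S r) \<le> measure lebesgue (\<Union>j<Suc m. {x. x + (real j * h) *\<^sub>R n \<in> S h})"
  proof (rule measure_mono_fmeasurable)
    show "S r \<subseteq> (\<Union>j<Suc m. {x. x + (real j * h) *\<^sub>R n \<in> S h})"
      unfolding S_def by (rule slab_translates_cover[OF n(1) h(1,3)])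
    show "(\<Union>j<Suc m. {x. x + (real j * h) *\<^sub>R n \<in> S h}) \<in> lmeasurable"
      unfolding tr using Sm[of h] h by (intro fmeasurable.finite_UN measurable_translation) auto
  qed (use Sm[of r] r(1) in \<open>auto simp: fmeasurableD\<close>)
  also have "\<dots> \<le> (\<Sum>j<Suc m. measure lebesgue {x. x + (real j * h) *\<^sub>R n \<in> S h})"
    using Sm[of h] h by (intro measure_UNION_le sets_lebesgue_translate) (auto simp: fmeasurableD)
  also have "\<dots> = (\<Sum>j<Suc m. measure lebesgue (S h))"
  proof (rule sum.cong)
    show "measure lebesgue {x. x + (real j * h) *\<^sub>R n \<in> S h} = measure lebesgue (S h)" for j
      unfolding tr by (rule measure_translation)
  qed simp
  also have "\<dots> = real (Suc m) * measure lebesgue (S h)" by simp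
  finally have "\<eta>\<^sup>2 * measure lebesgue (S r) \<le> real (Suc m) * (\<eta>\<^sup>2 * measure lebesgue (S h))"
    using mult_left_mono[of _ _ "\<eta>\<^sup>2"] by (fastforce simp: algebra_simps)
  also have "\<dots> \<le> real (Suc m) * (h * N)\<^sup>2" by (intro mult_left_mono est h) simp
  also have "\<dots> = r\<^sup>2 * N\<^sup>2 / real (Suc m)" by (simp add: h_def power2_eq_square field_simps del: of_nat_Suc)
  finally have "real (Suc m) * (\<eta>\<^sup>2 * measure lebesgue (S r)) \<le> r\<^sup>2 * N\<^sup>2" by (simp add: field_simps del: of_nat_Suc)
  moreover have "\<eta>\<^sup>2 * measure lebesgue (S r) > 0" using \<eta> Spos by simp
  ultimately have "real (Suc m) \<le> r\<^sup>2 * N\<^sup>2 / (\<eta>\<^sup>2 * measure lebesgue (S r))"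
    by (subst pos_le_divide_eq) auto
  then show False using m by linarith
qed

lemma L2_space_zero_extend:
  assumes "f \<in> L2_space U" "U \<in> sets lebesgue" "V \<in> sets lebesgue"
  shows "(\<lambda>x. if x \<in> U then f x else 0) \<in> L2_space V"
proof (rule L2_spaceI)
  have "(\<lambda>x. if x \<in> U then f x else 0) \<in> borel_measurable lebesgue"
    using L2_space_measurable[OF assms(1)] assms(2) borel_measurable_if by blast
  then have m: "(\<lambda>x. if x \<in> U then f x else 0) \<in> borel_measurable (lebesgue_on W)" for W
    by (rule measurable_restrict_space1)
  show "(\<lambda>x. if x \<in> U then f x else 0) \<in> borel_measurable (lebesgue_on V)" by (rule m)
  have 1: "integrable lebesgue (\<lambda>x. if x \<in> U then (norm (f x))\<^sup>2 else 0)"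
    using L2_space_integrable_square[OF assms(1)] assms(2) by (simp add: Lebesgue_Measure.integrable_restrict_UNIV)
  also have "(\<lambda>x. if x \<in> U then (norm (f x))\<^sup>2 else 0) = (\<lambda>x. (norm (if x \<in> U then f x else 0))\<^sup>2)" by auto
  finally have i: "integrable lebesgue (\<lambda>x. (norm (if x \<in> U then f x else 0))\<^sup>2)" .
  show "integrable (lebesgue_on V) (\<lambda>x. (norm (if x \<in> U then f x else 0))\<^sup>2)"
    using integrable_lebesgue_on_subset[of UNIV "\<lambda>x. (norm (if x \<in> U then f x else 0))\<^sup>2" V] i assms(3)
    by (simp add: lebesgue_on_UNIV_eq)
qed

lemma L2_inner_tendsto:
  assumes "\<And>k. f k \<in> L2_space U" "f' \<in> L2_space U" "g \<in> L2_space U"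
    "(\<lambda>k. L2_norm U (\<lambda>x. f k x - f' x)) \<longlonglongrightarrow> 0"
  shows "(\<lambda>k. L2_inner U (f k) g) \<longlonglongrightarrow> L2_inner U f' g"
proof -
  have "(\<lambda>k. L2_norm U (\<lambda>x. f k x - f' x) * L2_norm U g) \<longlonglongrightarrow> 0 * L2_norm U g"
    by (intro tendsto_intros assms)
  then have lim: "(\<lambda>k. L2_norm U (\<lambda>x. f k x - f' x) * L2_norm U g) \<longlonglongrightarrow> 0" by simp
  have "(\<lambda>k. L2_inner U (f k) g - L2_inner U f' g) \<longlonglongrightarrow> 0"
  proof (rule Lim_null_comparison[OF _ lim])
    show "\<forall>\<^sub>F k in sequentially. norm (L2_inner U (f k) g - L2_inner U f' g) \<le> L2_norm U (\<lambda>x. f k x - f' x) * L2_norm U g"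
      using L2_Cauchy_Schwarz[OF L2_space_diff[OF assms(1,2)] assms(3)]
      by (intro always_eventually) (simp add: L2_inner_diff_left assms)
  qed
  then show ?thesis by (simp add: LIM_zero_iff)
qed

lemma L2_norm_nth_le:
  fixes f :: "real ^ 'n \<Rightarrow> real ^ 'm"
  assumes "f \<in> L2_space U" shows "L2_norm U (\<lambda>x. f x $ i) \<le> L2_norm U f"
proof -
  have "L2_inner U (\<lambda>x. f x $ i) (\<lambda>x. f x $ i) \<le> L2_inner U f f"
    unfolding L2_inner_def
  proof (rule integral_mono)
    show "integrable (lebesgue_on U) (\<lambda>x. f x $ i \<bullet> f x $ i)"
      by (rule L2_inner_integrable[OF L2_space_nth[OF assms] L2_space_nth[OF assms]])
    show "integrable (lebesgue_on U) (\<lambda>x. f x \<bullet> f x)" by (rule L2_inner_integrable[OF assms assms])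
    show "f x $ i \<bullet> f x $ i \<le> f x \<bullet> f x" for x
      unfolding inner_vec_def by (rule member_le_sum[of i UNIV "\<lambda>i. f x $ i \<bullet> f x $ i"]) auto
  qed
  then show ?thesis by (simp add: L2_norm_def)
qed

lemma classical_grad_in_L2:
  assumes "smooth \<phi>" "bounded U" "U \<in> sets lebesgue" shows "classical_grad \<phi> \<in> L2_space U"
proof (rule continuous_in_L2_space[OF _ assms(2,3)])
  show "continuous_on UNIV (classical_grad \<phi>)"
    unfolding classical_grad_def[abs_def]
    using smooth_continuous_on smooth_partial_deriv assms(1) by (intro continuous_on_vec_lambda) blast
qed

text \<open>The weak gradient of the constant function 1 is zero.\<close>

lemma test_function_integral_partial_deriv:
  assumes "bounded U" "U \<in> sets lebesgue" "test_function U \<phi>"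
  shows "(LINT x|lebesgue_on U. partial_deriv i \<phi> x) = 0"
  using affine_has_weak_grad[OF assms(1,2), of 0 1] assms(3) by (simp add: has_weak_grad_def)

lemma H10_space_H1: "u \<in> H10_space U \<Longrightarrow> u \<in> H1_space U"
  by (simp add: H10_space_def)

text \<open>Substitute for a vanishing trace. For approximating test functions on \<open>U\<close>
  the integration by parts has no boundary term, even against \<open>\<psi>\<close> supported across
  the boundary of \<open>U\<close>, and both sides pass to the L2 limit.\<close>

lemma H10_has_weak_grad_zero_extension:
  fixes U V :: "(real ^ 'n) set"
  assumes U: "open U" "bounded U" and V: "V \<in> lmeasurable" and v: "v \<in> H10_space U"
  shows "has_weak_grad V (\<lambda>x. if x \<in> U then v x else 0) (\<lambda>x. if x \<in> U then weak_grad U v x else 0)"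
  unfolding has_weak_grad_iff
proof (intro allI impI)
  have Um: "U \<in> lmeasurable" "U \<in> sets lebesgue" using U bounded_open_lmeasurable by (auto simp: fmeasurableD)
  let ?G = "weak_grad U v"
  obtain \<phi> where \<phi>: "\<And>k::nat. test_function U (\<phi> k)"
      "(\<lambda>k. L2_norm U (\<lambda>x. \<phi> k x - v x)) \<longlonglongrightarrow> 0"
      "(\<lambda>k. L2_norm U (\<lambda>x. classical_grad (\<phi> k) x - ?G x)) \<longlonglongrightarrow> 0"
    using v by (auto simp: H10_space_def)
  have vL: "v \<in> L2_space U" "?G \<in> L2_space U" using H10_space_H1[OF v] H1_space_L2 weak_grad_in_L2_space by blast+
  have \<phi>L: "\<phi> k \<in> L2_space U" "classical_grad (\<phi> k) \<in> L2_space U" for k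
    using test_function_in_L2_space[OF \<phi>(1) Um(1)] classical_grad_in_L2[OF test_function_smooth[OF \<phi>(1)] U(2) Um(2)] by auto
  fix \<psi> i assume \<psi>: "test_function V \<psi>"
  have t\<psi>: "test_function V (partial_deriv i \<psi>)" using \<psi> by (rule test_function_partial_deriv)
  have \<psi>L: "\<psi> \<in> L2_space U" "partial_deriv i \<psi> \<in> L2_space U"
    using \<psi> t\<psi> Um(1) test_function_in_L2_space by blast+
  \<comment> \<open>The product of \<open>\<psi>\<close> and \<open>\<phi> k\<close> is a test
    function on \<open>U\<close>, and the integral of its partial derivative is zero.\<close>
  have parts: "L2_inner U (\<phi> k) (partial_deriv i \<psi>) = - L2_inner U (\<lambda>x. classical_grad (\<phi> k) x $ i) \<psi>" for k
  proof -
    have dL: "(\<lambda>x. classical_grad (\<phi> k) x $ i) \<in> L2_space U" by (rule L2_space_nth[OF \<phi>L(2)])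
    have "test_function U (\<lambda>x. \<psi> x * \<phi> k x)"
      by (rule test_function_smooth_mult[OF test_function_smooth[OF \<psi>] \<phi>(1)])
    then have "0 = (LINT x|lebesgue_on U. partial_deriv i (\<lambda>x. \<psi> x * \<phi> k x) x)"
      using test_function_integral_partial_deriv[OF U(2) Um(2)] by metis
    also have "\<dots> = (LINT x|lebesgue_on U. classical_grad (\<phi> k) x $ i * \<psi> x + \<phi> k x * partial_deriv i \<psi> x)"
      using test_function_smooth[OF \<psi>] test_function_smooth[OF \<phi>(1)]
      by (simp add: partial_deriv_mult classical_grad_def mult_ac)
    also have "\<dots> = L2_inner U (\<lambda>x. classical_grad (\<phi> k) x $ i) \<psi> + L2_inner U (\<phi> k) (partial_deriv i \<psi>)"
      using L2_space_mult_integrable[OF dL \<psi>L(1)] L2_space_mult_integrable[OF \<phi>L(1) \<psi>L(2)]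
      by (simp add: L2_inner_def)
    finally show ?thesis by simp
  qed
  have "(\<lambda>k. L2_inner U (\<phi> k) (partial_deriv i \<psi>)) \<longlonglongrightarrow> L2_inner U v (partial_deriv i \<psi>)"
    by (rule L2_inner_tendsto[OF \<phi>L(1) vL(1) \<psi>L(2) \<phi>(2)])
  moreover have "(\<lambda>k. - L2_inner U (\<lambda>x. classical_grad (\<phi> k) x $ i) \<psi>) \<longlonglongrightarrow> - L2_inner U (\<lambda>x. ?G x $ i) \<psi>"
  proof (intro tendsto_minus L2_inner_tendsto L2_space_nth \<phi>L vL \<psi>L)
    show "(\<lambda>k. L2_norm U (\<lambda>x. classical_grad (\<phi> k) x $ i - ?G x $ i)) \<longlonglongrightarrow> 0"
    proof (rule Lim_null_comparison[OF _ \<phi>(3)])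
      show "\<forall>\<^sub>F k in sequentially. norm (L2_norm U (\<lambda>x. classical_grad (\<phi> k) x $ i - ?G x $ i)) \<le> L2_norm U (\<lambda>x. classical_grad (\<phi> k) x - ?G x)"
        using L2_norm_nth_le[OF L2_space_diff[OF \<phi>L(2) vL(2)], of _ i] by (intro always_eventually) simp
    qed
  qed
  ultimately have eq: "L2_inner U v (partial_deriv i \<psi>) = - L2_inner U (\<lambda>x. ?G x $ i) \<psi>"
    unfolding parts by (rule LIMSEQ_unique)
  have V': "V \<in> sets lebesgue" "V \<inter> U \<in> sets lebesgue" using V Um(2) by (auto simp: fmeasurableD)
  have ext: "L2_inner V (\<lambda>x. if x \<in> U then f x else 0) g = L2_inner U f g"
    if "\<And>x. x \<notin> V \<Longrightarrow> g x = 0" for f g :: "real ^ 'n \<Rightarrow> real"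
  proof -
    have "L2_inner V (\<lambda>x. if x \<in> U then f x else 0) g = L2_inner (V \<inter> U) (\<lambda>x. if x \<in> U then f x else 0) g"
      by (rule L2_inner_support[OF _ V']) auto
    also have "\<dots> = L2_inner (V \<inter> U) f g" unfolding L2_inner_def by (intro Bochner_Integration.integral_cong) auto
    also have "\<dots> = L2_inner U f g" by (rule L2_inner_support[symmetric, OF _ Um(2) V'(2)]) (use that in auto)
    finally show ?thesis .
  qed
  have nth: "(\<lambda>x. (if x \<in> U then ?G x else 0) $ i) = (\<lambda>x. if x \<in> U then ?G x $ i else 0)" by auto
  show "L2_inner V (\<lambda>x. if x \<in> U then v x else 0) (partial_deriv i \<psi>) = - L2_inner V (\<lambda>x. (if x \<in> U then ?G x else 0) $ i) \<psi>"
    unfolding nth using eq ext[of "partial_deriv i \<psi>" v] ext[of \<psi> "\<lambda>x. ?G x $ i"]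
      test_function_outside[OF \<psi>] test_function_outside[OF t\<psi>] by simp
qed

lemma H10_function_space:
  fixes U :: "(real ^ 'n) set"
  assumes U: "open U" "bounded U" shows "function_space (H10_space U)"
proof -
  have Um: "U \<in> lmeasurable" "U \<in> sets lebesgue" using U bounded_open_lmeasurable by (auto simp: fmeasurableD)
  have gradL: "classical_grad \<phi> \<in> L2_space U" if "test_function U \<phi>" for \<phi>
    using classical_grad_in_L2[OF test_function_smooth[OF that] U(2) Um(2)] .
  note L = test_function_in_L2_space[OF _ Um(1)]
  show ?thesis
    unfolding function_space_def
  proof (intro conjI ballI allI)
    have "has_weak_grad U (\<lambda>x. 0) (\<lambda>x. 0)" by (simp add: has_weak_grad_def)
    then have z: "(\<lambda>x. 0) \<in> H1_space U" "AE x in lebesgue_on U. weak_grad U (\<lambda>x. 0) x = 0"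
      using H1_spaceI[of "\<lambda>x. 0" U "\<lambda>x. 0"] weak_grad_eqI[OF U(1) Um(1), of "\<lambda>x. 0" "\<lambda>x. 0"] by auto
    have "classical_grad (\<lambda>x::real ^ 'n. 0) = (\<lambda>x. 0)" by (simp add: classical_grad_def partial_deriv_def fun_eq_iff vec_eq_iff)
    then have "L2_norm U (\<lambda>x. classical_grad (\<lambda>x. 0) x - weak_grad U (\<lambda>x. 0) x) = 0"
      using z weak_grad_in_L2_space[OF z(1)] by (subst L2_norm_eq_0_iff) (auto intro: L2_space_uminus)
    moreover have "L2_norm U (\<lambda>x. 0 :: real) = 0" by (simp add: L2_norm_def)
    ultimately show "(\<lambda>x. 0) \<in> H10_space U"
      unfolding H10_space_def using z(1) by (intro CollectI conjI exI[of _ "\<lambda>k x. 0"]) simp_all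
  next
    fix u v assume uv: "u \<in> H10_space U" "v \<in> H10_space U"
    note u1 = H10_space_H1[OF uv(1)] and v1 = H10_space_H1[OF uv(2)]
    obtain \<phi> where \<phi>: "\<And>k::nat. test_function U (\<phi> k)" "(\<lambda>k. L2_norm U (\<lambda>x. \<phi> k x - u x)) \<longlonglongrightarrow> 0"
        "(\<lambda>k. L2_norm U (\<lambda>x. classical_grad (\<phi> k) x - weak_grad U u x)) \<longlonglongrightarrow> 0"
      using uv(1) by (auto simp: H10_space_def)
    obtain \<psi> where \<psi>: "\<And>k::nat. test_function U (\<psi> k)" "(\<lambda>k. L2_norm U (\<lambda>x. \<psi> k x - v x)) \<longlonglongrightarrow> 0"
        "(\<lambda>k. L2_norm U (\<lambda>x. classical_grad (\<psi> k) x - weak_grad U v x)) \<longlonglongrightarrow> 0"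
      using uv(2) by (auto simp: H10_space_def)
    note uvL = H1_space_L2[OF u1] H1_space_L2[OF v1] weak_grad_in_L2_space[OF u1] weak_grad_in_L2_space[OF v1]
    note sum = weak_grad_add[OF U(1) Um(1) u1 v1]
    show "(\<lambda>x. u x + v x) \<in> H10_space U"
      unfolding H10_space_def
    proof (intro CollectI conjI exI[of _ "\<lambda>k x. \<phi> k x + \<psi> k x"] allI sum(1) test_function_add \<phi>(1) \<psi>(1))
      show "(\<lambda>k. L2_norm U (\<lambda>x. \<phi> k x + \<psi> k x - (u x + v x))) \<longlonglongrightarrow> 0"
      proof (rule Lim_null_comparison[OF _ tendsto_add_zero[OF \<phi>(2) \<psi>(2)]], intro always_eventually allI)
        fix k
        have "L2_norm U (\<lambda>x. (\<phi> k x - u x) + (\<psi> k x - v x)) \<le> L2_norm U (\<lambda>x. \<phi> k x - u x) + L2_norm U (\<lambda>x. \<psi> k x - v x)"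
          by (intro L2_norm_triangle L2_space_diff uvL L[OF \<phi>(1)] L[OF \<psi>(1)])
        then show "norm (L2_norm U (\<lambda>x. \<phi> k x + \<psi> k x - (u x + v x))) \<le> L2_norm U (\<lambda>x. \<phi> k x - u x) + L2_norm U (\<lambda>x. \<psi> k x - v x)"
          by (simp add: algebra_simps)
      qed
      show "(\<lambda>k. L2_norm U (\<lambda>x. classical_grad (\<lambda>x. \<phi> k x + \<psi> k x) x - weak_grad U (\<lambda>x. u x + v x) x)) \<longlonglongrightarrow> 0"
      proof (rule Lim_null_comparison[OF _ tendsto_add_zero[OF \<phi>(3) \<psi>(3)]], intro always_eventually allI)
        fix k
        have g: "classical_grad (\<lambda>x. \<phi> k x + \<psi> k x) x = classical_grad (\<phi> k) x + classical_grad (\<psi> k) x" for x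
          by (simp add: classical_grad_def vec_eq_iff partial_deriv_add[OF test_function_smooth[OF \<phi>(1)] test_function_smooth[OF \<psi>(1)]])
        have "L2_norm U (\<lambda>x. classical_grad (\<lambda>x. \<phi> k x + \<psi> k x) x - weak_grad U (\<lambda>x. u x + v x) x)
            = L2_norm U (\<lambda>x. (classical_grad (\<phi> k) x - weak_grad U u x) + (classical_grad (\<psi> k) x - weak_grad U v x))"
        proof (rule L2_norm_cong_AE)
          show "AE x in lebesgue_on U. classical_grad (\<lambda>x. \<phi> k x + \<psi> k x) x - weak_grad U (\<lambda>x. u x + v x) x =
              (classical_grad (\<phi> k) x - weak_grad U u x) + (classical_grad (\<psi> k) x - weak_grad U v x)"
            using sum(2) by eventually_elim (simp add: g)
        qed (use weak_grad_in_L2_space[OF sum(1)] in \<open>intro L2_space_add L2_space_diff uvL gradL \<phi>(1) \<psi>(1) test_function_add; simp\<close>)+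
        also have "\<dots> \<le> L2_norm U (\<lambda>x. classical_grad (\<phi> k) x - weak_grad U u x) + L2_norm U (\<lambda>x. classical_grad (\<psi> k) x - weak_grad U v x)"
          by (intro L2_norm_triangle L2_space_diff uvL gradL \<phi>(1) \<psi>(1))
        finally show "norm (L2_norm U (\<lambda>x. classical_grad (\<lambda>x. \<phi> k x + \<psi> k x) x - weak_grad U (\<lambda>x. u x + v x) x))
          \<le> L2_norm U (\<lambda>x. classical_grad (\<phi> k) x - weak_grad U u x) + L2_norm U (\<lambda>x. classical_grad (\<psi> k) x - weak_grad U v x)"
          by simp
      qed
    qed
  next
    fix c v assume v: "v \<in> H10_space U"
    note v1 = H10_space_H1[OF v]
    obtain \<psi> where \<psi>: "\<And>k::nat. test_function U (\<psi> k)" "(\<lambda>k. L2_norm U (\<lambda>x. \<psi> k x - v x)) \<longlonglongrightarrow> 0"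
        "(\<lambda>k. L2_norm U (\<lambda>x. classical_grad (\<psi> k) x - weak_grad U v x)) \<longlonglongrightarrow> 0"
      using v by (auto simp: H10_space_def)
    note sc = weak_grad_scale[OF U(1) Um(1) v1, of c]
    show "(\<lambda>x. c * v x) \<in> H10_space U"
      unfolding H10_space_def
    proof (intro CollectI conjI exI[of _ "\<lambda>k x. c * \<psi> k x"] allI sc(1) test_function_scale \<psi>(1))
      show "(\<lambda>k. L2_norm U (\<lambda>x. c * \<psi> k x - c * v x)) \<longlonglongrightarrow> 0"
      proof -
        have "(\<lambda>k. \<bar>c\<bar> * L2_norm U (\<lambda>x. \<psi> k x - v x)) \<longlonglongrightarrow> \<bar>c\<bar> * 0" by (intro tendsto_intros \<psi>)
        then show ?thesis by (simp flip: L2_norm_mult right_diff_distrib)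
      qed
      show "(\<lambda>k. L2_norm U (\<lambda>x. classical_grad (\<lambda>x. c * \<psi> k x) x - weak_grad U (\<lambda>x. c * v x) x)) \<longlonglongrightarrow> 0"
      proof -
        have "L2_norm U (\<lambda>x. classical_grad (\<lambda>x. c * \<psi> k x) x - weak_grad U (\<lambda>x. c * v x) x) = \<bar>c\<bar> * L2_norm U (\<lambda>x. classical_grad (\<psi> k) x - weak_grad U v x)" for k
        proof -
          have "partial_deriv i (\<lambda>x. c * \<psi> k x) = (\<lambda>x. c * partial_deriv i (\<psi> k) x)" for i
            using partial_deriv_mult[OF smooth_const test_function_smooth[OF \<psi>(1)], of i c]
            by (simp add: fun_eq_iff partial_deriv_def)
          then have g: "classical_grad (\<lambda>x. c * \<psi> k x) x = c *\<^sub>R classical_grad (\<psi> k) x" for x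
            by (simp add: classical_grad_def vec_eq_iff)
          have "L2_norm U (\<lambda>x. classical_grad (\<lambda>x. c * \<psi> k x) x - weak_grad U (\<lambda>x. c * v x) x) = L2_norm U (\<lambda>x. c *\<^sub>R (classical_grad (\<psi> k) x - weak_grad U v x))"
          proof (rule L2_norm_cong_AE)
            show "AE x in lebesgue_on U. classical_grad (\<lambda>x. c * \<psi> k x) x - weak_grad U (\<lambda>x. c * v x) x = c *\<^sub>R (classical_grad (\<psi> k) x - weak_grad U v x)"
              using sc(2) by eventually_elim (simp add: g scaleR_diff_right)
            show "(\<lambda>x. classical_grad (\<lambda>x. c * \<psi> k x) x - weak_grad U (\<lambda>x. c * v x) x) \<in> L2_space U"
              by (intro L2_space_diff gradL test_function_scale \<psi>(1) weak_grad_in_L2_space[OF sc(1)])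
            show "(\<lambda>x. c *\<^sub>R (classical_grad (\<psi> k) x - weak_grad U v x)) \<in> L2_space U"
              by (intro L2_space_scaleR L2_space_diff gradL \<psi>(1) weak_grad_in_L2_space[OF v1])
          qed
          then show ?thesis by (simp add: L2_norm_scaleR)
        qed
        moreover have "(\<lambda>k. \<bar>c\<bar> * L2_norm U (\<lambda>x. classical_grad (\<psi> k) x - weak_grad U v x)) \<longlonglongrightarrow> \<bar>c\<bar> * 0" by (intro tendsto_intros \<psi>)
        ultimately show ?thesis by simp
      qed
    qed
  qed
qed

context mesh
begin

lemma broken_grad_H1:
  assumes "v \<in> H1_space \<Omega>"
  shows "AE x in lebesgue_on \<Omega>. broken_grad \<T> v x = weak_grad \<Omega> v x"
proof (rule broken_grad_eqI[OF _ weak_grad_in_L2_space[OF assms]])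
  show "v \<in> L2_space (interior T)" if "T \<in> \<T>" for T
    by (rule L2_space_subset[OF H1_space_L2[OF assms] interior_element_subset[OF that] domain_sets interior_sets])
  show "has_weak_grad (interior T) v (weak_grad \<Omega> v)" if "T \<in> \<T>" for T
    by (rule has_weak_grad_subset[OF has_weak_grad_weak_grad[OF assms] interior_element_subset[OF that] domain_sets interior_sets])
qed

text \<open>Subtracting the affine piece of \<open>T'\<close>, which has a weak gradient on the
  whole ball, leaves a weakly differentiable function that is zero on the side of \<open>T'\<close>
  and equals the difference of the two pieces on the side of \<open>T\<close>. This is the situation
  of \<open>jump_vanishes\<close>.\<close>

lemma conforming_shared_facet:
  assumes v: "v \<in> H1_space \<Omega>" "affine_pieces v a b"
    and T: "T \<in> \<T>" "T' \<in> \<T>" "T \<noteq> T'" "F facet_of T" "F facet_of T'" and z: "z \<in> rel_interior F"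
  shows "(a T - a T') \<bullet> z + (b T - b T') = 0"
proof -
  obtain n c \<epsilon> where n: "norm n = 1" "affine hull F = {x. n \<bullet> x = c}" "\<epsilon> > 0"
    "\<And>x. x \<in> ball z \<epsilon> \<Longrightarrow> (x \<in> T \<longleftrightarrow> n \<bullet> x \<le> c) \<and> (x \<in> T' \<longleftrightarrow> c \<le> n \<bullet> x)"
    using interior_facet_local[OF T z] by metis
  let ?B = "ball z \<epsilon>"
  have nz: "n \<bullet> z = c" using z rel_interior_subset hull_subset[of F affine] n(2) by blast
  have "?B \<subseteq> closure \<Omega>" using n(4) element_subset T(1,2) by (meson linear subsetD subsetI)
  then have B: "?B \<subseteq> \<Omega>" using interior_maximal[of ?B "closure \<Omega>"] interior_closure_domain by auto
  have inT: "v x = a T \<bullet> x + b T" if "x \<in> ?B" "n \<bullet> x < c" for x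
  proof -
    have "?B \<inter> {x. n \<bullet> x < c} \<subseteq> interior T"
      using n(4) by (intro interior_maximal open_Int open_ball open_halfspace_lt) (auto simp: less_imp_le)
    then show ?thesis using that affine_piecesD[OF v(2) T(1)] by blast
  qed
  have inT': "v x = a T' \<bullet> x + b T'" if "x \<in> ?B" "c < n \<bullet> x" for x
  proof -
    have "?B \<inter> {x. c < n \<bullet> x} \<subseteq> interior T'"
      using n(4) by (intro interior_maximal open_Int open_ball open_halfspace_gt) (auto simp: less_imp_le)
    then show ?thesis using that affine_piecesD[OF v(2) T(2)] by blast
  qed
  let ?\<alpha> = "\<lambda>x. a T' \<bullet> x + b T'" and ?G = "weak_grad \<Omega> v"
  have Bm: "?B \<in> lmeasurable" "?B \<in> sets lebesgue" by auto
  have vL: "v \<in> L2_space ?B" "?G \<in> L2_space ?B"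
    using H1_space_L2[OF v(1)] weak_grad_in_L2_space[OF v(1)] B domain_sets Bm(2) by (auto intro: L2_space_subset)
  have wv: "has_weak_grad ?B v ?G"
    by (rule has_weak_grad_subset[OF has_weak_grad_weak_grad[OF v(1)] B domain_sets Bm(2)])
  have \<alpha>L: "?\<alpha> \<in> L2_space ?B" by (intro continuous_in_L2_space continuous_intros) auto
  have w\<alpha>: "has_weak_grad ?B ?\<alpha> (\<lambda>x. a T')" by (rule affine_has_weak_grad) auto
  have cL: "(\<lambda>x. a T') \<in> L2_space ?B" by (rule const_in_L2_space[OF Bm(1)])
  let ?G' = "\<lambda>x. ?G x + (-1) *\<^sub>R a T'"
  have G'L: "?G' \<in> L2_space ?B" by (intro L2_space_add L2_space_scaleR vL cL)
  have "has_weak_grad ?B (\<lambda>x. v x + (-1) * ?\<alpha> x) ?G'"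
    by (rule has_weak_grad_add[OF Bm(1) vL wv L2_space_mult[OF \<alpha>L] L2_space_scaleR[OF cL] has_weak_grad_scale[OF w\<alpha>]])
  then have "has_weak_grad ?B (\<lambda>x. if n \<bullet> x \<le> c then (a T - a T') \<bullet> x + (b T - b T') else 0) ?G'"
  proof (rule has_weak_grad_cong_AE[OF Bm(1) _ L2_space_add[OF vL(1) L2_space_mult[OF \<alpha>L]] G'L])
    have "n \<noteq> 0" using n(1) by auto
    then have "{x. n \<bullet> x = c} \<in> null_sets lebesgue" using negligible_hyperplane negligible_iff_null_sets by blast
    then have "AE x in lebesgue. n \<bullet> x \<noteq> c" using AE_not_in by fastforce
    then have "AE x in lebesgue_on ?B. n \<bullet> x \<noteq> c" by (subst AE_restrict_space_iff) auto
    with AE_space show "AE x in lebesgue_on ?B. v x + (-1) * ?\<alpha> x = (if n \<bullet> x \<le> c then (a T - a T') \<bullet> x + (b T - b T') else 0)"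
    proof eventually_elim
      case (elim x)
      then have "x \<in> ?B" by simp
      then show ?case using elim(2) inT[of x] inT'[of x] by (auto simp: inner_diff_left)
    qed
  qed simp
  then show ?thesis by (rule jump_vanishes[OF n(1) nz n(3) G'L])
qed

text \<open>After extension by zero the boundary value becomes a jump across the facet, and the
  extension is weakly differentiable in a full ball.\<close>

lemma conforming_boundary_facet:
  assumes v: "v \<in> H10_space \<Omega>" "affine_pieces v a b"
    and T: "T \<in> \<T>" "F facet_of T" "F \<subseteq> frontier \<Omega>" and z: "z \<in> rel_interior F"
  shows "a T \<bullet> z + b T = 0"
proof -
  have "z \<notin> T'" if "T' \<in> \<T>" "T' \<noteq> T" for T'
    using boundary_facet_not_shared[OF T(1) that(1) _ T(2,3) z] that(2) by blast
  then obtain n c \<epsilon> where n: "norm n = 1" "affine hull F = {x. n \<bullet> x = c}" "\<epsilon> > 0"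
    "\<And>x. x \<in> ball z \<epsilon> \<Longrightarrow> (x \<in> T \<longleftrightarrow> n \<bullet> x \<le> c) \<and> (x \<in> \<Omega> \<longleftrightarrow> n \<bullet> x < c)"
    using boundary_facet_local[OF T(1,2) z] by metis
  let ?B = "ball z \<epsilon>"
  have nz: "n \<bullet> z = c" using z rel_interior_subset hull_subset[of F affine] n(2) by blast
  have inT: "v x = a T \<bullet> x + b T" if "x \<in> ?B" "n \<bullet> x < c" for x
  proof -
    have "?B \<inter> {x. n \<bullet> x < c} \<subseteq> interior T"
      using n(4) by (intro interior_maximal open_Int open_ball open_halfspace_lt) (auto simp: less_imp_le)
    then show ?thesis using that affine_piecesD[OF v(2) T(1)] by blast
  qed
  have Bm: "?B \<in> lmeasurable" by auto
  let ?v = "\<lambda>x. if x \<in> \<Omega> then v x else 0" and ?G = "\<lambda>x. if x \<in> \<Omega> then weak_grad \<Omega> v x else 0"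
  have L: "?v \<in> L2_space ?B" "?G \<in> L2_space ?B"
    using H10_space_H1[OF v(1)] H1_space_L2 weak_grad_in_L2_space domain_sets by (auto intro!: L2_space_zero_extend)
  have "has_weak_grad ?B ?v ?G"
    by (rule H10_has_weak_grad_zero_extension[OF open_domain bounded_domain Bm v(1)])
  then have "has_weak_grad ?B (\<lambda>x. if n \<bullet> x \<le> c then a T \<bullet> x + b T else 0) ?G"
  proof (rule has_weak_grad_cong_AE[OF Bm _ L])
    have "n \<noteq> 0" using n(1) by auto
    then have "{x. n \<bullet> x = c} \<in> null_sets lebesgue" using negligible_hyperplane negligible_iff_null_sets by blast
    then have "AE x in lebesgue. n \<bullet> x \<noteq> c" using AE_not_in by fastforce
    then have "AE x in lebesgue_on ?B. n \<bullet> x \<noteq> c" by (subst AE_restrict_space_iff) auto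
    with AE_space show "AE x in lebesgue_on ?B. ?v x = (if n \<bullet> x \<le> c then a T \<bullet> x + b T else 0)"
    proof eventually_elim
      case (elim x)
      then have "x \<in> ?B" by simp
      then show ?case using elim(2) inT[of x] n(4)[of x] by auto
    qed
  qed simp
  then show ?thesis by (rule jump_vanishes[OF n(1) nz n(3) L(2)])
qed

text \<open>The relative interior, where values are known, is dense in the facet, and the zero set
  of an affine function is closed.\<close>

lemma affine_zero_on_face:
  assumes "T \<in> \<T>" "F facet_of T" "\<And>z. z \<in> rel_interior F \<Longrightarrow> a \<bullet> z + b = (0::real)"
  shows "face_integral F (\<lambda>x. a \<bullet> x + b) = 0"
proof -
  interpret flat_face F using facet_flat_face assms by blast
  have "closed {x. a \<bullet> x + b = 0}" by (intro closed_Collect_eq continuous_intros)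
  moreover have "rel_interior F \<subseteq> {x. a \<bullet> x + b = 0}" using assms(3) by blast
  ultimately have "closure (rel_interior F) \<subseteq> {x. a \<bullet> x + b = 0}" by (rule closure_minimal[rotated])
  then have "F \<subseteq> {x. a \<bullet> x + b = 0}"
    using convex_closure_rel_interior[OF convex_face] closure_subset[of F] by auto
  then have "face_integral F (\<lambda>x. a \<bullet> x + b) = face_integral F (\<lambda>x. 0)" by (intro face_integral_cong) auto
  then show ?thesis by (simp add: face_integral_def)
qed

lemma conforming_subset_CR: "conforming_space \<Omega> \<T> \<subseteq> CR_space \<Omega> \<T>"
proof
  fix v assume "v \<in> conforming_space \<Omega> \<T>"
  then have v: "v \<in> H10_space \<Omega>" "v \<in> P1_space \<T>" by (auto simp: conforming_space_def)
  obtain a b where ab: "affine_pieces v a b" using v(2) by (rule P1_spaceE)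
  show "v \<in> CR_space \<Omega> \<T>"
    unfolding CR_space_iff[OF ab]
  proof (intro conjI ballI allI impI v(2))
    fix T T' F assume T: "T \<in> \<T>" "T' \<in> \<T>" "T \<noteq> T' \<and> F facet_of T \<and> F facet_of T'"
    then show "face_integral F (\<lambda>x. (a T - a T') \<bullet> x + (b T - b T')) = 0"
      using conforming_shared_facet[OF H10_space_H1[OF v(1)] ab T(1,2)] by (intro affine_zero_on_face[OF T(1)]) auto
  next
    fix T F assume T: "T \<in> \<T>" "F facet_of T \<and> F \<subseteq> frontier \<Omega>"
    then show "face_integral F (\<lambda>x. a T \<bullet> x + b T) = 0"
      using conforming_boundary_facet[OF v(1) ab T(1)] by (intro affine_zero_on_face[OF T(1)]) auto
  qed
qed

lemma conforming_function_space: "function_space (conforming_space \<Omega> \<T>)"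
  using H10_function_space[OF open_domain bounded_domain] P1_function_space
  by (simp add: conforming_space_def function_space_def)

lemma broken_grad_conforming:
  "v \<in> conforming_space \<Omega> \<T> \<Longrightarrow> AE x in lebesgue_on \<Omega>. broken_grad \<T> v x = weak_grad \<Omega> v x"
  by (rule broken_grad_H1) (auto simp: conforming_space_def H10_space_H1)

end

section \<open>Finite-dimensional function spaces\<close>

definition linear_on :: "('a \<Rightarrow> real) set \<Rightarrow> (('a \<Rightarrow> real) \<Rightarrow> real) \<Rightarrow> bool" where
  "linear_on V L \<longleftrightarrow> (\<forall>u\<in>V. \<forall>v\<in>V. L (\<lambda>x. u x + v x) = L u + L v) \<and> (\<forall>c. \<forall>v\<in>V. L (\<lambda>x. c * v x) = c * L v)"

lemma linear_on_add: "linear_on V L \<Longrightarrow> u \<in> V \<Longrightarrow> v \<in> V \<Longrightarrow> L (\<lambda>x. u x + v x) = L u + L v"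
  and linear_on_mult: "linear_on V L \<Longrightarrow> v \<in> V \<Longrightarrow> L (\<lambda>x. c * v x) = c * L v"
  by (simp_all add: linear_on_def)

lemma linear_on_subset: "linear_on V L \<Longrightarrow> W \<subseteq> V \<Longrightarrow> linear_on W L"
  by (simp add: linear_on_def subset_eq)

lemma linear_on_zero:
  assumes "linear_on V L" "function_space V" shows "L (\<lambda>x. 0) = 0"
  using linear_on_mult[OF assms(1) function_space_zero[OF assms(2)], of 0] by simp

text \<open>Definiteness concludes equality with the zero function itself; the discrete spaces
  satisfy this because their members vanish off the open elements.\<close>

locale inner_product_on =
  fixes V :: "('a \<Rightarrow> real) set" and A :: "('a \<Rightarrow> real) \<Rightarrow> ('a \<Rightarrow> real) \<Rightarrow> real"
  assumes function_space: "function_space V"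
    and linear: "w \<in> V \<Longrightarrow> linear_on V (\<lambda>v. A v w)"
    and symmetric: "v \<in> V \<Longrightarrow> w \<in> V \<Longrightarrow> A v w = A w v"
    and nonneg: "v \<in> V \<Longrightarrow> A v v \<ge> 0"
    and definite: "v \<in> V \<Longrightarrow> A v v = 0 \<Longrightarrow> v = (\<lambda>x. 0)"
begin

lemma linear_right: "w \<in> V \<Longrightarrow> linear_on V (A w)"
  using linear[of w] symmetric function_space_add[OF function_space] function_space_mult[OF function_space]
  by (simp add: linear_on_def)

lemma inner_product_on_subspace:
  assumes "function_space W" "W \<subseteq> V" shows "inner_product_on W A"
proof
  show "linear_on W (\<lambda>v. A v w)" if "w \<in> W" for w
    using linear_on_subset[OF linear assms(2)] that assms(2) by blast
  fix v assume v: "v \<in> W"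
  then have vV: "v \<in> V" using assms(2) by blast
  show "A v w = A w v" if "w \<in> W" for w using symmetric[OF vV] that assms(2) by blast
  show "A v v \<ge> 0" by (rule nonneg[OF vV])
  show "v = (\<lambda>x. 0)" if "A v v = 0" by (rule definite[OF vV that])
qed (rule assms(1))

lemma vanishing_at_point: "function_space {v \<in> V. v s = 0}"
  using function_space by (auto simp: function_space_def)

end

text \<open>
  Finite dimension is expressed by a finite set of points at which evaluation is injective, so that
  induction on the number of points replaces bases.
\<close>

lemma riesz_representation:
  assumes "finite S" "inner_product_on V A" "\<And>v. v \<in> V \<Longrightarrow> (\<And>s. s \<in> S \<Longrightarrow> v s = 0) \<Longrightarrow> v = (\<lambda>x. 0)" "linear_on V L"
  shows "\<exists>u\<in>V. \<forall>v\<in>V. A u v = L v"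
  using assms
proof (induction S arbitrary: V L rule: finite_induct)
  case empty
  interpret inner_product_on V A by fact
  have V: "v = (\<lambda>x. 0)" if "v \<in> V" for v using empty.prems(2)[OF that] by simp
  have z: "(\<lambda>x. 0) \<in> V" by (rule function_space_zero[OF function_space])
  show ?case
    using linear_on_zero[OF empty.prems(3) function_space] linear_on_zero[OF linear_right[OF z] function_space] V
    by (intro bexI[OF _ z]) metis
next
  case (insert s S)
  interpret inner_product_on V A by fact
  let ?V' = "{v \<in> V. v s = 0}"
  have sub: "?V' \<subseteq> V" by auto
  have ip': "inner_product_on ?V' A" by (rule inner_product_on_subspace[OF vanishing_at_point sub])
  have sep': "v = (\<lambda>x. 0)" if "v \<in> ?V'" "\<And>s'. s' \<in> S \<Longrightarrow> v s' = 0" for v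
    using insert.prems(2)[of v] that by auto
  have IH: "\<exists>u\<in>?V'. \<forall>v\<in>?V'. A u v = L' v" if "linear_on ?V' L'" for L'
    by (rule insert.IH[OF ip' _ that]) (rule sep')
  show ?case
  proof (cases "?V' = V")
    case True
    then show ?thesis using IH[of L] insert.prems(3) by simp
  next
    case False
    then obtain w where w: "w \<in> V" "w s \<noteq> 0" by auto
    obtain p where p: "p \<in> ?V'" "\<And>v. v \<in> ?V' \<Longrightarrow> A p v = A w v"
      using IH[OF linear_on_subset[OF linear_right[OF w(1)] sub]] by auto
    obtain u' where u': "u' \<in> ?V'" "\<And>v. v \<in> ?V' \<Longrightarrow> A u' v = L v"
      using IH[OF linear_on_subset[OF insert.prems(3) sub]] by auto
    \<comment> \<open>One Gram-Schmidt step: \<open>p\<close> is the projection of \<open>w\<close>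
      onto the functions vanishing at \<open>s\<close>, so \<open>e\<close> is orthogonal to them
      and spans a complement.\<close>
    define e where "e = (\<lambda>x. w x + (-1) * p x)"
    have pV: "p \<in> V" "u' \<in> V" using p(1) u'(1) by auto
    note mult = function_space_mult[OF function_space] and add = function_space_add[OF function_space]
    have e: "e \<in> V" "e s \<noteq> 0"
      using w p(1) add[OF w(1) mult[OF pV(1), of "-1"]] by (auto simp: e_def)
    have orth: "A e v = 0" if v: "v \<in> ?V'" for v
    proof -
      have vV: "v \<in> V" using v by simp
      have "A e v = A w v + A (\<lambda>x. (-1) * p x) v"
        unfolding e_def by (rule linear_on_add[OF linear[OF vV] w(1) mult[OF pV(1)]])
      also have "\<dots> = A w v + (-1) * A p v" by (simp only: linear_on_mult[OF linear[OF vV] pV(1)])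
      finally show ?thesis using p(2)[OF v] by simp
    qed
    have Ae: "A e e \<noteq> 0" using definite[OF e(1)] e(2) by auto
    \<comment> \<open>The coefficient for which \<open>u' + k e\<close> also represents
      \<open>L\<close> on \<open>e\<close>, given that \<open>u'\<close> is orthogonal to
      \<open>e\<close>.\<close>
    define k where "k = L e / A e e"
    define u where "u = (\<lambda>x. u' x + k * e x)"
    show ?thesis
    proof
      show uV: "u \<in> V" unfolding u_def by (rule add[OF pV(2) mult[OF e(1)]])
      show "\<forall>v\<in>V. A u v = L v"
      proof
        fix v assume v: "v \<in> V"
        \<comment> \<open>Makes \<open>v - c e\<close> vanish at \<open>s\<close>.\<close>
        define c where "c = v s / e s"
        define v' where "v' = (\<lambda>x. v x + (- c) * e x)"
        have v'V: "v' \<in> V" unfolding v'_def by (rule add[OF v mult[OF e(1)]])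
        have v': "v' \<in> ?V'" using v'V e(2) by (simp add: v'_def c_def)
        have veq: "v = (\<lambda>x. v' x + c * e x)" by (simp add: v'_def)
        have L: "L v = L v' + c * L e"
          using linear_on_add[OF insert.prems(3) v'V mult[OF e(1), of c]] linear_on_mult[OF insert.prems(3) e(1), of c] veq by metis
        have A: "A x v = A x v' + c * A x e" if "x \<in> V" for x
          using linear_on_add[OF linear_right[OF that] v'V mult[OF e(1), of c]] linear_on_mult[OF linear_right[OF that] e(1), of c] veq by metis
        have "A u v = A u' v + k * A e v"
          unfolding u_def
          using linear_on_add[OF linear[OF v] pV(2) mult[OF e(1), of k]] linear_on_mult[OF linear[OF v] e(1), of k] by simp
        also have "\<dots> = L v' + k * c * A e e"
          using A[OF pV(2)] A[OF e(1)] u'(2)[OF v'] orth[OF v'] orth[OF u'(1)] symmetric[OF pV(2) e(1)] by simp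
        also have "\<dots> = L v" using Ae by (simp add: L k_def)
        finally show "A u v = L v" .
      qed
    qed
  qed
qed

text \<open>The same splitting v = v' + c e as for the representation: orthogonality bounds the
  energy of either part by that of \<open>v\<close>, so the constants of the subspace and of the
  line add up. It bounds the quotients whose supremum is \<open>kappa_M\<close>.\<close>

lemma seminorm_bounded_by_inner_product:
  assumes "finite S" "inner_product_on V A" "\<And>v. v \<in> V \<Longrightarrow> (\<And>s. s \<in> S \<Longrightarrow> v s = 0) \<Longrightarrow> v = (\<lambda>x. 0)"
    and "\<And>u v. u \<in> V \<Longrightarrow> v \<in> V \<Longrightarrow> N (\<lambda>x. u x + v x) \<le> N u + N v"
    and "\<And>c v. v \<in> V \<Longrightarrow> N (\<lambda>x. c * v x) = \<bar>c\<bar> * N v"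
  shows "\<exists>C\<ge>0. \<forall>v\<in>V. N v \<le> C * sqrt (A v v)"
  using assms
proof (induction S arbitrary: V rule: finite_induct)
  case empty
  interpret inner_product_on V A by fact
  have z: "(\<lambda>x. 0) \<in> V" by (rule function_space_zero[OF function_space])
  have "N v \<le> 0 * sqrt (A v v)" if "v \<in> V" for v
  proof -
    have "v = (\<lambda>x. 0)" using empty.prems(2)[OF that] by simp
    then show ?thesis using empty.prems(4)[OF z, of 0] by simp
  qed
  then show ?case by blast
next
  case (insert s S)
  interpret inner_product_on V A by fact
  let ?V' = "{v \<in> V. v s = 0}"
  have sub: "?V' \<subseteq> V" by auto
  have ip': "inner_product_on ?V' A" by (rule inner_product_on_subspace[OF vanishing_at_point sub])
  have sep': "v = (\<lambda>x. 0)" if "v \<in> ?V'" "\<And>s'. s' \<in> S \<Longrightarrow> v s' = 0" for v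
    using insert.prems(2)[of v] that by auto
  have "\<exists>C\<ge>0. \<forall>v\<in>?V'. N v \<le> C * sqrt (A v v)"
    by (rule insert.IH[OF ip']) (use insert.prems(3,4) sep' in auto)
  then obtain C where C: "C \<ge> 0" "\<And>v. v \<in> ?V' \<Longrightarrow> N v \<le> C * sqrt (A v v)" by blast
  show ?case
  proof (cases "?V' = V")
    case True
    then show ?thesis using C by auto
  next
    case False
    then obtain w where w: "w \<in> V" "w s \<noteq> 0" by auto
    obtain p where p: "p \<in> ?V'" "\<And>v. v \<in> ?V' \<Longrightarrow> A p v = A w v"
    proof -
      have "\<exists>u\<in>?V'. \<forall>v\<in>?V'. A u v = A w v"
        by (rule riesz_representation[OF insert.hyps(1) ip' _ linear_on_subset[OF linear_right[OF w(1)] sub]]) (rule sep')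
      then show thesis using that by blast
    qed
    define e where "e = (\<lambda>x. w x + (-1) * p x)"
    have pV: "p \<in> V" using p(1) by auto
    note mult = function_space_mult[OF function_space] and add = function_space_add[OF function_space]
    have e: "e \<in> V" "e s \<noteq> 0"
      using w p(1) add[OF w(1) mult[OF pV, of "-1"]] by (auto simp: e_def)
    have orth: "A e v = 0" if v: "v \<in> ?V'" for v
    proof -
      have vV: "v \<in> V" using v by simp
      have "A e v = A w v + A (\<lambda>x. (-1) * p x) v"
        unfolding e_def by (rule linear_on_add[OF linear[OF vV] w(1) mult[OF pV]])
      also have "\<dots> = A w v + (-1) * A p v" by (simp only: linear_on_mult[OF linear[OF vV] pV])
      finally show ?thesis using p(2)[OF v] by simp
    qed
    have Ae: "A e e > 0" using definite[OF e(1)] nonneg[OF e(1)] e(2) by (metis order_le_less)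
    \<comment> \<open>The constant on the line spanned by \<open>e\<close>; the modulus makes it
      nonnegative at sight.\<close>
    define D where "D = \<bar>N e\<bar> / sqrt (A e e)"
    have D: "D \<ge> 0" "D * sqrt (A e e) = \<bar>N e\<bar>" using Ae by (auto simp: D_def)
    have "N v \<le> (C + D) * sqrt (A v v)" if v: "v \<in> V" for v
    proof -
      define c where "c = v s / e s"
      define v' where "v' = (\<lambda>x. v x + (- c) * e x)"
      have v'V: "v' \<in> V" unfolding v'_def by (rule add[OF v mult[OF e(1)]])
      have v': "v' \<in> ?V'" using v'V e(2) by (simp add: v'_def c_def)
      have veq: "v = (\<lambda>x. v' x + c * e x)" by (simp add: v'_def)
      have Al: "A v x = A v' x + c * A e x" if "x \<in> V" for x
        using linear_on_add[OF linear[OF that] v'V mult[OF e(1), of c]] linear_on_mult[OF linear[OF that] e(1), of c] veq by metis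
      have Ar: "A x v = A x v' + c * A x e" if "x \<in> V" for x
        using linear_on_add[OF linear_right[OF that] v'V mult[OF e(1), of c]] linear_on_mult[OF linear_right[OF that] e(1), of c] veq by metis
      have Avv: "A v v = A v' v' + c\<^sup>2 * A e e"
        using Al[OF v] Ar[OF v'V] Ar[OF e(1)] orth[OF v'] symmetric[OF v'V e(1)] by (simp add: power2_eq_square)
      have s1: "sqrt (A v' v') \<le> sqrt (A v v)" using Avv Ae by simp
      have "sqrt (c\<^sup>2 * A e e) \<le> sqrt (A v v)" using Avv nonneg[OF v'V] by simp
      then have s2: "\<bar>c\<bar> * sqrt (A e e) \<le> sqrt (A v v)" by (simp add: real_sqrt_mult)
      have "N v \<le> N v' + N (\<lambda>x. c * e x)"
        using insert.prems(3)[OF v'V mult[OF e(1), of c]] veq by metis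
      also have "N (\<lambda>x. c * e x) = \<bar>c\<bar> * N e" using insert.prems(4)[OF e(1)] .
      also have "N v' + \<bar>c\<bar> * N e \<le> C * sqrt (A v' v') + D * (\<bar>c\<bar> * sqrt (A e e))"
      proof (rule add_mono[OF C(2)[OF v']])
        have "\<bar>c\<bar> * N e \<le> \<bar>c\<bar> * (D * sqrt (A e e))" unfolding D(2) by (intro mult_left_mono) auto
        then show "\<bar>c\<bar> * N e \<le> D * (\<bar>c\<bar> * sqrt (A e e))" by (simp only: mult.left_commute)
      qed
      also have "\<dots> \<le> C * sqrt (A v v) + D * sqrt (A v v)"
        using s1 s2 C(1) D(1) by (intro add_mono mult_left_mono) auto
      finally show ?thesis by (simp add: algebra_simps)
    qed
    then show ?thesis using C(1) D(1) by (intro exI[of _ "C + D"]) auto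
  qed
qed

section \<open>The centroid of a simplex\<close>

text \<open>The vertices other than \<open>v\<close> lie in a hyperplane. It misses
  \<open>v\<close>, since otherwise all vertices would lie in it, against their full dimension; its
  affine equation is then normalised at \<open>v\<close>.\<close>

lemma simplex_barycentric_coordinate:
  fixes C :: "(real ^ 'n) set"
  assumes C: "\<not> affine_dependent C" "card C = CARD('n) + 1" and v: "v \<in> C"
  obtains p q where "p \<bullet> v + q = 1" "\<And>u. u \<in> C \<Longrightarrow> u \<noteq> v \<Longrightarrow> p \<bullet> u + q = 0"
proof -
  have fin: "finite C" using C(1) aff_independent_finite by blast
  have dimC: "aff_dim C = int CARD('n)" using aff_dim_affine_independent[OF C(1)] C(2) by simp
  have indep: "\<not> affine_dependent (C - {v})" using C(1) affine_independent_Diff by blast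
  have "aff_dim (C - {v}) = int CARD('n) - 1"
    using aff_dim_affine_independent[OF indep] C(2) v fin by simp
  then obtain a b where ab: "a \<noteq> 0" "C - {v} \<subseteq> {x. a \<bullet> x = b}"
    using aff_lowdim_subset_hyperplane[of "C - {v}"] by auto
  have "a \<bullet> v \<noteq> b"
  proof
    assume "a \<bullet> v = b"
    then have "C \<subseteq> {x. a \<bullet> x = b}" using ab(2) by blast
    then have "aff_dim C \<le> aff_dim {x. a \<bullet> x = b}" by (rule aff_dim_subset)
    then show False using dimC ab(1) by (simp add: aff_dim_hyperplane)
  qed
  then have k: "a \<bullet> v - b \<noteq> 0" by simp
  show thesis
  proof (rule that[of "a /\<^sub>R (a \<bullet> v - b)" "- b / (a \<bullet> v - b)"])
    have "(a /\<^sub>R (a \<bullet> v - b)) \<bullet> v + - b / (a \<bullet> v - b) = (a \<bullet> v - b) / (a \<bullet> v - b)"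
      unfolding diff_divide_distrib by (simp add: divide_inverse mult.commute)
    then show "(a /\<^sub>R (a \<bullet> v - b)) \<bullet> v + - b / (a \<bullet> v - b) = 1" using k by simp
    show "(a /\<^sub>R (a \<bullet> v - b)) \<bullet> u + - b / (a \<bullet> v - b) = 0" if "u \<in> C" "u \<noteq> v" for u
      using that ab(2) by (auto simp: divide_inverse)
  qed
qed

lemma convex_combination_coordinate:
  fixes p :: "'a::euclidean_space"
  assumes "finite C" "v \<in> C" "p \<bullet> v + q = 1" "\<And>u. u \<in> C \<Longrightarrow> u \<noteq> v \<Longrightarrow> p \<bullet> u + q = 0" "sum \<xi> C = 1"
  shows "p \<bullet> (\<Sum>u\<in>C. \<xi> u *\<^sub>R u) + q = \<xi> v"
proof -
  have "p \<bullet> (\<Sum>u\<in>C. \<xi> u *\<^sub>R u) + q = (\<Sum>u\<in>C. \<xi> u * (p \<bullet> u)) + (\<Sum>u\<in>C. \<xi> u) * q"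
    using assms(5) by (simp add: inner_sum_right)
  also have "\<dots> = (\<Sum>u\<in>C. \<xi> u * (p \<bullet> u + q))"
    by (simp add: sum_distrib_right distrib_left sum.distrib)
  also have "\<dots> = (\<Sum>u\<in>C. if u = v then \<xi> u else 0)"
    using assms(3,4) by (intro sum.cong) auto
  finally show ?thesis using assms(1,2) by simp
qed

lemma card_multiples_below:
  fixes s :: real
  assumes "0 \<le> s" "s \<le> real N"
  shows "real (card {k \<in> {1..<N}. real k \<le> s}) \<le> s" "s - 1 \<le> real (card {k \<in> {1..<N}. real k \<le> s})"
proof -
  have "{k \<in> {1..<N}. real k \<le> s} \<subseteq> {1..nat \<lfloor>s\<rfloor>}" by (auto simp: le_nat_floor)
  from card_mono[OF finite_atLeastAtMost this]
  have "card {k \<in> {1..<N}. real k \<le> s} \<le> nat \<lfloor>s\<rfloor>" by simp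
  then show "real (card {k \<in> {1..<N}. real k \<le> s}) \<le> s" using assms(1) by linarith
  \<comment> \<open>The cap \<open>N - 1\<close> only matters when \<open>s\<close> reaches
    \<open>N\<close>, where the count falls short of \<open>s\<close> by exactly 1.\<close>
  have "{1..min (nat \<lfloor>s\<rfloor>) (N - 1)} \<subseteq> {k \<in> {1..<N}. real k \<le> s}"
  proof
    fix k assume "k \<in> {1..min (nat \<lfloor>s\<rfloor>) (N - 1)}"
    then have k: "1 \<le> k" "k \<le> nat \<lfloor>s\<rfloor>" "k \<le> N - 1" by auto
    then have "real k \<le> s" using assms(1) by linarith
    then show "k \<in> {k \<in> {1..<N}. real k \<le> s}" using k by auto
  qed
  then have "card {1..min (nat \<lfloor>s\<rfloor>) (N - 1)} \<le> card {k \<in> {1..<N}. real k \<le> s}" by (intro card_mono) auto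
  then have "min (nat \<lfloor>s\<rfloor>) (N - 1) \<le> card {k \<in> {1..<N}. real k \<le> s}" by simp
  moreover have "s - 1 \<le> real (nat \<lfloor>s\<rfloor>)" using assms(1) by linarith
  moreover have "s - 1 \<le> real (N - 1)" using assms(2) by linarith
  ultimately show "s - 1 \<le> real (card {k \<in> {1..<N}. real k \<le> s})" by linarith
qed

text \<open>
  Scaling the simplex by $t$ about the vertex $v$ maps it onto the set where the barycentric
  coordinate of $v$ is at least $1 - t$. All barycentric coordinates therefore have the same
  distribution function, and hence the same integral.
\<close>

lemma barycentric_superlevel_measure:
  fixes C :: "(real ^ 'n) set"
  assumes C: "finite C" and v: "v \<in> C" and pq: "p \<bullet> v + q = 1" "\<And>u. u \<in> C \<Longrightarrow> u \<noteq> v \<Longrightarrow> p \<bullet> u + q = 0"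
    and t: "0 < t" "t \<le> 1"
  shows "measure lebesgue {x \<in> convex hull C. 1 - t \<le> p \<bullet> x + q} = t ^ CARD('n) * measure lebesgue (convex hull C)"
proof -
  have "{x \<in> convex hull C. 1 - t \<le> p \<bullet> x + q} = (\<lambda>x. t *\<^sub>R x + (1 - t) *\<^sub>R v) ` (convex hull C)"
  proof (intro equalityI subsetI)
    fix y assume y: "y \<in> {x \<in> convex hull C. 1 - t \<le> p \<bullet> x + q}"
    then obtain \<xi> where l: "\<And>u. u \<in> C \<Longrightarrow> 0 \<le> \<xi> u" "sum \<xi> C = 1" "(\<Sum>u\<in>C. \<xi> u *\<^sub>R u) = y"
      by (auto simp: convex_hull_finite[OF C])
    have lv: "1 - t \<le> \<xi> v" using convex_combination_coordinate[OF C v pq l(2)] l(3) y by simp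
    \<comment> \<open>The barycentric coordinates of the preimage of \<open>y\<close>: remove the
      share \<open>1 - t\<close> from vertex \<open>v\<close> and rescale by
      \<open>1 / t\<close>.\<close>
    define \<mu> where "\<mu> u = (\<xi> u - (if u = v then 1 - t else 0)) / t" for u
    have "sum \<mu> C = (sum \<xi> C - (\<Sum>u\<in>C. if u = v then 1 - t else 0)) / t"
      unfolding \<mu>_def by (simp add: sum_subtractf flip: sum_divide_distrib)
    then have \<mu>1: "sum \<mu> C = 1" using C v l(2) t by simp
    have "t *\<^sub>R (\<Sum>u\<in>C. \<mu> u *\<^sub>R u) = (\<Sum>u\<in>C. \<xi> u *\<^sub>R u - (if u = v then (1 - t) *\<^sub>R u else 0))"
      unfolding scaleR_sum_right \<mu>_def using t by (intro sum.cong) (auto simp: scaleR_left_diff_distrib)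
    also have "\<dots> = y - (1 - t) *\<^sub>R v" using C v l(3) by (simp add: sum_subtractf)
    finally have "y = t *\<^sub>R (\<Sum>u\<in>C. \<mu> u *\<^sub>R u) + (1 - t) *\<^sub>R v" by simp
    moreover have "(\<Sum>u\<in>C. \<mu> u *\<^sub>R u) \<in> convex hull C"
      unfolding convex_hull_finite[OF C] using \<mu>1 l(1) lv t by (auto simp: \<mu>_def intro!: exI[of _ \<mu>])
    ultimately show "y \<in> (\<lambda>x. t *\<^sub>R x + (1 - t) *\<^sub>R v) ` (convex hull C)" by blast
  next
    fix y assume "y \<in> (\<lambda>x. t *\<^sub>R x + (1 - t) *\<^sub>R v) ` (convex hull C)"
    then obtain x where x: "x \<in> convex hull C" "y = t *\<^sub>R x + (1 - t) *\<^sub>R v" by blast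
    obtain \<xi> where l: "\<And>u. u \<in> C \<Longrightarrow> 0 \<le> \<xi> u" "sum \<xi> C = 1" "(\<Sum>u\<in>C. \<xi> u *\<^sub>R u) = x"
      using x(1) by (auto simp: convex_hull_finite[OF C])
    have "0 \<le> p \<bullet> x + q" using convex_combination_coordinate[OF C v pq l(2)] l(1)[OF v] l(3) by simp
    moreover have "p \<bullet> y + q = t * (p \<bullet> x + q) + (1 - t)"
    proof -
      have "p \<bullet> y + q = t * (p \<bullet> x + q) + (1 - t) * (p \<bullet> v + q)"
        by (simp add: x(2) inner_add_right algebra_simps)
      then show ?thesis using pq(1) by simp
    qed
    moreover have "y \<in> convex hull C"
      unfolding x(2) using x(1) v t by (intro convexD[OF convex_convex_hull]) (auto simp: hull_inc)
    ultimately show "y \<in> {x \<in> convex hull C. 1 - t \<le> p \<bullet> x + q}" using t by simp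
  qed
  then show ?thesis using measure_lebesgue_affine[of t "(1 - t) *\<^sub>R v" "convex hull C"] t by simp
qed

text \<open>A discrete layer-cake formula: \<open>N\<close> times the coordinate differs by at most
  1 from the number of thresholds k/N below it, and the measure of each superlevel set does not
  depend on the vertex. The comparison sum is thus the same for all vertices, with an error
  independent of \<open>N\<close>.\<close>

lemma barycentric_coordinate_integral_approx:
  fixes C :: "(real ^ 'n) set"
  assumes C: "finite C" and v: "v \<in> C" and pq: "p \<bullet> v + q = 1" "\<And>u. u \<in> C \<Longrightarrow> u \<noteq> v \<Longrightarrow> p \<bullet> u + q = 0"
  shows "\<bar>real N * (LINT x|lebesgue_on (convex hull C). p \<bullet> x + q)
      - (\<Sum>k\<in>{1..<N}. (1 - real k / real N) ^ CARD('n) * measure lebesgue (convex hull C))\<bar> \<le> measure lebesgue (convex hull C)"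
proof -
  let ?T = "convex hull C" and ?\<beta> = "\<lambda>x. p \<bullet> x + q"
  have cT: "compact ?T" using C by (rule finite_imp_compact_convex_hull)
  have T: "?T \<in> lmeasurable" "?T \<in> sets lebesgue" using cT lmeasurable_compact by (auto simp: fmeasurableD)
  have int: "integrable (lebesgue_on ?T) f" if "continuous_on UNIV f" for f :: "real ^ 'n \<Rightarrow> real"
    using that cT T by (intro L2_space_integrable continuous_in_L2_space) (auto simp: compact_imp_bounded)
  define S where "S k = {x \<in> ?T. real k / real N \<le> ?\<beta> x}" for k
  have Ss: "S k \<in> sets lebesgue" for k
  proof -
    have "S k = ?T \<inter> {x. real k / real N \<le> ?\<beta> x}" by (auto simp: S_def)
    moreover have "closed {x. real k / real N \<le> ?\<beta> x}" by (intro closed_Collect_le continuous_intros)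
    ultimately show ?thesis using T(2) by (metis borel_closed sets.Int sets_completionI_sets sets_lborel)
  qed
  \<comment> \<open>The ends \<open>k = 0\<close> and \<open>k = N\<close> are left out; for the
    remaining \<open>k\<close> the scaling factor \<open>1 - k / N\<close> is positive, as the
    measure formula requires.\<close>
  have Sm: "measure lebesgue (S k) = (1 - real k / real N) ^ CARD('n) * measure lebesgue ?T" if "k \<in> {1..<N}" for k
    using barycentric_superlevel_measure[OF C v pq, of "1 - real k / real N"] that by (simp add: S_def field_simps)
  define g where "g x = (\<Sum>k\<in>{1..<N}. indicator (S k) x :: real)" for x
  have iS: "integrable (lebesgue_on ?T) (indicator (S k) :: _ \<Rightarrow> real)" for k
    by (rule L2_space_integrable[OF indicator_in_L2_space[OF T(1) Ss] T(1)])
  then have gi: "integrable (lebesgue_on ?T) g" unfolding g_def[abs_def] by (intro Bochner_Integration.integrable_sum)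
  have "(LINT x|lebesgue_on ?T. indicator (S k) x) = measure lebesgue (S k)" for k
  proof -
    have "measure (lebesgue_on ?T) (S k) = measure lebesgue (S k)"
      using T Ss by (intro measure_restrict_space) (auto simp: S_def)
    moreover have "S k \<inter> ?T = S k" by (auto simp: S_def)
    ultimately show ?thesis by simp
  qed
  then have gI: "(LINT x|lebesgue_on ?T. g x) = (\<Sum>k\<in>{1..<N}. (1 - real k / real N) ^ CARD('n) * measure lebesgue ?T)"
    unfolding g_def using iS Sm by (simp add: Bochner_Integration.integral_sum)
  have close: "\<bar>real N * ?\<beta> x - g x\<bar> \<le> 1" if x: "x \<in> ?T" for x
  proof -
    obtain \<xi> where l: "\<And>u. u \<in> C \<Longrightarrow> 0 \<le> \<xi> u" "sum \<xi> C = 1" "(\<Sum>u\<in>C. \<xi> u *\<^sub>R u) = x"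
      using x by (auto simp: convex_hull_finite[OF C])
    have "?\<beta> x = \<xi> v" using convex_combination_coordinate[OF C v pq l(2)] l(3) by simp
    moreover have "\<xi> v \<le> sum \<xi> C" using C v l(1) by (intro member_le_sum) auto
    ultimately have b: "0 \<le> ?\<beta> x" "?\<beta> x \<le> 1" using l v by auto
    have "g x = real (card {k \<in> {1..<N}. real k \<le> real N * ?\<beta> x})"
    proof -
      have "g x = (\<Sum>k\<in>{1..<N}. if real k \<le> real N * ?\<beta> x then 1 else 0)"
        unfolding g_def using x by (intro sum.cong) (auto simp: S_def indicator_def field_simps)
      also have "\<dots> = (\<Sum>k\<in>{k \<in> {1..<N}. real k \<le> real N * ?\<beta> x}. 1)"
        by (subst sum.inter_filter) auto
      finally show ?thesis by simp
    qed
    moreover have "0 \<le> real N * ?\<beta> x" "real N * ?\<beta> x \<le> real N" using b by (auto simp: mult_left_le)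
    ultimately show ?thesis using card_multiples_below[of "real N * ?\<beta> x" N] by linarith
  qed
  have \<beta>i: "integrable (lebesgue_on ?T) ?\<beta>" by (intro int continuous_intros)
  have "\<bar>real N * (LINT x|lebesgue_on ?T. ?\<beta> x) - (LINT x|lebesgue_on ?T. g x)\<bar> = \<bar>LINT x|lebesgue_on ?T. real N * ?\<beta> x - g x\<bar>"
    using \<beta>i gi by simp
  also have "\<dots> \<le> (LINT x|lebesgue_on ?T. \<bar>real N * ?\<beta> x - g x\<bar>)" by (rule integral_abs_bound)
  also have "\<dots> \<le> (LINT x|lebesgue_on ?T. 1)"
    by (rule integral_mono) (use \<beta>i gi close int[of "\<lambda>x. 1"] in auto)
  also have "\<dots> = measure lebesgue ?T" using T by (simp add: measure_restrict_space)
  finally show ?thesis by (simp only: gI)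
qed

text \<open>The barycentric coordinates have equal integrals and add up to 1, so each integrates to
  the volume divided by the number of vertices. Expanding a linear function in these coordinates
  yields its value at the barycentre times the volume.\<close>

lemma simplex_centroid:
  fixes T :: "(real ^ 'n) set"
  assumes T: "int CARD('n) simplex T"
  shows "(LINT x|lebesgue_on T. a \<bullet> (x - simplex_barycentre T)) = 0"
proof -
  obtain C where C: "\<not> affine_dependent C" "card C = CARD('n) + 1" "T = convex hull C"
    using T by (auto simp: simplex_def)
  have fin: "finite C" using C(1) aff_independent_finite by blast
  have ext: "{v. v extreme_point_of T} = C"
    using extreme_point_of_convex_hull_affine_independent[OF C(1)] C(3) by blast
  have cT: "compact T" using fin C(3) finite_imp_compact_convex_hull by blast
  have Tm: "T \<in> lmeasurable" "T \<in> sets lebesgue" using cT lmeasurable_compact by (auto simp: fmeasurableD)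
  have int: "integrable (lebesgue_on T) f" if "continuous_on UNIV f" for f :: "real ^ 'n \<Rightarrow> real"
    using that cT Tm by (intro L2_space_integrable continuous_in_L2_space) (auto simp: compact_imp_bounded)
  have "\<exists>p q. p \<bullet> v + q = 1 \<and> (\<forall>u\<in>C. u \<noteq> v \<longrightarrow> p \<bullet> u + q = 0)" if "v \<in> C" for v
    using simplex_barycentric_coordinate[OF C(1,2) that] by metis
  then obtain p q where pq: "\<And>v. v \<in> C \<Longrightarrow> p v \<bullet> v + q v = 1" "\<And>v u. v \<in> C \<Longrightarrow> u \<in> C \<Longrightarrow> u \<noteq> v \<Longrightarrow> p v \<bullet> u + q v = 0"
    by metis
  define I where "I v = (LINT x|lebesgue_on T. p v \<bullet> x + q v)" for v
  have eq: "I v = I w" if "v \<in> C" "w \<in> C" for v w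
  proof (rule ccontr)
    assume "I v \<noteq> I w"
    \<comment> \<open>Large enough that N |I v - I w| exceeds twice the volume, while both N I v and
      N I w lie within one volume of the same sum.\<close>
    then obtain N :: nat where N: "2 * measure lebesgue T / \<bar>I v - I w\<bar> < real N" using reals_Archimedean2 by blast
    let ?s = "\<Sum>k\<in>{1..<N}. (1 - real k / real N) ^ CARD('n) * measure lebesgue T"
    have "\<bar>real N * I u - ?s\<bar> \<le> measure lebesgue T" if "u \<in> C" for u
      unfolding I_def C(3) by (rule barycentric_coordinate_integral_approx[OF fin that pq(1)[OF that] pq(2)[OF that]])
    from this[OF that(1)] this[OF that(2)] have "\<bar>real N * I v - real N * I w\<bar> \<le> 2 * measure lebesgue T" by linarith
    then have "real N * \<bar>I v - I w\<bar> \<le> 2 * measure lebesgue T" by (simp add: abs_mult flip: right_diff_distrib)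
    then show False using N \<open>I v \<noteq> I w\<close> by (simp add: field_simps)
  qed
  have coord: "(\<Sum>v\<in>C. (p v \<bullet> x + q v)) = 1" "(\<Sum>v\<in>C. (p v \<bullet> x + q v) * (a \<bullet> v)) = a \<bullet> x" if xT: "x \<in> T" for x
  proof -
    obtain \<xi> where l: "\<And>u. u \<in> C \<Longrightarrow> 0 \<le> \<xi> u" "sum \<xi> C = 1" "(\<Sum>u\<in>C. \<xi> u *\<^sub>R u) = x"
      using xT by (auto simp: C(3) convex_hull_finite[OF fin])
    have c: "p v \<bullet> x + q v = \<xi> v" if "v \<in> C" for v
      using convex_combination_coordinate[OF fin that pq(1)[OF that] pq(2)[OF that] l(2)] l(3) by simp
    show "(\<Sum>v\<in>C. (p v \<bullet> x + q v)) = 1" using c l(2) by simp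
    have "a \<bullet> x = (\<Sum>v\<in>C. \<xi> v * (a \<bullet> v))" by (simp add: inner_sum_right flip: l(3))
    then show "(\<Sum>v\<in>C. (p v \<bullet> x + q v) * (a \<bullet> v)) = a \<bullet> x" using c by simp
  qed
  have i: "integrable (lebesgue_on T) (\<lambda>x. p v \<bullet> x + q v)" for v by (intro int continuous_intros)
  obtain v0 where v0: "v0 \<in> C" using C(2) by fastforce
  have tot: "(\<Sum>v\<in>C. I v) = measure lebesgue T"
  proof -
    have "(\<Sum>v\<in>C. I v) = (LINT x|lebesgue_on T. (\<Sum>v\<in>C. p v \<bullet> x + q v))"
      unfolding I_def using i by (intro Bochner_Integration.integral_sum[symmetric])
    also have "\<dots> = (LINT x|lebesgue_on T. 1)" using coord(1) by (intro Bochner_Integration.integral_cong) auto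
    finally show ?thesis using Tm by (simp add: measure_restrict_space)
  qed
  have "(\<Sum>v\<in>C. I v) = (\<Sum>v\<in>C. I v0)" by (intro sum.cong refl eq v0)
  then have I0: "real (CARD('n) + 1) * I v0 = measure lebesgue T" using tot C(2) by simp
  have "(LINT x|lebesgue_on T. a \<bullet> x) = (LINT x|lebesgue_on T. (\<Sum>v\<in>C. (p v \<bullet> x + q v) * (a \<bullet> v)))"
    using coord(2) by (intro Bochner_Integration.integral_cong) auto
  also have "\<dots> = (\<Sum>v\<in>C. LINT x|lebesgue_on T. (p v \<bullet> x + q v) * (a \<bullet> v))"
    by (intro Bochner_Integration.integral_sum int continuous_intros)
  also have "\<dots> = (\<Sum>v\<in>C. I v * (a \<bullet> v))" unfolding I_def by simp
  also have "\<dots> = (\<Sum>v\<in>C. I v0 * (a \<bullet> v))" by (intro sum.cong refl) (simp only: eq[OF _ v0])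
  also have "\<dots> = I v0 * (a \<bullet> (\<Sum>v\<in>C. v))" by (simp add: inner_sum_right sum_distrib_left)
  also have "\<dots> = measure lebesgue T * (a \<bullet> simplex_barycentre T)"
    unfolding simplex_barycentre_def ext I0[symmetric] by simp
  finally have "(LINT x|lebesgue_on T. a \<bullet> x) = measure lebesgue T * (a \<bullet> simplex_barycentre T)" .
  moreover have "integrable (lebesgue_on T) (\<lambda>x. a \<bullet> x)" by (intro int continuous_intros)
  moreover have "measure (lebesgue_on T) T = measure lebesgue T" using Tm by (intro measure_restrict_space) auto
  ultimately show ?thesis using int[of "\<lambda>x. a \<bullet> simplex_barycentre T"] by (simp add: inner_diff_right)
qed

section \<open>Discrete solution operators\<close>

context mesh
begin

text \<open>Provides the evaluation points for the induction in \<open>riesz_representation\<close>.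
  In each element a point of the interior and small shifts of it along the axes determine slope and
  constant.\<close>

lemma P1_determined_by_finite_set:
  "\<exists>S. finite S \<and> (\<forall>v\<in>P1_space \<T>. (\<forall>s\<in>S. v s = 0) \<longrightarrow> v = (\<lambda>x. 0))"
proof -
  have "\<exists>S. finite S \<and> S \<subseteq> interior T \<and> (\<forall>a b. (\<forall>s\<in>S. a \<bullet> s + b = 0) \<longrightarrow> a = 0 \<and> b = (0::real))" if T: "T \<in> \<T>" for T
  proof -
    obtain x where x: "x \<in> interior T" using element_interior_nonempty[OF T] by blast
    obtain e where e: "e > 0" "ball x e \<subseteq> interior T" using x open_interior open_contains_ball by blast
    let ?S = "insert x (range (\<lambda>i. x + (e / 2) *\<^sub>R axis i 1))"
    have "x + (e / 2) *\<^sub>R axis i 1 \<in> ball x e" for i using e(1) by (simp add: dist_norm)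
    then have sub: "?S \<subseteq> interior T" using e(2) x by blast
    have zero: "a = 0 \<and> b = 0" if z: "\<forall>s\<in>?S. a \<bullet> s + b = 0" for a :: "real ^ 'n" and b
    proof -
      have "a $ i = 0" for i
      proof -
        have "a \<bullet> x + b = 0" "a \<bullet> (x + (e / 2) *\<^sub>R axis i 1) + b = 0" using z by auto
        moreover have "a \<bullet> (x + (e / 2) *\<^sub>R axis i 1) + b = (a \<bullet> x + b) + (e / 2) * a $ i"
          by (simp add: inner_add_right inner_axis)
        ultimately have "(e / 2) * a $ i = 0" by linarith
        then show ?thesis using e(1) by simp
      qed
      then have "a = 0" by (simp add: vec_eq_iff)
      moreover have "a \<bullet> x + b = 0" using z by blast
      ultimately show ?thesis by simp
    qed
    show ?thesis
    proof (intro exI[of _ ?S] conjI sub)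
      show "\<forall>a b. (\<forall>s\<in>?S. a \<bullet> s + b = 0) \<longrightarrow> a = 0 \<and> b = (0::real)" using zero by blast
    qed simp
  qed
  then have "\<forall>T\<in>\<T>. \<exists>S. finite S \<and> S \<subseteq> interior T \<and> (\<forall>a b. (\<forall>s\<in>S. a \<bullet> s + b = 0) \<longrightarrow> a = 0 \<and> b = (0::real))"
    by blast
  from bchoice[OF this] obtain S where S': "\<forall>T\<in>\<T>. finite (S T) \<and> S T \<subseteq> interior T \<and>
      (\<forall>a b. (\<forall>s\<in>S T. a \<bullet> s + b = 0) \<longrightarrow> a = 0 \<and> b = (0::real))" ..
  have S: "finite (S T)" "S T \<subseteq> interior T" "\<And>a b. (\<forall>s\<in>S T. a \<bullet> s + b = 0) \<Longrightarrow> a = 0 \<and> b = (0::real)"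
    if "T \<in> \<T>" for T using S' that by blast+
  show ?thesis
  proof (intro exI[of _ "\<Union>T\<in>\<T>. S T"] conjI ballI impI)
    show "finite (\<Union>T\<in>\<T>. S T)" using finite_mesh S(1) by blast
    fix v assume v: "v \<in> P1_space \<T>" and z: "\<forall>s\<in>\<Union>T\<in>\<T>. S T. v s = 0"
    obtain a b where ab: "affine_pieces v a b" using v by (rule P1_spaceE)
    have 0: "a T = 0 \<and> b T = 0" if T: "T \<in> \<T>" for T
    proof (rule S(3)[OF T], rule ballI)
      fix s assume s: "s \<in> S T"
      then have "v s = a T \<bullet> s + b T" using affine_piecesD[OF ab T] S(2)[OF T] by blast
      then show "a T \<bullet> s + b T = 0" using z s T by auto
    qed
    show "v = (\<lambda>x. 0)"
    proof
      fix x show "v x = 0"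
      proof (cases "x \<in> (\<Union>T\<in>\<T>. interior T)")
        case True
        then show ?thesis using affine_piecesD[OF ab] 0 by auto
      next
        case False
        then show ?thesis using v by (auto simp: P1_space_def supported_on_elements_def)
      qed
    qed
  qed
qed

lemma broken_form_linear: "w \<in> P1_space \<T> \<Longrightarrow> linear_on (P1_space \<T>) (\<lambda>v. broken_form \<Omega> \<T> v w)"
  unfolding linear_on_def
proof (intro conjI ballI allI)
  assume w: "w \<in> P1_space \<T>"
  fix u v assume uv: "u \<in> P1_space \<T>" "v \<in> P1_space \<T>"
  have uv': "(\<lambda>x. u x + v x) \<in> P1_space \<T>" by (rule function_space_add[OF P1_function_space uv])
  note L = broken_grad_in_L2
  have "broken_form \<Omega> \<T> (\<lambda>x. u x + v x) w = L2_inner \<Omega> (\<lambda>x. broken_grad \<T> u x + broken_grad \<T> v x) (broken_grad \<T> w)"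
    unfolding broken_form_def
    by (rule L2_inner_cong_AE[OF broken_grad_add[OF uv] _ L[OF uv'] L2_space_add[OF L[OF uv(1)] L[OF uv(2)]] L[OF w] L[OF w]]) simp
  then show "broken_form \<Omega> \<T> (\<lambda>x. u x + v x) w = broken_form \<Omega> \<T> u w + broken_form \<Omega> \<T> v w"
    using uv w by (simp add: L2_inner_add_left L broken_form_def)
next
  assume w: "w \<in> P1_space \<T>"
  fix c v assume v: "v \<in> P1_space \<T>"
  have v': "(\<lambda>x. c * v x) \<in> P1_space \<T>" by (rule function_space_mult[OF P1_function_space v])
  note L = broken_grad_in_L2
  have "broken_form \<Omega> \<T> (\<lambda>x. c * v x) w = L2_inner \<Omega> (\<lambda>x. c *\<^sub>R broken_grad \<T> v x) (broken_grad \<T> w)"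
    unfolding broken_form_def
    by (rule L2_inner_cong_AE[OF broken_grad_mult[OF v] _ L[OF v'] L2_space_scaleR[OF L[OF v]] L[OF w] L[OF w]]) simp
  then show "broken_form \<Omega> \<T> (\<lambda>x. c * v x) w = c * broken_form \<Omega> \<T> v w"
    by (simp add: L2_inner_scaleR_left broken_form_def)
qed

lemma broken_form_commute: "broken_form \<Omega> \<T> v w = broken_form \<Omega> \<T> w v"
  by (simp add: broken_form_def L2_inner_commute)

lemma broken_form_self: "broken_form \<Omega> \<T> v v = (broken_H1_seminorm \<Omega> \<T> v)\<^sup>2"
  by (simp add: broken_form_def broken_H1_seminorm_def L2_norm_square)

lemma broken_form_Cauchy_Schwarz:
  "v \<in> P1_space \<T> \<Longrightarrow> w \<in> P1_space \<T> \<Longrightarrow>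
    broken_form \<Omega> \<T> v w \<le> broken_H1_seminorm \<Omega> \<T> v * broken_H1_seminorm \<Omega> \<T> w"
  using L2_Cauchy_Schwarz[OF broken_grad_in_L2 broken_grad_in_L2, of v w]
  by (simp add: broken_form_def broken_H1_seminorm_def)

lemma broken_form_inner_product_on:
  assumes "function_space V" "V \<subseteq> CR_space \<Omega> \<T>"
  shows "inner_product_on V (broken_form \<Omega> \<T>)"
proof
  have P1: "V \<subseteq> P1_space \<T>" using assms(2) CR_subset_P1 by blast
  show "linear_on V (\<lambda>v. broken_form \<Omega> \<T> v w)" if "w \<in> V" for w
    using linear_on_subset[OF broken_form_linear P1] that P1 by blast
  show "broken_form \<Omega> \<T> v w = broken_form \<Omega> \<T> w v" for v w by (rule broken_form_commute)
  show "broken_form \<Omega> \<T> v v \<ge> 0" for v by (simp add: broken_form_self)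
  show "v = (\<lambda>x. 0)" if "v \<in> V" "broken_form \<Omega> \<T> v v = 0" for v
  proof (rule CR_broken_grad_eq_0_imp)
    show "v \<in> CR_space \<Omega> \<T>" using that assms by blast
    have "L2_norm \<Omega> (broken_grad \<T> v) = 0" using that(2) by (simp add: broken_form_self broken_H1_seminorm_def)
    then show "AE x in lebesgue_on \<Omega>. broken_grad \<T> v x = 0"
      using L2_norm_eq_0_iff[OF broken_grad_in_L2] that(1) P1 by blast
  qed
qed (rule assms(1))

lemma L2_inner_linear_on:
  assumes "f \<in> L2_space \<Omega>" "V \<subseteq> L2_space \<Omega>" shows "linear_on V (L2_inner \<Omega> f)"
  unfolding linear_on_def using assms
  by (auto simp: L2_inner_add_right L2_inner_mult_right subset_iff)

text \<open>One notion for both methods: on conforming functions the broken gradient is the weak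
  gradient almost everywhere. Existence, uniqueness and linearity are then proved once, for any
  subspace of the Crouzeix-Raviart space.\<close>

definition galerkin :: "(real ^ 'n \<Rightarrow> real) set \<Rightarrow> (real ^ 'n \<Rightarrow> real) \<Rightarrow> (real ^ 'n \<Rightarrow> real) \<Rightarrow> bool" where
  "galerkin V f u \<longleftrightarrow> u \<in> V \<and> (\<forall>v\<in>V. broken_form \<Omega> \<T> u v = L2_inner \<Omega> f v)"

lemma galerkin_unique:
  assumes V: "function_space V" "V \<subseteq> CR_space \<Omega> \<T>" and u: "galerkin V f u" "galerkin V f w"
  shows "u = w"
proof -
  interpret inner_product_on V "broken_form \<Omega> \<T>" by (rule broken_form_inner_product_on[OF V])
  have uw: "u \<in> V" "w \<in> V" using u by (auto simp: galerkin_def)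
  define d where "d = (\<lambda>x. u x + (-1) * w x)"
  have d: "d \<in> V" unfolding d_def by (rule function_space_add[OF V(1) uw(1) function_space_mult[OF V(1) uw(2)]])
  have "broken_form \<Omega> \<T> d d = broken_form \<Omega> \<T> u d + (-1) * broken_form \<Omega> \<T> w d"
    using linear_on_add[OF linear[OF d] uw(1) function_space_mult[OF V(1) uw(2), of "-1"]]
      linear_on_mult[OF linear[OF d] uw(2), of "-1"] unfolding d_def by (simp only:)
  also have "\<dots> = 0" using u d by (simp add: galerkin_def)
  finally have "d = (\<lambda>x. 0)" by (rule definite[OF d])
  then show ?thesis by (auto simp: d_def fun_eq_iff)
qed

lemma galerkin_exists:
  assumes V: "function_space V" "V \<subseteq> CR_space \<Omega> \<T>" and f: "f \<in> L2_space \<Omega>"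
  shows "\<exists>u. galerkin V f u"
proof -
  have P1: "V \<subseteq> P1_space \<T>" using V(2) CR_subset_P1 by blast
  obtain S where S: "finite S" "\<And>v. v \<in> P1_space \<T> \<Longrightarrow> (\<forall>s\<in>S. v s = 0) \<Longrightarrow> v = (\<lambda>x. 0)"
    using P1_determined_by_finite_set by blast
  have "\<exists>u\<in>V. \<forall>v\<in>V. broken_form \<Omega> \<T> u v = L2_inner \<Omega> f v"
  proof (rule riesz_representation[OF S(1) broken_form_inner_product_on[OF V]])
    show "v = (\<lambda>x. 0)" if "v \<in> V" "\<And>s. s \<in> S \<Longrightarrow> v s = 0" for v using S(2)[of v] that P1 by blast
    show "linear_on V (L2_inner \<Omega> f)" using P1 P1_in_L2 by (intro L2_inner_linear_on[OF f]) blast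
  qed
  then show ?thesis by (auto simp: galerkin_def)
qed

lemma galerkin_add:
  assumes V: "function_space V" "V \<subseteq> CR_space \<Omega> \<T>" and f: "f \<in> L2_space \<Omega>" "g \<in> L2_space \<Omega>"
    and u: "galerkin V f u" "galerkin V g w"
  shows "galerkin V (\<lambda>x. f x + g x) (\<lambda>x. u x + w x)"
  unfolding galerkin_def
proof (intro conjI ballI)
  interpret inner_product_on V "broken_form \<Omega> \<T>" by (rule broken_form_inner_product_on[OF V])
  have uw: "u \<in> V" "w \<in> V" using u by (auto simp: galerkin_def)
  show "(\<lambda>x. u x + w x) \<in> V" by (rule function_space_add[OF V(1) uw])
  fix v assume v: "v \<in> V"
  then have "v \<in> L2_space \<Omega>" using V(2) CR_subset_P1 P1_in_L2 by blast
  then show "broken_form \<Omega> \<T> (\<lambda>x. u x + w x) v = L2_inner \<Omega> (\<lambda>x. f x + g x) v"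
    using linear_on_add[OF linear[OF v] uw] u v f by (simp add: galerkin_def L2_inner_add_left)
qed

lemma galerkin_mult:
  assumes V: "function_space V" "V \<subseteq> CR_space \<Omega> \<T>" and u: "galerkin V f u"
  shows "galerkin V (\<lambda>x. c * f x) (\<lambda>x. c * u x)"
  unfolding galerkin_def
proof (intro conjI ballI)
  interpret inner_product_on V "broken_form \<Omega> \<T>" by (rule broken_form_inner_product_on[OF V])
  have uV: "u \<in> V" using u by (auto simp: galerkin_def)
  show "(\<lambda>x. c * u x) \<in> V" by (rule function_space_mult[OF V(1) uV])
  fix v assume v: "v \<in> V"
  then show "broken_form \<Omega> \<T> (\<lambda>x. c * u x) v = L2_inner \<Omega> (\<lambda>x. c * f x) v"
    using linear_on_mult[OF linear[OF v] uV] u by (simp add: galerkin_def L2_inner_mult_left)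
qed

lemma CR_solution_eq_The: "CR_solution \<Omega> \<T> f = (THE u. galerkin (CR_space \<Omega> \<T>) f u)"
  by (simp add: CR_solution_def galerkin_def broken_form_def)

lemma broken_form_conforming:
  assumes "u \<in> conforming_space \<Omega> \<T>" "v \<in> conforming_space \<Omega> \<T>"
  shows "L2_inner \<Omega> (weak_grad \<Omega> u) (weak_grad \<Omega> v) = broken_form \<Omega> \<T> u v"
  unfolding broken_form_def
proof (rule L2_inner_cong_AE[symmetric, OF broken_grad_conforming[OF assms(1)] broken_grad_conforming[OF assms(2)]])
  have "w \<in> P1_space \<T>" "w \<in> H1_space \<Omega>" if "w \<in> conforming_space \<Omega> \<T>" for w
    using that by (auto simp: conforming_space_def H10_space_H1)
  then show "broken_grad \<T> u \<in> L2_space \<Omega>" "broken_grad \<T> v \<in> L2_space \<Omega>"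
    "weak_grad \<Omega> u \<in> L2_space \<Omega>" "weak_grad \<Omega> v \<in> L2_space \<Omega>"
    using assms by (auto intro: broken_grad_in_L2 weak_grad_in_L2_space)
qed

lemma conforming_solution_eq_The: "conforming_solution \<Omega> \<T> f = (THE u. galerkin (conforming_space \<Omega> \<T>) f u)"
proof -
  have "(u \<in> conforming_space \<Omega> \<T> \<and>
        (\<forall>v\<in>conforming_space \<Omega> \<T>. L2_inner \<Omega> (weak_grad \<Omega> u) (weak_grad \<Omega> v) = L2_inner \<Omega> f v))
      = galerkin (conforming_space \<Omega> \<T>) f u" for u
    unfolding galerkin_def using broken_form_conforming[of u] by auto
  then show ?thesis by (simp add: conforming_solution_def)
qed

lemma galerkin_The:
  assumes V: "function_space V" "V \<subseteq> CR_space \<Omega> \<T>" and f: "f \<in> L2_space \<Omega>"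
  shows "galerkin V f (THE u. galerkin V f u)"
  using galerkin_exists[OF V f] galerkin_unique[OF V] by (metis theI)

lemmas CR_galerkin = galerkin_The[OF CR_function_space order_refl, folded CR_solution_eq_The]
  and conforming_galerkin = galerkin_The[OF conforming_function_space conforming_subset_CR, folded conforming_solution_eq_The]

section \<open>The gap operator and its identity\<close>

abbreviation "D \<equiv> gap_operator \<Omega> \<T>"

lemma gap_in_CR: "f \<in> L2_space \<Omega> \<Longrightarrow> D f \<in> CR_space \<Omega> \<T>"
  unfolding gap_operator_def
  using CR_galerkin[of f] conforming_galerkin[of f] conforming_subset_CR
  by (intro function_space_diff[OF CR_function_space]) (auto simp: galerkin_def)

lemma gap_in_P1: "f \<in> L2_space \<Omega> \<Longrightarrow> D f \<in> P1_space \<T>"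
  using gap_in_CR CR_subset_P1 by blast

lemma gap_in_L2: "f \<in> L2_space \<Omega> \<Longrightarrow> D f \<in> L2_space \<Omega>"
  using gap_in_P1 P1_in_L2 by blast

lemma gap_add:
  assumes "f \<in> L2_space \<Omega>" "g \<in> L2_space \<Omega>"
  shows "D (\<lambda>x. f x + g x) = (\<lambda>x. D f x + D g x)"
proof -
  note fg = L2_space_add[OF assms]
  have "CR_solution \<Omega> \<T> (\<lambda>x. f x + g x) = (\<lambda>x. CR_solution \<Omega> \<T> f x + CR_solution \<Omega> \<T> g x)"
    by (rule galerkin_unique[OF CR_function_space order_refl CR_galerkin[OF fg]])
      (rule galerkin_add[OF CR_function_space order_refl assms CR_galerkin[OF assms(1)] CR_galerkin[OF assms(2)]])
  moreover have "conforming_solution \<Omega> \<T> (\<lambda>x. f x + g x) = (\<lambda>x. conforming_solution \<Omega> \<T> f x + conforming_solution \<Omega> \<T> g x)"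
    by (rule galerkin_unique[OF conforming_function_space conforming_subset_CR conforming_galerkin[OF fg]])
      (rule galerkin_add[OF conforming_function_space conforming_subset_CR assms conforming_galerkin[OF assms(1)] conforming_galerkin[OF assms(2)]])
  ultimately show ?thesis by (simp add: gap_operator_def fun_eq_iff)
qed

lemma gap_mult:
  assumes "f \<in> L2_space \<Omega>" shows "D (\<lambda>x. c * f x) = (\<lambda>x. c * D f x)"
proof -
  note cf = L2_space_mult[OF assms]
  have "CR_solution \<Omega> \<T> (\<lambda>x. c * f x) = (\<lambda>x. c * CR_solution \<Omega> \<T> f x)"
    by (rule galerkin_unique[OF CR_function_space order_refl CR_galerkin[OF cf]])
      (rule galerkin_mult[OF CR_function_space order_refl CR_galerkin[OF assms]])
  moreover have "conforming_solution \<Omega> \<T> (\<lambda>x. c * f x) = (\<lambda>x. c * conforming_solution \<Omega> \<T> f x)"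
    by (rule galerkin_unique[OF conforming_function_space conforming_subset_CR conforming_galerkin[OF cf]])
      (rule galerkin_mult[OF conforming_function_space conforming_subset_CR conforming_galerkin[OF assms]])
  ultimately show ?thesis by (simp add: gap_operator_def fun_eq_iff right_diff_distrib)
qed

lemma gap_cong_AE:
  assumes "f \<in> L2_space \<Omega>" "g \<in> L2_space \<Omega>" "AE x in lebesgue_on \<Omega>. f x = g x"
  shows "D f = D g"
proof -
  have "L2_inner \<Omega> f v = L2_inner \<Omega> g v" if "v \<in> P1_space \<T>" for v
    by (rule L2_inner_cong_AE[OF assms(3) _ assms(1,2) P1_in_L2[OF that] P1_in_L2[OF that]]) simp
  then have "galerkin V f = galerkin V g" if "V \<subseteq> CR_space \<Omega> \<T>" for V
    using that CR_subset_P1 unfolding galerkin_def by (auto simp: fun_eq_iff subset_iff)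
  then show ?thesis
    using conforming_subset_CR by (simp add: gap_operator_def CR_solution_eq_The conforming_solution_eq_The)
qed

text \<open>Expanding the form gives four terms. The two containing the conforming solution for
  \<open>g\<close> cancel, since the conforming and the Crouzeix-Raviart equation for
  \<open>f\<close> can both be tested with it; the other two are equations for \<open>g\<close>
  tested with the solutions for \<open>f\<close>.\<close>

lemma gap_identity:
  assumes "f \<in> L2_space \<Omega>" "g \<in> L2_space \<Omega>"
  shows "L2_inner \<Omega> (D f) g = broken_form \<Omega> \<T> (D f) (D g)"
proof -
  let ?a = "broken_form \<Omega> \<T>"
  define u uc w wc where "u = CR_solution \<Omega> \<T> f" and "uc = conforming_solution \<Omega> \<T> f"
    and "w = CR_solution \<Omega> \<T> g" and "wc = conforming_solution \<Omega> \<T> g"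
  have G: "galerkin (CR_space \<Omega> \<T>) f u" "galerkin (conforming_space \<Omega> \<T>) f uc"
    "galerkin (CR_space \<Omega> \<T>) g w" "galerkin (conforming_space \<Omega> \<T>) g wc"
    using CR_galerkin conforming_galerkin assms by (auto simp: u_def uc_def w_def wc_def)
  have CR: "u \<in> CR_space \<Omega> \<T>" "uc \<in> CR_space \<Omega> \<T>" "w \<in> CR_space \<Omega> \<T>" "wc \<in> CR_space \<Omega> \<T>"
    and c: "uc \<in> conforming_space \<Omega> \<T>" "wc \<in> conforming_space \<Omega> \<T>"
    using G conforming_subset_CR by (auto simp: galerkin_def)
  have P1: "u \<in> P1_space \<T>" "uc \<in> P1_space \<T>" "w \<in> P1_space \<T>" "wc \<in> P1_space \<T>"
    using CR CR_subset_P1 by blast+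
  have D: "D f = (\<lambda>x. u x + (-1) * uc x)" "D g = (\<lambda>x. w x + (-1) * wc x)"
    by (simp_all add: gap_operator_def u_def uc_def w_def wc_def)
  have diff: "?a (\<lambda>x. p x + (-1) * q x) r = ?a p r - ?a q r"
    if "p \<in> P1_space \<T>" "q \<in> P1_space \<T>" "r \<in> P1_space \<T>" for p q r
    using linear_on_add[OF broken_form_linear[OF that(3)] that(1) function_space_mult[OF P1_function_space that(2), of "-1"]]
      linear_on_mult[OF broken_form_linear[OF that(3)] that(2), of "-1"] by simp
  have "?a (D f) (D g) = ?a u (D g) - ?a uc (D g)"
    unfolding D(1) by (rule diff[OF P1(1,2) gap_in_P1[OF assms(2)]])
  also have "?a u (D g) = ?a w u - ?a wc u"
    unfolding D(2) using diff[OF P1(3,4,1)] by (simp only: broken_form_commute[of u])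
  also have "?a uc (D g) = ?a w uc - ?a wc uc"
    unfolding D(2) using diff[OF P1(3,4,2)] by (simp only: broken_form_commute[of uc])
  also have "?a w u = L2_inner \<Omega> g u" using G(3) CR(1) by (simp add: galerkin_def)
  also have "?a w uc = L2_inner \<Omega> g uc" using G(3) CR(2) by (simp add: galerkin_def)
  also have "?a wc uc = L2_inner \<Omega> f wc" using G(2) c(2) by (simp add: galerkin_def broken_form_commute[of wc])
  also have "?a wc u = L2_inner \<Omega> f wc" using G(1) CR(4) by (simp add: galerkin_def broken_form_commute[of wc])
  finally have "?a (D f) (D g) = L2_inner \<Omega> g u - L2_inner \<Omega> g uc" by simp
  also have "\<dots> = L2_inner \<Omega> g (D f)"
    using assms P1_in_L2 P1 by (simp add: gap_operator_def u_def uc_def L2_inner_diff_right)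
  finally show ?thesis by (simp add: L2_inner_commute)
qed

section \<open>Piecewise constants and the two constants\<close>

lemma P0_spaceE:
  assumes "v \<in> P0_space \<T>"
  obtains c where "\<And>T x. T \<in> \<T> \<Longrightarrow> x \<in> interior T \<Longrightarrow> v x = c T"
proof -
  have "\<forall>T\<in>\<T>. \<exists>c. \<forall>x\<in>interior T. v x = c" using assms by (simp add: P0_space_def)
  then show thesis using that by (metis bchoice)
qed

lemma P0_subset_P1: "P0_space \<T> \<subseteq> P1_space \<T>"
proof
  fix v assume v: "v \<in> P0_space \<T>"
  obtain c where c: "\<And>T x. T \<in> \<T> \<Longrightarrow> x \<in> interior T \<Longrightarrow> v x = c T" using P0_spaceE[OF v] by metis
  then have "affine_pieces v (\<lambda>T. 0) c" by (simp add: affine_pieces_def)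
  then show "v \<in> P1_space \<T>" using v by (auto simp: P1_space_iff P0_space_def)
qed

lemma P0_in_L2: "v \<in> P0_space \<T> \<Longrightarrow> v \<in> L2_space \<Omega>"
  using P0_subset_P1 P1_in_L2 by blast

lemma P0_function_space: "function_space (P0_space \<T>)"
  unfolding function_space_def
proof (intro conjI ballI allI)
  show "(\<lambda>x. 0) \<in> P0_space \<T>" by (auto simp: P0_space_def supported_on_elements_def)
next
  fix u v assume uv: "u \<in> P0_space \<T>" "v \<in> P0_space \<T>"
  obtain c where c: "\<And>T x. T \<in> \<T> \<Longrightarrow> x \<in> interior T \<Longrightarrow> u x = c T" using P0_spaceE[OF uv(1)] by metis
  obtain d where d: "\<And>T x. T \<in> \<T> \<Longrightarrow> x \<in> interior T \<Longrightarrow> v x = d T" using P0_spaceE[OF uv(2)] by metis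
  have "\<forall>x\<in>interior T. u x + v x = c T + d T" if "T \<in> \<T>" for T using c[OF that] d[OF that] by simp
  then show "(\<lambda>x. u x + v x) \<in> P0_space \<T>"
    using uv unfolding P0_space_def by (auto simp: supported_on_elements_def)
next
  fix k v assume v: "v \<in> P0_space \<T>"
  obtain c where c: "\<And>T x. T \<in> \<T> \<Longrightarrow> x \<in> interior T \<Longrightarrow> v x = c T" using P0_spaceE[OF v] by metis
  have "\<forall>x\<in>interior T. k * v x = k * c T" if "T \<in> \<T>" for T using c[OF that] by simp
  then show "(\<lambda>x. k * v x) \<in> P0_space \<T>"
    using v unfolding P0_space_def by (auto simp: supported_on_elements_def)
qed

lemma P0_inner_product_on: "inner_product_on (P0_space \<T>) (L2_inner \<Omega>)"
proof
  show "linear_on (P0_space \<T>) (\<lambda>v. L2_inner \<Omega> v w)" if "w \<in> P0_space \<T>" for w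
    using L2_inner_linear_on[OF P0_in_L2[OF that], of "P0_space \<T>"] P0_in_L2
    by (simp add: L2_inner_commute[of _ _ w] subset_iff)
  show "L2_inner \<Omega> v w = L2_inner \<Omega> w v" for v w by (rule L2_inner_commute)
  show "L2_inner \<Omega> v v \<ge> 0" for v by (rule L2_inner_self_nonneg)
  fix v assume v: "v \<in> P0_space \<T>" "L2_inner \<Omega> v v = 0"
  obtain c where c: "\<And>T x. T \<in> \<T> \<Longrightarrow> x \<in> interior T \<Longrightarrow> v x = c T" using P0_spaceE[OF v(1)] by metis
  have ae: "AE x in lebesgue_on \<Omega>. v x = 0"
    using L2_norm_eq_0_iff[OF P0_in_L2[OF v(1)]] v(2) by (simp add: L2_norm_def)
  have "c T = 0" if T: "T \<in> \<T>" for T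
  proof -
    have "AE x in lebesgue_on (interior T). c T = 0"
      using AE_on_element[OF ae T] AE_space by eventually_elim (simp add: c[OF T])
    then show ?thesis using T by (rule AE_const_on_element)
  qed
  then show "v = (\<lambda>x. 0)" using v(1) c by (auto simp: P0_space_def supported_on_elements_def fun_eq_iff)
qed (rule P0_function_space)

lemma P0_determined_by_finite_set:
  obtains S where "finite S" "\<And>v. v \<in> P0_space \<T> \<Longrightarrow> (\<And>s. s \<in> S \<Longrightarrow> v s = 0) \<Longrightarrow> v = (\<lambda>x. 0)"
  using P1_determined_by_finite_set P0_subset_P1 by (metis subsetD)

text \<open>Existence is the Riesz representation of the pairing with \<open>f\<close> on piecewise
  constants, and uniqueness is definiteness; together they give meaning to the description
  \<open>THE\<close>.\<close>

lemma P0_projection: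
  assumes "f \<in> L2_space \<Omega>"
  shows P0_projection_in_P0: "P0_projection \<Omega> \<T> f \<in> P0_space \<T>"
    and P0_projection_orthogonal: "p \<in> P0_space \<T> \<Longrightarrow> L2_inner \<Omega> (\<lambda>x. f x - P0_projection \<Omega> \<T> f x) p = 0"
proof -
  interpret inner_product_on "P0_space \<T>" "L2_inner \<Omega>" by (rule P0_inner_product_on)
  let ?P = "\<lambda>q. q \<in> P0_space \<T> \<and> (\<forall>p\<in>P0_space \<T>. L2_inner \<Omega> (\<lambda>x. f x - q x) p = 0)"
  obtain S where S: "finite S" "\<And>v. v \<in> P0_space \<T> \<Longrightarrow> (\<And>s. s \<in> S \<Longrightarrow> v s = 0) \<Longrightarrow> v = (\<lambda>x. 0)"
    using P0_determined_by_finite_set by blast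
  have "\<exists>q\<in>P0_space \<T>. \<forall>p\<in>P0_space \<T>. L2_inner \<Omega> q p = L2_inner \<Omega> f p"
    by (rule riesz_representation[OF S(1) P0_inner_product_on S(2)])
      (use P0_in_L2 in \<open>auto intro: L2_inner_linear_on[OF assms]\<close>)
  then obtain q where q0: "q \<in> P0_space \<T>" "\<And>p. p \<in> P0_space \<T> \<Longrightarrow> L2_inner \<Omega> q p = L2_inner \<Omega> f p" by blast
  then have q: "?P q" using assms P0_in_L2 by (simp add: L2_inner_diff_left)
  have "q' = q" if q': "?P q'" for q'
  proof -
    have qq: "q \<in> P0_space \<T>" "q' \<in> P0_space \<T>" using q q' by auto
    let ?d = "\<lambda>x. q x - q' x"
    have d: "?d \<in> P0_space \<T>" by (rule function_space_diff[OF function_space qq])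
    have "L2_inner \<Omega> ?d ?d = L2_inner \<Omega> q ?d - L2_inner \<Omega> q' ?d"
      using qq d P0_in_L2 by (intro L2_inner_diff_left) auto
    moreover have "L2_inner \<Omega> (\<lambda>x. f x - q x) ?d = L2_inner \<Omega> f ?d - L2_inner \<Omega> q ?d"
      using qq d P0_in_L2 assms by (intro L2_inner_diff_left) auto
    moreover have "L2_inner \<Omega> (\<lambda>x. f x - q' x) ?d = L2_inner \<Omega> f ?d - L2_inner \<Omega> q' ?d"
      using qq d P0_in_L2 assms by (intro L2_inner_diff_left) auto
    moreover have "L2_inner \<Omega> (\<lambda>x. f x - q x) ?d = 0" "L2_inner \<Omega> (\<lambda>x. f x - q' x) ?d = 0"
      using q q' d by blast+
    ultimately have "L2_inner \<Omega> ?d ?d = 0" by simp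
    then have "?d = (\<lambda>x. 0)" by (rule definite[OF d])
    then show ?thesis by (auto simp: fun_eq_iff)
  qed
  then have "?P (P0_projection \<Omega> \<T> f)" unfolding P0_projection_def using q by (intro theI[of ?P q]) blast+
  then show "P0_projection \<Omega> \<T> f \<in> P0_space \<T>"
    "p \<in> P0_space \<T> \<Longrightarrow> L2_inner \<Omega> (\<lambda>x. f x - P0_projection \<Omega> \<T> f x) p = 0" by auto
qed

lemma indicator_element_in_P0:
  assumes "T \<in> \<T>" shows "indicator (interior T) \<in> P0_space \<T>"
proof -
  have "\<forall>x\<in>interior T'. indicator (interior T) x = (if T' = T then 1 else 0 :: real)" if "T' \<in> \<T>" for T'
    using that interiors_disjoint[OF assms that] interior_subset[of T'] by (auto simp: indicator_def)
  then have "\<forall>T'\<in>\<T>. \<exists>c. \<forall>x\<in>interior T'. indicator (interior T) x = (c::real)" by meson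
  moreover have "supported_on_elements \<T> (indicator (interior T))"
    using assms by (auto simp: supported_on_elements_def indicator_def)
  ultimately show ?thesis by (simp add: P0_space_def)
qed

lemma L2_inner_elements:
  assumes "f \<in> L2_space \<Omega>" "g \<in> L2_space \<Omega>"
  shows "L2_inner \<Omega> f g = (\<Sum>T\<in>\<T>. L2_inner (interior T) f g)"
proof -
  note I = L2_inner_integrable[OF assms]
  have i: "integrable (lebesgue_on \<Omega>) (\<lambda>x. indicator (interior T) x * (f x \<bullet> g x))" if "T \<in> \<T>" for T
    using integrable_real_mult_indicator[OF _ I, of "interior T"] interior_element_subset[OF that] domain_sets
    by (simp add: sets_restrict_space_iff mult.commute)
  have "(\<Sum>T\<in>\<T>. L2_inner (interior T) f g) = (\<Sum>T\<in>\<T>. LINT x|lebesgue_on \<Omega>. indicator (interior T) x * (f x \<bullet> g x))"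
    by (intro sum.cong refl L2_inner_subset interior_element_subset domain_sets interior_sets)
  also have "\<dots> = (LINT x|lebesgue_on \<Omega>. (\<Sum>T\<in>\<T>. indicator (interior T) x * (f x \<bullet> g x)))"
    using i by (intro Bochner_Integration.integral_sum[symmetric])
  also have "\<dots> = L2_inner \<Omega> f g"
    unfolding L2_inner_def
  proof (rule integral_cong_AE)
    show "AE x in lebesgue_on \<Omega>. (\<Sum>T\<in>\<T>. indicator (interior T) x * (f x \<bullet> g x)) = f x \<bullet> g x"
      using AE_in_elements
    proof eventually_elim
      case (elim x)
      then obtain T where "T \<in> \<T>" "x \<in> interior T" by blast
      from sum_over_elements[OF this, of "\<lambda>T. f x \<bullet> g x"] show ?case by simp
    qed
    show "(\<lambda>x. \<Sum>T\<in>\<T>. indicator (interior T) x * (f x \<bullet> g x)) \<in> borel_measurable (lebesgue_on \<Omega>)"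
      using i by (intro borel_measurable_sum borel_measurable_integrable)
  qed (rule borel_measurable_integrable[OF I])
  finally show ?thesis by simp
qed

text \<open>The indicator of an open element is itself piecewise constant and isolates the element;
  this is where orthogonality turns into elementwise means.\<close>

lemma P0_projection_mean:
  assumes f: "f \<in> L2_space \<Omega>" and T: "T \<in> \<T>"
  shows "(LINT x|lebesgue_on (interior T). f x - P0_projection \<Omega> \<T> f x) = 0"
proof -
  let ?g = "\<lambda>x. f x - P0_projection \<Omega> \<T> f x"
  have "0 = L2_inner \<Omega> ?g (indicator (interior T))"
    using P0_projection_orthogonal[OF f indicator_element_in_P0[OF T]] by simp
  also have "\<dots> = L2_inner (interior T) ?g (indicator (interior T))"
    by (rule L2_inner_support[OF interior_element_subset[OF T] domain_sets interior_sets]) auto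
  also have "\<dots> = (LINT x|lebesgue_on (interior T). ?g x)"
    unfolding L2_inner_def by (intro Bochner_Integration.integral_cong) auto
  finally show ?thesis by simp
qed

text \<open>A supremum of reals bounds its set only if that set is bounded above, which is the
  Poincare inequality on the convex interior of \<open>T\<close>. Nonnegativity needs a member of
  the set: a coordinate function minus its mean.\<close>

lemma poincare_const:
  assumes T: "T \<in> \<T>"
  shows poincare_const_nonneg: "0 \<le> poincare_const T"
    and poincare_const_bound: "v \<in> H1_space (interior T) \<Longrightarrow> (LINT x|lebesgue_on (interior T). v x) = 0 \<Longrightarrow>
      L2_norm (interior T) v \<le> poincare_const T * L2_norm (interior T) (weak_grad (interior T) v)"
proof -
  let ?U = "interior T"
  let ?R = "{L2_norm ?U v / L2_norm ?U (weak_grad ?U v) | v. v \<in> H1_space ?U \<and> L2_norm ?U v \<noteq> 0 \<and> (LINT x|lebesgue_on ?U. v x) = 0}"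
  have Um: "?U \<in> lmeasurable" by (rule interior_element_lmeasurable[OF T])
  obtain C where C: "C \<ge> 0" "\<And>u G. u \<in> L2_space ?U \<Longrightarrow> G \<in> L2_space ?U \<Longrightarrow>
      has_weak_grad ?U u G \<Longrightarrow> (LINT x|lebesgue_on ?U. u x) = 0 \<Longrightarrow> L2_norm ?U u \<le> C * L2_norm ?U G"
    using poincare_inequality[OF open_interior interior_element_bounded[OF T] interior_element_convex[OF T] element_interior_nonempty[OF T]]
    by metis
  have Cv: "L2_norm ?U v \<le> C * L2_norm ?U (weak_grad ?U v)"
    if "v \<in> H1_space ?U" "(LINT x|lebesgue_on ?U. v x) = 0" for v
    using C(2)[OF H1_space_L2[OF that(1)] weak_grad[OF that(1)] that(2)] .
  have bdd: "bdd_above ?R"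
  proof (rule bdd_aboveI[of _ C])
    fix r assume "r \<in> ?R"
    then obtain v where v: "r = L2_norm ?U v / L2_norm ?U (weak_grad ?U v)" "v \<in> H1_space ?U" "(LINT x|lebesgue_on ?U. v x) = 0" by auto
    show "r \<le> C"
    \<comment> \<open>A vanishing denominator makes the quotient 0, which respects the bound as
      well.\<close>
    proof (cases "L2_norm ?U (weak_grad ?U v) = 0")
      case False
      then have "L2_norm ?U (weak_grad ?U v) > 0" using L2_norm_nonneg by (metis order_le_less)
      then show ?thesis using Cv[OF v(2,3)] by (simp add: v(1) pos_divide_le_eq)
    qed (simp add: v(1) C(1))
  qed
  have nonneg: "0 \<le> poincare_const T"
  proof -
    obtain i :: 'n where True by simp
    \<comment> \<open>The mean of the coordinate, so that \<open>?v\<close> has mean zero; it is not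
      the zero class because its weak gradient is a unit vector.\<close>
    define m where "m = (LINT x|lebesgue_on ?U. axis i 1 \<bullet> x) / measure lebesgue ?U"
    let ?v = "\<lambda>x. axis i 1 \<bullet> x + (- m)"
    have mpos: "measure lebesgue ?U \<noteq> 0"
      using negligible_iff_measure0[OF Um] open_not_negligible[OF open_interior element_interior_nonempty[OF T]] by simp
    have vL: "?v \<in> L2_space ?U" "(\<lambda>x. axis i 1 \<bullet> x) \<in> L2_space ?U"
      using interior_element_bounded[OF T] by (auto intro!: continuous_in_L2_space continuous_intros)
    have eL: "(\<lambda>x. axis i 1) \<in> L2_space ?U" by (rule const_in_L2_space[OF Um])
    have wv: "has_weak_grad ?U ?v (\<lambda>x. axis i 1)" by (rule affine_has_weak_grad[OF interior_element_bounded[OF T] interior_sets])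
    have "(LINT x|lebesgue_on ?U. ?v x) = (LINT x|lebesgue_on ?U. axis i 1 \<bullet> x) + (LINT x|lebesgue_on ?U. - m)"
      using L2_space_integrable[OF vL(2) Um] L2_space_integrable[OF const_in_L2_space[OF Um] Um, of "- m"]
      by (rule Bochner_Integration.integral_add)
    also have "\<dots> = 0" using mpos by (simp add: m_def measure_restrict_space)
    finally have mean: "(LINT x|lebesgue_on ?U. ?v x) = 0" .
    have "L2_norm ?U ?v \<noteq> 0"
    proof
      assume "L2_norm ?U ?v = 0"
      then have "AE x in lebesgue_on ?U. ?v x = 0" by (rule iffD1[OF L2_norm_eq_0_iff[OF vL(1)]])
      then have "has_weak_grad ?U (\<lambda>x. 0) (\<lambda>x. axis i 1)"
        by (rule has_weak_grad_cong_AE[OF Um wv vL(1) eL]) simp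
      moreover have "has_weak_grad ?U (\<lambda>x. 0) (\<lambda>x. 0)" by (simp add: has_weak_grad_def)
      ultimately have "AE x in lebesgue_on ?U. axis i 1 = (0 :: real ^ 'n)"
        using has_weak_grad_unique[OF open_interior Um] eL by fastforce
      then have "axis i 1 = (0 :: real ^ 'n)" using T by (rule AE_const_on_element)
      then show False by (simp add: axis_eq_0_iff)
    qed
    then have "L2_norm ?U ?v / L2_norm ?U (weak_grad ?U ?v) \<in> ?R"
      using H1_spaceI[OF vL(1) eL wv] mean by blast
    then have "L2_norm ?U ?v / L2_norm ?U (weak_grad ?U ?v) \<le> poincare_const T"
      unfolding poincare_const_def using bdd by (rule cSup_upper)
    moreover have "0 \<le> L2_norm ?U ?v / L2_norm ?U (weak_grad ?U ?v)" by simp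
    ultimately show ?thesis by linarith
  qed
  then show "0 \<le> poincare_const T" .
  show "L2_norm ?U v \<le> poincare_const T * L2_norm ?U (weak_grad ?U v)"
    if v: "v \<in> H1_space ?U" "(LINT x|lebesgue_on ?U. v x) = 0"
  proof (cases "L2_norm ?U v = 0")
    case True
    then show ?thesis using nonneg by simp
  next
    case False
    \<comment> \<open>The Poincare inequality with \<open>C\<close> excludes a zero gradient for a
      nonzero function of mean zero, so the quotient may be multiplied out.\<close>
    then have "L2_norm ?U (weak_grad ?U v) \<noteq> 0" using Cv[OF v] by (metis L2_norm_nonneg antisym mult_zero_right)
    then have pos: "L2_norm ?U (weak_grad ?U v) > 0" using L2_norm_nonneg by (metis order_le_less)
    have "L2_norm ?U v / L2_norm ?U (weak_grad ?U v) \<in> ?R" using v False by blast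
    then have "L2_norm ?U v / L2_norm ?U (weak_grad ?U v) \<le> poincare_const T"
      unfolding poincare_const_def using bdd by (rule cSup_upper)
    then show ?thesis using pos by (simp add: pos_divide_le_eq)
  qed
qed

end

context mesh
begin

lemma max_poincare_const:
  shows max_poincare_const_ge: "T \<in> \<T> \<Longrightarrow> poincare_const T \<le> max_poincare_const \<T>"
    and max_poincare_const_nonneg: "0 \<le> max_poincare_const \<T>"
proof -
  show ge: "poincare_const T \<le> max_poincare_const \<T>" if "T \<in> \<T>" for T
    unfolding max_poincare_const_def using finite_mesh that by simp
  obtain T where "T \<in> \<T>" using mesh_nonempty by auto
  then show "0 \<le> max_poincare_const \<T>" using ge poincare_const_nonneg order_trans by blast
qed

text \<open>On each element the deviation has mean zero and the same gradient as \<open>w\<close>,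
  so the local Poincare constant applies. Squares are summed after passing to the largest
  constant.\<close>

lemma P0_projection_error:
  assumes w: "w \<in> P1_space \<T>"
  shows "L2_norm \<Omega> (\<lambda>x. w x - P0_projection \<Omega> \<T> w x) \<le> max_poincare_const \<T> * broken_H1_seminorm \<Omega> \<T> w"
proof -
  let ?q = "P0_projection \<Omega> \<T> w" and ?C = "max_poincare_const \<T>"
  have wL: "w \<in> L2_space \<Omega>" using P1_in_L2[OF w] .
  have q: "?q \<in> P0_space \<T>" by (rule P0_projection_in_P0[OF wL])
  obtain a b where ab: "affine_pieces w a b" using w by (rule P1_spaceE)
  obtain c where c: "\<And>T x. T \<in> \<T> \<Longrightarrow> x \<in> interior T \<Longrightarrow> ?q x = c T" using P0_spaceE[OF q] by metis
  have ab': "affine_pieces (\<lambda>x. w x - ?q x) a (\<lambda>T. b T - c T)"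
    using affine_piecesD[OF ab] c by (simp add: affine_pieces_def)
  have dL: "(\<lambda>x. w x - ?q x) \<in> L2_space \<Omega>" by (rule L2_space_diff[OF wL P0_in_L2[OF q]])
  have local: "L2_inner (interior T) (\<lambda>x. w x - ?q x) (\<lambda>x. w x - ?q x) \<le> ?C\<^sup>2 * L2_inner (interior T) (piecewise a) (piecewise a)"
    if T: "T \<in> \<T>" for T
  proof -
    let ?U = "interior T" and ?d = "\<lambda>x. w x - ?q x"
    note aw = affine_pieces_weak_grad[OF ab' T]
    have Um: "?U \<in> lmeasurable" by (rule interior_element_lmeasurable[OF T])
    have aL: "(\<lambda>x. a T) \<in> L2_space ?U" by (rule const_in_L2_space[OF Um])
    have H: "?d \<in> H1_space ?U" by (rule H1_spaceI[OF aw(1) aL aw(2)])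
    have "L2_norm ?U ?d \<le> poincare_const T * L2_norm ?U (weak_grad ?U ?d)"
      by (rule poincare_const_bound[OF T H P0_projection_mean[OF wL T]])
    also have "L2_norm ?U (weak_grad ?U ?d) = L2_norm ?U (\<lambda>x. a T)"
      by (rule L2_norm_cong_AE[OF weak_grad_eqI[OF open_interior Um aw(1) aL aw(2)] weak_grad_in_L2_space[OF H] aL])
    also have "\<dots> = L2_norm ?U (piecewise a)"
      unfolding L2_norm_def L2_inner_def
      by (intro arg_cong[of _ _ sqrt] Bochner_Integration.integral_cong) (auto simp: piecewise_on_element[OF T])
    also have "poincare_const T * L2_norm ?U (piecewise a) \<le> ?C * L2_norm ?U (piecewise a)"
      using max_poincare_const_ge[OF T] by (intro mult_right_mono) auto
    finally have "(L2_norm ?U ?d)\<^sup>2 \<le> (?C * L2_norm ?U (piecewise a))\<^sup>2" by (intro power_mono) auto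
    then show ?thesis by (simp only: power_mult_distrib L2_norm_square)
  qed
  have "(L2_norm \<Omega> (\<lambda>x. w x - ?q x))\<^sup>2 = (\<Sum>T\<in>\<T>. L2_inner (interior T) (\<lambda>x. w x - ?q x) (\<lambda>x. w x - ?q x))"
    unfolding L2_norm_square by (rule L2_inner_elements[OF dL dL])
  also have "\<dots> \<le> (\<Sum>T\<in>\<T>. ?C\<^sup>2 * L2_inner (interior T) (piecewise a) (piecewise a))"
    by (intro sum_mono local)
  also have "\<dots> = ?C\<^sup>2 * L2_inner \<Omega> (piecewise a) (piecewise a)"
    unfolding L2_inner_elements[OF piecewise_in_L2 piecewise_in_L2] by (simp add: sum_distrib_left)
  also have "L2_inner \<Omega> (piecewise a) (piecewise a) = L2_inner \<Omega> (broken_grad \<T> w) (broken_grad \<T> w)"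
    by (rule L2_inner_cong_AE[symmetric, OF broken_grad_affine_pieces[OF ab] broken_grad_affine_pieces[OF ab]
          broken_grad_in_L2[OF w] piecewise_in_L2 broken_grad_in_L2[OF w] piecewise_in_L2])
  also have "?C\<^sup>2 * \<dots> = (?C * broken_H1_seminorm \<Omega> \<T> w)\<^sup>2"
    by (simp only: power_mult_distrib broken_H1_seminorm_def L2_norm_square)
  finally show ?thesis
    by (rule power2_le_imp_le) (simp add: max_poincare_const_nonneg broken_H1_seminorm_def)
qed

section \<open>Marini flux and equilibration error\<close>

definition marini_correction :: "(real ^ 'n \<Rightarrow> real) \<Rightarrow> real ^ 'n \<Rightarrow> real ^ 'n" where
  "marini_correction g x =
     (\<Sum>T\<in>\<T>. indicator (interior T) x *\<^sub>R ((g x / real CARD('n)) *\<^sub>R (x - simplex_barycentre T)))"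

lemma marini_correction_in_L2:
  assumes g: "g \<in> P0_space \<T>" shows "marini_correction g \<in> L2_space \<Omega>"
proof -
  obtain c where c: "\<And>T x. T \<in> \<T> \<Longrightarrow> x \<in> interior T \<Longrightarrow> g x = c T" using P0_spaceE[OF g] by metis
  have "(\<lambda>x. (g x / real CARD('n)) *\<^sub>R (x - simplex_barycentre T)) \<in> L2_space (interior T)" if T: "T \<in> \<T>" for T
  proof (rule L2_space_cong_AE[OF _ interior_sets])
    show "(\<lambda>x. (c T / real CARD('n)) *\<^sub>R (x - simplex_barycentre T)) \<in> L2_space (interior T)"
      using interior_element_bounded[OF T] by (intro continuous_in_L2_space continuous_intros) auto
    show "AE x in lebesgue_on (interior T). (c T / real CARD('n)) *\<^sub>R (x - simplex_barycentre T) =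
        (g x / real CARD('n)) *\<^sub>R (x - simplex_barycentre T)"
      by (intro AE_I2) (simp add: c[OF T])
  qed
  then show ?thesis
    unfolding marini_correction_def[abs_def] by (intro L2_space_sum indicator_scaleR_in_L2)
qed

text \<open>Connects the open elements of the L2 products with the closed simplices of
  \<open>simplex_centroid\<close>: the frontier of a convex set is a null set.\<close>

lemma integral_interior_element:
  fixes f :: "real ^ 'n \<Rightarrow> real"
  assumes T: "T \<in> \<T>" and f: "f \<in> borel_measurable borel"
  shows "(LINT x|lebesgue_on (interior T). f x) = (LINT x|lebesgue_on T. f x)"
proof -
  have Ts: "T \<in> sets lebesgue" using element_closed[OF T] by (simp add: borel_closed)
  have fm: "f \<in> borel_measurable (lebesgue_on S)" for S by (rule borel_imp_measurable_lebesgue_on[OF f])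
  have "frontier T \<in> null_sets lebesgue"
    using negligible_convex_frontier[OF element_convex[OF T]] by (simp add: negligible_iff_null_sets)
  then have ae: "AE x in lebesgue. x \<notin> frontier T" by (rule AE_not_in)
  have "(LINT x|lebesgue. (if x \<in> interior T then f x else 0)) = (LINT x|lebesgue. (if x \<in> T then f x else 0))"
  proof (rule integral_cong_AE)
    show "(\<lambda>x. if x \<in> interior T then f x else 0) \<in> borel_measurable lebesgue"
      using fm[of "interior T"] borel_measurable_if[OF interior_sets] by blast
    show "(\<lambda>x. if x \<in> T then f x else 0) \<in> borel_measurable lebesgue"
      using fm[of T] borel_measurable_if[OF Ts] by blast
    show "AE x in lebesgue. (if x \<in> interior T then f x else 0) = (if x \<in> T then f x else 0)"
      using ae by eventually_elim (use interior_subset[of T] closure_subset[of T] in \<open>auto simp: frontier_def\<close>)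
  qed
  then show ?thesis using Ts by (simp add: Lebesgue_Measure.integral_restrict_UNIV)
qed

text \<open>
  The gradient of a piecewise affine function is constant on each element, and the correction has
  mean zero there because the barycentre is the centroid.
\<close>

lemma marini_correction_orthogonal:
  assumes g: "g \<in> P0_space \<T>" and w: "w \<in> P1_space \<T>"
  shows "L2_inner \<Omega> (broken_grad \<T> w) (marini_correction g) = 0"
proof -
  obtain a b where ab: "affine_pieces w a b" using w by (rule P1_spaceE)
  obtain c where c: "\<And>T x. T \<in> \<T> \<Longrightarrow> x \<in> interior T \<Longrightarrow> g x = c T" using P0_spaceE[OF g] by metis
  note m = marini_correction_in_L2[OF g]
  have "L2_inner \<Omega> (broken_grad \<T> w) (marini_correction g) = L2_inner \<Omega> (piecewise a) (marini_correction g)"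
    by (rule L2_inner_cong_AE[OF broken_grad_affine_pieces[OF ab] _ broken_grad_in_L2[OF w] piecewise_in_L2 m m]) simp
  also have "\<dots> = (\<Sum>T\<in>\<T>. L2_inner (interior T) (piecewise a) (marini_correction g))"
    by (rule L2_inner_elements[OF piecewise_in_L2 m])
  also have "\<dots> = (\<Sum>T\<in>\<T>. 0)"
  proof (rule sum.cong[OF refl])
    fix T assume T: "T \<in> \<T>"
    have "L2_inner (interior T) (piecewise a) (marini_correction g)
        = (LINT x|lebesgue_on (interior T). (c T / real CARD('n)) * (a T \<bullet> (x - simplex_barycentre T)))"
      unfolding L2_inner_def
    proof (rule Bochner_Integration.integral_cong)
      fix x assume "x \<in> space (lebesgue_on (interior T))"
      then have x: "x \<in> interior T" by simp
      have "marini_correction g x = (c T / real CARD('n)) *\<^sub>R (x - simplex_barycentre T)"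
        unfolding marini_correction_def by (simp only: sum_over_elements[OF T x] c[OF T x])
      then show "piecewise a x \<bullet> marini_correction g x = (c T / real CARD('n)) * (a T \<bullet> (x - simplex_barycentre T))"
        by (simp add: piecewise_on_element[OF T x])
    qed simp
    also have "\<dots> = (c T / real CARD('n)) * (LINT x|lebesgue_on T. a T \<bullet> (x - simplex_barycentre T))"
      using integral_interior_element[OF T, of "\<lambda>x. a T \<bullet> (x - simplex_barycentre T)"] by simp
    also have "\<dots> = 0" using simplex_centroid[OF simplex_mesh[OF T]] by simp
    finally show "L2_inner (interior T) (piecewise a) (marini_correction g) = 0" .
  qed
  finally show ?thesis by simp
qed

text \<open>Its norm is the numerator in \<open>kappa_M\<close>. Almost everywhere it is the broken
  gradient of the gap minus the correction, and thus linear in \<open>g\<close>.\<close>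

definition equilibration_error :: "(real ^ 'n \<Rightarrow> real) \<Rightarrow> real ^ 'n \<Rightarrow> real ^ 'n" where
  "equilibration_error g x = marini_flux \<Omega> \<T> g x - weak_grad \<Omega> (conforming_solution \<Omega> \<T> g) x"

lemma equilibration_error_AE:
  assumes g: "g \<in> P0_space \<T>"
  shows "AE x in lebesgue_on \<Omega>. equilibration_error g x = broken_grad \<T> (D g) x - marini_correction g x"
proof -
  note gL = P0_in_L2[OF g]
  let ?u = "CR_solution \<Omega> \<T> g" and ?w = "conforming_solution \<Omega> \<T> g"
  have u: "?u \<in> P1_space \<T>" and wc: "?w \<in> conforming_space \<Omega> \<T>"
    using CR_galerkin[OF gL] conforming_galerkin[OF gL] CR_subset_P1 by (auto simp: galerkin_def)
  then have w: "?w \<in> P1_space \<T>" by (simp add: conforming_space_def)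
  have w': "(\<lambda>x. (-1) * ?w x) \<in> P1_space \<T>" by (rule function_space_mult[OF P1_function_space w])
  have D: "D g = (\<lambda>x. ?u x + (-1) * ?w x)" by (simp add: gap_operator_def)
  show ?thesis
    using broken_grad_add[OF u w'] broken_grad_mult[OF w, of "-1"] broken_grad_conforming[OF wc]
    unfolding D
    by eventually_elim (simp add: equilibration_error_def marini_flux_def marini_correction_def)
qed

lemma equilibration_error_in_L2:
  assumes g: "g \<in> P0_space \<T>" shows "equilibration_error g \<in> L2_space \<Omega>"
proof (rule L2_space_cong_AE[OF _ domain_sets])
  show "(\<lambda>x. broken_grad \<T> (D g) x - marini_correction g x) \<in> L2_space \<Omega>"
    by (intro L2_space_diff broken_grad_in_L2 gap_in_P1 P0_in_L2 marini_correction_in_L2 g)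
  show "AE x in lebesgue_on \<Omega>. broken_grad \<T> (D g) x - marini_correction g x = equilibration_error g x"
    using equilibration_error_AE[OF g] by eventually_elim simp
qed

text \<open>Pythagoras: the equilibration error is the difference of the broken gradient and a
  correction orthogonal to it, so dropping the correction can only shorten it.\<close>

lemma gap_le_equilibration_error:
  assumes g: "g \<in> P0_space \<T>"
  shows "broken_H1_seminorm \<Omega> \<T> (D g) \<le> L2_norm \<Omega> (equilibration_error g)"
proof (rule power2_le_imp_le)
  let ?p = "broken_grad \<T> (D g)" and ?m = "marini_correction g"
  have P1: "D g \<in> P1_space \<T>" by (rule gap_in_P1[OF P0_in_L2[OF g]])
  have L: "?p \<in> L2_space \<Omega>" "?m \<in> L2_space \<Omega>"
    by (rule broken_grad_in_L2[OF P1], rule marini_correction_in_L2[OF g])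
  have "(L2_norm \<Omega> (equilibration_error g))\<^sup>2 = (L2_norm \<Omega> (\<lambda>x. ?p x - ?m x))\<^sup>2"
    using L2_norm_cong_AE[OF equilibration_error_AE[OF g] equilibration_error_in_L2[OF g] L2_space_diff[OF L]] by simp
  also have "\<dots> = L2_inner \<Omega> ?p ?p + L2_inner \<Omega> ?m ?m"
    using L marini_correction_orthogonal[OF g P1]
    by (simp add: L2_norm_square L2_inner_diff_left L2_inner_diff_right L2_space_diff L2_inner_commute[of \<Omega> ?m ?p])
  finally show "(broken_H1_seminorm \<Omega> \<T> (D g))\<^sup>2 \<le> (L2_norm \<Omega> (equilibration_error g))\<^sup>2"
    using L2_inner_self_nonneg[of \<Omega> ?m] by (simp add: broken_H1_seminorm_def L2_norm_square)
qed simp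

lemma equilibration_error_add:
  assumes u: "u \<in> P0_space \<T>" and v: "v \<in> P0_space \<T>"
  shows "AE x in lebesgue_on \<Omega>. equilibration_error (\<lambda>x. u x + v x) x = equilibration_error u x + equilibration_error v x"
proof -
  have m: "marini_correction (\<lambda>x. u x + v x) x = marini_correction u x + marini_correction v x" for x
    by (simp add: marini_correction_def add_divide_distrib scaleR_add_left scaleR_add_right sum.distrib)
  show ?thesis
    using equilibration_error_AE[OF function_space_add[OF P0_function_space u v]]
      equilibration_error_AE[OF u] equilibration_error_AE[OF v]
      broken_grad_add[OF gap_in_P1[OF P0_in_L2[OF u]] gap_in_P1[OF P0_in_L2[OF v]]]
    unfolding gap_add[OF P0_in_L2[OF u] P0_in_L2[OF v]]
    by eventually_elim (simp add: m)
qed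

lemma equilibration_error_mult:
  assumes v: "v \<in> P0_space \<T>"
  shows "AE x in lebesgue_on \<Omega>. equilibration_error (\<lambda>x. c * v x) x = c *\<^sub>R equilibration_error v x"
proof -
  have m: "marini_correction (\<lambda>x. c * v x) x = c *\<^sub>R marini_correction v x" for x
    by (simp add: marini_correction_def scaleR_sum_right mult.left_commute)
  show ?thesis
    using equilibration_error_AE[OF function_space_mult[OF P0_function_space v, of c]] equilibration_error_AE[OF v]
      broken_grad_mult[OF gap_in_P1[OF P0_in_L2[OF v]], of c]
    unfolding gap_mult[OF P0_in_L2[OF v]]
    by eventually_elim (simp add: m scaleR_diff_right)
qed

text \<open>Keeps the sets of quotients behind \<open>kappa_M\<close> and the operator norm
  nonempty.\<close>

lemma P0_nonzero: "\<exists>g\<in>P0_space \<T>. L2_norm \<Omega> g \<noteq> 0"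
proof -
  interpret inner_product_on "P0_space \<T>" "L2_inner \<Omega>" by (rule P0_inner_product_on)
  obtain T where T: "T \<in> \<T>" using mesh_nonempty by auto
  obtain x where x: "x \<in> interior T" using element_interior_nonempty[OF T] by auto
  let ?g = "indicator (interior T) :: real ^ 'n \<Rightarrow> real"
  have g: "?g \<in> P0_space \<T>" by (rule indicator_element_in_P0[OF T])
  have "?g \<noteq> (\<lambda>x. 0)" using x by (auto simp: fun_eq_iff indicator_def)
  then have "L2_norm \<Omega> ?g \<noteq> 0" using definite[OF g] by (auto simp flip: L2_norm_square)
  then show ?thesis using g by blast
qed

text \<open>Finite dimension of the piecewise constants bounds the quotients, through
  \<open>seminorm_bounded_by_inner_product\<close> applied to the norm of the error, which is a
  seminorm in \<open>g\<close>.\<close>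

lemma kappa_M:
  shows kappa_M_nonneg: "0 \<le> kappa_M \<Omega> \<T>"
    and kappa_M_bound: "g \<in> P0_space \<T> \<Longrightarrow> L2_norm \<Omega> (equilibration_error g) \<le> kappa_M \<Omega> \<T> * L2_norm \<Omega> g"
proof -
  let ?N = "\<lambda>g. L2_norm \<Omega> (equilibration_error g)"
  let ?R = "{?N g / L2_norm \<Omega> g | g. g \<in> P0_space \<T> \<and> L2_norm \<Omega> g \<noteq> 0}"
  obtain S where S: "finite S" "\<And>v. v \<in> P0_space \<T> \<Longrightarrow> (\<And>s. s \<in> S \<Longrightarrow> v s = 0) \<Longrightarrow> v = (\<lambda>x. 0)"
    using P0_determined_by_finite_set by blast
  have "\<exists>C\<ge>0. \<forall>v\<in>P0_space \<T>. ?N v \<le> C * sqrt (L2_inner \<Omega> v v)"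
  proof (rule seminorm_bounded_by_inner_product[OF S(1) P0_inner_product_on S(2)])
    show "?N (\<lambda>x. u x + v x) \<le> ?N u + ?N v" if "u \<in> P0_space \<T>" "v \<in> P0_space \<T>" for u v
    proof -
      note L = equilibration_error_in_L2
      have "?N (\<lambda>x. u x + v x) = L2_norm \<Omega> (\<lambda>x. equilibration_error u x + equilibration_error v x)"
        by (rule L2_norm_cong_AE[OF equilibration_error_add[OF that] L[OF function_space_add[OF P0_function_space that]]
              L2_space_add[OF L[OF that(1)] L[OF that(2)]]])
      then show ?thesis using L2_norm_triangle[OF L[OF that(1)] L[OF that(2)]] by simp
    qed
    show "?N (\<lambda>x. c * v x) = \<bar>c\<bar> * ?N v" if "v \<in> P0_space \<T>" for c v
    proof -
      note L = equilibration_error_in_L2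
      have "?N (\<lambda>x. c * v x) = L2_norm \<Omega> (\<lambda>x. c *\<^sub>R equilibration_error v x)"
        by (rule L2_norm_cong_AE[OF equilibration_error_mult[OF that] L[OF function_space_mult[OF P0_function_space that]]
              L2_space_scaleR[OF L[OF that]]])
      then show ?thesis by (simp add: L2_norm_scaleR)
    qed
  qed
  then obtain C where C: "C \<ge> 0" "\<And>v. v \<in> P0_space \<T> \<Longrightarrow> ?N v \<le> C * L2_norm \<Omega> v"
    by (auto simp: L2_norm_def)
  have bdd: "bdd_above ?R"
  proof (rule bdd_aboveI[of _ C])
    fix r assume "r \<in> ?R"
    then obtain g where g: "r = ?N g / L2_norm \<Omega> g" "g \<in> P0_space \<T>" "L2_norm \<Omega> g \<noteq> 0" by blast
    then have "L2_norm \<Omega> g > 0" using L2_norm_nonneg by (metis order_le_less)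
    then show "r \<le> C" using C(2)[OF g(2)] by (simp add: g(1) pos_divide_le_eq)
  qed
  have \<kappa>: "kappa_M \<Omega> \<T> = Sup ?R" by (simp add: kappa_M_def equilibration_error_def[abs_def])
  have le: "?N g / L2_norm \<Omega> g \<le> kappa_M \<Omega> \<T>" if "g \<in> P0_space \<T>" "L2_norm \<Omega> g \<noteq> 0" for g
    unfolding \<kappa> using that by (intro cSup_upper bdd) blast
  obtain g0 where g0: "g0 \<in> P0_space \<T>" "L2_norm \<Omega> g0 \<noteq> 0" using P0_nonzero by blast
  have "0 \<le> ?N g0 / L2_norm \<Omega> g0" by simp
  then show nonneg: "0 \<le> kappa_M \<Omega> \<T>" using le[OF g0] by linarith
  show "?N g \<le> kappa_M \<Omega> \<T> * L2_norm \<Omega> g" if g: "g \<in> P0_space \<T>"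
  proof (cases "L2_norm \<Omega> g = 0")
    case True
    \<comment> \<open>Here \<open>g\<close> does not enter the supremum; the bound with
      \<open>C\<close> shows that its error has norm 0 as well.\<close>
    then show ?thesis using C(2)[OF g] by simp
  next
    case False
    then have "L2_norm \<Omega> g > 0" using L2_norm_nonneg by (metis order_le_less)
    then show ?thesis using le[OF g False] by (simp add: pos_divide_le_eq)
  qed
qed

section \<open>Estimates for the gap operator\<close>

abbreviation "E f \<equiv> broken_H1_seminorm \<Omega> \<T> (D f)"
abbreviation "Q \<equiv> P0_projection \<Omega> \<T>"

lemma energy_nonneg: "0 \<le> broken_H1_seminorm \<Omega> \<T> v"
  by (simp add: broken_H1_seminorm_def)

text \<open>
  The energy of the gap is its pairing with the data. The oscillation of the data is paired with the
  deviation of the gap from its element means, the mean part is moved onto the second argument of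
  the form.
\<close>

lemma gap_energy_estimate:
  assumes f: "f \<in> L2_space \<Omega>"
  shows "E f \<le> max_poincare_const \<T> * L2_norm \<Omega> (\<lambda>x. f x - Q f x) + kappa_M \<Omega> \<T> * L2_norm \<Omega> (Q f)"
proof -
  let ?r = "\<lambda>x. f x - Q f x"
  have DfL: "D f \<in> L2_space \<Omega>" and P1: "D f \<in> P1_space \<T>" using gap_in_L2[OF f] gap_in_P1[OF f] by auto
  have q: "Q f \<in> P0_space \<T>" "Q f \<in> L2_space \<Omega>" using P0_projection_in_P0[OF f] P0_in_L2 by auto
  have r: "?r \<in> L2_space \<Omega>" by (rule L2_space_diff[OF f q(2)])
  have QD: "Q (D f) \<in> P0_space \<T>" "Q (D f) \<in> L2_space \<Omega>" using P0_projection_in_P0[OF DfL] P0_in_L2 by auto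
  have "(E f)\<^sup>2 = L2_inner \<Omega> (D f) f" using gap_identity[OF f f] by (simp add: broken_form_self)
  also have "\<dots> = L2_inner \<Omega> (D f) ?r + L2_inner \<Omega> (D f) (Q f)"
    using DfL f q by (simp add: L2_inner_diff_right)
  \<comment> \<open>The element means of the gap may be subtracted because \<open>?r\<close> is
    orthogonal to piecewise constants.\<close>
  also have "L2_inner \<Omega> (D f) ?r = L2_inner \<Omega> (\<lambda>x. D f x - Q (D f) x) ?r"
    using P0_projection_orthogonal[OF f QD(1)] DfL QD(2) r
    by (simp add: L2_inner_diff_left L2_inner_commute[of \<Omega> "Q (D f)"])
  also have "\<dots> \<le> L2_norm \<Omega> (\<lambda>x. D f x - Q (D f) x) * L2_norm \<Omega> ?r"
    using L2_Cauchy_Schwarz[OF L2_space_diff[OF DfL QD(2)] r] by linarith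
  also have "\<dots> \<le> max_poincare_const \<T> * E f * L2_norm \<Omega> ?r"
    by (rule mult_right_mono[OF P0_projection_error[OF P1]]) simp
  also have "L2_inner \<Omega> (D f) (Q f) = broken_form \<Omega> \<T> (D f) (D (Q f))"
    by (rule gap_identity[OF f q(2)])
  also have "\<dots> \<le> E f * E (Q f)"
    by (rule broken_form_Cauchy_Schwarz[OF P1 gap_in_P1[OF q(2)]])
  also have "\<dots> \<le> E f * (kappa_M \<Omega> \<T> * L2_norm \<Omega> (Q f))"
    using gap_le_equilibration_error[OF q(1)] kappa_M_bound[OF q(1)] energy_nonneg
    by (intro mult_left_mono) auto
  \<comment> \<open>One factor \<open>E f\<close> is cancelled; when it is zero the claim is the
    nonnegativity of the right side.\<close>
  finally have "E f * E f \<le> E f * (max_poincare_const \<T> * L2_norm \<Omega> ?r + kappa_M \<Omega> \<T> * L2_norm \<Omega> (Q f))"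
    by (simp add: power2_eq_square algebra_simps)
  moreover have "0 \<le> max_poincare_const \<T> * L2_norm \<Omega> ?r + kappa_M \<Omega> \<T> * L2_norm \<Omega> (Q f)"
    using max_poincare_const_nonneg kappa_M_nonneg by simp
  ultimately show ?thesis
    using energy_nonneg[of "D f"] by (cases "E f = 0") (auto simp: mult_le_cancel_left)
qed

text \<open>Origin of the square root in \<open>gap_const\<close>: oscillation and means of
  \<open>f\<close> are orthogonal, so the squares of their norms add up to that of \<open>f\<close>,
  and Cauchy-Schwarz in the plane pairs them with the two constants.\<close>

lemma gap_const_estimate:
  assumes f: "f \<in> L2_space \<Omega>"
  shows "max_poincare_const \<T> * L2_norm \<Omega> (\<lambda>x. f x - Q f x) + kappa_M \<Omega> \<T> * L2_norm \<Omega> (Q f) \<le> gap_const \<Omega> \<T> * L2_norm \<Omega> f"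
proof (rule power2_le_imp_le)
  let ?r = "\<lambda>x. f x - Q f x"
  define C k s t where "C = max_poincare_const \<T>" and "k = kappa_M \<Omega> \<T>" and "s = L2_norm \<Omega> ?r" and "t = L2_norm \<Omega> (Q f)"
  have q: "Q f \<in> P0_space \<T>" "Q f \<in> L2_space \<Omega>" using P0_projection_in_P0[OF f] P0_in_L2 by auto
  have r: "?r \<in> L2_space \<Omega>" by (rule L2_space_diff[OF f q(2)])
  have "(L2_norm \<Omega> f)\<^sup>2 = L2_inner \<Omega> (\<lambda>x. ?r x + Q f x) (\<lambda>x. ?r x + Q f x)" by (simp add: L2_norm_square)
  also have "\<dots> = L2_inner \<Omega> ?r ?r + 2 * L2_inner \<Omega> ?r (Q f) + L2_inner \<Omega> (Q f) (Q f)"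
    by (simp only: L2_inner_add_left[OF r q(2) L2_space_add[OF r q(2)]] L2_inner_add_right[OF r q(2) r]
        L2_inner_add_right[OF r q(2) q(2)] L2_inner_commute[of \<Omega> "Q f" ?r])
  also have "\<dots> = s\<^sup>2 + t\<^sup>2" using P0_projection_orthogonal[OF f q(1)] by (simp add: s_def t_def L2_norm_square)
  finally have pyth: "(L2_norm \<Omega> f)\<^sup>2 = s\<^sup>2 + t\<^sup>2" .
  \<comment> \<open>By Lagrange's identity the two sides differ by the square of C t - k s.\<close>
  have "(C * s + k * t)\<^sup>2 \<le> (C\<^sup>2 + k\<^sup>2) * (s\<^sup>2 + t\<^sup>2)"
    using zero_le_power2[of "C * t - k * s"] by (simp add: power2_eq_square algebra_simps)
  also have "\<dots> = (gap_const \<Omega> \<T> * L2_norm \<Omega> f)\<^sup>2"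
    by (simp add: power_mult_distrib pyth gap_const_def C_def k_def)
  finally show "(max_poincare_const \<T> * L2_norm \<Omega> ?r + kappa_M \<Omega> \<T> * L2_norm \<Omega> (Q f))\<^sup>2 \<le> (gap_const \<Omega> \<T> * L2_norm \<Omega> f)\<^sup>2"
    by (simp only: C_def k_def s_def t_def)
  show "0 \<le> gap_const \<Omega> \<T> * L2_norm \<Omega> f" by (simp add: gap_const_def)
qed

text \<open>The constant appears squared because the squared norm is bounded by a product of two
  energies, that of \<open>D f\<close> and that of \<open>D (D f)\<close>. The second contributes a
  factor \<open>L2_norm \<Omega> (D f)\<close>, which cancels.\<close>

lemma gap_L2_bound:
  assumes f: "f \<in> L2_space \<Omega>"
  shows "L2_norm \<Omega> (D f) \<le> (gap_const \<Omega> \<T>)\<^sup>2 * L2_norm \<Omega> f"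
proof -
  let ?M = "gap_const \<Omega> \<T>"
  have Df: "D f \<in> L2_space \<Omega>" by (rule gap_in_L2[OF f])
  have e: "E g \<le> ?M * L2_norm \<Omega> g" if "g \<in> L2_space \<Omega>" for g
    using gap_energy_estimate[OF that] gap_const_estimate[OF that] by linarith
  have "(L2_norm \<Omega> (D f))\<^sup>2 = broken_form \<Omega> \<T> (D f) (D (D f))"
    using gap_identity[OF f Df] by (simp add: L2_norm_square)
  also have "\<dots> \<le> E f * E (D f)" by (rule broken_form_Cauchy_Schwarz[OF gap_in_P1[OF f] gap_in_P1[OF Df]])
  also have "\<dots> \<le> (?M * L2_norm \<Omega> f) * (?M * L2_norm \<Omega> (D f))"
    using e[OF f] e[OF Df] energy_nonneg by (intro mult_mono) (auto simp: gap_const_def)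
  finally have "L2_norm \<Omega> (D f) * L2_norm \<Omega> (D f) \<le> L2_norm \<Omega> (D f) * (?M\<^sup>2 * L2_norm \<Omega> f)"
    by (simp add: power2_eq_square mult_ac)
  moreover have "0 \<le> ?M\<^sup>2 * L2_norm \<Omega> f" by simp
  ultimately show ?thesis
    using L2_norm_nonneg[of \<Omega> "D f"] by (cases "L2_norm \<Omega> (D f) = 0") (auto simp: mult_le_cancel_left)
qed

section \<open>The gap as an operator on L2\<close>

lemma gap_bounded_operator: "bounded_L2_operator \<Omega> D"
  unfolding bounded_L2_operator_def
proof (intro conjI ballI allI impI)
  show "D f \<in> L2_space \<Omega>" if "f \<in> L2_space \<Omega>" for f by (rule gap_in_L2[OF that])
  show "AE x in lebesgue_on \<Omega>. D f x = D g x"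
    if "f \<in> L2_space \<Omega>" "g \<in> L2_space \<Omega>" "AE x in lebesgue_on \<Omega>. f x = g x" for f g
    unfolding gap_cong_AE[OF that] by simp
  show "AE x in lebesgue_on \<Omega>. D (\<lambda>y. f y + g y) x = D f x + D g x"
    if "f \<in> L2_space \<Omega>" "g \<in> L2_space \<Omega>" for f g
    unfolding gap_add[OF that] by simp
  show "AE x in lebesgue_on \<Omega>. D (\<lambda>y. c * f y) x = c * D f x" if "f \<in> L2_space \<Omega>" for c f
    unfolding gap_mult[OF that] by simp
  show "\<exists>B. \<forall>f\<in>L2_space \<Omega>. L2_norm \<Omega> (D f) \<le> B * L2_norm \<Omega> f" using gap_L2_bound by blast
qed

lemma gap_operator_norm: "L2_operator_norm \<Omega> D \<le> (gap_const \<Omega> \<T>)\<^sup>2"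
  unfolding L2_operator_norm_def
proof (rule cSup_least)
  show "{L2_norm \<Omega> (D f) / L2_norm \<Omega> f | f. f \<in> L2_space \<Omega> \<and> L2_norm \<Omega> f \<noteq> 0} \<noteq> {}"
    using P0_nonzero P0_in_L2 by blast
  fix r assume "r \<in> {L2_norm \<Omega> (D f) / L2_norm \<Omega> f | f. f \<in> L2_space \<Omega> \<and> L2_norm \<Omega> f \<noteq> 0}"
  then obtain f where f: "r = L2_norm \<Omega> (D f) / L2_norm \<Omega> f" "f \<in> L2_space \<Omega>" "L2_norm \<Omega> f \<noteq> 0" by blast
  then have "L2_norm \<Omega> f > 0" using L2_norm_nonneg by (metis order_le_less)
  then show "r \<le> (gap_const \<Omega> \<T>)\<^sup>2" using gap_L2_bound[OF f(2)] by (simp add: f(1) pos_divide_le_eq)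
qed

lemma gap_selfadjoint: "selfadjoint_L2_operator \<Omega> D"
  unfolding selfadjoint_L2_operator_def
proof (intro ballI)
  fix f g :: "real ^ 'n \<Rightarrow> real" assume f: "f \<in> L2_space \<Omega>" and g: "g \<in> L2_space \<Omega>"
  have "L2_inner \<Omega> (D f) g = L2_inner \<Omega> (D g) f"
    using gap_identity[OF f g] gap_identity[OF g f] by (simp add: broken_form_commute[of "D g"])
  then show "L2_inner \<Omega> (D f) g = L2_inner \<Omega> f (D g)" by (simp add: L2_inner_commute[of \<Omega> f])
qed

lemma gap_positive: "positive_L2_operator \<Omega> D"
  unfolding positive_L2_operator_def by (simp add: gap_identity broken_form_self)

end

theorem proposition4p7:
  fixes \<Omega> :: "(real ^ 'n) set" and \<T> :: "(real ^ 'n) set set"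
  assumes "CARD('n) = 2 \<or> CARD('n) = 3"
    and "bounded \<Omega>" and "lipschitz_domain \<Omega>" and "polyhedral \<Omega>"
    and "conforming_triangulation \<Omega> \<T>"
  shows "(\<forall>f\<in>L2_space \<Omega>. gap_operator \<Omega> \<T> f \<in> CR_space \<Omega> \<T>) \<and>
    (\<forall>f\<in>L2_space \<Omega>. \<forall>g\<in>L2_space \<Omega>.
       L2_inner \<Omega> (gap_operator \<Omega> \<T> f) g
         = broken_form \<Omega> \<T> (gap_operator \<Omega> \<T> f) (gap_operator \<Omega> \<T> g)) \<and>
    bounded_L2_operator \<Omega> (gap_operator \<Omega> \<T>) \<and>
    positive_L2_operator \<Omega> (gap_operator \<Omega> \<T>) \<and>
    selfadjoint_L2_operator \<Omega> (gap_operator \<Omega> \<T>) \<and>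
    (\<forall>f\<in>L2_space \<Omega>.
       broken_H1_seminorm \<Omega> \<T> (gap_operator \<Omega> \<T> f)
         \<le> max_poincare_const \<T> * L2_norm \<Omega> (\<lambda>x. f x - P0_projection \<Omega> \<T> f x)
           + kappa_M \<Omega> \<T> * L2_norm \<Omega> (P0_projection \<Omega> \<T> f) \<and>
       max_poincare_const \<T> * L2_norm \<Omega> (\<lambda>x. f x - P0_projection \<Omega> \<T> f x)
           + kappa_M \<Omega> \<T> * L2_norm \<Omega> (P0_projection \<Omega> \<T> f)
         \<le> gap_const \<Omega> \<T> * L2_norm \<Omega> f) \<and>
    L2_operator_norm \<Omega> (gap_operator \<Omega> \<T>) \<le> (gap_const \<Omega> \<T>)\<^sup>2"
proof -
  interpret mesh \<Omega> \<T> using assms(2,3,5) by unfold_locales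
  show ?thesis
    using gap_in_CR gap_identity gap_bounded_operator gap_positive gap_selfadjoint
      gap_energy_estimate gap_const_estimate gap_operator_norm
    by (intro conjI ballI) auto
qed

end
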